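(* Consider the two-way rate-distortion problem with a helper described in the context, where the source triple satisfies the Markov chain $Y-X-Z$. Then the operational achievable region equals the single-letter region: $$\mathcal R^O(D_x,D_z)=\mathcal R(D_x,D_z).$$
   Context: Let $\mathcal X,\mathcal Y,\mathcal Z$ be finite alphabets and let $(X_i,Y_i,Z_i)$, $i=1,2,\dots$, be i.i.d. with distribution $p(x,y,z)$ such that $Y-X-Z$ is a Markov chain, i.e. $p(x,y,z)=p(x,y)p(z|x)$. Let $\hat{\mathcal X},\hat{\mathcal Z}$ be finite reconstruction alphabets and $d_x:\mathcal X\times\hat{\mathcal X}\to[0,\infty)$, $d_z:\mathcal Z\times\hat{\mathcal Z}\to[0,\infty)$ single-letter distortion measures. For positive integers $M_1,M_2,M_3$ write $\mathcal M_j=\{1,\dots,M_j\}$. An $(n,M_1,M_2,M_3,D_x,D_z)$ code consists of a helper encoder $f_1:\mathcal Y^n\to\mathcal M_1$, an encoder $f_2:\mathcal Z^n\times\mathcal M_1\to\mathcal M_2$ at User Z, an encoder $f_3:\mathcal X^n\times\mathcal M_1\times\mathcal M_2\to\mathcal M_3$ at User X, and decoders $g_2:\mathcal X^n\times\mathcal M_1\times\mathcal M_2\to\hat{\mathcal Z}^n$ (at User X) and $g_3:\mathcal Z^n\times\mathcal M_1\times\mathcal M_3\to\hat{\mathcal X}^n$ (at User Z), with $T_1=f_1(Y^n)$, $T_2=f_2(Z^n,T_1)$, $T_3=f_3(X^n,T_1,T_2)$, $\hat Z^n=g_2(X^n,T_1,T_2)$, $\hat X^n=g_3(Z^n,T_1,T_3)$,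 such that $\mathbb E\big[\frac1n\sum_{i=1}^n d_x(X_i,\hat X_i)\big]\le D_x$ and $\mathbb E\big[\frac1n\sum_{i=1}^n d_z(Z_i,\hat Z_i)\big]\le D_z$. A rate triple $(R_1,R_2,R_3)$ is achievable for $(D_x,D_z)$ if for every $\epsilon>0$ and all sufficiently large $n$ there is an $(n,2^{nR_1},2^{nR_2},2^{nR_3},D_x+\epsilon,D_z+\epsilon)$ code. $\mathcal R^O(D_x,D_z)$ is the closure of the set of achievable rate triples. $\mathcal R(D_x,D_z)$ is the set of all $(R_1,R_2,R_3)$ such that $R_1\ge I(Y;U|Z)$, $R_2\ge I(Z;V|U,X)$, $R_3\ge I(X;W|U,V,Z)$ for some finite-alphabet auxiliary random variables $U,V,W$ with joint distribution $p(x,y,z,u,v,w)=p(x,y)p(z|x)p(u|y)p(v|u,z)p(w|u,v,x)$ and some deterministic functions $\hat X(U,W,Z)\in\hat{\mathcal X}$ and $\hat Z(U,V,X)\in\hat{\mathcal Z}$ with $\mathbb E\, d_x(X,\hat X(U,W,Z))\le D_x$ and $\mathbb E\, d_z(Z,\hat Z(U,V,X))\le D_z$. *)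

theory Defs
  imports "HOL-Analysis.Analysis"
begin

definition prob_eq :: "'w set \<Rightarrow> ('w \<Rightarrow> real) \<Rightarrow> ('w \<Rightarrow> 'a) \<Rightarrow> 'w \<Rightarrow> real" where
  "prob_eq S P F \<omega> = (\<Sum>\<omega>'\<in>S. if F \<omega>' = F \<omega> then P \<omega>' else 0)"

definition cond_mutual_info ::
  "'w set \<Rightarrow> ('w \<Rightarrow> real) \<Rightarrow> ('w \<Rightarrow> 'a) \<Rightarrow> ('w \<Rightarrow> 'b) \<Rightarrow> ('w \<Rightarrow> 'c) \<Rightarrow> real" where
  "cond_mutual_info S P A B C =
     (\<Sum>\<omega>\<in>S. P \<omega> * log 2
        (prob_eq S P (\<lambda>\<omega>. (A \<omega>, B \<omega>, C \<omega>)) \<omega> * prob_eq S P C \<omega> /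
         (prob_eq S P (\<lambda>\<omega>. (A \<omega>, C \<omega>)) \<omega> * prob_eq S P (\<lambda>\<omega>. (B \<omega>, C \<omega>)) \<omega>)))"

definition is_pmf :: "('a::finite \<Rightarrow> real) \<Rightarrow> bool" where
  "is_pmf p \<longleftrightarrow> (\<forall>a. 0 \<le> p a) \<and> (\<Sum>a\<in>UNIV. p a) = 1"

definition markov_YXZ :: "('x::finite \<times> 'y::finite \<times> 'z::finite \<Rightarrow> real) \<Rightarrow> bool" where
  "markov_YXZ p \<longleftrightarrow> (\<forall>x y z.
     p (x, y, z) = (\<Sum>z'\<in>UNIV. p (x, y, z')) *
       ((\<Sum>y'\<in>UNIV. p (x, y', z)) / (\<Sum>y'\<in>UNIV. \<Sum>z'\<in>UNIV. p (x, y', z'))))"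

definition iid_expect :: "('x \<times> 'y \<times> 'z \<Rightarrow> real) \<Rightarrow> nat \<Rightarrow> (('x \<times> 'y \<times> 'z) list \<Rightarrow> real) \<Rightarrow> real" where
  "iid_expect p n F = (\<Sum>ws\<in>{ws. length ws = n}. prod_list (map p ws) * F ws)"

text \<open>Existence of an (n, M1, M2, M3, Dx, Dz) code. Messages are {0..<Mj}. Decoders output
  sequences (only the first n entries are used).\<close>
definition code_exists ::
  "('x::finite \<times> 'y::finite \<times> 'z::finite \<Rightarrow> real) \<Rightarrow> ('x \<Rightarrow> 'xh \<Rightarrow> real) \<Rightarrow> ('z \<Rightarrow> 'zh \<Rightarrow> real)
   \<Rightarrow> nat \<Rightarrow> nat \<Rightarrow> nat \<Rightarrow> nat \<Rightarrow> real \<Rightarrow> real \<Rightarrow> bool" where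
  "code_exists p dx dz n M1 M2 M3 Dx Dz \<longleftrightarrow>
    (\<exists>(f1 :: 'y list \<Rightarrow> nat) (f2 :: 'z list \<Rightarrow> nat \<Rightarrow> nat) (f3 :: 'x list \<Rightarrow> nat \<Rightarrow> nat \<Rightarrow> nat)
       (g2 :: 'x list \<Rightarrow> nat \<Rightarrow> nat \<Rightarrow> nat \<Rightarrow> 'zh) (g3 :: 'z list \<Rightarrow> nat \<Rightarrow> nat \<Rightarrow> nat \<Rightarrow> 'xh).
       (\<forall>ys. f1 ys < M1) \<and> (\<forall>zs t1. f2 zs t1 < M2) \<and> (\<forall>xs t1 t2. f3 xs t1 t2 < M3) \<and>
       iid_expect p n (\<lambda>ws.
          let xs = map fst ws; ys = map (fst \<circ> snd) ws; zs = map (snd \<circ> snd) ws;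
              t1 = f1 ys; t2 = f2 zs t1; t3 = f3 xs t1 t2; xh = g3 zs t1 t3
          in (1 / real n) * (\<Sum>i<n. dx (xs ! i) (xh i))) \<le> Dx \<and>
       iid_expect p n (\<lambda>ws.
          let xs = map fst ws; ys = map (fst \<circ> snd) ws; zs = map (snd \<circ> snd) ws;
              t1 = f1 ys; t2 = f2 zs t1; zh = g2 xs t1 t2
          in (1 / real n) * (\<Sum>i<n. dz (zs ! i) (zh i))) \<le> Dz)"

definition achievable ::
  "('x::finite \<times> 'y::finite \<times> 'z::finite \<Rightarrow> real) \<Rightarrow> ('x \<Rightarrow> 'xh \<Rightarrow> real) \<Rightarrow> ('z \<Rightarrow> 'zh \<Rightarrow> real)
   \<Rightarrow> real \<Rightarrow> real \<Rightarrow> real \<times> real \<times> real \<Rightarrow> bool" where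
  "achievable p dx dz Dx Dz R \<longleftrightarrow>
    (\<forall>\<epsilon>>0. \<exists>N. \<forall>n\<ge>N. \<exists>M1 M2 M3.
       real M1 \<le> 2 powr (real n * fst R) \<and> real M2 \<le> 2 powr (real n * fst (snd R)) \<and>
       real M3 \<le> 2 powr (real n * snd (snd R)) \<and>
       code_exists p dx dz n M1 M2 M3 (Dx + \<epsilon>) (Dz + \<epsilon>))"

definition operational_region ::
  "('x::finite \<times> 'y::finite \<times> 'z::finite \<Rightarrow> real) \<Rightarrow> ('x \<Rightarrow> 'xh \<Rightarrow> real) \<Rightarrow> ('z \<Rightarrow> 'zh \<Rightarrow> real)
   \<Rightarrow> real \<Rightarrow> real \<Rightarrow> (real \<times> real \<times> real) set" where
  "operational_region p dx dz Dx Dz = closure {R. achievable p dx dz Dx Dz R}"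

text \<open>Auxiliary variables U, V, W take values in the finite alphabet {0..<K} (K arbitrary).
  Sample points are ((x,y,z),(u,v,w)); the joint law is
  p(x,y,z) p(u|y) p(v|u,z) p(w|u,v,x).\<close>
definition aux_space :: "nat \<Rightarrow> (('x::finite \<times> 'y::finite \<times> 'z::finite) \<times> nat \<times> nat \<times> nat) set" where
  "aux_space K = UNIV \<times> {..<K} \<times> {..<K} \<times> {..<K}"

definition joint_law ::
  "('x \<times> 'y \<times> 'z \<Rightarrow> real) \<Rightarrow> ('y \<Rightarrow> nat \<Rightarrow> real) \<Rightarrow> (nat \<Rightarrow> 'z \<Rightarrow> nat \<Rightarrow> real)
   \<Rightarrow> (nat \<Rightarrow> nat \<Rightarrow> 'x \<Rightarrow> nat \<Rightarrow> real) \<Rightarrow> ('x \<times> 'y \<times> 'z) \<times> nat \<times> nat \<times> nat \<Rightarrow> real" where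
  "joint_law p qU qV qW = (\<lambda>((x, y, z), u, v, w). p (x, y, z) * qU y u * qV u z v * qW u v x w)"

definition is_kernel :: "nat \<Rightarrow> ('a \<Rightarrow> nat \<Rightarrow> real) \<Rightarrow> bool" where
  "is_kernel K q \<longleftrightarrow> (\<forall>a. (\<forall>b<K. 0 \<le> q a b) \<and> (\<Sum>b<K. q a b) = 1)"

definition single_letter_region ::
  "('x::finite \<times> 'y::finite \<times> 'z::finite \<Rightarrow> real) \<Rightarrow> ('x \<Rightarrow> 'xh \<Rightarrow> real) \<Rightarrow> ('z \<Rightarrow> 'zh \<Rightarrow> real)
   \<Rightarrow> real \<Rightarrow> real \<Rightarrow> (real \<times> real \<times> real) set" where
  "single_letter_region p dx dz Dx Dz = {(R1, R2, R3).
     \<exists>K qU qV qW (xhat :: nat \<Rightarrow> nat \<Rightarrow> 'z \<Rightarrow> 'xh) (zhat :: nat \<Rightarrow> nat \<Rightarrow> 'x \<Rightarrow> 'zh).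
       is_kernel K qU \<and> is_kernel K (\<lambda>(u, z). qV u z) \<and> is_kernel K (\<lambda>(u, v, x). qW u v x) \<and>
       (let S = aux_space K; P = joint_law p qU qV qW in
          R1 \<ge> cond_mutual_info S P (\<lambda>((x, y, z), u, v, w). y) (\<lambda>((x, y, z), u, v, w). u)
                                     (\<lambda>((x, y, z), u, v, w). z) \<and>
          R2 \<ge> cond_mutual_info S P (\<lambda>((x, y, z), u, v, w). z) (\<lambda>((x, y, z), u, v, w). v)
                                     (\<lambda>((x, y, z), u, v, w). (u, x)) \<and>
          R3 \<ge> cond_mutual_info S P (\<lambda>((x, y, z), u, v, w). x) (\<lambda>((x, y, z), u, v, w). w)
                                     (\<lambda>((x, y, z), u, v, w). (u, v, z)) \<and>
          (\<Sum>\<omega>\<in>S. P \<omega> * (case \<omega> of ((x, y, z), u, v, w) \<Rightarrow> dx x (xhat u w z))) \<le> Dx \<and>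
          (\<Sum>\<omega>\<in>S. P \<omega> * (case \<omega> of ((x, y, z), u, v, w) \<Rightarrow> dz z (zhat u v x))) \<le> Dz)}"

end

theory Submission
  imports Defs
begin

text \<open>Converse: with \<open>U_i = (X^(i-1), T1, Z_(i+1)^n)\<close>, \<open>V_i = T2\<close>, \<open>W_i = T3\<close> and a uniform
  time-sharing index as part of \<open>U\<close>, a code yields auxiliary variables for slightly larger distortions.
  The variable \<open>W\<close> need not be independent of \<open>Y\<close> given \<open>(U, V, X)\<close>; this does no harm, because rates
  and distortions only depend on the laws of \<open>(X, Y, Z, U)\<close> and \<open>(X, Z, U, V, W)\<close>. Reweighting the joint
  law by a function of \<open>U\<close>, then of \<open>(U, V)\<close>, then of \<open>(U, V, W)\<close> bounds the alphabets by Caratheodory's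
  theorem, and compactness allows the excess distortion and the sequence of rates to pass to the limit.

  Achievability: three Wyner-Ziv steps. In each step codewords are drawn independently and binned at
  random; the encoder selects one by rejection sampling, so that the selected word has essentially the law
  prescribed by the test channel, and the decoder finds it in its bin by a likelihood test. As the estimate
  is additive in an arbitrary bad-event function of the source and the selected word, the steps compose,
  and the typicality of the ideal joint law enters only once, through Chebyshev's inequality. User X
  can decode \<open>U\<close> whenever User Z can, since \<open>U - X - Z\<close> is a Markov chain.\<close>

section \<open>Finite probability spaces\<close>

text \<open>The converse has to cope with decoders and messages that see whole blocks, while the
  estimators of the region see one letter and the auxiliary variables. With past \<open>X\<close>
  and future \<open>Z\<close> inside \<open>U\<close>, the conditional independences of the
  memoryless chain \<open>Y - X - Z\<close> persist when the messages are adjoined one after the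
  other, so the rest of the block does not help to estimate the current letter. The alphabet of this
  \<open>U\<close> grows with the block length, which may have to grow without bound as the excess
  distortion shrinks; a limit can be taken only after the alphabets have been bounded in terms of
  the source alphabets alone.

  In achievability the usual obstacle is the Markov lemma: a word selected by joint typicality does
  not follow the product law of the test channel, so its typicality with sources hidden from the
  encoder needs an argument of its own. A word selected by rejection sampling is, up to a constant
  factor, no more likely to be bad than a word of the ideal law, whatever "bad" means and whatever
  sources it involves.\<close>

abbreviation joint :: "('w \<Rightarrow> 'a) \<Rightarrow> ('w \<Rightarrow> 'b) \<Rightarrow> 'w \<Rightarrow> 'a \<times> 'b"  (infixr \<open>\<bowtie>\<close> 65) where
  "A \<bowtie> B \<equiv> \<lambda>\<omega>. (A \<omega>, B \<omega>)"

definition pr :: "'w set \<Rightarrow> ('w \<Rightarrow> real) \<Rightarrow> ('w \<Rightarrow> 'a) \<Rightarrow> 'a \<Rightarrow> real" where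
  "pr S P F a = (\<Sum>\<omega>\<in>S. if F \<omega> = a then P \<omega> else 0)"

definition ent :: "'w set \<Rightarrow> ('w \<Rightarrow> real) \<Rightarrow> ('w \<Rightarrow> 'a) \<Rightarrow> real" where
  "ent S P F = - (\<Sum>\<omega>\<in>S. P \<omega> * log 2 (prob_eq S P F \<omega>))"

text \<open>A factorisation is used instead of an equation between conditional probabilities:
  nothing is divided, events of probability zero need no care, and weights can be absorbed into a
  factor. \<open>ci_prod\<close> recovers the usual product formula.\<close>

definition ci :: "'w set \<Rightarrow> ('w \<Rightarrow> real) \<Rightarrow> ('w \<Rightarrow> 'a) \<Rightarrow> ('w \<Rightarrow> 'b) \<Rightarrow> ('w \<Rightarrow> 'c) \<Rightarrow> bool" where
  "ci S P A B C \<longleftrightarrow>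
     (\<exists>f g. \<forall>a b c. pr S P (A \<bowtie> B \<bowtie> C) (a, b, c) = f a c * g b c)"

lemma prob_eq_pr: "prob_eq S P F \<omega> = pr S P F (F \<omega>)"
  by (simp add: prob_eq_def pr_def)

lemma pr_marginal:
  assumes "finite S" "finite T" "F ` S \<subseteq> T"
  shows "pr S P (\<lambda>\<omega>. h (F \<omega>)) b = (\<Sum>a\<in>T. if h a = b then pr S P F a else 0)"
proof -
  have "(\<Sum>a\<in>T. if h a = b then pr S P F a else 0)
      = (\<Sum>a\<in>T. \<Sum>\<omega>\<in>S. if F \<omega> = a then (if h (F \<omega>) = b then P \<omega> else 0) else 0)"
    unfolding pr_def by (intro sum.cong refl) (auto intro!: sum.cong sum.neutral)
  also have "\<dots> = (\<Sum>\<omega>\<in>S. \<Sum>a\<in>T. if F \<omega> = a then (if h (F \<omega>) = b then P \<omega> else 0) else 0)"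
    by (rule sum.swap)
  also have "\<dots> = (\<Sum>\<omega>\<in>S. if h (F \<omega>) = b then P \<omega> else 0)"
    using assms by (intro sum.cong refl) (auto simp: sum.delta')
  finally show ?thesis by (simp add: pr_def)
qed

lemma sum_law:
  assumes "finite S" "finite T" "F ` S \<subseteq> T"
  shows "(\<Sum>\<omega>\<in>S. P \<omega> * g (F \<omega>)) = (\<Sum>a\<in>T. pr S P F a * g a)"
proof -
  have "(\<Sum>a\<in>T. pr S P F a * g a) = (\<Sum>a\<in>T. \<Sum>\<omega>\<in>S. if F \<omega> = a then P \<omega> * g (F \<omega>) else 0)"
    unfolding pr_def sum_distrib_right by (intro sum.cong refl) auto
  also have "\<dots> = (\<Sum>\<omega>\<in>S. \<Sum>a\<in>T. if F \<omega> = a then P \<omega> * g (F \<omega>) else 0)"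
    by (rule sum.swap)
  also have "\<dots> = (\<Sum>\<omega>\<in>S. P \<omega> * g (F \<omega>))"
    using assms by (intro sum.cong refl) (auto simp: sum.delta')
  finally show ?thesis by simp
qed

lemma pr_outside: "a \<notin> F ` S \<Longrightarrow> pr S P F a = 0"
  unfolding pr_def by (rule sum.neutral) auto

lemma law_marginal:
  assumes "finite S" "finite S'" and eq: "\<And>a. pr S P F a = pr S' P' F' a"
  shows "pr S P (\<lambda>\<omega>. h (F \<omega>)) b = pr S' P' (\<lambda>\<omega>. h (F' \<omega>)) b"
proof -
  let ?T = "F ` S \<union> F' ` S'"
  have "finite ?T" using assms by auto
  then show ?thesis
    using pr_marginal[of S ?T F P h b] pr_marginal[of S' ?T F' P' h b] assms(1,2)
    by (simp add: eq cong: if_cong)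
qed

lemma sum_triple: "(\<Sum>t\<in>A \<times> B \<times> C. F t) = (\<Sum>a\<in>A. \<Sum>b\<in>B. \<Sum>c\<in>C. F (a, b, c))"
  by (simp add: sum.cartesian_product case_prod_beta)

lemma sum_pair: "(\<Sum>t\<in>A \<times> B. F t) = (\<Sum>a\<in>A. \<Sum>b\<in>B. F (a, b))"
  by (simp add: sum.cartesian_product case_prod_beta)

lemma pr_marginal2:
  assumes "finite S"
  shows "pr S P (\<lambda>\<omega>. h (A \<omega>) (B \<omega>)) d =
    (\<Sum>a\<in>A`S. \<Sum>b\<in>B`S. if h a b = d then pr S P (A \<bowtie> B) (a, b) else 0)"
  using pr_marginal[of S "A`S \<times> B`S" "A \<bowtie> B" P "\<lambda>(a, b). h a b" d] assms
  by (simp add: sum_pair image_subset_iff)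

lemma pr_marginal3:
  assumes "finite S"
  shows "pr S P (\<lambda>\<omega>. h (A \<omega>) (B \<omega>) (C \<omega>)) d =
    (\<Sum>a\<in>A`S. \<Sum>b\<in>B`S. \<Sum>c\<in>C`S.
       if h a b c = d then pr S P (A \<bowtie> B \<bowtie> C) (a, b, c) else 0)"
  using pr_marginal[of S "A`S \<times> B`S \<times> C`S" "A \<bowtie> B \<bowtie> C" P "\<lambda>(a, b, c). h a b c" d] assms
  by (simp add: sum_triple image_subset_iff)

lemma law_expect:
  assumes "finite S" "finite S'" and eq: "\<And>a. pr S P F a = pr S' P' F' a"
  shows "(\<Sum>\<omega>\<in>S. P \<omega> * g (F \<omega>)) = (\<Sum>\<omega>\<in>S'. P' \<omega> * g (F' \<omega>))"
proof -
  let ?T = "F ` S \<union> F' ` S'"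
  have "finite ?T" using assms by auto
  then show ?thesis
    using sum_law[of S ?T F P g] sum_law[of S' ?T F' P' g] assms by auto
qed

lemma cmi_law:
  assumes "finite S" "finite S'"
    and eq: "\<And>t. pr S P (A \<bowtie> B \<bowtie> C) t = pr S' P' (A' \<bowtie> B' \<bowtie> C') t"
  shows "cond_mutual_info S P A B C = cond_mutual_info S' P' A' B' C'"
proof -
  note m = law_marginal[OF assms(1,2) eq]
  have 1: "pr S P C t = pr S' P' C' t" for t using m[of "\<lambda>(a,b,c). c" t] by simp
  have 2: "pr S P (A \<bowtie> C) t = pr S' P' (A' \<bowtie> C') t" for t
    using m[of "\<lambda>(a,b,c). (a,c)" t] by simp
  have 3: "pr S P (B \<bowtie> C) t = pr S' P' (B' \<bowtie> C') t" for t
    using m[of "\<lambda>(a,b,c). (b,c)" t] by simp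
  show ?thesis
    unfolding cond_mutual_info_def prob_eq_pr 1 2 3 eq
    using law_expect[OF assms(1,2) eq, of "\<lambda>(a,b,c). log 2 (pr S' P' (A' \<bowtie> B' \<bowtie> C') (a,b,c)
       * pr S' P' C' c / (pr S' P' (A' \<bowtie> C') (a,c) * pr S' P' (B' \<bowtie> C') (b,c)))"]
    by simp
qed

lemma prob_eq_cong:
  assumes "\<And>\<omega>'. \<omega>' \<in> S \<Longrightarrow> F \<omega>' = F \<omega> \<longleftrightarrow> G \<omega>' = G \<omega>"
  shows "prob_eq S P F \<omega> = prob_eq S P G \<omega>"
  unfolding prob_eq_def using assms by (intro sum.cong) auto

lemma ent_cong:
  assumes "\<And>\<omega> \<omega>'. \<omega> \<in> S \<Longrightarrow> \<omega>' \<in> S \<Longrightarrow> F \<omega>' = F \<omega> \<longleftrightarrow> G \<omega>' = G \<omega>"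
  shows "ent S P F = ent S P G"
  unfolding ent_def using assms by (intro arg_cong[where f=uminus] sum.cong refl) (simp add: prob_eq_cong[of S F _ G])

lemma ci_law:
  assumes "\<And>t. pr S P (A \<bowtie> B \<bowtie> C) t = pr S' P' (A' \<bowtie> B' \<bowtie> C') t"
  shows "ci S P A B C \<longleftrightarrow> ci S' P' A' B' C'"
  unfolding ci_def assms ..

text \<open>The weight is absorbed into the factor that depends on \<open>A\<close> and
  \<open>C\<close>. This is how the Markov chains survive when alphabets are cut down by
  reweighting.\<close>

lemma ci_reweight:
  assumes "ci S P A B C" and P': "\<And>\<omega>. \<omega> \<in> S \<Longrightarrow> P' \<omega> = k (A \<omega>) (C \<omega>) * P \<omega>"
  shows "ci S P' A B C"
proof -
  from assms obtain f g where fg: "\<And>a b c. pr S P (A \<bowtie> B \<bowtie> C) (a, b, c) = f a c * g b c"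
    unfolding ci_def by blast
  have "pr S P' (A \<bowtie> B \<bowtie> C) (a, b, c) = (k a c * f a c) * g b c" for a b c
  proof -
    have "pr S P' (A \<bowtie> B \<bowtie> C) (a, b, c) = k a c * pr S P (A \<bowtie> B \<bowtie> C) (a, b, c)"
      unfolding pr_def sum_distrib_left using P' by (intro sum.cong refl) auto
    then show ?thesis by (simp add: fg)
  qed
  then show ?thesis unfolding ci_def by (intro exI allI)
qed

lemma ci_sym: "ci S P A B C \<Longrightarrow> ci S P B A C"
proof -
  assume "ci S P A B C"
  then obtain f g where fg: "\<And>a b c. pr S P (A \<bowtie> B \<bowtie> C) (a, b, c) = f a c * g b c"
    unfolding ci_def by blast
  have "pr S P (B \<bowtie> A \<bowtie> C) (b, a, c) = g b c * f a c" for a b c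
    using fg[of a b c] unfolding pr_def by (simp add: mult.commute conj_left_commute)
  then show ?thesis unfolding ci_def by (intro exI allI)
qed

text \<open>Functional dependence is mostly stated by comparing values at pairs of sample points,
  which is easy to verify for list-valued variables. Choosing a preimage of each value of
  \<open>F\<close> turns it into an actual function.\<close>

lemma determined_fun:
  assumes "\<And>\<omega> \<omega>'. \<omega> \<in> S \<Longrightarrow> \<omega>' \<in> S \<Longrightarrow> F \<omega> = F \<omega>' \<Longrightarrow> G \<omega> = G \<omega>'"
  obtains h where "\<And>\<omega>. \<omega> \<in> S \<Longrightarrow> G \<omega> = h (F \<omega>)"
proof
  fix \<omega> assume "\<omega> \<in> S"
  then show "G \<omega> = (\<lambda>t. G (inv_into S F t)) (F \<omega>)"
    using assms[of \<omega> "inv_into S F (F \<omega>)"] inv_into_into[of "F \<omega>" F S] f_inv_into_f[of "F \<omega>" F S]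
    by simp
qed

text \<open>One rule containing decomposition, weak union and relabelling: the new condition may absorb
  anything that \<open>A\<close> and \<open>C\<close> determine.\<close>
lemma ci_derive:
  assumes fin: "finite S" and ci: "ci S P A B C"
    and C'1: "\<And>\<omega> \<omega>'. \<omega> \<in> S \<Longrightarrow> \<omega>' \<in> S \<Longrightarrow> A \<omega> = A \<omega>' \<Longrightarrow> C \<omega> = C \<omega>' \<Longrightarrow> C' \<omega> = C' \<omega>'"
    and C'2: "\<And>\<omega> \<omega>'. \<omega> \<in> S \<Longrightarrow> \<omega>' \<in> S \<Longrightarrow> C' \<omega> = C' \<omega>' \<Longrightarrow> C \<omega> = C \<omega>'"
    and A': "\<And>\<omega> \<omega>'. \<omega> \<in> S \<Longrightarrow> \<omega>' \<in> S \<Longrightarrow> A \<omega> = A \<omega>' \<Longrightarrow> C' \<omega> = C' \<omega>' \<Longrightarrow> A' \<omega> = A' \<omega>'"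
    and B': "\<And>\<omega> \<omega>'. \<omega> \<in> S \<Longrightarrow> \<omega>' \<in> S \<Longrightarrow> B \<omega> = B \<omega>' \<Longrightarrow> C' \<omega> = C' \<omega>' \<Longrightarrow> B' \<omega> = B' \<omega>'"
  shows "ci S P A' B' C'"
proof -
  from ci obtain f g where fg: "\<And>a b c. pr S P (A \<bowtie> B \<bowtie> C) (a, b, c) = f a c * g b c"
    unfolding ci_def by blast
  obtain \<phi> where \<phi>: "\<And>\<omega>. \<omega> \<in> S \<Longrightarrow> C' \<omega> = \<phi> (A \<omega>, C \<omega>)"
    using determined_fun[of S "A \<bowtie> C" C'] C'1 by (metis prod.inject)
  obtain k where k: "\<And>\<omega>. \<omega> \<in> S \<Longrightarrow> C \<omega> = k (C' \<omega>)"
    using determined_fun[of S C' C] C'2 by metis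
  obtain \<alpha> where \<alpha>: "\<And>\<omega>. \<omega> \<in> S \<Longrightarrow> A' \<omega> = \<alpha> (A \<omega>, C' \<omega>)"
    using determined_fun[of S "A \<bowtie> C'" A'] A' by (metis prod.inject)
  obtain \<beta> where \<beta>: "\<And>\<omega>. \<omega> \<in> S \<Longrightarrow> B' \<omega> = \<beta> (B \<omega>, C' \<omega>)"
    using determined_fun[of S "B \<bowtie> C'" B'] B' by (metis prod.inject)
  \<comment> \<open>\<open>C'\<close> determines \<open>C\<close>, and \<open>A\<close> with
    \<open>C\<close> determines \<open>C'\<close>. So when \<open>A = a\<close>, the event
    \<open>C' = c\<close> is the event \<open>C = k c\<close> if \<open>\<phi> (a, k c) = c\<close>,
    and impossible otherwise. The proviso involves only \<open>a\<close> and \<open>c\<close> and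
    goes into the first factor.\<close>
  have 1: "pr S P (A \<bowtie> B \<bowtie> C') (a, b, c) =
      (if \<phi> (a, k c) = c then f a (k c) else 0) * g b (k c)" for a b c
  proof -
    have "pr S P (A \<bowtie> B \<bowtie> C') (a, b, c) =
        (if \<phi> (a, k c) = c then pr S P (A \<bowtie> B \<bowtie> C) (a, b, k c) else 0)"
    proof (cases "\<phi> (a, k c) = c")
      case True
      have "(A \<omega>, B \<omega>, C' \<omega>) = (a, b, c) \<longleftrightarrow> (A \<omega>, B \<omega>, C \<omega>) = (a, b, k c)" if "\<omega> \<in> S" for \<omega>
        using \<phi>[OF that] k[OF that] True by auto
      then show ?thesis using True unfolding pr_def by (auto intro!: sum.cong)
    next
      case False
      have "(A \<omega>, B \<omega>, C' \<omega>) \<noteq> (a, b, c)" if "\<omega> \<in> S" for \<omega>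
        using \<phi>[OF that] k[OF that] False by auto
      then have "(a, b, c) \<notin> (A \<bowtie> B \<bowtie> C') ` S" by (metis (no_types, lifting) imageE)
      then show ?thesis using False by (simp add: pr_outside)
    qed
    then show ?thesis by (simp add: fg)
  qed
  define F where "F a' c = (\<Sum>a\<in>A`S. if \<alpha> (a, c) = a' then (if \<phi> (a, k c) = c then f a (k c) else 0) else 0)" for a' c
  define G where "G b' c = (\<Sum>b\<in>B`S. if \<beta> (b, c) = b' then g b (k c) else 0)" for b' c
  have "pr S P (A' \<bowtie> B' \<bowtie> C') (a', b', c) = F a' c * G b' c" for a' b' c
  proof (cases "c \<in> C' ` S")
    case False
    \<comment> \<open>Outside the range of \<open>C'\<close> the law vanishes, so the product of the
      two sums has to vanish as well; by \<open>1\<close> it does so term by term.\<close>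
    have "f a (k c) * g b (k c) = 0" if "\<phi> (a, k c) = c" for a b
      using 1[of a b c] that False pr_outside[of "(a,b,c)" "A \<bowtie> B \<bowtie> C'" S P] by force
    then have "F a' c * G b' c = 0" unfolding F_def G_def sum_product
      by (intro sum.neutral ballI) auto
    then show ?thesis using False pr_outside[of "(a',b',c)" "A' \<bowtie> B' \<bowtie> C'" S P] by force
  next
    case True
    have "pr S P (A' \<bowtie> B' \<bowtie> C') (a', b', c) =
        pr S P (\<lambda>\<omega>. (\<alpha> (A \<omega>, C' \<omega>), \<beta> (B \<omega>, C' \<omega>), C' \<omega>)) (a', b', c)"
      unfolding pr_def using \<alpha> \<beta> by (intro sum.cong refl) auto
    also have "\<dots> = (\<Sum>a\<in>A`S. \<Sum>b\<in>B`S. \<Sum>c'\<in>C'`S. if c' = c then (if \<alpha> (a,c) = a' \<and> \<beta> (b,c) = b'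
        then pr S P (A \<bowtie> B \<bowtie> C') (a,b,c) else 0) else 0)"
      by (subst pr_marginal3[OF fin]) (auto intro!: sum.cong)
    also have "\<dots> = (\<Sum>a\<in>A`S. \<Sum>b\<in>B`S. if \<alpha> (a,c) = a' \<and> \<beta> (b,c) = b'
        then pr S P (A \<bowtie> B \<bowtie> C') (a,b,c) else 0)"
      using True fin by (simp add: sum.delta)
    also have "\<dots> = F a' c * G b' c"
      unfolding F_def G_def sum_product 1 by (intro sum.cong refl) auto
    finally show ?thesis .
  qed
  then show ?thesis unfolding ci_def by (intro exI allI)
qed

text \<open>With \<open>F\<close> and \<open>G\<close> the sums of the two factors over the ranges
  of \<open>A\<close> and \<open>B\<close>, the four probabilities are \<open>f a c * g b c\<close>,
  \<open>F * G\<close>, \<open>f a c * G\<close> and \<open>F * g b c\<close>. Values outside the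
  ranges are treated apart, because the sums do not see them; both sides are zero there.\<close>

lemma ci_prod:
  assumes fin: "finite S" and ci: "ci S P A B C"
  shows "pr S P (A \<bowtie> B \<bowtie> C) (a, b, c) * pr S P C c
    = pr S P (A \<bowtie> C) (a, c) * pr S P (B \<bowtie> C) (b, c)"
proof (cases "(a, c) \<in> (A \<bowtie> C) ` S \<and> (b, c) \<in> (B \<bowtie> C) ` S")
  case False
  then have "pr S P (A \<bowtie> C) (a, c) * pr S P (B \<bowtie> C) (b, c) = 0"
    using pr_outside[of "(a,c)" "A \<bowtie> C" S P] pr_outside[of "(b,c)" "B \<bowtie> C" S P] by auto
  moreover have "(a,b,c) \<notin> (A \<bowtie> B \<bowtie> C) ` S" using False by auto
  ultimately show ?thesis by (simp add: pr_outside)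
next
  case True
  from ci obtain f g where fg: "\<And>a b c. pr S P (A \<bowtie> B \<bowtie> C) (a, b, c) = f a c * g b c"
    unfolding ci_def by blast
  have abc: "a \<in> A ` S" "b \<in> B ` S" "c \<in> C ` S" using True by auto
  define F where "F = (\<Sum>a\<in>A`S. f a c)"
  define G where "G = (\<Sum>b\<in>B`S. g b c)"
  have fin': "finite (A`S)" "finite (B`S)" "finite (C`S)" using fin by auto
  have "pr S P C c = (\<Sum>a\<in>A`S. \<Sum>b\<in>B`S. \<Sum>c'\<in>C`S. if c' = c then f a c * g b c else 0)"
    using pr_marginal3[OF fin, of P "\<lambda>a b c. c" A B C c] by (simp add: fg cong: if_cong)
  then have 1: "pr S P C c = F * G"
    using abc fin' by (simp add: F_def G_def sum_product)
  have "pr S P (A \<bowtie> C) (a, c) =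
     (\<Sum>a'\<in>A`S. \<Sum>b\<in>B`S. \<Sum>c'\<in>C`S. if c' = c then (if a' = a then f a c * g b c else 0) else 0)"
    by (subst pr_marginal3[OF fin, of P "\<lambda>a b c. (a, c)" A B C]) (auto intro!: sum.cong simp: fg)
  also have "\<dots> = (\<Sum>a'\<in>A`S. if a' = a then (\<Sum>b\<in>B`S. f a c * g b c) else 0)"
    by (intro sum.cong refl) (use abc fin' in \<open>auto simp: sum.delta\<close>)
  finally have 2: "pr S P (A \<bowtie> C) (a, c) = f a c * G"
    using abc fin' by (simp add: G_def sum_distrib_left)
  have "pr S P (B \<bowtie> C) (b, c) =
     (\<Sum>a\<in>A`S. \<Sum>b'\<in>B`S. \<Sum>c'\<in>C`S. if c' = c then (if b' = b then f a c * g b c else 0) else 0)"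
    by (subst pr_marginal3[OF fin, of P "\<lambda>a b c. (b, c)" A B C]) (auto intro!: sum.cong simp: fg)
  also have "\<dots> = (\<Sum>a\<in>A`S. f a c * g b c)"
    using abc fin' by (simp cong: if_cong)
  finally have 3: "pr S P (B \<bowtie> C) (b, c) = F * g b c"
    by (simp add: F_def sum_distrib_right)
  show ?thesis unfolding 1 2 3 fg by simp
qed

text \<open>Sample points are identified by their coordinates and every fibre of \<open>C\<close> is
  a full rectangle, so a factorisation of the point masses is one of the law. The rectangle
  condition is what allows the indicator of the range to be split between the two factors.\<close>

lemma ci_rectangular:
  assumes fin: "finite S"
    and inj: "inj_on (A \<bowtie> B \<bowtie> C) S"
    and rect: "\<And>\<omega>1 \<omega>2. \<omega>1 \<in> S \<Longrightarrow> \<omega>2 \<in> S \<Longrightarrow> C \<omega>1 = C \<omega>2 \<Longrightarrow>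
       \<exists>\<omega>\<in>S. A \<omega> = A \<omega>1 \<and> B \<omega> = B \<omega>2 \<and> C \<omega> = C \<omega>1"
    and fact: "\<And>\<omega>. \<omega> \<in> S \<Longrightarrow> P \<omega> = f (A \<omega>) (C \<omega>) * g (B \<omega>) (C \<omega>)"
  shows "ci S P A B C"
proof -
  have "pr S P (A \<bowtie> B \<bowtie> C) (a, b, c) =
     (if \<exists>\<omega>\<in>S. A \<omega> = a \<and> C \<omega> = c then f a c else 0) * (if \<exists>\<omega>\<in>S. B \<omega> = b \<and> C \<omega> = c then g b c else 0)" for a b c
  proof (cases "\<exists>\<omega>\<in>S. A \<omega> = a \<and> B \<omega> = b \<and> C \<omega> = c")
    case True
    then obtain \<omega>0 where w: "\<omega>0 \<in> S" "A \<omega>0 = a" "B \<omega>0 = b" "C \<omega>0 = c" by blast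
    have "pr S P (A \<bowtie> B \<bowtie> C) (a, b, c) = (\<Sum>\<omega>\<in>S. if \<omega> = \<omega>0 then P \<omega>0 else 0)"
      unfolding pr_def using w inj by (intro sum.cong refl) (auto simp: inj_on_def)
    also have "\<dots> = P \<omega>0" using w fin by simp
    finally show ?thesis using fact[OF w(1)] w True by auto
  next
    case False
    then have "pr S P (A \<bowtie> B \<bowtie> C) (a, b, c) = 0" by (intro pr_outside) auto
    moreover have "\<not> ((\<exists>\<omega>\<in>S. A \<omega> = a \<and> C \<omega> = c) \<and> (\<exists>\<omega>\<in>S. B \<omega> = b \<and> C \<omega> = c))"
      using False rect by metis
    ultimately show ?thesis by auto
  qed
  then show ?thesis unfolding ci_def by (intro exI allI)
qed

section \<open>Entropy and conditional mutual information\<close>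

locale fin_space =
  fixes S :: "'w set" and P :: "'w \<Rightarrow> real"
  assumes fin: "finite S" and nn: "\<And>\<omega>. \<omega> \<in> S \<Longrightarrow> 0 \<le> P \<omega>"
begin

lemma pr_nonneg: "0 \<le> pr S P F a"
  unfolding pr_def using nn by (intro sum_nonneg) auto

lemma pr_ge: "\<omega> \<in> S \<Longrightarrow> P \<omega> \<le> pr S P F (F \<omega>)"
proof -
  assume w: "\<omega> \<in> S"
  have "(if F \<omega> = F \<omega> then P \<omega> else 0) \<le> pr S P F (F \<omega>)"
    unfolding pr_def using nn w fin by (intro member_le_sum) auto
  then show ?thesis by simp
qed

lemma pr_pos: "\<omega> \<in> S \<Longrightarrow> P \<omega> > 0 \<Longrightarrow> pr S P F (F \<omega>) > 0"
  using pr_ge[of \<omega> F] by linarith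

lemma pr_mono:
  assumes "\<And>\<omega>. \<omega> \<in> S \<Longrightarrow> F \<omega> = a \<Longrightarrow> G \<omega> = b"
  shows "pr S P F a \<le> pr S P G b"
  unfolding pr_def using nn assms by (intro sum_mono) auto

lemma prob_eq_pos: "\<omega> \<in> S \<Longrightarrow> P \<omega> > 0 \<Longrightarrow> prob_eq S P F \<omega> > 0"
  unfolding prob_eq_pr by (rule pr_pos)

lemma cmi_ent:
  "cond_mutual_info S P A B C = ent S P (A \<bowtie> C) + ent S P (B \<bowtie> C)
      - ent S P (A \<bowtie> B \<bowtie> C) - ent S P C"
proof -
  have "P \<omega> * log 2 (prob_eq S P (A \<bowtie> B \<bowtie> C) \<omega> * prob_eq S P C \<omega> /
         (prob_eq S P (A \<bowtie> C) \<omega> * prob_eq S P (B \<bowtie> C) \<omega>))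
     = P \<omega> * log 2 (prob_eq S P (A \<bowtie> B \<bowtie> C) \<omega>) + P \<omega> * log 2 (prob_eq S P C \<omega>)
       - P \<omega> * log 2 (prob_eq S P (A \<bowtie> C) \<omega>) - P \<omega> * log 2 (prob_eq S P (B \<bowtie> C) \<omega>)"
    if "\<omega> \<in> S" for \<omega>
  proof (cases "P \<omega> = 0")
    case False
    then have "P \<omega> > 0" using nn[OF that] by simp
    note pos = prob_eq_pos[OF that this]
    show ?thesis using pos[of "A \<bowtie> B \<bowtie> C"] pos[of C] pos[of "A \<bowtie> C"] pos[of "B \<bowtie> C"]
      by (simp add: log_divide log_mult algebra_simps)
  qed simp
  then show ?thesis unfolding cond_mutual_info_def ent_def
    by (simp add: sum.distrib sum_subtractf)
qed

text \<open>Gibbs' inequality: \<open>ln r \<ge> 1 - 1 / r\<close> reduces the claim to a comparison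
  of masses, and \<open>?AC * ?BC / ?C\<close> summed over the product of the ranges gives exactly
  the total mass of \<open>P\<close>.\<close>

lemma cmi_nonneg: "0 \<le> cond_mutual_info S P A B C"
proof -
  let ?ABC = "pr S P (A \<bowtie> B \<bowtie> C)"
  let ?AC = "pr S P (A \<bowtie> C)"
  let ?BC = "pr S P (B \<bowtie> C)"
  let ?C = "pr S P C"
  let ?T = "A ` S \<times> B ` S \<times> C ` S"
  have T: "finite ?T" "(A \<bowtie> B \<bowtie> C) ` S \<subseteq> ?T" using fin by auto
  have fin': "finite (A`S)" "finite (B`S)" "finite (C`S)" using fin by auto
  define g where "g = (\<lambda>(a,b,c). 1 - ?AC (a,c) * ?BC (b,c) / (?ABC (a,b,c) * ?C c))"
  have sumA: "(\<Sum>a\<in>A`S. ?AC (a,c)) = ?C c" for c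
  proof -
    have "?C c = (\<Sum>a\<in>A`S. \<Sum>c'\<in>C`S. if c' = c then ?AC (a,c) else 0)"
      by (subst pr_marginal2[OF fin, of P "\<lambda>a c. c" A C]) (auto intro!: sum.cong)
    also have "\<dots> = (\<Sum>a\<in>A`S. ?AC (a,c))"
    proof (cases "c \<in> C`S")
      case True then show ?thesis using fin' by (simp add: sum.delta)
    next
      case False
      then have "?AC (a,c) = 0" for a by (intro pr_outside) auto
      then show ?thesis by (simp cong: if_cong)
    qed
    finally show ?thesis by simp
  qed
  have sumB: "(\<Sum>a\<in>B`S. ?BC (a,c)) = ?C c" for c
  proof -
    have "?C c = (\<Sum>a\<in>B`S. \<Sum>c'\<in>C`S. if c' = c then ?BC (a,c) else 0)"
      by (subst pr_marginal2[OF fin, of P "\<lambda>a c. c" B C]) (auto intro!: sum.cong)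
    also have "\<dots> = (\<Sum>a\<in>B`S. ?BC (a,c))"
    proof (cases "c \<in> C`S")
      case True then show ?thesis using fin' by (simp add: sum.delta)
    next
      case False
      then have "?BC (a,c) = 0" for a by (intro pr_outside) auto
      then show ?thesis by (simp cong: if_cong)
    qed
    finally show ?thesis by simp
  qed
  have "P \<omega> * g (A \<omega>, B \<omega>, C \<omega>) \<le> ln 2 * (P \<omega> * log 2
        (prob_eq S P (A \<bowtie> B \<bowtie> C) \<omega> * prob_eq S P C \<omega> /
         (prob_eq S P (A \<bowtie> C) \<omega> * prob_eq S P (B \<bowtie> C) \<omega>)))"
    if "\<omega> \<in> S" for \<omega>
  proof (cases "P \<omega> = 0")
    case False
    then have "P \<omega> > 0" using nn[OF that] by simp
    note pos = prob_eq_pos[OF that this]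
    let ?r = "prob_eq S P (A \<bowtie> B \<bowtie> C) \<omega> * prob_eq S P C \<omega> /
         (prob_eq S P (A \<bowtie> C) \<omega> * prob_eq S P (B \<bowtie> C) \<omega>)"
    have rpos: "?r > 0" by (intro divide_pos_pos mult_pos_pos pos)
    have "1 - 1 / r \<le> ln r" if "0 < r" for r :: real
      using ln_le_minus_one[of "1 / r"] that by (simp add: ln_div)
    then have "1 - 1 / ?r \<le> ln ?r" using rpos by blast
    moreover have "g (A \<omega>, B \<omega>, C \<omega>) = 1 - 1 / ?r" by (simp add: g_def prob_eq_pr)
    ultimately have "P \<omega> * g (A \<omega>, B \<omega>, C \<omega>) \<le> P \<omega> * ln ?r"
      using \<open>P \<omega> > 0\<close> by (intro mult_left_mono) auto
    then show ?thesis by (simp add: log_def)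
  qed simp
  then have "(\<Sum>\<omega>\<in>S. P \<omega> * g (A \<omega>, B \<omega>, C \<omega>)) \<le> ln 2 * cond_mutual_info S P A B C"
    unfolding cond_mutual_info_def sum_distrib_left by (intro sum_mono) auto
  moreover have "0 \<le> (\<Sum>\<omega>\<in>S. P \<omega> * g (A \<omega>, B \<omega>, C \<omega>))"
  proof -
    have "(\<Sum>\<omega>\<in>S. P \<omega> * g (A \<omega>, B \<omega>, C \<omega>)) = (\<Sum>t\<in>?T. ?ABC t * g t)"
      by (rule sum_law[OF fin T])
    \<comment> \<open>At triples of probability zero the product with \<open>g\<close> is zero while
      the subtracted term may be positive, hence only an inequality.\<close>
    also have "\<dots> \<ge> (\<Sum>(a,b,c)\<in>?T. ?ABC (a,b,c) - ?AC (a,c) * ?BC (b,c) / ?C c)"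
    proof (intro sum_mono, clarify)
      fix \<omega>1 \<omega>2 \<omega>3
      let ?a = "A \<omega>1" let ?b = "B \<omega>2" let ?c = "C \<omega>3"
      have "0 \<le> ?AC (?a, ?c) * ?BC (?b, ?c) / ?C ?c" by (simp add: pr_nonneg)
      then show "?ABC (?a, ?b, ?c) - ?AC (?a, ?c) * ?BC (?b, ?c) / ?C ?c \<le> ?ABC (?a, ?b, ?c) * g (?a, ?b, ?c)"
        by (cases "?ABC (?a, ?b, ?c) = 0") (auto simp: g_def field_simps)
    qed
    also have "(\<Sum>(a,b,c)\<in>?T. ?ABC (a,b,c) - ?AC (a,c) * ?BC (b,c) / ?C c)
       = (\<Sum>t\<in>?T. ?ABC t) - (\<Sum>(a,b,c)\<in>?T. ?AC (a,c) * ?BC (b,c) / ?C c)"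
      by (simp add: sum_subtractf case_prod_beta)
    also have "(\<Sum>t\<in>?T. ?ABC t) = (\<Sum>\<omega>\<in>S. P \<omega>)"
      using sum_law[OF fin T, of P "\<lambda>_. 1"] by simp
    also have "(\<Sum>(a,b,c)\<in>?T. ?AC (a,c) * ?BC (b,c) / ?C c) =
        (\<Sum>a\<in>A`S. \<Sum>b\<in>B`S. \<Sum>c\<in>C`S. ?AC (a,c) * ?BC (b,c) / ?C c)"
      by (simp add: sum_triple)
    also have "\<dots> = (\<Sum>a\<in>A`S. \<Sum>c\<in>C`S. \<Sum>b\<in>B`S. ?AC (a,c) * ?BC (b,c) / ?C c)"
      by (intro sum.cong refl sum.swap)
    also have "\<dots> = (\<Sum>c\<in>C`S. \<Sum>a\<in>A`S. \<Sum>b\<in>B`S. ?AC (a,c) * ?BC (b,c) / ?C c)"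
      by (rule sum.swap)
    also have "\<dots> = (\<Sum>c\<in>C`S. (\<Sum>a\<in>A`S. ?AC (a,c)) * (\<Sum>b\<in>B`S. ?BC (b,c)) / ?C c)"
      by (simp add: sum_product sum_divide_distrib)
    also have "\<dots> = (\<Sum>c\<in>C`S. ?C c)" unfolding sumA sumB by simp
    also have "\<dots> = (\<Sum>\<omega>\<in>S. P \<omega>)"
      using sum_law[OF fin, of "C`S" C P "\<lambda>_. 1"] fin by simp
    finally show ?thesis by simp
  qed
  ultimately have "0 \<le> ln 2 * cond_mutual_info S P A B C" by linarith
  then show ?thesis by (simp add: zero_le_mult_iff)
qed

lemma ci_cmi_zero:
  assumes "ci S P A B C"
  shows "cond_mutual_info S P A B C = 0"
  unfolding cond_mutual_info_def
proof (intro sum.neutral ballI)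
  fix \<omega> assume w: "\<omega> \<in> S"
  show "P \<omega> * log 2 (prob_eq S P (A \<bowtie> B \<bowtie> C) \<omega> * prob_eq S P C \<omega> /
         (prob_eq S P (A \<bowtie> C) \<omega> * prob_eq S P (B \<bowtie> C) \<omega>)) = 0"
  proof (cases "P \<omega> = 0")
    case False
    then have "P \<omega> > 0" using nn[OF w] by simp
    note pos = prob_eq_pos[OF w this]
    show ?thesis using ci_prod[OF fin assms, of "A \<omega>" "B \<omega>" "C \<omega>"]
        pos[of "A \<bowtie> C"] pos[of "B \<bowtie> C"]
      by (simp add: prob_eq_pr)
  qed simp
qed

lemma ent_mono:
  assumes "\<And>\<omega> \<omega>'. \<omega> \<in> S \<Longrightarrow> \<omega>' \<in> S \<Longrightarrow> F \<omega> = F \<omega>' \<Longrightarrow> G \<omega> = G \<omega>'"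
  shows "ent S P G \<le> ent S P F"
proof -
  have "P \<omega> * log 2 (prob_eq S P F \<omega>) \<le> P \<omega> * log 2 (prob_eq S P G \<omega>)" if w: "\<omega> \<in> S" for \<omega>
  proof (cases "P \<omega> = 0")
    case False
    then have p: "P \<omega> > 0" using nn[OF w] by simp
    have "prob_eq S P F \<omega> \<le> prob_eq S P G \<omega>"
      unfolding prob_eq_pr using assms[OF _ w] by (intro pr_mono) auto
    then show ?thesis using p prob_eq_pos[OF w p, of F] by (intro mult_left_mono) auto
  qed simp
  then show ?thesis unfolding ent_def by (auto intro!: sum_mono)
qed

text \<open>The single-letterisation step: side information independent of \<open>A\<close> may be moved into
  the condition at the price of only increasing the information.\<close>
lemma cmi_absorb:
  assumes ci: "ci S P A E D"
    and B': "\<And>\<omega> \<omega>'. \<omega> \<in> S \<Longrightarrow> \<omega>' \<in> S \<Longrightarrow> B \<omega> = B \<omega>' \<Longrightarrow> E \<omega> = E \<omega>' \<Longrightarrow> D \<omega> = D \<omega>' \<Longrightarrow> B' \<omega> = B' \<omega>'"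
  shows "cond_mutual_info S P A B' D \<le> cond_mutual_info S P A B (E \<bowtie> D)"
proof -
  have 0: "0 = cond_mutual_info S P A E D" using ci_cmi_zero[OF ci] by simp
  have 1: "0 \<le> cond_mutual_info S P A (B \<bowtie> E) (B' \<bowtie> D)" by (rule cmi_nonneg)
  have e: "ent S P ((B \<bowtie> E) \<bowtie> B' \<bowtie> D) = ent S P (B \<bowtie> E \<bowtie> D)"
    "ent S P (A \<bowtie> (B \<bowtie> E) \<bowtie> B' \<bowtie> D) = ent S P (A \<bowtie> B \<bowtie> E \<bowtie> D)"
    by (auto intro!: ent_cong intro: B')
  show ?thesis using 0 1 unfolding cmi_ent e by linarith
qed

text \<open>By the chain rule the difference of the two sides is the information between
  \<open>A\<close> and \<open>C\<close> given \<open>D\<close>.\<close>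

lemma cmi_split_cond:
  "cond_mutual_info S P A B (C \<bowtie> D) \<le> cond_mutual_info S P A (B \<bowtie> C) D"
proof -
  have 1: "0 \<le> cond_mutual_info S P A C D" by (rule cmi_nonneg)
  have e: "ent S P ((B \<bowtie> C) \<bowtie> D) = ent S P (B \<bowtie> C \<bowtie> D)"
    "ent S P (A \<bowtie> (B \<bowtie> C) \<bowtie> D) = ent S P (A \<bowtie> B \<bowtie> C \<bowtie> D)"
    by (auto intro!: ent_cong)
  show ?thesis using 1 unfolding cmi_ent e by linarith
qed

text \<open>Given \<open>C\<close>, the variable \<open>B\<close> says nothing about
  \<open>A\<close>. For each value \<open>c\<close> the cost of an estimator using both is therefore
  an average over \<open>B\<close> of the costs \<open>m c x\<close> of fixed guesses, and the best
  fixed guess does no worse. This turns block decoders into single-letter estimators.\<close>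

lemma ci_estimator:
  fixes d :: "'a \<Rightarrow> 'h::finite \<Rightarrow> real"
  assumes ci: "ci S P A B C"
    and e: "\<And>\<omega> \<omega>'. \<omega> \<in> S \<Longrightarrow> \<omega>' \<in> S \<Longrightarrow> B \<omega> = B \<omega>' \<Longrightarrow> C \<omega> = C \<omega>' \<Longrightarrow> e \<omega> = e \<omega>'"
  shows "\<exists>h. (\<Sum>\<omega>\<in>S. P \<omega> * d (A \<omega>) (h (C \<omega>))) \<le> (\<Sum>\<omega>\<in>S. P \<omega> * d (A \<omega>) (e \<omega>))"
proof -
  let ?ABC = "pr S P (A \<bowtie> B \<bowtie> C)"
  let ?AC = "pr S P (A \<bowtie> C)"
  let ?BC = "pr S P (B \<bowtie> C)"
  let ?C = "pr S P C"
  obtain \<epsilon> where \<epsilon>: "\<And>\<omega>. \<omega> \<in> S \<Longrightarrow> e \<omega> = \<epsilon> (B \<omega>, C \<omega>)"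
    using determined_fun[of S "B \<bowtie> C" e] e by (metis prod.inject)
  define m where "m c x = (\<Sum>a\<in>A`S. ?AC (a,c) * d a x)" for c x
  have "\<exists>x. \<forall>y. m c x \<le> m c y" for c
  proof -
    have "finite (range (m c))" "range (m c) \<noteq> {}" by auto
    from Min_in[OF this] obtain x where "Min (range (m c)) = m c x" by blast
    then show ?thesis by (metis Min_le \<open>finite (range (m c))\<close> rangeI)
  qed
  then obtain h where h: "\<And>c y. m c (h c) \<le> m c y" by metis
  let ?T = "A ` S \<times> B ` S \<times> C ` S"
  have T: "finite ?T" "(A \<bowtie> B \<bowtie> C) ` S \<subseteq> ?T" using fin by auto
  have key: "(\<Sum>\<omega>\<in>S. P \<omega> * d (A \<omega>) (\<eta> (B \<omega>, C \<omega>)))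
      = (\<Sum>c\<in>C`S. \<Sum>b\<in>B`S. ?BC (b,c) / ?C c * m c (\<eta> (b,c)))" for \<eta>
  proof -
    have abc: "?ABC (a,b,c) = ?BC (b,c) / ?C c * ?AC (a,c)" for a b c
    proof (cases "?C c = 0")
      case True
      have "?ABC (a,b,c) \<le> ?C c" by (rule pr_mono) auto
      then show ?thesis using True pr_nonneg[of "A \<bowtie> B \<bowtie> C" "(a,b,c)"] by simp
    next
      case False
      then show ?thesis using ci_prod[OF fin ci, of a b c] by (simp add: field_simps)
    qed
    have "(\<Sum>\<omega>\<in>S. P \<omega> * d (A \<omega>) (\<eta> (B \<omega>, C \<omega>))) = (\<Sum>(a,b,c)\<in>?T. ?ABC (a,b,c) * d a (\<eta> (b,c)))"
      using sum_law[OF fin T, of P "\<lambda>(a,b,c). d a (\<eta> (b,c))"] by (simp add: case_prod_beta)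
    also have "\<dots> = (\<Sum>a\<in>A`S. \<Sum>b\<in>B`S. \<Sum>c\<in>C`S. ?ABC (a,b,c) * d a (\<eta> (b,c)))"
      by (simp add: sum_triple)
    also have "\<dots> = (\<Sum>a\<in>A`S. \<Sum>c\<in>C`S. \<Sum>b\<in>B`S. ?ABC (a,b,c) * d a (\<eta> (b,c)))"
      by (intro sum.cong refl sum.swap)
    also have "\<dots> = (\<Sum>c\<in>C`S. \<Sum>a\<in>A`S. \<Sum>b\<in>B`S. ?ABC (a,b,c) * d a (\<eta> (b,c)))"
      by (rule sum.swap)
    also have "\<dots> = (\<Sum>c\<in>C`S. \<Sum>b\<in>B`S. \<Sum>a\<in>A`S. ?ABC (a,b,c) * d a (\<eta> (b,c)))"
      by (intro sum.cong refl sum.swap)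
    also have "\<dots> = (\<Sum>c\<in>C`S. \<Sum>b\<in>B`S. ?BC (b,c) / ?C c * m c (\<eta> (b,c)))"
      by (simp add: abc m_def sum_distrib_left mult.assoc)
    finally show ?thesis .
  qed
  have "(\<Sum>\<omega>\<in>S. P \<omega> * d (A \<omega>) (h (C \<omega>))) = (\<Sum>c\<in>C`S. \<Sum>b\<in>B`S. ?BC (b,c) / ?C c * m c (h c))"
    using key[of "\<lambda>(b,c). h c"] by simp
  also have "\<dots> \<le> (\<Sum>c\<in>C`S. \<Sum>b\<in>B`S. ?BC (b,c) / ?C c * m c (\<epsilon> (b,c)))"
    by (intro sum_mono mult_left_mono h) (simp add: pr_nonneg)
  also have "\<dots> = (\<Sum>\<omega>\<in>S. P \<omega> * d (A \<omega>) (e \<omega>))"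
    using key[of \<epsilon>] \<epsilon> by (simp cong: sum.cong)
  finally show ?thesis by blast
qed

end

section \<open>Alphabet reduction\<close>

definition idens :: "'w set \<Rightarrow> ('w \<Rightarrow> real) \<Rightarrow> ('w \<Rightarrow> 'a) \<Rightarrow> ('w \<Rightarrow> 'b) \<Rightarrow> ('w \<Rightarrow> 'c) \<Rightarrow> 'w \<Rightarrow> real" where
  "idens S P A B C \<omega> = prob_eq S P (A \<bowtie> B \<bowtie> C) \<omega> * prob_eq S P C \<omega> /
         (prob_eq S P (A \<bowtie> C) \<omega> * prob_eq S P (B \<bowtie> C) \<omega>)"

lemma cmi_idens: "cond_mutual_info S P A B C = (\<Sum>\<omega>\<in>S. P \<omega> * log 2 (idens S P A B C \<omega>))"
  by (simp add: cond_mutual_info_def idens_def)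

text \<open>Only the partitions matter, and those of \<open>A\<close> and \<open>B\<close> only
  within a cell of \<open>C\<close>. Relabelling needs this weak form, because labels of
  \<open>V\<close> may be reused for different values of \<open>U\<close>.\<close>

lemma cmi_cong:
  assumes "\<And>\<omega> \<omega>'. \<omega> \<in> S \<Longrightarrow> \<omega>' \<in> S \<Longrightarrow> C \<omega>' = C \<omega> \<longleftrightarrow> C' \<omega>' = C' \<omega>"
    and "\<And>\<omega> \<omega>'. \<omega> \<in> S \<Longrightarrow> \<omega>' \<in> S \<Longrightarrow> C \<omega>' = C \<omega> \<Longrightarrow> A \<omega>' = A \<omega> \<longleftrightarrow> A' \<omega>' = A' \<omega>"
    and "\<And>\<omega> \<omega>'. \<omega> \<in> S \<Longrightarrow> \<omega>' \<in> S \<Longrightarrow> C \<omega>' = C \<omega> \<Longrightarrow> B \<omega>' = B \<omega> \<longleftrightarrow> B' \<omega>' = B' \<omega>"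
  shows "cond_mutual_info S P A B C = cond_mutual_info S P A' B' C'"
  unfolding cmi_idens idens_def
proof (intro sum.cong refl)
  fix \<omega> assume w: "\<omega> \<in> S"
  have "prob_eq S P C \<omega> = prob_eq S P C' \<omega>"
    "prob_eq S P (A \<bowtie> C) \<omega> = prob_eq S P (A' \<bowtie> C') \<omega>"
    "prob_eq S P (B \<bowtie> C) \<omega> = prob_eq S P (B' \<bowtie> C') \<omega>"
    "prob_eq S P (A \<bowtie> B \<bowtie> C) \<omega> = prob_eq S P (A' \<bowtie> B' \<bowtie> C') \<omega>"
    using assms w by (auto intro!: prob_eq_cong)
  then show "P \<omega> * log 2 (prob_eq S P (A \<bowtie> B \<bowtie> C) \<omega> * prob_eq S P C \<omega> /
         (prob_eq S P (A \<bowtie> C) \<omega> * prob_eq S P (B \<bowtie> C) \<omega>)) =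
     P \<omega> * log 2 (prob_eq S P (A' \<bowtie> B' \<bowtie> C') \<omega> * prob_eq S P C' \<omega> /
         (prob_eq S P (A' \<bowtie> C') \<omega> * prob_eq S P (B' \<bowtie> C') \<omega>))"
    by simp
qed

text \<open>The average of \<open>\<phi>\<close> lies in the convex hull of its values, hence in the
  hull of at most \<open>DIM('v) + 1\<close> of them. Multiplying the convex coefficients by the
  number of indices turns the average back into the sum; the section \<open>s\<close> charges each
  value used to a single index.\<close>

lemma caratheodory_weights:
  fixes \<phi> :: "'i \<Rightarrow> 'v::euclidean_space"
  assumes fin: "finite I"
  shows "\<exists>lam. (\<forall>i. (0::real) \<le> lam i) \<and> (\<Sum>i\<in>I. lam i *\<^sub>R \<phi> i) = (\<Sum>i\<in>I. \<phi> i) \<and>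
     card {i\<in>I. lam i \<noteq> 0} \<le> DIM('v) + 1"
proof (cases "I = {}")
  case True
  then show ?thesis by (intro exI[of _ "\<lambda>_. 0"]) auto
next
  case False
  define N where "N = real (card I)"
  have N: "N > 0" using False fin by (simp add: N_def card_gt_0_iff)
  have "(\<Sum>i\<in>I. (1 / N) *\<^sub>R \<phi> i) \<in> convex hull (\<phi> ` I)"
    using fin N by (intro convex_sum) (auto simp: N_def hull_inc)
  then obtain T where T: "finite T" "T \<subseteq> \<phi> ` I" "card T \<le> DIM('v) + 1"
     "(\<Sum>i\<in>I. (1 / N) *\<^sub>R \<phi> i) \<in> convex hull T"
    unfolding caratheodory[of "\<phi> ` I"] by blast
  from T(4) obtain u where u: "\<forall>x\<in>T. 0 \<le> u x" "sum u T = 1"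
     "(\<Sum>x\<in>T. u x *\<^sub>R x) = (\<Sum>i\<in>I. (1 / N) *\<^sub>R \<phi> i)"
    unfolding convex_hull_finite[OF T(1)] by blast
  define s where "s = inv_into I \<phi>"
  have s: "s x \<in> I" "\<phi> (s x) = x" if "x \<in> T" for x
    using that T(2) by (auto simp: s_def inv_into_into f_inv_into_f subset_iff)
  have inj: "inj_on s T" using s by (metis inj_onI)
  define lam where "lam i = (if i \<in> s ` T then N * u (\<phi> i) else 0)" for i
  have "(\<Sum>i\<in>I. lam i *\<^sub>R \<phi> i) = (\<Sum>i\<in>s`T. (N * u (\<phi> i)) *\<^sub>R \<phi> i)"
    using fin s by (intro sum.mono_neutral_cong_right) (auto simp: lam_def)
  also have "\<dots> = (\<Sum>x\<in>T. (N * u x) *\<^sub>R x)"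
    using s by (subst sum.reindex[OF inj]) (auto intro!: sum.cong)
  also have "\<dots> = N *\<^sub>R (\<Sum>x\<in>T. u x *\<^sub>R x)" by (simp add: scaleR_sum_right)
  also have "\<dots> = (\<Sum>i\<in>I. \<phi> i)" using N by (simp add: u(3) scaleR_sum_right[symmetric])
  finally have "(\<Sum>i\<in>I. lam i *\<^sub>R \<phi> i) = (\<Sum>i\<in>I. \<phi> i)" .
  moreover have "0 \<le> lam i" for i using u(1) s N by (auto simp: lam_def)
  moreover have "card {i\<in>I. lam i \<noteq> 0} \<le> card (s ` T)"
    using T(1) by (intro card_mono) (auto simp: lam_def split: if_splits)
  moreover have "card (s ` T) \<le> DIM('v) + 1"
    using card_image_le[OF T(1), of s] T(3) by linarith
  ultimately show ?thesis by (intro exI[of _ lam]) auto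
qed

text \<open>Caratheodory's theorem is applied separately in each cell of \<open>C\<close>, to the
  sums of \<open>\<Phi>\<close> over the cells of \<open>G\<close>. As \<open>G\<close> determines
  \<open>C\<close>, the weights of the different cells combine into one function of
  \<open>G\<close>. Preserving the sums in every cell, and not only overall, protects the law of the
  variables already reduced.\<close>

lemma reweight_contexts:
  fixes \<Phi> :: "'w \<Rightarrow> 'v::euclidean_space"
  assumes fin: "finite S"
    and det: "\<And>\<omega> \<omega>'. \<omega> \<in> S \<Longrightarrow> \<omega>' \<in> S \<Longrightarrow> G \<omega> = G \<omega>' \<Longrightarrow> C \<omega> = C \<omega>'"
  shows "\<exists>lam. (\<forall>g. (0::real) \<le> lam g) \<and>
     (\<forall>c. (\<Sum>\<omega>\<in>{\<omega>\<in>S. C \<omega> = c}. lam (G \<omega>) *\<^sub>R \<Phi> \<omega>) = (\<Sum>\<omega>\<in>{\<omega>\<in>S. C \<omega> = c}. \<Phi> \<omega>)) \<and>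
     (\<forall>c. card (G ` {\<omega>\<in>S. C \<omega> = c \<and> lam (G \<omega>) \<noteq> 0}) \<le> DIM('v) + 1)"
proof -
  define T where "T c = {\<omega>\<in>S. C \<omega> = c}" for c
  define \<phi> where "\<phi> g = (\<Sum>\<omega>\<in>{\<omega>\<in>S. G \<omega> = g}. \<Phi> \<omega>)" for g
  have finT: "finite (T c)" for c using fin by (simp add: T_def)
  have "\<forall>c. \<exists>lam. (\<forall>i. (0::real) \<le> lam i) \<and> (\<Sum>i\<in>G`T c. lam i *\<^sub>R \<phi> i) = (\<Sum>i\<in>G`T c. \<phi> i) \<and>
     card {i\<in>G`T c. lam i \<noteq> 0} \<le> DIM('v) + 1"
    using finT by (intro allI caratheodory_weights) auto
  from choice[OF this] obtain L where LL: "\<forall>c. (\<forall>i. (0::real) \<le> L c i) \<and>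
     (\<Sum>i\<in>G`T c. L c i *\<^sub>R \<phi> i) = (\<Sum>i\<in>G`T c. \<phi> i) \<and>
     card {i\<in>G`T c. L c i \<noteq> 0} \<le> DIM('v) + 1" by blast
  then have L: "\<And>c i. (0::real) \<le> L c i"
     "\<And>c. (\<Sum>i\<in>G`T c. L c i *\<^sub>R \<phi> i) = (\<Sum>i\<in>G`T c. \<phi> i)"
     "\<And>c. card {i\<in>G`T c. L c i \<noteq> 0} \<le> DIM('v) + 1" by blast+
  obtain k where k: "\<And>\<omega>. \<omega> \<in> S \<Longrightarrow> C \<omega> = k (G \<omega>)" using determined_fun[of S G C] det by metis
  define lam where "lam g = L (k g) g" for g
  have *: "(\<Sum>\<omega>\<in>T c. \<mu> (G \<omega>) *\<^sub>R \<Phi> \<omega>) = (\<Sum>i\<in>G`T c. \<mu> i *\<^sub>R \<phi> i)" for \<mu> :: "_ \<Rightarrow> real" and c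
  proof -
    have "(\<Sum>\<omega>\<in>T c. \<mu> (G \<omega>) *\<^sub>R \<Phi> \<omega>) = (\<Sum>g\<in>G`T c. \<Sum>\<omega>\<in>{\<omega>\<in>T c. G \<omega> = g}. \<mu> (G \<omega>) *\<^sub>R \<Phi> \<omega>)"
      by (rule sum.image_gen[OF finT])
    also have "\<dots> = (\<Sum>g\<in>G`T c. \<mu> g *\<^sub>R \<phi> g)"
    proof (intro sum.cong refl)
      fix g assume "g \<in> G ` T c"
      then have "{\<omega>\<in>T c. G \<omega> = g} = {\<omega>\<in>S. G \<omega> = g}" using det by (auto simp: T_def)
      then show "(\<Sum>\<omega>\<in>{\<omega>\<in>T c. G \<omega> = g}. \<mu> (G \<omega>) *\<^sub>R \<Phi> \<omega>) = \<mu> g *\<^sub>R \<phi> g"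
        by (simp add: \<phi>_def scaleR_sum_right)
    qed
    finally show ?thesis .
  qed
  have "(\<Sum>\<omega>\<in>T c. lam (G \<omega>) *\<^sub>R \<Phi> \<omega>) = (\<Sum>\<omega>\<in>T c. \<Phi> \<omega>)" for c
  proof -
    have "(\<Sum>\<omega>\<in>T c. lam (G \<omega>) *\<^sub>R \<Phi> \<omega>) = (\<Sum>\<omega>\<in>T c. L c (G \<omega>) *\<^sub>R \<Phi> \<omega>)"
      by (intro sum.cong refl) (auto simp: T_def lam_def k[symmetric])
    also have "\<dots> = (\<Sum>\<omega>\<in>T c. \<Phi> \<omega>)" using *[of "L c" c] *[of "\<lambda>_. 1" c] L(2)[of c] by simp
    finally show ?thesis .
  qed
  moreover have "card (G ` {\<omega>\<in>S. C \<omega> = c \<and> lam (G \<omega>) \<noteq> 0}) \<le> DIM('v) + 1" for c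
  proof -
    have "G ` {\<omega>\<in>S. C \<omega> = c \<and> lam (G \<omega>) \<noteq> 0} \<subseteq> {i\<in>G`T c. L c i \<noteq> 0}"
      by (auto simp: T_def lam_def k[symmetric])
    then have "card (G ` {\<omega>\<in>S. C \<omega> = c \<and> lam (G \<omega>) \<noteq> 0}) \<le> card {i\<in>G`T c. L c i \<noteq> 0}"
      using finT by (intro card_mono) auto
    then show ?thesis using L(3)[of c] by linarith
  qed
  ultimately show ?thesis using L(1) unfolding T_def by (intro exI[of _ lam]) (auto simp: lam_def)
qed

lemma pr_support:
  assumes "finite S"
  shows "pr {\<omega>\<in>S. P \<omega> \<noteq> 0} P F a = pr S P F a"
  unfolding pr_def using assms by (intro sum.mono_neutral_left) auto

lemma sum_support:
  assumes "finite S"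
  shows "(\<Sum>\<omega>\<in>{\<omega>\<in>S. P \<omega> \<noteq> 0}. P \<omega> * h \<omega>) = (\<Sum>\<omega>\<in>S. P \<omega> * (h \<omega> :: real))"
  using assms by (intro sum.mono_neutral_left) auto

lemma law_determined:
  assumes fin: "finite S" and sub: "S' \<subseteq> S"
    and eq: "\<And>t. pr S' P' B t = pr S P B t"
    and det: "\<And>\<omega> \<omega>'. \<omega> \<in> S \<Longrightarrow> \<omega>' \<in> S \<Longrightarrow> B \<omega> = B \<omega>' \<Longrightarrow> F \<omega> = F \<omega>'"
  shows "pr S' P' F a = pr S P F a"
proof -
  obtain h where h: "\<And>\<omega>. \<omega> \<in> S \<Longrightarrow> F \<omega> = h (B \<omega>)" using determined_fun[of S B F] det by metis
  have "pr S' P' F a = pr S' P' (\<lambda>\<omega>. h (B \<omega>)) a" "pr S P F a = pr S P (\<lambda>\<omega>. h (B \<omega>)) a"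
    unfolding pr_def using h sub by (auto intro!: sum.cong)
  then show ?thesis using law_marginal[of S' S P' B P B h a] eq fin finite_subset[OF sub fin] by simp
qed

text \<open>If \<open>F\<close> determines \<open>G\<close>, the weight is constant on the event
  whose probability is taken.\<close>

lemma prob_eq_reweight:
  assumes fin: "finite S" and S': "S' = {\<omega>\<in>S. l (G \<omega>) \<noteq> 0}" and P': "P' = (\<lambda>\<omega>. l (G \<omega>) * P \<omega>)"
    and det: "\<And>\<omega>'. \<omega>' \<in> S \<Longrightarrow> F \<omega>' = F \<omega> \<Longrightarrow> G \<omega>' = G \<omega>"
  shows "prob_eq S' P' F \<omega> = l (G \<omega>) * prob_eq S P F \<omega>"
proof -
  have "prob_eq S' P' F \<omega> = prob_eq S P' F \<omega>"
    unfolding prob_eq_def S' P' using fin by (intro sum.mono_neutral_left) auto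
  also have "\<dots> = l (G \<omega>) * prob_eq S P F \<omega>"
    unfolding prob_eq_def sum_distrib_left P' using det by (intro sum.cong refl) auto
  finally show ?thesis .
qed

section \<open>Systems of auxiliary variables and the reduction of their alphabets\<close>

text \<open>The demands of the region, relaxed to variables on any finite sample space: the chains
  for \<open>V\<close> and \<open>W\<close> leave out \<open>Y\<close>, the estimators are random
  variables with a determinacy condition, and the estimate of \<open>X\<close> may also use
  \<open>V\<close>. Positivity of \<open>P\<close> means that reweighting with zeros passes to a
  smaller space.\<close>

locale rv_system =
  fixes p :: "'x::finite \<times> 'y::finite \<times> 'z::finite \<Rightarrow> real"
    and dx :: "'x \<Rightarrow> 'xh::finite \<Rightarrow> real" and dz :: "'z \<Rightarrow> 'zh::finite \<Rightarrow> real"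
    and Dx Dz R1 R2 R3 :: real
    and S :: "'w set" and P :: "'w \<Rightarrow> real"
    and X :: "'w \<Rightarrow> 'x" and Y :: "'w \<Rightarrow> 'y" and Z :: "'w \<Rightarrow> 'z"
    and U :: "'w \<Rightarrow> 'u" and V :: "'w \<Rightarrow> 'v" and W :: "'w \<Rightarrow> 't"
    and xh :: "'w \<Rightarrow> 'xh" and zh :: "'w \<Rightarrow> 'zh"
  assumes fin_S: "finite S" and pos: "\<And>\<omega>. \<omega> \<in> S \<Longrightarrow> 0 < P \<omega>"
    and law: "\<And>t. pr S P (X \<bowtie> Y \<bowtie> Z) t = p t"
    and ciU: "ci S P U (X \<bowtie> Z) Y"
    and ciV: "ci S P V X (U \<bowtie> Z)"
    and ciW: "ci S P W Z (U \<bowtie> V \<bowtie> X)"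
    and rate1: "cond_mutual_info S P Y U Z \<le> R1"
    and rate2: "cond_mutual_info S P Z V (U \<bowtie> X) \<le> R2"
    and rate3: "cond_mutual_info S P X W (U \<bowtie> V \<bowtie> Z) \<le> R3"
    and xh_det: "\<And>\<omega> \<omega>'. \<omega> \<in> S \<Longrightarrow> \<omega>' \<in> S \<Longrightarrow> U \<omega> = U \<omega>' \<Longrightarrow> V \<omega> = V \<omega>' \<Longrightarrow> W \<omega> = W \<omega>' \<Longrightarrow>
       Z \<omega> = Z \<omega>' \<Longrightarrow> xh \<omega> = xh \<omega>'"
    and zh_det: "\<And>\<omega> \<omega>'. \<omega> \<in> S \<Longrightarrow> \<omega>' \<in> S \<Longrightarrow> U \<omega> = U \<omega>' \<Longrightarrow> V \<omega> = V \<omega>' \<Longrightarrow>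
       X \<omega> = X \<omega>' \<Longrightarrow> zh \<omega> = zh \<omega>'"
    and dist_x: "(\<Sum>\<omega>\<in>S. P \<omega> * dx (X \<omega>) (xh \<omega>)) \<le> Dx"
    and dist_z: "(\<Sum>\<omega>\<in>S. P \<omega> * dz (Z \<omega>) (zh \<omega>)) \<le> Dz"
begin

text \<open>Reweighting by a function of \<open>G\<close> leaves the information densities unchanged, so the rates and
  the distortions become linear in the weights and Caratheodory's theorem applies.\<close>
lemma reweight:
  fixes G :: "'w \<Rightarrow> 'g" and C0 :: "'w \<Rightarrow> 'c"
  assumes det: "\<And>\<omega> \<omega>'. \<omega> \<in> S \<Longrightarrow> \<omega>' \<in> S \<Longrightarrow> G \<omega> = G \<omega>' \<Longrightarrow> C0 \<omega> = C0 \<omega>'"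
  obtains lam S' P' where
    "\<And>g. (0::real) \<le> lam g"
    "S' = {\<omega>\<in>S. lam (G \<omega>) \<noteq> 0}" "P' = (\<lambda>\<omega>. lam (G \<omega>) * P \<omega>)"
    "\<And>c. card (G ` {\<omega>\<in>S'. C0 \<omega> = c}) \<le> CARD('x \<times> 'y \<times> 'z) + 6"
    "\<And>t. pr S' P' (C0 \<bowtie> X \<bowtie> Y \<bowtie> Z) t = pr S P (C0 \<bowtie> X \<bowtie> Y \<bowtie> Z) t"
    "(\<And>\<omega>. \<omega> \<in> S' \<Longrightarrow> idens S' P' Y U Z \<omega> = idens S P Y U Z \<omega>) \<Longrightarrow>
     (\<And>\<omega>. \<omega> \<in> S' \<Longrightarrow> idens S' P' Z V (U \<bowtie> X) \<omega> = idens S P Z V (U \<bowtie> X) \<omega>) \<Longrightarrow>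
     (\<And>\<omega>. \<omega> \<in> S' \<Longrightarrow> idens S' P' X W (U \<bowtie> V \<bowtie> Z) \<omega> = idens S P X W (U \<bowtie> V \<bowtie> Z) \<omega>) \<Longrightarrow>
     ci S P' U (X \<bowtie> Z) Y \<Longrightarrow> ci S P' V X (U \<bowtie> Z) \<Longrightarrow> ci S P' W Z (U \<bowtie> V \<bowtie> X) \<Longrightarrow>
     rv_system p dx dz Dx Dz R1 R2 R3 S' P' X Y Z U V W xh zh"
proof -
  define h1 where "h1 \<omega> = log 2 (idens S P Y U Z \<omega>)" for \<omega>
  define h2 where "h2 \<omega> = log 2 (idens S P Z V (U \<bowtie> X) \<omega>)" for \<omega>
  define h3 where "h3 \<omega> = log 2 (idens S P X W (U \<bowtie> V \<bowtie> Z) \<omega>)" for \<omega>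
  define h4 where "h4 \<omega> = dx (X \<omega>) (xh \<omega>)" for \<omega>
  define h5 where "h5 \<omega> = dz (Z \<omega>) (zh \<omega>)" for \<omega>
  define \<Phi> :: "'w \<Rightarrow> (real^('x \<times> 'y \<times> 'z)) \<times> real \<times> real \<times> real \<times> real \<times> real"
    where "\<Phi> \<omega> = P \<omega> *\<^sub>R (\<chi> t. if (X \<omega>, Y \<omega>, Z \<omega>) = t then 1 else 0, h1 \<omega>, h2 \<omega>, h3 \<omega>, h4 \<omega>, h5 \<omega>)" for \<omega>
  obtain lam where lam0: "\<And>g. (0::real) \<le> lam g"
    and lam1: "\<And>c. (\<Sum>\<omega>\<in>{\<omega>\<in>S. C0 \<omega> = c}. lam (G \<omega>) *\<^sub>R \<Phi> \<omega>) = (\<Sum>\<omega>\<in>{\<omega>\<in>S. C0 \<omega> = c}. \<Phi> \<omega>)"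
    and lam2: "\<And>c. card (G ` {\<omega>\<in>S. C0 \<omega> = c \<and> lam (G \<omega>) \<noteq> 0}) \<le> CARD('x \<times> 'y \<times> 'z) + 6"
  proof -
    \<comment> \<open>One coordinate for each source triple, three for the rates and two for the
      distortions; Caratheodory's theorem adds one point, whence \<open>+ 6\<close>.\<close>
    have "DIM((real^('x \<times> 'y \<times> 'z)) \<times> real \<times> real \<times> real \<times> real \<times> real) + 1 = CARD('x \<times> 'y \<times> 'z) + 6"
      by (simp add: DIM_cart)
    from reweight_contexts[of S G C0 \<Phi>, OF fin_S det, unfolded this] show ?thesis
      using that by blast
  qed
  define S' where "S' = {\<omega>\<in>S. lam (G \<omega>) \<noteq> 0}"
  define P' where "P' = (\<lambda>\<omega>. lam (G \<omega>) * P \<omega>)"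
  have S'P': "S' = {\<omega>\<in>S. P' \<omega> \<noteq> 0}" using pos by (force simp: S'_def P'_def)
  have sub: "S' \<subseteq> S" and finS': "finite S'" using fin_S by (auto simp: S'_def)
  have prS': "pr S' P' F a = pr S P' F a" for F :: "'w \<Rightarrow> 'i" and a
    unfolding S'P' by (rule pr_support[OF fin_S])
  have tot: "(\<Sum>\<omega>\<in>S. lam (G \<omega>) *\<^sub>R \<Phi> \<omega>) = (\<Sum>\<omega>\<in>S. \<Phi> \<omega>)"
    using sum.image_gen[OF fin_S, of "\<lambda>\<omega>. lam (G \<omega>) *\<^sub>R \<Phi> \<omega>" C0] sum.image_gen[OF fin_S, of \<Phi> C0] lam1
    by simp
  have s: "(\<Sum>\<omega>\<in>S'. P' \<omega> * h \<omega>) = (\<Sum>\<omega>\<in>S. P' \<omega> * h \<omega>)" for h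
    unfolding S'P' by (rule sum_support[OF fin_S])
  have sums: "(\<Sum>\<omega>\<in>S'. P' \<omega> * h1 \<omega>) = (\<Sum>\<omega>\<in>S. P \<omega> * h1 \<omega>)"
    "(\<Sum>\<omega>\<in>S'. P' \<omega> * h2 \<omega>) = (\<Sum>\<omega>\<in>S. P \<omega> * h2 \<omega>)"
    "(\<Sum>\<omega>\<in>S'. P' \<omega> * h3 \<omega>) = (\<Sum>\<omega>\<in>S. P \<omega> * h3 \<omega>)"
    "(\<Sum>\<omega>\<in>S'. P' \<omega> * h4 \<omega>) = (\<Sum>\<omega>\<in>S. P \<omega> * h4 \<omega>)"
    "(\<Sum>\<omega>\<in>S'. P' \<omega> * h5 \<omega>) = (\<Sum>\<omega>\<in>S. P \<omega> * h5 \<omega>)"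
    using tot unfolding s by (simp_all add: \<Phi>_def prod_eq_iff fst_sum snd_sum P'_def mult.assoc)
  \<comment> \<open>The first block of coordinates of \<open>\<Phi>\<close> records the masses of
    the source triples, and it is preserved in each cell of \<open>C0\<close>.\<close>
  have prC: "pr S' P' (C0 \<bowtie> X \<bowtie> Y \<bowtie> Z) (c, t) = pr S P (C0 \<bowtie> X \<bowtie> Y \<bowtie> Z) (c, t)" for c t
  proof -
    have "(\<Sum>\<omega>\<in>{\<omega>\<in>S. C0 \<omega> = c}. P' \<omega> * (if (X \<omega>, Y \<omega>, Z \<omega>) = t then 1 else 0)) =
      (\<Sum>\<omega>\<in>{\<omega>\<in>S. C0 \<omega> = c}. P \<omega> * (if (X \<omega>, Y \<omega>, Z \<omega>) = t then 1 else 0))"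
      using arg_cong[OF lam1[of c], of "\<lambda>v. fst v $ t"]
      by (simp add: \<Phi>_def fst_sum P'_def mult.assoc)
    moreover have "pr S Q (C0 \<bowtie> X \<bowtie> Y \<bowtie> Z) (c, t) =
      (\<Sum>\<omega>\<in>{\<omega>\<in>S. C0 \<omega> = c}. Q \<omega> * (if (X \<omega>, Y \<omega>, Z \<omega>) = t then 1 else 0))" for Q
      unfolding pr_def sum.inter_filter[OF fin_S] by (intro sum.cong refl) auto
    ultimately show ?thesis unfolding prS' by simp
  qed
  have law': "pr S' P' (X \<bowtie> Y \<bowtie> Z) t = p t" for t
    using law_determined[OF fin_S sub, of P' "C0 \<bowtie> X \<bowtie> Y \<bowtie> Z" P "X \<bowtie> Y \<bowtie> Z" t] prC law
    by (simp add: split_paired_all)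
  have ciS': "ci S' P' A B C \<longleftrightarrow> ci S P' A B C" for A :: "'w \<Rightarrow> 'i" and B :: "'w \<Rightarrow> 'j" and C :: "'w \<Rightarrow> 'k"
    unfolding S'P' by (intro ci_law pr_support[OF fin_S])
  show thesis
  proof (rule that[of lam S' P'])
    show "card (G ` {\<omega> \<in> S'. C0 \<omega> = c}) \<le> CARD('x \<times> 'y \<times> 'z) + 6" for c
    proof -
      have "{\<omega> \<in> S'. C0 \<omega> = c} = {\<omega>\<in>S. C0 \<omega> = c \<and> lam (G \<omega>) \<noteq> 0}" by (auto simp: S'_def)
      then show ?thesis using lam2[of c] by simp
    qed
    show "pr S' P' (C0 \<bowtie> X \<bowtie> Y \<bowtie> Z) t = pr S P (C0 \<bowtie> X \<bowtie> Y \<bowtie> Z) t" for t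
      using prC by (cases t) auto
    assume i: "\<And>\<omega>. \<omega> \<in> S' \<Longrightarrow> idens S' P' Y U Z \<omega> = idens S P Y U Z \<omega>"
     "\<And>\<omega>. \<omega> \<in> S' \<Longrightarrow> idens S' P' Z V (U \<bowtie> X) \<omega> = idens S P Z V (U \<bowtie> X) \<omega>"
     "\<And>\<omega>. \<omega> \<in> S' \<Longrightarrow> idens S' P' X W (U \<bowtie> V \<bowtie> Z) \<omega> = idens S P X W (U \<bowtie> V \<bowtie> Z) \<omega>"
    assume c: "ci S P' U (X \<bowtie> Z) Y" "ci S P' V X (U \<bowtie> Z)" "ci S P' W Z (U \<bowtie> V \<bowtie> X)"
    show "rv_system p dx dz Dx Dz R1 R2 R3 S' P' X Y Z U V W xh zh"
    proof
      show "0 < P' \<omega>" if "\<omega> \<in> S'" for \<omega>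
        using that pos[of \<omega>] lam0[of "G \<omega>"] by (auto simp: S'_def P'_def order_less_le)
      show "cond_mutual_info S' P' Y U Z \<le> R1"
        using rate1 sums(1) unfolding cmi_idens by (simp add: i h1_def)
      show "cond_mutual_info S' P' Z V (U \<bowtie> X) \<le> R2"
        using rate2 sums(2) unfolding cmi_idens by (simp add: i h2_def)
      show "cond_mutual_info S' P' X W (U \<bowtie> V \<bowtie> Z) \<le> R3"
        using rate3 sums(3) unfolding cmi_idens by (simp add: i h3_def)
      show "(\<Sum>\<omega>\<in>S'. P' \<omega> * dx (X \<omega>) (xh \<omega>)) \<le> Dx" using dist_x sums(4) by (simp add: h4_def)
      show "(\<Sum>\<omega>\<in>S'. P' \<omega> * dz (Z \<omega>) (zh \<omega>)) \<le> Dz" using dist_z sums(5) by (simp add: h5_def)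
      show "xh \<omega> = xh \<omega>'" if "\<omega> \<in> S'" "\<omega>' \<in> S'" "U \<omega> = U \<omega>'" "V \<omega> = V \<omega>'" "W \<omega> = W \<omega>'" "Z \<omega> = Z \<omega>'" for \<omega> \<omega>'
        using that sub xh_det by blast
      show "zh \<omega> = zh \<omega>'" if "\<omega> \<in> S'" "\<omega>' \<in> S'" "U \<omega> = U \<omega>'" "V \<omega> = V \<omega>'" "X \<omega> = X \<omega>'" for \<omega> \<omega>'
        using that sub zh_det by blast
    qed (use finS' law' c ciS' in blast)+
  qed (use lam0 in \<open>auto simp: S'_def P'_def\<close>)
qed

text \<open>In the first density the weight of \<open>U\<close> occurs once above and once below, in
  the other two it occurs twice above and twice below; it always cancels. Probabilities of source
  events are unchanged because the law of the triple is preserved.\<close>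

lemma reduce_U:
  "\<exists>S' P'. S' \<subseteq> S \<and> rv_system p dx dz Dx Dz R1 R2 R3 S' P' X Y Z U V W xh zh \<and>
     card (U ` S') \<le> CARD('x \<times> 'y \<times> 'z) + 6"
proof (rule reweight[of "\<lambda>\<omega>. U \<omega>" "\<lambda>\<omega>. ()"])
  fix lam :: "_ \<Rightarrow> real" and S' P'
  assume lam: "\<And>g. 0 \<le> lam g"
    and S': "S' = {\<omega>\<in>S. lam (U \<omega>) \<noteq> 0}" and P': "P' = (\<lambda>\<omega>. lam (U \<omega>) * P \<omega>)"
    and card: "\<And>c. card ((\<lambda>\<omega>. U \<omega>) ` {\<omega>\<in>S'. () = c}) \<le> CARD('x \<times> 'y \<times> 'z) + 6"
    and pr: "\<And>t. pr S' P' (\<lambda>\<omega>. ((), X \<omega>, Y \<omega>, Z \<omega>)) t = pr S P (\<lambda>\<omega>. ((), X \<omega>, Y \<omega>, Z \<omega>)) t"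
    and rv: "(\<And>\<omega>. \<omega> \<in> S' \<Longrightarrow> idens S' P' Y U Z \<omega> = idens S P Y U Z \<omega>) \<Longrightarrow>
     (\<And>\<omega>. \<omega> \<in> S' \<Longrightarrow> idens S' P' Z V (U \<bowtie> X) \<omega> = idens S P Z V (U \<bowtie> X) \<omega>) \<Longrightarrow>
     (\<And>\<omega>. \<omega> \<in> S' \<Longrightarrow> idens S' P' X W (U \<bowtie> V \<bowtie> Z) \<omega> = idens S P X W (U \<bowtie> V \<bowtie> Z) \<omega>) \<Longrightarrow>
     ci S P' U (X \<bowtie> Z) Y \<Longrightarrow> ci S P' V X (U \<bowtie> Z) \<Longrightarrow> ci S P' W Z (U \<bowtie> V \<bowtie> X) \<Longrightarrow>
     rv_system p dx dz Dx Dz R1 R2 R3 S' P' X Y Z U V W xh zh"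
  have sub: "S' \<subseteq> S" by (auto simp: S')
  note keep = law_determined[OF fin_S sub pr]
  note scale = prob_eq_reweight[where l = lam and G = "\<lambda>\<omega>. U \<omega>", OF fin_S S' P']
  have "rv_system p dx dz Dx Dz R1 R2 R3 S' P' X Y Z U V W xh zh"
  proof (rule rv)
    fix \<omega> assume "\<omega> \<in> S'"
    then have l: "lam (U \<omega>) \<noteq> 0" by (simp add: S')

    have k1: "prob_eq S' P' (\<lambda>\<omega>. Z \<omega>) \<omega> = prob_eq S P (\<lambda>\<omega>. Z \<omega>) \<omega>"
      "prob_eq S' P' (Y \<bowtie> Z) \<omega> = prob_eq S P (Y \<bowtie> Z) \<omega>"
      unfolding prob_eq_pr by (auto intro!: keep)
    have s1: "prob_eq S' P' (Y \<bowtie> U \<bowtie> Z) \<omega> = lam (U \<omega>) * prob_eq S P (Y \<bowtie> U \<bowtie> Z) \<omega>"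
      "prob_eq S' P' (U \<bowtie> Z) \<omega> = lam (U \<omega>) * prob_eq S P (U \<bowtie> Z) \<omega>"
      by (auto intro!: scale)
    show "idens S' P' Y U Z \<omega> = idens S P Y U Z \<omega>"
      unfolding idens_def k1 s1 using l by simp
    have s2: "prob_eq S' P' (Z \<bowtie> V \<bowtie> (U \<bowtie> X)) \<omega> = lam (U \<omega>) * prob_eq S P (Z \<bowtie> V \<bowtie> (U \<bowtie> X)) \<omega>"
      "prob_eq S' P' (U \<bowtie> X) \<omega> = lam (U \<omega>) * prob_eq S P (U \<bowtie> X) \<omega>"
      "prob_eq S' P' (Z \<bowtie> (U \<bowtie> X)) \<omega> = lam (U \<omega>) * prob_eq S P (Z \<bowtie> (U \<bowtie> X)) \<omega>"
      "prob_eq S' P' (V \<bowtie> (U \<bowtie> X)) \<omega> = lam (U \<omega>) * prob_eq S P (V \<bowtie> (U \<bowtie> X)) \<omega>"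
      by (auto intro!: scale)
    show "idens S' P' Z V (U \<bowtie> X) \<omega> = idens S P Z V (U \<bowtie> X) \<omega>"
      unfolding idens_def s2 using l by simp
    have s3: "prob_eq S' P' (X \<bowtie> W \<bowtie> (U \<bowtie> V \<bowtie> Z)) \<omega> = lam (U \<omega>) * prob_eq S P (X \<bowtie> W \<bowtie> (U \<bowtie> V \<bowtie> Z)) \<omega>"
      "prob_eq S' P' (U \<bowtie> V \<bowtie> Z) \<omega> = lam (U \<omega>) * prob_eq S P (U \<bowtie> V \<bowtie> Z) \<omega>"
      "prob_eq S' P' (X \<bowtie> (U \<bowtie> V \<bowtie> Z)) \<omega> = lam (U \<omega>) * prob_eq S P (X \<bowtie> (U \<bowtie> V \<bowtie> Z)) \<omega>"
      "prob_eq S' P' (W \<bowtie> (U \<bowtie> V \<bowtie> Z)) \<omega> = lam (U \<omega>) * prob_eq S P (W \<bowtie> (U \<bowtie> V \<bowtie> Z)) \<omega>"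
      by (auto intro!: scale)
    show "idens S' P' X W (U \<bowtie> V \<bowtie> Z) \<omega> = idens S P X W (U \<bowtie> V \<bowtie> Z) \<omega>"
      unfolding idens_def s3 using l by simp

  next
    show "ci S P' U (X \<bowtie> Z) Y"
      by (rule ci_reweight[OF ciU, of _ "\<lambda>u y. lam u"]) (simp add: P')
    show "ci S P' V X (U \<bowtie> Z)"
      by (rule ci_reweight[OF ciV, of _ "\<lambda>v (u, z). lam u"]) (simp add: P')
    show "ci S P' W Z (U \<bowtie> V \<bowtie> X)"
      by (rule ci_reweight[OF ciW, of _ "\<lambda>w (u, v, x). lam u"]) (simp add: P')
  qed
  then show ?thesis using card[of "()"] sub by auto
qed auto

text \<open>The law of \<open>U\<close> with the sources is preserved, so the first density and the
  first chain do not change at all; in the other densities the weights cancel. The number of values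
  is bounded for each value of \<open>U\<close> separately, since labels of \<open>V\<close> can be
  shared between different values of \<open>U\<close>.\<close>

lemma reduce_V:
  "\<exists>S' P'. S' \<subseteq> S \<and> rv_system p dx dz Dx Dz R1 R2 R3 S' P' X Y Z U V W xh zh \<and>
     (\<forall>u. card ((U \<bowtie> V) ` {\<omega>\<in>S'. U \<omega> = u}) \<le> CARD('x \<times> 'y \<times> 'z) + 6)"
proof (rule reweight[of "U \<bowtie> V" "\<lambda>\<omega>. U \<omega>"])
  fix lam :: "_ \<Rightarrow> real" and S' P'
  assume lam: "\<And>g. 0 \<le> lam g"
    and S': "S' = {\<omega>\<in>S. lam ((U \<omega>, V \<omega>)) \<noteq> 0}" and P': "P' = (\<lambda>\<omega>. lam ((U \<omega>, V \<omega>)) * P \<omega>)"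
    and card: "\<And>c. card ((U \<bowtie> V) ` {\<omega>\<in>S'. U \<omega> = c}) \<le> CARD('x \<times> 'y \<times> 'z) + 6"
    and pr: "\<And>t. pr S' P' (U \<bowtie> X \<bowtie> Y \<bowtie> Z) t = pr S P (U \<bowtie> X \<bowtie> Y \<bowtie> Z) t"
    and rv: "(\<And>\<omega>. \<omega> \<in> S' \<Longrightarrow> idens S' P' Y U Z \<omega> = idens S P Y U Z \<omega>) \<Longrightarrow>
     (\<And>\<omega>. \<omega> \<in> S' \<Longrightarrow> idens S' P' Z V (U \<bowtie> X) \<omega> = idens S P Z V (U \<bowtie> X) \<omega>) \<Longrightarrow>
     (\<And>\<omega>. \<omega> \<in> S' \<Longrightarrow> idens S' P' X W (U \<bowtie> V \<bowtie> Z) \<omega> = idens S P X W (U \<bowtie> V \<bowtie> Z) \<omega>) \<Longrightarrow>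
     ci S P' U (X \<bowtie> Z) Y \<Longrightarrow> ci S P' V X (U \<bowtie> Z) \<Longrightarrow> ci S P' W Z (U \<bowtie> V \<bowtie> X) \<Longrightarrow>
     rv_system p dx dz Dx Dz R1 R2 R3 S' P' X Y Z U V W xh zh"
  have sub: "S' \<subseteq> S" by (auto simp: S')
  have S'P': "S' = {\<omega>\<in>S. P' \<omega> \<noteq> 0}" using pos by (force simp: S' P')
  note keep = law_determined[OF fin_S sub pr]
  note scale = prob_eq_reweight[where l = lam and G = "U \<bowtie> V", OF fin_S S' P']
  have "rv_system p dx dz Dx Dz R1 R2 R3 S' P' X Y Z U V W xh zh"
  proof (rule rv)
    fix \<omega> assume "\<omega> \<in> S'"
    then have l: "lam ((U \<omega>, V \<omega>)) \<noteq> 0" by (simp add: S')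

    have k1: "prob_eq S' P' (Y \<bowtie> U \<bowtie> Z) \<omega> = prob_eq S P (Y \<bowtie> U \<bowtie> Z) \<omega>"
      "prob_eq S' P' (\<lambda>\<omega>. Z \<omega>) \<omega> = prob_eq S P (\<lambda>\<omega>. Z \<omega>) \<omega>"
      "prob_eq S' P' (Y \<bowtie> Z) \<omega> = prob_eq S P (Y \<bowtie> Z) \<omega>"
      "prob_eq S' P' (U \<bowtie> Z) \<omega> = prob_eq S P (U \<bowtie> Z) \<omega>"
      unfolding prob_eq_pr by (auto intro!: keep)
    show "idens S' P' Y U Z \<omega> = idens S P Y U Z \<omega>"
      unfolding idens_def k1 using l by simp
    have k2: "prob_eq S' P' (U \<bowtie> X) \<omega> = prob_eq S P (U \<bowtie> X) \<omega>"
      "prob_eq S' P' (Z \<bowtie> (U \<bowtie> X)) \<omega> = prob_eq S P (Z \<bowtie> (U \<bowtie> X)) \<omega>"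
      unfolding prob_eq_pr by (auto intro!: keep)
    have s2: "prob_eq S' P' (Z \<bowtie> V \<bowtie> (U \<bowtie> X)) \<omega> = lam ((U \<omega>, V \<omega>)) * prob_eq S P (Z \<bowtie> V \<bowtie> (U \<bowtie> X)) \<omega>"
      "prob_eq S' P' (V \<bowtie> (U \<bowtie> X)) \<omega> = lam ((U \<omega>, V \<omega>)) * prob_eq S P (V \<bowtie> (U \<bowtie> X)) \<omega>"
      by (auto intro!: scale)
    show "idens S' P' Z V (U \<bowtie> X) \<omega> = idens S P Z V (U \<bowtie> X) \<omega>"
      unfolding idens_def k2 s2 using l by simp
    have s3: "prob_eq S' P' (X \<bowtie> W \<bowtie> (U \<bowtie> V \<bowtie> Z)) \<omega> = lam ((U \<omega>, V \<omega>)) * prob_eq S P (X \<bowtie> W \<bowtie> (U \<bowtie> V \<bowtie> Z)) \<omega>"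
      "prob_eq S' P' (U \<bowtie> V \<bowtie> Z) \<omega> = lam ((U \<omega>, V \<omega>)) * prob_eq S P (U \<bowtie> V \<bowtie> Z) \<omega>"
      "prob_eq S' P' (X \<bowtie> (U \<bowtie> V \<bowtie> Z)) \<omega> = lam ((U \<omega>, V \<omega>)) * prob_eq S P (X \<bowtie> (U \<bowtie> V \<bowtie> Z)) \<omega>"
      "prob_eq S' P' (W \<bowtie> (U \<bowtie> V \<bowtie> Z)) \<omega> = lam ((U \<omega>, V \<omega>)) * prob_eq S P (W \<bowtie> (U \<bowtie> V \<bowtie> Z)) \<omega>"
      by (auto intro!: scale)
    show "idens S' P' X W (U \<bowtie> V \<bowtie> Z) \<omega> = idens S P X W (U \<bowtie> V \<bowtie> Z) \<omega>"
      unfolding idens_def s3 using l by simp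

  next
    have "ci S P' U (X \<bowtie> Z) Y \<longleftrightarrow> ci S' P' U (X \<bowtie> Z) Y"
      unfolding S'P' by (intro ci_law pr_support[OF fin_S, symmetric])
    also have "\<dots> \<longleftrightarrow> ci S P U (X \<bowtie> Z) Y"
      by (intro ci_law keep) auto
    finally show "ci S P' U (X \<bowtie> Z) Y" using ciU by simp
  next
    show "ci S P' V X (U \<bowtie> Z)"
      by (rule ci_reweight[OF ciV, of _ "\<lambda>v (u, z). lam (u, v)"]) (simp add: P')
    show "ci S P' W Z (U \<bowtie> V \<bowtie> X)"
      by (rule ci_reweight[OF ciW, of _ "\<lambda>w (u, v, x). lam (u, v)"]) (simp add: P')
  qed
  then show ?thesis using card sub by auto
qed auto

text \<open>Only the third density feels these weights, once in its numerator and once in its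
  denominator.\<close>

lemma reduce_W:
  "\<exists>S' P'. S' \<subseteq> S \<and> rv_system p dx dz Dx Dz R1 R2 R3 S' P' X Y Z U V W xh zh \<and>
     (\<forall>c. card ((U \<bowtie> V \<bowtie> W) ` {\<omega>\<in>S'. (U \<omega>, V \<omega>) = c}) \<le> CARD('x \<times> 'y \<times> 'z) + 6)"
proof (rule reweight[of "U \<bowtie> V \<bowtie> W" "U \<bowtie> V"])
  fix lam :: "_ \<Rightarrow> real" and S' P'
  assume lam: "\<And>g. 0 \<le> lam g"
    and S': "S' = {\<omega>\<in>S. lam ((U \<omega>, V \<omega>, W \<omega>)) \<noteq> 0}" and P': "P' = (\<lambda>\<omega>. lam ((U \<omega>, V \<omega>, W \<omega>)) * P \<omega>)"
    and card: "\<And>c. card ((U \<bowtie> V \<bowtie> W) ` {\<omega>\<in>S'. (U \<omega>, V \<omega>) = c}) \<le> CARD('x \<times> 'y \<times> 'z) + 6"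
    and pr: "\<And>t. pr S' P' ((U \<bowtie> V) \<bowtie> X \<bowtie> Y \<bowtie> Z) t = pr S P ((U \<bowtie> V) \<bowtie> X \<bowtie> Y \<bowtie> Z) t"
    and rv: "(\<And>\<omega>. \<omega> \<in> S' \<Longrightarrow> idens S' P' Y U Z \<omega> = idens S P Y U Z \<omega>) \<Longrightarrow>
     (\<And>\<omega>. \<omega> \<in> S' \<Longrightarrow> idens S' P' Z V (U \<bowtie> X) \<omega> = idens S P Z V (U \<bowtie> X) \<omega>) \<Longrightarrow>
     (\<And>\<omega>. \<omega> \<in> S' \<Longrightarrow> idens S' P' X W (U \<bowtie> V \<bowtie> Z) \<omega> = idens S P X W (U \<bowtie> V \<bowtie> Z) \<omega>) \<Longrightarrow>
     ci S P' U (X \<bowtie> Z) Y \<Longrightarrow> ci S P' V X (U \<bowtie> Z) \<Longrightarrow> ci S P' W Z (U \<bowtie> V \<bowtie> X) \<Longrightarrow>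
     rv_system p dx dz Dx Dz R1 R2 R3 S' P' X Y Z U V W xh zh"
  have sub: "S' \<subseteq> S" by (auto simp: S')
  have S'P': "S' = {\<omega>\<in>S. P' \<omega> \<noteq> 0}" using pos by (force simp: S' P')
  note keep = law_determined[OF fin_S sub pr]
  note scale = prob_eq_reweight[where l = lam and G = "U \<bowtie> V \<bowtie> W", OF fin_S S' P']
  have "rv_system p dx dz Dx Dz R1 R2 R3 S' P' X Y Z U V W xh zh"
  proof (rule rv)
    fix \<omega> assume "\<omega> \<in> S'"
    then have l: "lam ((U \<omega>, V \<omega>, W \<omega>)) \<noteq> 0" by (simp add: S')

    have k1: "prob_eq S' P' (Y \<bowtie> U \<bowtie> Z) \<omega> = prob_eq S P (Y \<bowtie> U \<bowtie> Z) \<omega>"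
      "prob_eq S' P' (\<lambda>\<omega>. Z \<omega>) \<omega> = prob_eq S P (\<lambda>\<omega>. Z \<omega>) \<omega>"
      "prob_eq S' P' (Y \<bowtie> Z) \<omega> = prob_eq S P (Y \<bowtie> Z) \<omega>"
      "prob_eq S' P' (U \<bowtie> Z) \<omega> = prob_eq S P (U \<bowtie> Z) \<omega>"
      unfolding prob_eq_pr by (auto intro!: keep)
    show "idens S' P' Y U Z \<omega> = idens S P Y U Z \<omega>"
      unfolding idens_def k1 using l by simp
    have k2: "prob_eq S' P' (Z \<bowtie> V \<bowtie> (U \<bowtie> X)) \<omega> = prob_eq S P (Z \<bowtie> V \<bowtie> (U \<bowtie> X)) \<omega>"
      "prob_eq S' P' (U \<bowtie> X) \<omega> = prob_eq S P (U \<bowtie> X) \<omega>"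
      "prob_eq S' P' (Z \<bowtie> (U \<bowtie> X)) \<omega> = prob_eq S P (Z \<bowtie> (U \<bowtie> X)) \<omega>"
      "prob_eq S' P' (V \<bowtie> (U \<bowtie> X)) \<omega> = prob_eq S P (V \<bowtie> (U \<bowtie> X)) \<omega>"
      unfolding prob_eq_pr by (auto intro!: keep)
    show "idens S' P' Z V (U \<bowtie> X) \<omega> = idens S P Z V (U \<bowtie> X) \<omega>"
      unfolding idens_def k2 using l by simp
    have k3: "prob_eq S' P' (U \<bowtie> V \<bowtie> Z) \<omega> = prob_eq S P (U \<bowtie> V \<bowtie> Z) \<omega>"
      "prob_eq S' P' (X \<bowtie> (U \<bowtie> V \<bowtie> Z)) \<omega> = prob_eq S P (X \<bowtie> (U \<bowtie> V \<bowtie> Z)) \<omega>"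
      unfolding prob_eq_pr by (auto intro!: keep)
    have s3: "prob_eq S' P' (X \<bowtie> W \<bowtie> (U \<bowtie> V \<bowtie> Z)) \<omega> = lam ((U \<omega>, V \<omega>, W \<omega>)) * prob_eq S P (X \<bowtie> W \<bowtie> (U \<bowtie> V \<bowtie> Z)) \<omega>"
      "prob_eq S' P' (W \<bowtie> (U \<bowtie> V \<bowtie> Z)) \<omega> = lam ((U \<omega>, V \<omega>, W \<omega>)) * prob_eq S P (W \<bowtie> (U \<bowtie> V \<bowtie> Z)) \<omega>"
      by (auto intro!: scale)
    show "idens S' P' X W (U \<bowtie> V \<bowtie> Z) \<omega> = idens S P X W (U \<bowtie> V \<bowtie> Z) \<omega>"
      unfolding idens_def k3 s3 using l by simp

  next
    have "ci S P' U (X \<bowtie> Z) Y \<longleftrightarrow> ci S' P' U (X \<bowtie> Z) Y"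
      unfolding S'P' by (intro ci_law pr_support[OF fin_S, symmetric])
    also have "\<dots> \<longleftrightarrow> ci S P U (X \<bowtie> Z) Y"
      by (intro ci_law keep) auto
    finally show "ci S P' U (X \<bowtie> Z) Y" using ciU by simp
  next
    have "ci S P' V X (U \<bowtie> Z) \<longleftrightarrow> ci S' P' V X (U \<bowtie> Z)"
      unfolding S'P' by (intro ci_law pr_support[OF fin_S, symmetric])
    also have "\<dots> \<longleftrightarrow> ci S P V X (U \<bowtie> Z)"
      by (intro ci_law keep) auto
    finally show "ci S P' V X (U \<bowtie> Z)" using ciV by simp
  next
    show "ci S P' W Z (U \<bowtie> V \<bowtie> X)"
      by (rule ci_reweight[OF ciW, of _ "\<lambda>w (u, v, x). lam (u, v, w)"]) (simp add: P')
  qed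
  then show ?thesis using card sub by auto
qed auto

end

context rv_system
begin

sublocale fin_space S P
  using fin_S pos by unfold_locales (auto intro: less_imp_le)

text \<open>All conditions depend only on the partition by \<open>U\<close>, on that by
  \<open>V\<close> for fixed \<open>U\<close>, and on that by \<open>W\<close> for fixed
  \<open>U\<close> and \<open>V\<close>.\<close>

lemma relabel:
  assumes U': "\<And>\<omega> \<omega>'. \<omega> \<in> S \<Longrightarrow> \<omega>' \<in> S \<Longrightarrow> U' \<omega> = U' \<omega>' \<longleftrightarrow> U \<omega> = U \<omega>'"
    and V': "\<And>\<omega> \<omega>'. \<omega> \<in> S \<Longrightarrow> \<omega>' \<in> S \<Longrightarrow> U \<omega> = U \<omega>' \<Longrightarrow> V' \<omega> = V' \<omega>' \<longleftrightarrow> V \<omega> = V \<omega>'"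
    and W': "\<And>\<omega> \<omega>'. \<omega> \<in> S \<Longrightarrow> \<omega>' \<in> S \<Longrightarrow> U \<omega> = U \<omega>' \<Longrightarrow> V \<omega> = V \<omega>' \<Longrightarrow> W' \<omega> = W' \<omega>' \<longleftrightarrow> W \<omega> = W \<omega>'"
  shows "rv_system p dx dz Dx Dz R1 R2 R3 S P X Y Z U' V' W' xh zh"
proof
  show "ci S P U' (X \<bowtie> Z) Y"
    by (rule ci_derive[OF fin_S ciU]) (use U' in auto)
  show "ci S P V' X (U' \<bowtie> Z)"
    by (rule ci_derive[OF fin_S ciV]) (use U' V' in auto)
  show "ci S P W' Z (U' \<bowtie> V' \<bowtie> X)"
    by (rule ci_derive[OF fin_S ciW]) (use U' V' W' in auto)
  have "cond_mutual_info S P Y U Z = cond_mutual_info S P Y U' Z"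
    by (rule cmi_cong) (use U' in auto)
  then show "cond_mutual_info S P Y U' Z \<le> R1" using rate1 by simp
  have "cond_mutual_info S P Z V (U \<bowtie> X) = cond_mutual_info S P Z V' (U' \<bowtie> X)"
    by (rule cmi_cong) (use U' V' in auto)
  then show "cond_mutual_info S P Z V' (U' \<bowtie> X) \<le> R2" using rate2 by simp
  have "cond_mutual_info S P X W (U \<bowtie> V \<bowtie> Z) = cond_mutual_info S P X W' (U' \<bowtie> V' \<bowtie> Z)"
    by (rule cmi_cong) (use U' V' W' in auto)
  then show "cond_mutual_info S P X W' (U' \<bowtie> V' \<bowtie> Z) \<le> R3" using rate3 by simp
  show "xh \<omega> = xh \<omega>'" if "\<omega> \<in> S" "\<omega>' \<in> S" "U' \<omega> = U' \<omega>'" "V' \<omega> = V' \<omega>'" "W' \<omega> = W' \<omega>'" "Z \<omega> = Z \<omega>'" for \<omega> \<omega>'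
    using that U' V' W' xh_det by metis
  show "zh \<omega> = zh \<omega>'" if "\<omega> \<in> S" "\<omega>' \<in> S" "U' \<omega> = U' \<omega>'" "V' \<omega> = V' \<omega>'" "X \<omega> = X \<omega>'" for \<omega> \<omega>'
    using that U' V' zh_det by metis
qed (use fin_S pos law dist_x dist_z in auto)

end

section \<open>From systems of variables to test channels on a bounded alphabet\<close>

text \<open>The single-letter region with its witnesses exposed: compactness needs a sequence of
  them with a common alphabet size \<open>K\<close>.\<close>

definition feasible ::
  "('x::finite \<times> 'y::finite \<times> 'z::finite \<Rightarrow> real) \<Rightarrow> ('x \<Rightarrow> 'xh \<Rightarrow> real) \<Rightarrow> ('z \<Rightarrow> 'zh \<Rightarrow> real)
   \<Rightarrow> real \<Rightarrow> real \<Rightarrow> real \<times> real \<times> real \<Rightarrow> nat \<Rightarrow> ('y \<Rightarrow> nat \<Rightarrow> real) \<Rightarrow> (nat \<Rightarrow> 'z \<Rightarrow> nat \<Rightarrow> real)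
   \<Rightarrow> (nat \<Rightarrow> nat \<Rightarrow> 'x \<Rightarrow> nat \<Rightarrow> real) \<Rightarrow> (nat \<Rightarrow> nat \<Rightarrow> 'z \<Rightarrow> 'xh) \<Rightarrow> (nat \<Rightarrow> nat \<Rightarrow> 'x \<Rightarrow> 'zh) \<Rightarrow> bool" where
  "feasible p dx dz Dx Dz R K qU qV qW xhat zhat \<longleftrightarrow>
     is_kernel K qU \<and> is_kernel K (\<lambda>(u, z). qV u z) \<and> is_kernel K (\<lambda>(u, v, x). qW u v x) \<and>
     cond_mutual_info (aux_space K) (joint_law p qU qV qW) (\<lambda>((x, y, z), u, v, w). y)
       (\<lambda>((x, y, z), u, v, w). u) (\<lambda>((x, y, z), u, v, w). z) \<le> fst R \<and>
     cond_mutual_info (aux_space K) (joint_law p qU qV qW) (\<lambda>((x, y, z), u, v, w). z)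
       (\<lambda>((x, y, z), u, v, w). v) (\<lambda>((x, y, z), u, v, w). (u, x)) \<le> fst (snd R) \<and>
     cond_mutual_info (aux_space K) (joint_law p qU qV qW) (\<lambda>((x, y, z), u, v, w). x)
       (\<lambda>((x, y, z), u, v, w). w) (\<lambda>((x, y, z), u, v, w). (u, v, z)) \<le> snd (snd R) \<and>
     (\<Sum>\<omega>\<in>aux_space K. joint_law p qU qV qW \<omega> * (case \<omega> of ((x, y, z), u, v, w) \<Rightarrow> dx x (xhat u w z))) \<le> Dx \<and>
     (\<Sum>\<omega>\<in>aux_space K. joint_law p qU qV qW \<omega> * (case \<omega> of ((x, y, z), u, v, w) \<Rightarrow> dz z (zhat u v x))) \<le> Dz"

lemma single_letter_region_feasible:
  "R \<in> single_letter_region p dx dz Dx Dz \<longleftrightarrow> (\<exists>K qU qV qW xhat zhat. feasible p dx dz Dx Dz R K qU qV qW xhat zhat)"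
  by (cases R) (auto simp: single_letter_region_def feasible_def Let_def)

text \<open>On conditions of probability zero, the kernel is the point mass at \<open>0\<close>.\<close>
definition kern :: "'w set \<Rightarrow> ('w \<Rightarrow> real) \<Rightarrow> ('w \<Rightarrow> 'c) \<Rightarrow> ('w \<Rightarrow> nat) \<Rightarrow> 'c \<Rightarrow> nat \<Rightarrow> real" where
  "kern S P C F c f = (if pr S P C c = 0 then (if f = 0 then 1 else 0)
     else pr S P (F \<bowtie> C) (f, c) / pr S P C c)"

context fin_space
begin

lemma kern_nonneg: "0 \<le> kern S P C F c f"
  by (simp add: kern_def pr_nonneg)

lemma kern_sum:
  assumes "\<And>\<omega>. \<omega> \<in> S \<Longrightarrow> F \<omega> < K" and "0 < K"
  shows "(\<Sum>f<K. kern S P C F c f) = 1"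
proof (cases "pr S P C c = 0")
  case True
  then show ?thesis using assms(2) by (simp add: kern_def sum.delta')
next
  case False
  have "(\<Sum>f<K. pr S P (F \<bowtie> C) (f, c)) = (\<Sum>\<omega>\<in>S. \<Sum>f<K. if F \<omega> = f then (if C \<omega> = c then P \<omega> else 0) else 0)"
    unfolding pr_def by (subst sum.swap) (auto intro!: sum.cong)
  also have "\<dots> = pr S P C c"
    unfolding pr_def using assms(1) by (intro sum.cong refl) (simp add: sum.delta')
  finally show ?thesis using False by (simp add: kern_def sum_divide_distrib[symmetric])
qed

text \<open>Because \<open>B\<close> has no influence beyond \<open>C\<close>, multiplying by the
  conditional law given \<open>C\<close> alone adds \<open>F\<close> to the joint law. The default
  value at conditions of probability zero is harmless, as both sides vanish there.\<close>

lemma kern_ci: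
  assumes ci: "ci S P F B C"
  shows "pr S P (B \<bowtie> C) (b, c) * kern S P C F c f = pr S P (F \<bowtie> B \<bowtie> C) (f, b, c)"
proof (cases "pr S P C c = 0")
  case True
  have "pr S P (F \<bowtie> B \<bowtie> C) (f, b, c) \<le> pr S P C c" "pr S P (B \<bowtie> C) (b, c) \<le> pr S P C c"
    by (rule pr_mono; auto)+
  then show ?thesis
    using True pr_nonneg[of "F \<bowtie> B \<bowtie> C" "(f, b, c)"] pr_nonneg[of "B \<bowtie> C" "(b, c)"] by simp
next
  case False
  then show ?thesis using ci_prod[OF fin ci, of f b c] by (simp add: kern_def field_simps)
qed

end

lemma pr_reindex:
  assumes "finite T" and inj: "inj_on f I" and img: "\<And>\<omega>. \<omega> \<in> T \<and> F \<omega> = a \<longleftrightarrow> \<omega> \<in> f ` I"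
  shows "pr T J F a = (\<Sum>i\<in>I. J (f i))"
proof -
  have "pr T J F a = (\<Sum>\<omega>\<in>{\<omega>\<in>T. F \<omega> = a}. J \<omega>)"
    unfolding pr_def using assms(1) by (simp add: sum.inter_filter)
  also have "{\<omega>\<in>T. F \<omega> = a} = f ` I" using img by auto
  finally show ?thesis by (simp add: sum.reindex[OF inj])
qed

lemma pr_cong_events:
  assumes "\<And>\<omega>. \<omega> \<in> S \<Longrightarrow> F \<omega> = a \<longleftrightarrow> G \<omega> = b"
  shows "pr S P F a = pr S P G b"
  unfolding pr_def using assms by (intro sum.cong) auto

text \<open>The kernels are the conditional laws of the given variables. Two marginals are compared
  instead of the full joint laws, which may differ: \<open>lawF\<close> settles the first rate,
  \<open>lawH\<close> the other two rates and both distortions.\<close>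

lemma (in rv_system) canonical:
  fixes U' V' W' :: "'w \<Rightarrow> nat"
  assumes rv: "rv_system p dx dz Dx Dz R1 R2 R3 S P X Y Z U' V' W' xh zh"
    and K: "\<And>\<omega>. \<omega> \<in> S \<Longrightarrow> U' \<omega> < K" "\<And>\<omega>. \<omega> \<in> S \<Longrightarrow> V' \<omega> < K" "\<And>\<omega>. \<omega> \<in> S \<Longrightarrow> W' \<omega> < K" "0 < K"
    and xh': "\<And>\<omega> \<omega>'. \<omega> \<in> S \<Longrightarrow> \<omega>' \<in> S \<Longrightarrow> U' \<omega> = U' \<omega>' \<Longrightarrow> W' \<omega> = W' \<omega>' \<Longrightarrow> Z \<omega> = Z \<omega>' \<Longrightarrow> xh \<omega> = xh \<omega>'"
  shows "\<exists>qU qV qW xhat zhat. feasible p dx dz Dx Dz (R1, R2, R3) K qU qV qW xhat zhat"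
proof -
  interpret N: rv_system p dx dz Dx Dz R1 R2 R3 S P X Y Z U' V' W' xh zh by (rule rv)
  obtain xh0 where xh0: "\<And>\<omega>. \<omega> \<in> S \<Longrightarrow> xh \<omega> = xh0 (U' \<omega>, W' \<omega>, Z \<omega>)"
    using determined_fun[of S "U' \<bowtie> W' \<bowtie> Z" xh] xh' by (metis prod.inject)
  obtain zh0 where zh0: "\<And>\<omega>. \<omega> \<in> S \<Longrightarrow> zh \<omega> = zh0 (U' \<omega>, V' \<omega>, X \<omega>)"
    using determined_fun[of S "U' \<bowtie> V' \<bowtie> X" zh] N.zh_det by (metis prod.inject)
  define qU where "qU = kern S P Y U'"
  define qV where "qV u z = kern S P (U' \<bowtie> Z) V' (u, z)" for u z
  define qW where "qW u v x = kern S P (U' \<bowtie> V' \<bowtie> X) W' (u, v, x)" for u v x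
  have qU1: "(\<Sum>u<K. qU y u) = 1" for y unfolding qU_def by (rule kern_sum) (use K in auto)
  have qV1: "(\<Sum>v<K. qV u z v) = 1" for u z unfolding qV_def by (rule kern_sum) (use K in auto)
  have qW1: "(\<Sum>w<K. qW u v x w) = 1" for u v x unfolding qW_def by (rule kern_sum) (use K in auto)
  define T where "T = (aux_space K :: (('x \<times> 'y \<times> 'z) \<times> nat \<times> nat \<times> nat) set)"
  define J where "J = joint_law p qU qV qW"
  have finT: "finite T" by (simp add: T_def aux_space_def)
  let ?F = "\<lambda>((x::'x, y::'y, z::'z), u::nat, v::nat, w::nat). (x, y, z, u)"
  let ?H = "\<lambda>((x::'x, y::'y, z::'z), u::nat, v::nat, w::nat). (x, z, u, v, w)"
  have lawF: "pr T J ?F t = pr S P (X \<bowtie> Y \<bowtie> Z \<bowtie> U') t" for t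
  proof -
    obtain x y z u where t: "t = (x, y, z, u)" by (cases t)
    show ?thesis
    proof (cases "u < K")
      case False
      have "t \<notin> ?F ` T" "t \<notin> (X \<bowtie> Y \<bowtie> Z \<bowtie> U') ` S"
        using False K(1) by (auto simp: t T_def aux_space_def)
      then show ?thesis by (simp add: pr_outside)
    next
      case True
      have "pr T J ?F t = (\<Sum>(v, w)\<in>{..<K} \<times> {..<K}. J ((x, y, z), u, v, w))"
        unfolding t by (subst pr_reindex[OF finT, where f = "\<lambda>(v, w). ((x, y, z), u, v, w)" and I = "{..<K} \<times> {..<K}"])
          (use True in \<open>auto simp: inj_on_def T_def aux_space_def case_prod_beta\<close>)
      also have "\<dots> = p (x, y, z) * qU y u * (\<Sum>v<K. qV u z v * (\<Sum>w<K. qW u v x w))"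
        by (simp add: sum_pair J_def joint_law_def sum_distrib_left mult.assoc)
      also have "\<dots> = p (x, y, z) * qU y u" by (simp add: qW1 qV1)
      also have "p (x, y, z) = pr S P ((X \<bowtie> Z) \<bowtie> Y) ((x, z), y)"
        unfolding law[symmetric] by (rule pr_cong_events) auto
      also have "\<dots> * qU y u = pr S P (U' \<bowtie> (X \<bowtie> Z) \<bowtie> Y) (u, (x, z), y)"
        unfolding qU_def by (rule kern_ci[OF N.ciU])
      also have "\<dots> = pr S P (X \<bowtie> Y \<bowtie> Z \<bowtie> U') t"
        unfolding t by (rule pr_cong_events) auto
      finally show ?thesis .
    qed
  qed
  have lawH: "pr T J ?H t = pr S P (X \<bowtie> Z \<bowtie> U' \<bowtie> V' \<bowtie> W') t" for t
  proof -
    obtain x z u v w where t: "t = (x, z, u, v, w)" by (cases t)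
    show ?thesis
    proof (cases "u < K \<and> v < K \<and> w < K")
      case False
      have "t \<notin> ?H ` T" "t \<notin> (X \<bowtie> Z \<bowtie> U' \<bowtie> V' \<bowtie> W') ` S"
        using False K by (auto simp: t T_def aux_space_def)
      then show ?thesis by (simp add: pr_outside)
    next
      case True
      \<comment> \<open>\<open>Y\<close> enters only through \<open>p\<close> and \<open>qU\<close>.
        It is summed out before \<open>V\<close> and \<open>W\<close> are attached, and from there
        on the chains without \<open>Y\<close> are enough.\<close>
      have A: "p (x, y, z) * qU y u = pr S P (Y \<bowtie> X \<bowtie> Z \<bowtie> U') (y, x, z, u)" for y
      proof -
        have "p (x, y, z) = pr S P ((X \<bowtie> Z) \<bowtie> Y) ((x, z), y)"
          unfolding law[symmetric] by (rule pr_cong_events) auto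
        also have "\<dots> * qU y u = pr S P (U' \<bowtie> (X \<bowtie> Z) \<bowtie> Y) (u, (x, z), y)"
          unfolding qU_def by (rule kern_ci[OF N.ciU])
        also have "\<dots> = pr S P (Y \<bowtie> X \<bowtie> Z \<bowtie> U') (y, x, z, u)"
          by (rule pr_cong_events) auto
        finally show ?thesis .
      qed
      have "pr T J ?H t = (\<Sum>y\<in>UNIV. J ((x, y, z), u, v, w))"
        unfolding t by (subst pr_reindex[OF finT, where f = "\<lambda>y. ((x, y, z), u, v, w)" and I = UNIV])
          (use True in \<open>auto simp: inj_on_def T_def aux_space_def case_prod_beta\<close>)
      also have "\<dots> = (\<Sum>y\<in>UNIV. p (x, y, z) * qU y u) * qV u z v * qW u v x w"
        by (simp add: J_def joint_law_def sum_distrib_right)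
      also have "(\<Sum>y\<in>UNIV. p (x, y, z) * qU y u) = pr S P (X \<bowtie> U' \<bowtie> Z) (x, u, z)"
      proof -
        have "pr S P (X \<bowtie> U' \<bowtie> Z) (x, u, z) =
          (\<Sum>\<omega>\<in>S. \<Sum>y\<in>UNIV. if Y \<omega> = y then (if X \<omega> = x \<and> U' \<omega> = u \<and> Z \<omega> = z then P \<omega> else 0) else 0)"
          unfolding pr_def by (intro sum.cong refl) (simp add: sum.delta')
        also have "\<dots> = (\<Sum>y\<in>UNIV. pr S P (Y \<bowtie> X \<bowtie> Z \<bowtie> U') (y, x, z, u))"
          unfolding pr_def by (subst sum.swap) (auto intro!: sum.cong)
        finally show ?thesis by (simp add: A)
      qed
      also have "\<dots> * qV u z v = pr S P (V' \<bowtie> X \<bowtie> U' \<bowtie> Z) (v, x, u, z)"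
        unfolding qV_def by (rule kern_ci[OF N.ciV])
      also have "\<dots> = pr S P (Z \<bowtie> U' \<bowtie> V' \<bowtie> X) (z, u, v, x)"
        by (rule pr_cong_events) auto
      also have "\<dots> * qW u v x w = pr S P (W' \<bowtie> Z \<bowtie> U' \<bowtie> V' \<bowtie> X) (w, z, u, v, x)"
        unfolding qW_def by (rule kern_ci[OF N.ciW])
      also have "\<dots> = pr S P (X \<bowtie> Z \<bowtie> U' \<bowtie> V' \<bowtie> W') t"
        unfolding t by (rule pr_cong_events) auto
      finally show ?thesis .
    qed
  qed
  have c1: "cond_mutual_info T J (\<lambda>((x, y, z), u, v, w). y) (\<lambda>((x, y, z), u, v, w). u) (\<lambda>((x, y, z), u, v, w). z)
      = cond_mutual_info S P Y U' Z"
    by (rule cmi_law[OF finT fin_S])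
      (use law_marginal[OF finT fin_S lawF, of "\<lambda>(x, y, z, u). (y, u, z)"] in \<open>simp add: case_prod_beta\<close>)
  have c2: "cond_mutual_info T J (\<lambda>((x, y, z), u, v, w). z) (\<lambda>((x, y, z), u, v, w). v) (\<lambda>((x, y, z), u, v, w). (u, x))
      = cond_mutual_info S P Z V' (U' \<bowtie> X)"
    by (rule cmi_law[OF finT fin_S])
      (use law_marginal[OF finT fin_S lawH, of "\<lambda>(x, z, u, v, w). (z, v, u, x)"] in \<open>simp add: case_prod_beta\<close>)
  have c3: "cond_mutual_info T J (\<lambda>((x, y, z), u, v, w). x) (\<lambda>((x, y, z), u, v, w). w) (\<lambda>((x, y, z), u, v, w). (u, v, z))
      = cond_mutual_info S P X W' (U' \<bowtie> V' \<bowtie> Z)"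
    by (rule cmi_law[OF finT fin_S])
      (use law_marginal[OF finT fin_S lawH, of "\<lambda>(x, z, u, v, w). (x, w, u, v, z)"] in \<open>simp add: case_prod_beta\<close>)
  have d1: "(\<Sum>\<omega>\<in>T. J \<omega> * (case \<omega> of ((x, y, z), u, v, w) \<Rightarrow> dx x (xh0 (u, w, z)))) = (\<Sum>\<omega>\<in>S. P \<omega> * dx (X \<omega>) (xh \<omega>))"
    using law_expect[OF finT fin_S lawH, of "\<lambda>(x, z, u, v, w). dx x (xh0 (u, w, z))"] xh0
    by (simp add: case_prod_beta cong: sum.cong)
  have d2: "(\<Sum>\<omega>\<in>T. J \<omega> * (case \<omega> of ((x, y, z), u, v, w) \<Rightarrow> dz z (zh0 (u, v, x)))) = (\<Sum>\<omega>\<in>S. P \<omega> * dz (Z \<omega>) (zh \<omega>))"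
    using law_expect[OF finT fin_S lawH, of "\<lambda>(x, z, u, v, w). dz z (zh0 (u, v, x))"] zh0
    by (simp add: case_prod_beta cong: sum.cong)
  have "feasible p dx dz Dx Dz (R1, R2, R3) K qU qV qW (\<lambda>u w z. xh0 (u, w, z)) (\<lambda>u v x. zh0 (u, v, x))"
    unfolding feasible_def T_def[symmetric] J_def[symmetric] c1 c2 c3 d1 d2
    using N.rate1 N.rate2 N.rate3 dist_x dist_z qU1 qV1 qW1
    by (auto simp: is_kernel_def qU_def qV_def qW_def kern_nonneg)
  then show ?thesis by blast
qed

text \<open>One factor is the number of labels that each variable needs after its reduction; the
  second appears because the final \<open>W\<close> carries a label of \<open>V\<close> as
  well.\<close>

definition alphabet_bound :: "('x::finite \<times> 'y::finite \<times> 'z::finite \<Rightarrow> real) \<Rightarrow> nat" where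
  "alphabet_bound p = (CARD('x \<times> 'y \<times> 'z) + 6) * (CARD('x \<times> 'y \<times> 'z) + 6)"

lemma label_set:
  assumes "finite A" "card A \<le> d"
  obtains e :: "'a \<Rightarrow> nat" where "inj_on e A" "\<And>a. a \<in> A \<Longrightarrow> e a < d"
proof -
  obtain h where "bij_betw h A {0..<card A}" using ex_bij_betw_finite_nat[OF assms(1)] by blast
  then have "inj_on h A" "\<And>a. a \<in> A \<Longrightarrow> h a < card A" by (auto simp: bij_betw_def)
  then show ?thesis using assms(2) by (intro that[of h]) (auto intro: less_le_trans)
qed

text \<open>The variables are reduced in the order \<open>U\<close>, \<open>V\<close>,
  \<open>W\<close>. Each reduction only shrinks the sample space, so the bounds already obtained
  persist. Labels then enumerate \<open>U\<close>, then \<open>V\<close> within each value of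
  \<open>U\<close>, then \<open>W\<close> within each pair.\<close>

lemma (in rv_system) bounded_alphabet:
  "\<exists>qU qV qW xhat zhat. feasible p dx dz Dx Dz (R1, R2, R3) (alphabet_bound p) qU qV qW xhat zhat"
proof -
  define d where "d = CARD('x \<times> 'y \<times> 'z) + 6"
  obtain S1 P1 where 1: "rv_system p dx dz Dx Dz R1 R2 R3 S1 P1 X Y Z U V W xh zh" "card (U ` S1) \<le> d"
    using reduce_U unfolding d_def by blast
  interpret A1: rv_system p dx dz Dx Dz R1 R2 R3 S1 P1 X Y Z U V W xh zh by (rule 1)
  obtain S2 P2 where 2: "S2 \<subseteq> S1" "rv_system p dx dz Dx Dz R1 R2 R3 S2 P2 X Y Z U V W xh zh"
     "\<And>u. card ((U \<bowtie> V) ` {\<omega>\<in>S2. U \<omega> = u}) \<le> d"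
    using A1.reduce_V unfolding d_def by blast
  interpret A2: rv_system p dx dz Dx Dz R1 R2 R3 S2 P2 X Y Z U V W xh zh by (rule 2)
  obtain S3 P3 where 3: "S3 \<subseteq> S2" "rv_system p dx dz Dx Dz R1 R2 R3 S3 P3 X Y Z U V W xh zh"
     "\<And>c. card ((U \<bowtie> V \<bowtie> W) ` {\<omega>\<in>S3. (U \<omega>, V \<omega>) = c}) \<le> d"
    using A2.reduce_W unfolding d_def by blast
  interpret A3: rv_system p dx dz Dx Dz R1 R2 R3 S3 P3 X Y Z U V W xh zh by (rule 3)
  have "card (U ` S3) \<le> card (U ` S1)" using 2(1) 3(1) A1.fin_S by (intro card_mono) auto
  then obtain eU :: "_ \<Rightarrow> nat" where eU: "inj_on eU (U ` S3)" "\<And>a. a \<in> U ` S3 \<Longrightarrow> eU a < d"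
    using label_set[of "U ` S3" d] A3.fin_S 1(2) by (metis finite_imageI order_trans)
  have "\<forall>u. \<exists>e :: _ \<Rightarrow> nat. inj_on e ((U \<bowtie> V) ` {\<omega>\<in>S3. U \<omega> = u}) \<and>
      (\<forall>a\<in>(U \<bowtie> V) ` {\<omega>\<in>S3. U \<omega> = u}. e a < d)"
  proof
    fix u
    have "card ((U \<bowtie> V) ` {\<omega>\<in>S3. U \<omega> = u}) \<le> card ((U \<bowtie> V) ` {\<omega>\<in>S2. U \<omega> = u})"
      using 3(1) A2.fin_S by (intro card_mono) auto
    then have "card ((U \<bowtie> V) ` {\<omega>\<in>S3. U \<omega> = u}) \<le> d" using 2(3)[of u] by linarith
    then show "\<exists>e :: _ \<Rightarrow> nat. inj_on e ((U \<bowtie> V) ` {\<omega>\<in>S3. U \<omega> = u}) \<and>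
      (\<forall>a\<in>(U \<bowtie> V) ` {\<omega>\<in>S3. U \<omega> = u}. e a < d)"
      using A3.fin_S by (elim label_set[rotated]) auto
  qed
  from choice[OF this] obtain eV :: "_ \<Rightarrow> _ \<Rightarrow> nat" where
    "\<forall>u. inj_on (eV u) ((U \<bowtie> V) ` {\<omega>\<in>S3. U \<omega> = u}) \<and>
      (\<forall>a\<in>(U \<bowtie> V) ` {\<omega>\<in>S3. U \<omega> = u}. eV u a < d)" by blast
  then have eV: "\<And>u. inj_on (eV u) ((U \<bowtie> V) ` {\<omega>\<in>S3. U \<omega> = u})"
     "\<And>u a. a \<in> (U \<bowtie> V) ` {\<omega>\<in>S3. U \<omega> = u} \<Longrightarrow> eV u a < d" by blast+
  have "\<exists>e :: _ \<Rightarrow> nat. inj_on e ((U \<bowtie> V \<bowtie> W) ` {\<omega>\<in>S3. (U \<omega>, V \<omega>) = c}) \<and>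
      (\<forall>a\<in>(U \<bowtie> V \<bowtie> W) ` {\<omega>\<in>S3. (U \<omega>, V \<omega>) = c}. e a < d)" for c
    using 3(3)[of c] A3.fin_S by (elim label_set[rotated]) auto
  then have "\<forall>c. \<exists>e :: _ \<Rightarrow> nat. inj_on e ((U \<bowtie> V \<bowtie> W) ` {\<omega>\<in>S3. (U \<omega>, V \<omega>) = c}) \<and>
      (\<forall>a\<in>(U \<bowtie> V \<bowtie> W) ` {\<omega>\<in>S3. (U \<omega>, V \<omega>) = c}. e a < d)" by (rule allI)
  from choice[OF this] obtain eW :: "_ \<Rightarrow> _ \<Rightarrow> nat" where
    "\<forall>c. inj_on (eW c) ((U \<bowtie> V \<bowtie> W) ` {\<omega>\<in>S3. (U \<omega>, V \<omega>) = c}) \<and>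
      (\<forall>a\<in>(U \<bowtie> V \<bowtie> W) ` {\<omega>\<in>S3. (U \<omega>, V \<omega>) = c}. eW c a < d)" by blast
  then have eW: "\<And>c. inj_on (eW c) ((U \<bowtie> V \<bowtie> W) ` {\<omega>\<in>S3. (U \<omega>, V \<omega>) = c})"
     "\<And>c a. a \<in> (U \<bowtie> V \<bowtie> W) ` {\<omega>\<in>S3. (U \<omega>, V \<omega>) = c} \<Longrightarrow> eW c a < d" by blast+
  define U' where "U' \<omega> = eU (U \<omega>)" for \<omega>
  define V' where "V' \<omega> = eV (U \<omega>) (U \<omega>, V \<omega>)" for \<omega>
  define W0 where "W0 \<omega> = eW (U \<omega>, V \<omega>) (U \<omega>, V \<omega>, W \<omega>)" for \<omega>
  \<comment> \<open>The new \<open>W\<close> also carries \<open>V\<close>: the estimator of \<open>X\<close> in the region does not see \<open>V\<close>.\<close>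
  define W' where "W' \<omega> = V' \<omega> * d + W0 \<omega>" for \<omega>
  have d0: "d > 0" by (simp add: d_def)
  have U'i: "U' \<omega> = U' \<omega>' \<longleftrightarrow> U \<omega> = U \<omega>'" if "\<omega> \<in> S3" "\<omega>' \<in> S3" for \<omega> \<omega>'
    using that eU(1) by (auto simp: U'_def inj_on_def)
  have U'd: "U' \<omega> < d" if "\<omega> \<in> S3" for \<omega> using that eU(2) by (auto simp: U'_def)
  have V'i: "V' \<omega> = V' \<omega>' \<longleftrightarrow> V \<omega> = V \<omega>'" if "\<omega> \<in> S3" "\<omega>' \<in> S3" "U \<omega> = U \<omega>'" for \<omega> \<omega>'
  proof -
    have "(U \<omega>, V \<omega>) \<in> (U \<bowtie> V) ` {\<omega>''\<in>S3. U \<omega>'' = U \<omega>}"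
      "(U \<omega>, V \<omega>') \<in> (U \<bowtie> V) ` {\<omega>''\<in>S3. U \<omega>'' = U \<omega>}" using that by auto
    from inj_on_eq_iff[OF eV(1) this] show ?thesis using that by (simp add: V'_def)
  qed
  have V'd: "V' \<omega> < d" if "\<omega> \<in> S3" for \<omega> unfolding V'_def using that by (intro eV(2)) auto
  have W0i: "W0 \<omega> = W0 \<omega>' \<longleftrightarrow> W \<omega> = W \<omega>'" if "\<omega> \<in> S3" "\<omega>' \<in> S3" "U \<omega> = U \<omega>'" "V \<omega> = V \<omega>'" for \<omega> \<omega>'
  proof -
    have "(U \<omega>, V \<omega>, W \<omega>) \<in> (U \<bowtie> V \<bowtie> W) ` {\<omega>''\<in>S3. (U \<omega>'', V \<omega>'') = (U \<omega>, V \<omega>)}"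
      "(U \<omega>, V \<omega>, W \<omega>') \<in> (U \<bowtie> V \<bowtie> W) ` {\<omega>''\<in>S3. (U \<omega>'', V \<omega>'') = (U \<omega>, V \<omega>)}" using that by auto
    from inj_on_eq_iff[OF eW(1) this] show ?thesis using that by (simp add: W0_def)
  qed
  have W0d: "W0 \<omega> < d" if "\<omega> \<in> S3" for \<omega> unfolding W0_def using that by (intro eW(2)) auto
  have W'div: "W' \<omega> div d = V' \<omega>" "W' \<omega> mod d = W0 \<omega>" if "\<omega> \<in> S3" for \<omega>
    using W0d[OF that] d0 by (auto simp: W'_def)
  have W'd: "W' \<omega> < d * d" if "\<omega> \<in> S3" for \<omega>
  proof -
    have "W' \<omega> < (V' \<omega> + 1) * d" using W0d[OF that] by (simp add: W'_def)
    also have "\<dots> \<le> d * d" using V'd[OF that] by (intro mult_right_mono) auto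
    finally show ?thesis .
  qed
  \<comment> \<open>The region uses one alphabet size for all three variables, so the labels of
    \<open>U\<close> and \<open>V\<close> are put into the larger range needed for
    \<open>W\<close>.\<close>
  have dd: "d \<le> d * d" by simp
  have W'i: "W' \<omega> = W' \<omega>' \<longleftrightarrow> W \<omega> = W \<omega>'" if "\<omega> \<in> S3" "\<omega>' \<in> S3" "U \<omega> = U \<omega>'" "V \<omega> = V \<omega>'" for \<omega> \<omega>'
    using W0i[OF that] V'i[OF that(1-3)] that(4) by (auto simp: W'_def)
  have "\<exists>qU qV qW xhat zhat. feasible p dx dz Dx Dz (R1, R2, R3) (d * d) qU qV qW xhat zhat"
  proof (rule A3.canonical)
    show "rv_system p dx dz Dx Dz R1 R2 R3 S3 P3 X Y Z U' V' W' xh zh"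
      by (rule A3.relabel) (use U'i V'i W'i in auto)
    show "xh \<omega> = xh \<omega>'" if "\<omega> \<in> S3" "\<omega>' \<in> S3" "U' \<omega> = U' \<omega>'" "W' \<omega> = W' \<omega>'" "Z \<omega> = Z \<omega>'" for \<omega> \<omega>'
    proof -
      have u: "U \<omega> = U \<omega>'" using U'i that by blast
      have v: "V \<omega> = V \<omega>'" using V'i[OF that(1,2) u] W'div(1)[OF that(1)] W'div(1)[OF that(2)] that(4) by simp
      have w: "W \<omega> = W \<omega>'" using W'i[OF that(1,2) u v] that(4) by simp
      show ?thesis by (rule A3.xh_det[OF that(1,2) u v w that(5)])
    qed
  qed (use U'd V'd W'd dd d0 in \<open>auto intro: less_le_trans[OF _ dd]\<close>)
  then show ?thesis unfolding alphabet_bound_def d_def .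
qed

section \<open>Closedness of the single-letter region\<close>

text \<open>Only the point \<open>0\<close> is delicate: substituting \<open>inverse t\<close> turns
  \<open>t * ln t\<close> into \<open>- (ln x / x)\<close> at infinity.\<close>

lemma continuous_on_x_log_x: "continuous_on {0..} (\<lambda>t::real. t * log 2 t)"
proof -
  have 0: "((\<lambda>t::real. t * ln t) \<longlongrightarrow> 0) (at_right 0)"
  proof -
    have "((\<lambda>t::real. - (ln (inverse t) / inverse t)) \<longlongrightarrow> - 0) (at_right 0)"
      by (intro tendsto_minus filterlim_compose[OF ln_x_over_x_tendsto_0 filterlim_inverse_at_top_right])
    moreover have "eventually (\<lambda>t::real. - (ln (inverse t) / inverse t) = t * ln t) (at_right 0)"
      by (rule eventually_mono[OF eventually_at_right_less]) (simp add: ln_inverse divide_inverse)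
    ultimately show ?thesis using Lim_transform_eventually by force
  qed
  have "continuous (at x within {0..}) (\<lambda>t::real. t * ln t)" if "x \<ge> 0" for x
  proof (cases "x = 0")
    case True
    have "{0..} - {0} = {0<..} - {0::real}" by auto
    then have "at 0 within {0..} = at_right (0::real)" by (simp only: at_within_def)
    then show ?thesis using 0 True by (simp add: continuous_within)
  next
    case False
    then have "isCont (\<lambda>t. t * ln t) x" by (intro isCont_mult continuous_ident isCont_ln)
    then show ?thesis by (rule continuous_at_imp_continuous_at_within)
  qed
  then have "continuous_on {0..} (\<lambda>t::real. t * ln t)"
    by (simp add: continuous_on_eq_continuous_within)
  from continuous_on_mult_right[OF this, of "1 / ln 2"] show ?thesis by (simp add: log_def)
qed

lemma ent_sum:
  assumes "finite S"
  shows "ent S P F = - (\<Sum>a\<in>F ` S. pr S P F a * log 2 (pr S P F a))"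
  unfolding ent_def prob_eq_pr using sum_law[of S "F ` S" F P "\<lambda>a. log 2 (pr S P F a)"] assms by simp

lemma ent_tendsto:
  assumes fin: "finite S" and nn: "\<And>k \<omega>. \<omega> \<in> S \<Longrightarrow> 0 \<le> Pk k \<omega>"
    and lim: "\<And>\<omega>. \<omega> \<in> S \<Longrightarrow> (\<lambda>k. Pk k \<omega>) \<longlonglongrightarrow> P \<omega>"
  shows "(\<lambda>k. ent S (Pk k) F) \<longlonglongrightarrow> ent S P F"
proof -
  have pr: "(\<lambda>k. pr S (Pk k) F a) \<longlonglongrightarrow> pr S P F a" for a
    unfolding pr_def using lim by (intro tendsto_sum) auto
  have prnn: "0 \<le> pr S (Pk k) F a" for k a
    unfolding pr_def using nn by (intro sum_nonneg) auto
  have "0 \<le> pr S P F a" for a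
    using LIMSEQ_le_const[OF pr[of a], of 0] prnn by auto
  then have "(\<lambda>k. pr S (Pk k) F a * log 2 (pr S (Pk k) F a)) \<longlonglongrightarrow> pr S P F a * log 2 (pr S P F a)" for a
    using prnn by (intro continuous_on_tendsto_compose[OF continuous_on_x_log_x pr]) auto
  then show ?thesis unfolding ent_sum[OF fin] by (intro tendsto_minus tendsto_sum)
qed

text \<open>The ratio under the logarithm need not converge where limiting probabilities vanish.
  Written with entropies, the information involves only the continuous function
  \<open>t * log 2 t\<close>.\<close>

lemma cmi_tendsto:
  assumes fin: "finite S" and nn: "\<And>k \<omega>. \<omega> \<in> S \<Longrightarrow> 0 \<le> Pk k \<omega>"
    and lim: "\<And>\<omega>. \<omega> \<in> S \<Longrightarrow> (\<lambda>k. Pk k \<omega>) \<longlonglongrightarrow> P \<omega>"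
  shows "(\<lambda>k. cond_mutual_info S (Pk k) A B C) \<longlonglongrightarrow> cond_mutual_info S P A B C"
proof -
  have "0 \<le> P \<omega>" if "\<omega> \<in> S" for \<omega>
    using lim[OF that] nn[OF that] by (intro LIMSEQ_le_const) auto
  then interpret L: fin_space S P using fin by unfold_locales auto
  have e: "cond_mutual_info S (Pk k) A B C = ent S (Pk k) (A \<bowtie> C) + ent S (Pk k) (B \<bowtie> C)
      - ent S (Pk k) (A \<bowtie> B \<bowtie> C) - ent S (Pk k) C" for k
    by (rule fin_space.cmi_ent) (use fin nn in \<open>auto intro: fin_space.intro\<close>)
  show ?thesis unfolding e L.cmi_ent
    by (intro tendsto_intros ent_tendsto[OF fin nn lim])
qed

text \<open>Bolzano-Weierstrass, one coordinate at a time. It serves as the compactness of the set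
  of kernels, of which only finitely many entries matter.\<close>

lemma finite_bounded_subseq:
  fixes a :: "nat \<Rightarrow> 'i \<Rightarrow> real"
  assumes "finite I" and "\<And>k i. i \<in> I \<Longrightarrow> a k i \<in> {0..1}"
  shows "\<exists>r l. strict_mono (r :: nat \<Rightarrow> nat) \<and> (\<forall>i\<in>I. (\<lambda>k. a (r k) i) \<longlonglongrightarrow> l i)"
  using assms
proof (induction I rule: finite_induct)
  case empty
  then show ?case by (intro exI[of _ "\<lambda>k. k"]) (auto simp: strict_mono_def)
next
  case (insert i I)
  then obtain r l where r: "strict_mono r" "\<forall>i\<in>I. (\<lambda>k. a (r k) i) \<longlonglongrightarrow> l i" by blast
  have "seq_compact {0..1::real}" by (intro compact_imp_seq_compact) auto
  moreover have "\<forall>k. a (r k) i \<in> {0..1}" using insert.prems by blast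
  ultimately obtain x s where s: "strict_mono s" "((\<lambda>k. a (r k) i) \<circ> s) \<longlonglongrightarrow> x"
    using seq_compactE[of "{0..1}" "\<lambda>k. a (r k) i"] by metis
  have "strict_mono (r \<circ> s)" using r(1) s(1) by (rule strict_mono_o)
  moreover have "(\<lambda>k. a ((r \<circ> s) k) j) \<longlonglongrightarrow> (l(i := x)) j" if "j \<in> insert i I" for j
  proof (cases "j = i")
    case True
    then show ?thesis using s(2) by (simp add: o_def)
  next
    case False
    then have "(\<lambda>k. a (r k) j) \<longlonglongrightarrow> l j" using r(2) that by auto
    from LIMSEQ_subseq_LIMSEQ[OF this s(1)] show ?thesis using False by (simp add: o_def)
  qed
  ultimately show ?case by blast
qed

lemma kernel_le_1:
  assumes "is_kernel K q" "b < K"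
  shows "0 \<le> q a b" "q a b \<le> 1"
proof -
  show "0 \<le> q a b" using assms by (simp add: is_kernel_def)
  have "q a b \<le> (\<Sum>b<K. q a b)" using assms by (intro member_le_sum) (auto simp: is_kernel_def)
  then show "q a b \<le> 1" using assms by (simp add: is_kernel_def)
qed

lemma kernel_limit:
  assumes k: "\<And>k. is_kernel K (q k)" and lim: "\<And>a b. b < K \<Longrightarrow> (\<lambda>k. q k a b) \<longlonglongrightarrow> l a b"
  shows "is_kernel K l"
  unfolding is_kernel_def
proof (intro allI conjI impI)
  fix a b assume "b < K"
  then show "0 \<le> l a b" using lim kernel_le_1(1)[OF k] by (intro LIMSEQ_le_const[of "\<lambda>k. q k a b"]) auto
next
  fix a
  have "(\<lambda>k. \<Sum>b<K. q k a b) \<longlonglongrightarrow> (\<Sum>b<K. l a b)" using lim by (intro tendsto_sum) auto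
  moreover have "(\<lambda>k. \<Sum>b<K. q k a b) = (\<lambda>k. 1)" using k by (auto simp: is_kernel_def)
  ultimately show "(\<Sum>b<K. l a b) = 1" by (metis LIMSEQ_unique tendsto_const)
qed

lemma joint_law_nonneg:
  assumes "\<And>t. 0 \<le> p t" "is_kernel K qU" "is_kernel K (\<lambda>(u, z). qV u z)" "is_kernel K (\<lambda>(u, v, x). qW u v x)"
    and "\<omega> \<in> aux_space K"
  shows "0 \<le> joint_law p qU qV qW \<omega>"
proof -
  obtain x y z u v w where w: "\<omega> = ((x, y, z), u, v, w)" by (metis surj_pair)
  have "0 \<le> qU y u" "0 \<le> qV u z v" "0 \<le> qW u v x w"
    using kernel_le_1(1)[OF assms(2), of u y] kernel_le_1(1)[OF assms(3), of v "(u, z)"]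
      kernel_le_1(1)[OF assms(4), of w "(u, v, x)"] assms(5) by (auto simp: w aux_space_def)
  then show ?thesis using assms(1) by (simp add: w joint_law_def)
qed

text \<open>With \<open>K\<close> fixed, the kernels have finitely many entries between
  \<open>0\<close> and \<open>1\<close>, and the estimators have finitely many restrictions to the
  alphabets. Along a subsequence the restricted estimators are constant and the entries converge;
  rates and distortions are continuous in the entries.\<close>

lemma feasible_limit:
  fixes p :: "'x::finite \<times> 'y::finite \<times> 'z::finite \<Rightarrow> real"
    and dx :: "'x \<Rightarrow> 'xh::finite \<Rightarrow> real" and dz :: "'z \<Rightarrow> 'zh::finite \<Rightarrow> real"
  assumes p: "\<And>t. 0 \<le> p t" and R: "R \<longlonglongrightarrow> R0" and e: "e \<longlonglongrightarrow> 0"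
    and f: "\<And>k. \<exists>qU qV qW xhat zhat. feasible p dx dz (Dx + e k) (Dz + e k) (R k) K qU qV qW xhat zhat"
  shows "\<exists>qU qV qW xhat zhat. feasible p dx dz Dx Dz R0 K qU qV qW xhat zhat"
proof -
  have "\<forall>k. \<exists>t. case t of (qU, qV, qW, xhat, zhat) \<Rightarrow>
      feasible p dx dz (Dx + e k) (Dz + e k) (R k) K qU qV qW xhat zhat"
  proof
    fix k
    from f[of k] obtain qU qV qW xhat zhat
      where "feasible p dx dz (Dx + e k) (Dz + e k) (R k) K qU qV qW xhat zhat" by blast
    then show "\<exists>t. case t of (qU, qV, qW, xhat, zhat) \<Rightarrow>
      feasible p dx dz (Dx + e k) (Dz + e k) (R k) K qU qV qW xhat zhat"
      by (intro exI[of _ "(qU, qV, qW, xhat, zhat)"]) simp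
  qed
  from choice[OF this] obtain T where T: "\<forall>k. case T k of (qU, qV, qW, xhat, zhat) \<Rightarrow>
      feasible p dx dz (Dx + e k) (Dz + e k) (R k) K qU qV qW xhat zhat" ..
  define qU where "qU k = fst (T k)" for k
  define qV where "qV k = fst (snd (T k))" for k
  define qW where "qW k = fst (snd (snd (T k)))" for k
  define xhat where "xhat k = fst (snd (snd (snd (T k))))" for k
  define zhat where "zhat k = snd (snd (snd (snd (T k))))" for k
  have F: "feasible p dx dz (Dx + e k) (Dz + e k) (R k) K (qU k) (qV k) (qW k) (xhat k) (zhat k)" for k
    using spec[OF T, of k] by (simp add: qU_def qV_def qW_def xhat_def zhat_def case_prod_beta)
  let ?A = "{..<K} \<times> {..<K} \<times> (UNIV :: 'z set)" and ?B = "{..<K} \<times> {..<K} \<times> (UNIV :: 'x set)"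
  \<comment> \<open>Estimators are functions on all natural numbers, so infinitely many could occur
    in the sequence; only their restrictions to the alphabets form a finite set.\<close>
  define h where "h k = (restrict (\<lambda>(u, w, z). xhat k u w z) ?A, restrict (\<lambda>(u, v, x). zhat k u v x) ?B)" for k
  have "range h \<subseteq> (?A \<rightarrow>\<^sub>E UNIV) \<times> (?B \<rightarrow>\<^sub>E UNIV)" 
    unfolding h_def by (intro image_subsetI SigmaI) (unfold restrict_PiE_iff, blast+)
  moreover have "finite ((?A \<rightarrow>\<^sub>E (UNIV::'xh set)) \<times> (?B \<rightarrow>\<^sub>E (UNIV::'zh set)))"
    by (intro finite_cartesian_product finite_PiE) auto
  ultimately have "finite (range h)" by (rule finite_subset)
  then obtain k0 where "infinite {k\<in>UNIV. h k = h k0}"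
    using pigeonhole_infinite[of UNIV h] by auto
  from infinite_enumerate[OF this] obtain r :: "nat \<Rightarrow> nat"
    where r0: "strict_mono r" "\<forall>n. r n \<in> {k\<in>UNIV. h k = h k0}" by blast
  then have r: "strict_mono r" "\<And>n. h (r n) = h k0" by auto
  have xk: "xhat (r n) u w z = xhat k0 u w z" if "u < K" "w < K" for n u w z
    using fun_cong[OF arg_cong[OF r(2)[of n], of fst], of "(u, w, z)"] that by (simp add: h_def)
  have zk: "zhat (r n) u v x = zhat k0 u v x" if "u < K" "v < K" for n u v x
    using fun_cong[OF arg_cong[OF r(2)[of n], of snd], of "(u, v, x)"] that by (simp add: h_def)
  define I where "I = (UNIV :: 'y set) \<times> {..<K} <+> ({..<K} \<times> (UNIV :: 'z set) \<times> {..<K}) <+> ({..<K} \<times> {..<K} \<times> (UNIV :: 'x set) \<times> {..<K})"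
  define a where "a k i = (case i of Inl (y, u) \<Rightarrow> qU k y u | Inr (Inl (u, z, v)) \<Rightarrow> qV k u z v
     | Inr (Inr (u, v, x, w)) \<Rightarrow> qW k u v x w)" for k and i :: "'y \<times> nat + nat \<times> 'z \<times> nat + nat \<times> nat \<times> 'x \<times> nat"
  have ker: "is_kernel K (qU k)" "is_kernel K (\<lambda>(u, z). qV k u z)" "is_kernel K (\<lambda>(u, v, x). qW k u v x)" for k
    using F[of k] by (auto simp: feasible_def)
  have bd: "a (r k) i \<in> {0..1}" if "i \<in> I" for i k
    using that kernel_le_1[OF ker(1)] kernel_le_1[OF ker(2), of _ _ "(_, _)"] kernel_le_1[OF ker(3), of _ _ "(_, _, _)"]
    by (auto simp: I_def a_def)
  have "finite I" unfolding I_def by (intro finite_Plus finite_cartesian_product) auto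
  from finite_bounded_subseq[of I "\<lambda>k. a (r k)", OF this bd] obtain s l where s: "strict_mono s"
    and l: "\<And>i. i \<in> I \<Longrightarrow> (\<lambda>k. a (r (s k)) i) \<longlonglongrightarrow> l i" by blast
  define t where "t k = r (s k)" for k
  have t: "strict_mono t" using strict_mono_o[OF r(1) s] by (simp add: t_def o_def strict_mono_def)
  define lU where "lU y u = l (Inl (y, u))" for y u
  \<comment> \<open>A kernel must be normalised under every condition, also for labels
    \<open>u\<close> outside the alphabet, where no convergence has been arranged. There the kernel
    with index \<open>0\<close> is copied.\<close>
  define lV where "lV u z v = (if u < K then l (Inr (Inl (u, z, v))) else qV 0 u z v)" for u z v
  define lW where "lW u v x w = (if u < K \<and> v < K then l (Inr (Inr (u, v, x, w))) else qW 0 u v x w)" for u v x w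
  have limU: "(\<lambda>k. qU (t k) y u) \<longlonglongrightarrow> lU y u" if "u < K" for y u
    using l[of "Inl (y, u)"] that by (auto simp: I_def a_def t_def lU_def)
  have limV: "(\<lambda>k. qV (t k) u z v) \<longlonglongrightarrow> lV u z v" if "u < K" "v < K" for u z v
    using l[of "Inr (Inl (u, z, v))"] that by (auto simp: I_def a_def t_def lV_def)
  have limW: "(\<lambda>k. qW (t k) u v x w) \<longlonglongrightarrow> lW u v x w" if "u < K" "v < K" "w < K" for u v x w
    using l[of "Inr (Inr (u, v, x, w))"] that by (auto simp: I_def a_def t_def lW_def)
  have kU: "is_kernel K lU" by (rule kernel_limit[OF ker(1) limU])
  have "is_kernel K (\<lambda>(u, z). lV u z)"
  proof (rule kernel_limit[of K "\<lambda>k (u, z). if u < K then qV (t k) u z else qV 0 u z"])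
    show "is_kernel K (\<lambda>(u, z). if u < K then qV (t k) u z else qV 0 u z)" for k
      using ker(2)[of "t k"] ker(2)[of 0] by (auto simp: is_kernel_def)
    show "(\<lambda>k. (case a of (u, z) \<Rightarrow> if u < K then qV (t k) u z else qV 0 u z) b) \<longlonglongrightarrow> (case a of (u, z) \<Rightarrow> lV u z) b"
      if "b < K" for a b
      using limV that by (cases a) (auto simp: lV_def)
  qed
  note kV = this
  have "is_kernel K (\<lambda>(u, v, x). lW u v x)"
  proof (rule kernel_limit[of K "\<lambda>k (u, v, x). if u < K \<and> v < K then qW (t k) u v x else qW 0 u v x"])
    show "is_kernel K (\<lambda>(u, v, x). if u < K \<and> v < K then qW (t k) u v x else qW 0 u v x)" for k
      using ker(3)[of "t k"] ker(3)[of 0] by (auto simp: is_kernel_def)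
    show "(\<lambda>k. (case a of (u, v, x) \<Rightarrow> if u < K \<and> v < K then qW (t k) u v x else qW 0 u v x) b) \<longlonglongrightarrow> (case a of (u, v, x) \<Rightarrow> lW u v x) b"
      if "b < K" for a b
      using limW that by (cases a) (auto simp: lW_def)
  qed
  note kW = this
  define J where "J k = joint_law p (qU (t k)) (qV (t k)) (qW (t k))" for k
  define J0 where "J0 = joint_law p lU lV lW"
  have finS: "finite (aux_space K :: (('x \<times> 'y \<times> 'z) \<times> nat \<times> nat \<times> nat) set)" by (simp add: aux_space_def)
  have nn: "0 \<le> J k \<omega>" if "\<omega> \<in> aux_space K" for k \<omega>
    unfolding J_def using that by (intro joint_law_nonneg[OF p ker])
  have lim: "(\<lambda>k. J k \<omega>) \<longlonglongrightarrow> J0 \<omega>" if "\<omega> \<in> aux_space K" for \<omega>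
  proof -
    obtain x y z u v w where w: "\<omega> = ((x, y, z), u, v, w)" by (metis surj_pair)
    then have "u < K" "v < K" "w < K" using that by (auto simp: aux_space_def)
    then show ?thesis unfolding w J_def J0_def joint_law_def by (auto intro!: tendsto_intros limU limV limW)
  qed
  note cmi = cmi_tendsto[OF finS nn lim]
  have Rt: "(\<lambda>k. R (t k)) \<longlonglongrightarrow> R0" using LIMSEQ_subseq_LIMSEQ[OF R t] by (simp add: o_def)
  have et: "(\<lambda>k. e (t k)) \<longlonglongrightarrow> 0" using LIMSEQ_subseq_LIMSEQ[OF e t] by (simp add: o_def)
  have "feasible p dx dz Dx Dz R0 K lU lV lW (xhat k0) (zhat k0)"
    unfolding feasible_def J0_def[symmetric]
  proof (intro conjI kU kV kW)
    note Ft = F[of "t _", unfolded feasible_def, folded J_def]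
    show "cond_mutual_info (aux_space K) J0 (\<lambda>((x, y, z), u, v, w). y)
       (\<lambda>((x, y, z), u, v, w). u) (\<lambda>((x, y, z), u, v, w). z) \<le> fst R0"
      using Ft by (intro LIMSEQ_le[OF cmi tendsto_fst[OF Rt]]) auto
    show "cond_mutual_info (aux_space K) J0 (\<lambda>((x, y, z), u, v, w). z)
       (\<lambda>((x, y, z), u, v, w). v) (\<lambda>((x, y, z), u, v, w). (u, x)) \<le> fst (snd R0)"
      using Ft by (intro LIMSEQ_le[OF cmi tendsto_fst[OF tendsto_snd[OF Rt]]]) auto
    show "cond_mutual_info (aux_space K) J0 (\<lambda>((x, y, z), u, v, w). x)
       (\<lambda>((x, y, z), u, v, w). w) (\<lambda>((x, y, z), u, v, w). (u, v, z)) \<le> snd (snd R0)"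
      using Ft by (intro LIMSEQ_le[OF cmi tendsto_snd[OF tendsto_snd[OF Rt]]]) auto
    have "(\<lambda>k. \<Sum>\<omega>\<in>aux_space K. J k \<omega> * (case \<omega> of ((x, y, z), u, v, w) \<Rightarrow> dx x (xhat k0 u w z))) \<longlonglongrightarrow>
       (\<Sum>\<omega>\<in>aux_space K. J0 \<omega> * (case \<omega> of ((x, y, z), u, v, w) \<Rightarrow> dx x (xhat k0 u w z)))"
      by (intro tendsto_sum tendsto_mult_right lim)
    moreover have "(\<Sum>\<omega>\<in>aux_space K. J k \<omega> * (case \<omega> of ((x, y, z), u, v, w) \<Rightarrow> dx x (xhat k0 u w z))) \<le> Dx + e (t k)" for k
    proof -
      have "(\<Sum>\<omega>\<in>aux_space K. J k \<omega> * (case \<omega> of ((x, y, z), u, v, w) \<Rightarrow> dx x (xhat k0 u w z))) =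
        (\<Sum>\<omega>\<in>aux_space K. J k \<omega> * (case \<omega> of ((x, y, z), u, v, w) \<Rightarrow> dx x (xhat (t k) u w z)))"
        unfolding t_def by (intro sum.cong refl) (auto simp: aux_space_def xk)
      then show ?thesis using Ft[of k] by simp
    qed
    moreover have "(\<lambda>k. Dx + e (t k)) \<longlonglongrightarrow> Dx + 0" by (intro tendsto_intros et)
    ultimately show "(\<Sum>\<omega>\<in>aux_space K. J0 \<omega> * (case \<omega> of ((x, y, z), u, v, w) \<Rightarrow> dx x (xhat k0 u w z))) \<le> Dx"
      using LIMSEQ_le[of _ _ _ "Dx + 0"] by auto
    have "(\<lambda>k. \<Sum>\<omega>\<in>aux_space K. J k \<omega> * (case \<omega> of ((x, y, z), u, v, w) \<Rightarrow> dz z (zhat k0 u v x))) \<longlonglongrightarrow>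
       (\<Sum>\<omega>\<in>aux_space K. J0 \<omega> * (case \<omega> of ((x, y, z), u, v, w) \<Rightarrow> dz z (zhat k0 u v x)))"
      by (intro tendsto_sum tendsto_mult_right lim)
    moreover have "(\<Sum>\<omega>\<in>aux_space K. J k \<omega> * (case \<omega> of ((x, y, z), u, v, w) \<Rightarrow> dz z (zhat k0 u v x))) \<le> Dz + e (t k)" for k
    proof -
      have "(\<Sum>\<omega>\<in>aux_space K. J k \<omega> * (case \<omega> of ((x, y, z), u, v, w) \<Rightarrow> dz z (zhat k0 u v x))) =
        (\<Sum>\<omega>\<in>aux_space K. J k \<omega> * (case \<omega> of ((x, y, z), u, v, w) \<Rightarrow> dz z (zhat (t k) u v x)))"
        unfolding t_def by (intro sum.cong refl) (auto simp: aux_space_def zk)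
      then show ?thesis using Ft[of k] by simp
    qed
    moreover have "(\<lambda>k. Dz + e (t k)) \<longlonglongrightarrow> Dz + 0" by (intro tendsto_intros et)
    ultimately show "(\<Sum>\<omega>\<in>aux_space K. J0 \<omega> * (case \<omega> of ((x, y, z), u, v, w) \<Rightarrow> dz z (zhat k0 u v x))) \<le> Dz"
      using LIMSEQ_le[of _ _ _ "Dz + 0"] by auto
  qed
  then show ?thesis by blast
qed

section \<open>Converse\<close>

context fin_space
begin

text \<open>Data processing: the difference of the two sides is the information between
  \<open>A\<close> and \<open>B\<close> given \<open>A'\<close> and \<open>C\<close>.\<close>

lemma cmi_mono_left:
  assumes "\<And>\<omega> \<omega>'. \<omega> \<in> S \<Longrightarrow> \<omega>' \<in> S \<Longrightarrow> A \<omega> = A \<omega>' \<Longrightarrow> A' \<omega> = A' \<omega>'"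
  shows "cond_mutual_info S P A' B C \<le> cond_mutual_info S P A B C"
proof -
  have 1: "0 \<le> cond_mutual_info S P A B (A' \<bowtie> C)" by (rule cmi_nonneg)
  have e: "ent S P (A \<bowtie> A' \<bowtie> C) = ent S P (A \<bowtie> C)"
    "ent S P (A \<bowtie> B \<bowtie> A' \<bowtie> C) = ent S P (A \<bowtie> B \<bowtie> C)"
    "ent S P (B \<bowtie> A' \<bowtie> C) = ent S P (A' \<bowtie> B \<bowtie> C)"
    by (auto intro!: ent_cong intro: assms)
  show ?thesis using 1 unfolding cmi_ent e by linarith
qed

text \<open>The information becomes a difference of two values of one expression, the entropy of
  \<open>B\<close> given \<open>F\<close> and given \<open>F'\<close>. If \<open>F\<close> and
  \<open>F'\<close> are consecutive members of a chain, the sum over the block telescopes.\<close>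

lemma cmi_step:
  assumes F: "\<And>\<omega> \<omega>'. \<omega> \<in> S \<Longrightarrow> \<omega>' \<in> S \<Longrightarrow> F \<omega>' = F \<omega> \<longleftrightarrow> C \<omega>' = C \<omega>"
    and F': "\<And>\<omega> \<omega>'. \<omega> \<in> S \<Longrightarrow> \<omega>' \<in> S \<Longrightarrow> F' \<omega>' = F' \<omega> \<longleftrightarrow> A \<omega>' = A \<omega> \<and> C \<omega>' = C \<omega>"
  shows "cond_mutual_info S P A B C =
    (ent S P (B \<bowtie> F) - ent S P F) - (ent S P (B \<bowtie> F') - ent S P F')"
proof -
  have "ent S P (A \<bowtie> C) = ent S P F'" "ent S P C = ent S P F"
    "ent S P (B \<bowtie> C) = ent S P (B \<bowtie> F)"
    "ent S P (A \<bowtie> B \<bowtie> C) = ent S P (B \<bowtie> F')"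
    by (auto intro!: ent_cong simp: F F')
  then show ?thesis unfolding cmi_ent by simp
qed

lemma ent_le_log:
  assumes "\<And>\<omega>. \<omega> \<in> S \<Longrightarrow> F \<omega> < (M::nat)" and sum1: "(\<Sum>\<omega>\<in>S. P \<omega>) = 1"
  shows "ent S P F \<le> log 2 M"
proof -
  have M: "0 < M"
  proof (rule ccontr)
    assume "\<not> 0 < M"
    then have "S = {}" using assms(1) by auto
    then show False using sum1 by simp
  qed
  let ?q = "pr S P F"
  have tot: "(\<Sum>a<M. ?q a) = 1"
    using sum_law[OF fin, of "{..<M}" F P "\<lambda>_. 1"] assms by auto
  have "ln 2 * ent S P F = - (\<Sum>a<M. ?q a * ln (?q a))"
    using sum_law[OF fin, of "{..<M}" F P "\<lambda>a. log 2 (?q a)"] assms(1)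
    by (auto simp: ent_def prob_eq_pr log_def sum_divide_distrib[symmetric])
  also have "\<dots> = (\<Sum>a<M. - (?q a * ln (?q a)))" by (simp add: sum_negf)
  also have "\<dots> \<le> (\<Sum>a<M. 1 / real M - ?q a + ?q a * ln M)"
  proof (intro sum_mono)
    fix a assume "a \<in> {..<M}"
    show "- (?q a * ln (?q a)) \<le> 1 / real M - ?q a + ?q a * ln M"
    proof (cases "?q a = 0")
      case False
      then have q: "?q a > 0" using pr_nonneg[of F a] by simp
      have "ln (1 / (real M * ?q a)) \<le> 1 / (real M * ?q a) - 1"
        using q M by (intro ln_le_minus_one) auto
      then have "- ln (real M) - ln (?q a) \<le> 1 / (real M * ?q a) - 1"
        using q M by (simp add: ln_div ln_mult)
      then have "?q a * (- ln (real M) - ln (?q a)) \<le> ?q a * (1 / (real M * ?q a) - 1)"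
        using q by (intro mult_left_mono) auto
      then show ?thesis using q M by (simp add: algebra_simps)
    qed simp
  qed
  also have "\<dots> = 1 - (\<Sum>a<M. ?q a) + (\<Sum>a<M. ?q a) * ln M"
    using M by (simp add: sum.distrib sum_subtractf sum_distrib_right)
  also have "\<dots> = ln M" by (simp add: tot)
  finally have "ln 2 * ent S P F \<le> ln M" .
  then show ?thesis by (simp add: log_def field_simps)
qed

text \<open>Conditioning does not increase the entropy of \<open>t\<close>, and the subtracted
  conditional entropy is not negative, so the difference is at most the entropy of
  \<open>t\<close>.\<close>

lemma telescoped_information:
  assumes t: "\<And>\<omega>. \<omega> \<in> S \<Longrightarrow> t \<omega> < (M::nat)" and sum1: "(\<Sum>\<omega>\<in>S. P \<omega>) = 1"
  shows "ent S P (t \<bowtie> F) - ent S P F - (ent S P (t \<bowtie> G) - ent S P G) \<le> log 2 M"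
proof -
  have "0 \<le> cond_mutual_info S P t F (\<lambda>_. ())" by (rule cmi_nonneg)
  moreover have "ent S P (\<lambda>\<omega>. (t \<omega>, ())) = ent S P t" "ent S P (\<lambda>\<omega>. (F \<omega>, ())) = ent S P F"
    "ent S P (\<lambda>\<omega>. (t \<omega>, F \<omega>, ())) = ent S P (t \<bowtie> F)" by (auto intro!: ent_cong)
  moreover have "ent S P (\<lambda>_. ()) = 0"
    by (simp add: ent_def prob_eq_def sum1)
  moreover have "ent S P t \<le> log 2 M" by (rule ent_le_log[OF t sum1])
  moreover have "ent S P G \<le> ent S P (t \<bowtie> G)" by (rule ent_mono) auto
  ultimately show ?thesis unfolding cmi_ent by linarith
qed

end

section \<open>Words of independent symbols\<close>

lemma sum_lists_Suc:
  assumes "finite A"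
  shows "(\<Sum>ws\<in>{ws. set ws \<subseteq> A \<and> length ws = Suc n}. F ws) =
    (\<Sum>w\<in>A. \<Sum>ws\<in>{ws. set ws \<subseteq> A \<and> length ws = n}. F (w # ws))"
proof -
  have "{ws. set ws \<subseteq> A \<and> length ws = Suc n} = (\<lambda>(w, ws). w # ws) ` (A \<times> {ws. set ws \<subseteq> A \<and> length ws = n})"
    by (force simp: length_Suc_conv image_iff)
  then show ?thesis
    by (simp add: sum.reindex inj_on_def sum.cartesian_product case_prod_beta)
qed

lemma sum_lists_Suc_UNIV:
  "(\<Sum>ws\<in>{ws :: 'a::finite list. length ws = Suc n}. F ws) = (\<Sum>w\<in>UNIV. \<Sum>ws\<in>{ws. length ws = n}. F (w # ws))"
  using sum_lists_Suc[where A = "UNIV :: 'a set" and n = n and F = F] by simp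

lemma finite_lists_length: "finite {ws :: 'a::finite list. length ws = n}"
  using finite_lists_length_eq[of "UNIV :: 'a set" n] by simp

lemma sum_prod_list:
  fixes p :: "'a::finite \<Rightarrow> real"
  assumes "(\<Sum>a\<in>UNIV. p a) = 1"
  shows "(\<Sum>ws\<in>{ws. length ws = n}. prod_list (map p ws)) = 1"
proof (induction n)
  case (Suc n)
  then show ?case using assms
    by (simp add: sum_lists_Suc_UNIV sum_distrib_left[symmetric])
qed simp

lemma pr_iid_coordinate:
  fixes p :: "'a::finite \<Rightarrow> real"
  assumes p1: "(\<Sum>a\<in>UNIV. p a) = 1" and "i < n"
  shows "pr {ws. length ws = n} (\<lambda>ws. prod_list (map p ws)) (\<lambda>ws. ws ! i) t = p t"
  using assms(2)
proof (induction n arbitrary: i)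
  case (Suc n)
  show ?case
  proof (cases i)
    case 0
    have "pr {ws. length ws = Suc n} (\<lambda>ws. prod_list (map p ws)) (\<lambda>ws. ws ! i) t =
       (\<Sum>w\<in>UNIV. \<Sum>ws\<in>{ws. length ws = n}. if w = t then p w * prod_list (map p ws) else 0)"
      unfolding pr_def by (subst sum_lists_Suc_UNIV) (simp add: 0 cong: if_cong)
    also have "\<dots> = (\<Sum>w\<in>UNIV. if w = t then p w else 0)"
      by (intro sum.cong refl) (simp add: sum_distrib_left[symmetric] sum_prod_list[OF p1])
    finally show ?thesis by simp
  next
    case (Suc j)
    have "pr {ws. length ws = Suc n} (\<lambda>ws. prod_list (map p ws)) (\<lambda>ws. ws ! i) t =
       (\<Sum>w\<in>UNIV. \<Sum>ws\<in>{ws. length ws = n}. p w * (if ws ! j = t then prod_list (map p ws) else 0))"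
      unfolding pr_def by (subst sum_lists_Suc_UNIV) (auto simp: Suc intro!: sum.cong)
    also have "\<dots> = (\<Sum>w\<in>UNIV. p w) * pr {ws. length ws = n} (\<lambda>ws. prod_list (map p ws)) (\<lambda>ws. ws ! j) t"
      by (simp add: pr_def sum_product sum_distrib_left[symmetric])
    finally show ?thesis using Suc.IH[of j] Suc.prems p1 Suc by simp
  qed
qed simp

lemma list_split_eq:
  assumes "length as = n" "length bs = n" "i < n"
  shows "as = bs \<longleftrightarrow> take i as = take i bs \<and> as ! i = bs ! i \<and> drop (Suc i) as = drop (Suc i) bs"
  using assms by (metis id_take_nth_drop)

lemma take_Suc_eq:
  assumes "length as = n" "length bs = n" "i < n"
  shows "take (Suc i) as = take (Suc i) bs \<longleftrightarrow> take i as = take i bs \<and> as ! i = bs ! i"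
  using assms by (auto simp: take_Suc_conv_app_nth)

lemma drop_eq:
  assumes "length as = n" "length bs = n" "i < n"
  shows "drop i as = drop i bs \<longleftrightarrow> as ! i = bs ! i \<and> drop (Suc i) as = drop (Suc i) bs"
  using assms by (metis Cons_nth_drop_Suc list.inject)

lemma triple_maps_eq:
  assumes "map fst us = map fst vs" "map (fst \<circ> snd) us = map (fst \<circ> snd) vs" "map (snd \<circ> snd) us = map (snd \<circ> snd) vs"
  shows "us = vs"
proof (rule nth_equalityI)
  show len: "length us = length vs" using assms(1) by (metis length_map)
  fix i assume i: "i < length us"
  have "fst (us ! i) = fst (vs ! i)" "fst (snd (us ! i)) = fst (snd (vs ! i))" "snd (snd (us ! i)) = snd (snd (vs ! i))"
    using arg_cong[OF assms(1), of "\<lambda>l. l ! i"] arg_cong[OF assms(2), of "\<lambda>l. l ! i"] arg_cong[OF assms(3), of "\<lambda>l. l ! i"] i len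
    by auto
  then show "us ! i = vs ! i" by (simp add: prod_eq_iff)
qed

section \<open>Markov chains and rate bounds for a block code\<close>

locale source_code =
  fixes p :: "'x::finite \<times> 'y::finite \<times> 'z::finite \<Rightarrow> real" and n :: nat
    and f1 :: "'y list \<Rightarrow> nat" and f2 :: "'z list \<Rightarrow> nat \<Rightarrow> nat" and f3 :: "'x list \<Rightarrow> nat \<Rightarrow> nat \<Rightarrow> nat"
    and M1 M2 M3 :: nat
  assumes pmf: "is_pmf p" and markov: "markov_YXZ p" and n: "0 < n"
    and f1: "\<And>ys. f1 ys < M1" and f2: "\<And>zs t. f2 zs t < M2" and f3: "\<And>xs t t'. f3 xs t t' < M3"
begin

definition S :: "('x \<times> 'y \<times> 'z) list set" where "S = {ws. length ws = n}"
definition P :: "('x \<times> 'y \<times> 'z) list \<Rightarrow> real" where "P ws = prod_list (map p ws)"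
definition xs :: "('x \<times> 'y \<times> 'z) list \<Rightarrow> 'x list" where "xs ws = map fst ws"
definition ys :: "('x \<times> 'y \<times> 'z) list \<Rightarrow> 'y list" where "ys ws = map (fst \<circ> snd) ws"
definition zs :: "('x \<times> 'y \<times> 'z) list \<Rightarrow> 'z list" where "zs ws = map (snd \<circ> snd) ws"
definition t1 :: "('x \<times> 'y \<times> 'z) list \<Rightarrow> nat" where "t1 ws = f1 (ys ws)"
definition t2 :: "('x \<times> 'y \<times> 'z) list \<Rightarrow> nat" where "t2 ws = f2 (zs ws) (t1 ws)"
definition t3 :: "('x \<times> 'y \<times> 'z) list \<Rightarrow> nat" where "t3 ws = f3 (xs ws) (t1 ws) (t2 ws)"
text \<open>Coordinates count from \<open>0\<close>: \<open>take i\<close> is the past of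
  \<open>i\<close> and \<open>drop (Suc i)\<close> its future. The past of \<open>X\<close> screens
  off the past of \<open>Z\<close> by \<open>ci_past\<close>. With the future of \<open>Z\<close>
  also known, the part of \<open>zs\<close> that \<open>t2\<close> still needs is only past and
  present.\<close>

definition U :: "nat \<Rightarrow> ('x \<times> 'y \<times> 'z) list \<Rightarrow> 'x list \<times> nat \<times> 'z list" where
  "U i ws = (take i (xs ws), t1 ws, drop (Suc i) (zs ws))"

lemma p_nonneg: "0 \<le> p t" and p_sum: "(\<Sum>t\<in>UNIV. p t) = 1"
  using pmf unfolding is_pmf_def by blast+

lemma fin_S: "finite S" unfolding S_def by (rule finite_lists_length)

lemma P_nonneg: "0 \<le> P ws" unfolding P_def using p_nonneg by (induction ws) auto

sublocale fin_space S P using fin_S P_nonneg by unfold_locales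

lemma P_sum: "(\<Sum>ws\<in>S. P ws) = 1" unfolding S_def P_def by (rule sum_prod_list[OF p_sum])

lemma len: "ws \<in> S \<Longrightarrow> length ws = n" "ws \<in> S \<Longrightarrow> length (xs ws) = n"
  "ws \<in> S \<Longrightarrow> length (ys ws) = n" "ws \<in> S \<Longrightarrow> length (zs ws) = n"
  by (auto simp: S_def xs_def ys_def zs_def)

lemma coords: "\<omega> \<in> S \<Longrightarrow> i < n \<Longrightarrow> xs \<omega> ! i = fst (\<omega> ! i)" "\<omega> \<in> S \<Longrightarrow> i < n \<Longrightarrow> ys \<omega> ! i = fst (snd (\<omega> ! i))"
  "\<omega> \<in> S \<Longrightarrow> i < n \<Longrightarrow> zs \<omega> ! i = snd (snd (\<omega> ! i))"
  by (auto simp: S_def xs_def ys_def zs_def)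

lemma takes: "take i (xs ws) = xs (take i ws)" "take i (ys ws) = ys (take i ws)" "take i (zs ws) = zs (take i ws)"
  "drop i (xs ws) = xs (drop i ws)" "drop i (ys ws) = ys (drop i ws)" "drop i (zs ws) = zs (drop i ws)"
  by (simp_all add: xs_def ys_def zs_def take_map drop_map)

lemma t1_det: "ys \<omega> = ys \<omega>' \<Longrightarrow> t1 \<omega> = t1 \<omega>'" by (simp add: t1_def)

lemma t2_det:
  assumes "i < n" "\<omega> \<in> S" "\<omega>' \<in> S" "take i (zs \<omega>) = take i (zs \<omega>')" "zs \<omega> ! i = zs \<omega>' ! i"
    "drop (Suc i) (zs \<omega>) = drop (Suc i) (zs \<omega>')" "t1 \<omega> = t1 \<omega>'"
  shows "t2 \<omega> = t2 \<omega>'"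
  using list_split_eq[OF len(4)[OF assms(2)] len(4)[OF assms(3)] assms(1)] assms by (simp add: t2_def)

lemma t3_det:
  assumes "i < n" "\<omega> \<in> S" "\<omega>' \<in> S" "take i (xs \<omega>) = take i (xs \<omega>')" "xs \<omega> ! i = xs \<omega>' ! i"
    "drop (Suc i) (xs \<omega>) = drop (Suc i) (xs \<omega>')" "t1 \<omega> = t1 \<omega>'" "t2 \<omega> = t2 \<omega>'"
  shows "t3 \<omega> = t3 \<omega>'"
  using list_split_eq[OF len(2)[OF assms(2)] len(2)[OF assms(3)] assms(1)] assms by (simp add: t3_def)

definition pxy :: "'x \<Rightarrow> 'y \<Rightarrow> real" where "pxy x y = (\<Sum>z\<in>UNIV. p (x, y, z))"
definition pzx :: "'x \<Rightarrow> 'z \<Rightarrow> real" where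
  "pzx x z = (\<Sum>y\<in>UNIV. p (x, y, z)) / (\<Sum>y\<in>UNIV. \<Sum>z'\<in>UNIV. p (x, y, z'))"

lemma p_factor: "p (x, y, z) = pxy x y * pzx x z"
  using markov unfolding markov_YXZ_def pxy_def pzx_def by blast

lemma P_append: "P (us @ vs) = P us * P vs"
  by (simp add: P_def)

lemma P_factor: "P us = prod_list (map2 pzx (xs us) (zs us)) * prod_list (map2 pxy (xs us) (ys us))"
  by (induction us) (auto simp: P_def xs_def ys_def zs_def p_factor)

text \<open>\<open>Z\<close> arises from \<open>X\<close> letter by letter, without memory and
  independently of \<open>Y\<close>. Hence its past depends on the rest of the block only through
  the past of \<open>X\<close>. The conditional independences with \<open>t2\<close> or
  \<open>t3\<close> are all derived from this one.\<close>

lemma ci_past: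
  assumes i: "i \<le> n"
  shows "ci S P (\<lambda>ws. take i (zs ws)) (\<lambda>ws. (ys ws, drop i ws)) (\<lambda>ws. take i (xs ws))"
proof (rule ci_rectangular[OF fin_S, where f = "\<lambda>a c. prod_list (map2 pzx c a)"
      and g = "\<lambda>(b, d) c. prod_list (map2 pxy c (take i b)) * P d"])
  show "inj_on (\<lambda>ws. (take i (zs ws), (ys ws, drop i ws), take i (xs ws))) S"
  proof (rule inj_onI)
    fix a b assume "(take i (zs a), (ys a, drop i a), take i (xs a)) = (take i (zs b), (ys b, drop i b), take i (xs b))"
    then have "take i (zs a) = take i (zs b)" "take i (ys a) = take i (ys b)" "take i (xs a) = take i (xs b)"
      and d: "drop i a = drop i b" by auto
    then have "take i a = take i b" unfolding takes unfolding xs_def ys_def zs_def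
      by (intro triple_maps_eq)
    then show "a = b" using d by (metis append_take_drop_id)
  qed
next
  fix a b assume a: "a \<in> S" and b: "b \<in> S" and eq: "take i (xs a) = take i (xs b)"
  \<comment> \<open>The sample point must take the past of \<open>Z\<close> from \<open>a\<close>
    and all the rest from \<open>b\<close>; the pasts of \<open>X\<close> agree.\<close>
  define \<omega> where "\<omega> = zip (take i (xs a)) (zip (take i (ys b)) (take i (zs a))) @ drop i b"
  have l: "length (take i (xs a)) = i" "length (take i (ys b)) = i" "length (take i (zs a)) = i" "length (drop i b) = n - i"
    using len[OF a] len[OF b] i by auto
  have "\<omega> \<in> S" using l i by (simp add: \<omega>_def S_def)
  moreover have t: "take i \<omega> = zip (take i (xs a)) (zip (take i (ys b)) (take i (zs a)))" "drop i \<omega> = drop i b"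
    using l by (simp_all add: \<omega>_def)
  have "take i (xs \<omega>) = take i (xs a)"
    unfolding takes(1)[of i \<omega>] t(1) using l by (simp add: xs_def)
  moreover have "take i (zs \<omega>) = take i (zs a)"
    unfolding takes(3)[of i \<omega>] t(1) using l by (simp add: zs_def map_map[symmetric] del: map_map)
  moreover have ty: "take i (ys \<omega>) = take i (ys b)"
    unfolding takes(2)[of i \<omega>] t(1) using l by (simp add: ys_def map_map[symmetric] del: map_map)
  moreover have "drop i (ys \<omega>) = drop i (ys b)" unfolding takes t ..
  then have "ys \<omega> = ys b" using ty by (metis append_take_drop_id)
  ultimately show "\<exists>\<omega>\<in>S. take i (zs \<omega>) = take i (zs a) \<and> (ys \<omega>, drop i \<omega>) = (ys b, drop i b) \<and> take i (xs \<omega>) = take i (xs a)"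
    using t(2) by blast
next
  fix \<omega> assume "\<omega> \<in> S"
  have "P \<omega> = P (take i \<omega>) * P (drop i \<omega>)" by (metis P_append append_take_drop_id)
  then show "P \<omega> = prod_list (map2 pzx (take i (xs \<omega>)) (take i (zs \<omega>))) *
      (case (ys \<omega>, drop i \<omega>) of (b, d) \<Rightarrow> \<lambda>c. prod_list (map2 pxy c (take i b)) * P d) (take i (xs \<omega>))"
    by (simp add: P_factor[of "take i \<omega>"] takes)
qed

lemma ci_coordinate:
  assumes i: "i < n"
  shows "ci S P (\<lambda>ws. ws ! i) (\<lambda>ws. (take i ws, drop (Suc i) ws)) (\<lambda>_. ())"
proof (rule ci_rectangular[OF fin_S, where f = "\<lambda>a _. p a" and g = "\<lambda>(b, d) _. P b * P d"])
  show "inj_on (\<lambda>ws. (ws ! i, (take i ws, drop (Suc i) ws), ())) S"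
    by (rule inj_onI) (use list_split_eq[OF len(1) len(1) i] in auto)
next
  fix a b assume a: "a \<in> S" and b: "b \<in> S"
  have l: "length (take i b) = i" "length (drop (Suc i) b) = n - Suc i" using len[OF b] i by auto
  show "\<exists>\<omega>\<in>S. \<omega> ! i = a ! i \<and> (take i \<omega>, drop (Suc i) \<omega>) = (take i b, drop (Suc i) b) \<and> () = ()"
    using l i by (intro bexI[of _ "take i b @ a ! i # drop (Suc i) b"]) (auto simp: S_def nth_append)
next
  fix \<omega> assume "\<omega> \<in> S"
  then have "\<omega> = take i \<omega> @ \<omega> ! i # drop (Suc i) \<omega>" using i len(1) by (intro id_take_nth_drop) auto
  then have "P \<omega> = P (take i \<omega>) * P (\<omega> ! i # drop (Suc i) \<omega>)" by (metis P_append)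
  then show "P \<omega> = p (\<omega> ! i) * (case (take i \<omega>, drop (Suc i) \<omega>) of (b, d) \<Rightarrow> \<lambda>_. P b * P d) ()"
    by (simp add: P_def)
qed

lemma ci_coordinate_Z:
  assumes i: "i < n"
  shows "ci S P (\<lambda>ws. zs ws ! i) (\<lambda>ws. (take i ws, drop (Suc i) ws, ys ws ! i)) (\<lambda>ws. xs ws ! i)"
proof (rule ci_rectangular[OF fin_S, where f = "\<lambda>z x. pzx x z" and g = "\<lambda>(b, d, y) x. P b * P d * pxy x y"])
  show "inj_on (\<lambda>ws. (zs ws ! i, (take i ws, drop (Suc i) ws, ys ws ! i), xs ws ! i)) S"
    by (rule inj_onI) (use list_split_eq[OF len(1) len(1) i] coords[OF _ i] in \<open>auto simp: prod_eq_iff\<close>)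
next
  fix a b assume a: "a \<in> S" and b: "b \<in> S" and eq: "xs a ! i = xs b ! i"
  have l: "length (take i b) = i" "length (drop (Suc i) b) = n - Suc i" using len[OF b] i by auto
  define \<omega> where "\<omega> = take i b @ (xs a ! i, ys b ! i, zs a ! i) # drop (Suc i) b"
  have w: "\<omega> \<in> S" using l i by (simp add: \<omega>_def S_def)
  have "\<omega> ! i = (xs a ! i, ys b ! i, zs a ! i)" "take i \<omega> = take i b" "drop (Suc i) \<omega> = drop (Suc i) b"
    using l by (simp_all add: \<omega>_def nth_append)
  then show "\<exists>\<omega>\<in>S. zs \<omega> ! i = zs a ! i \<and> (take i \<omega>, drop (Suc i) \<omega>, ys \<omega> ! i) = (take i b, drop (Suc i) b, ys b ! i) \<and>
      xs \<omega> ! i = xs a ! i"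
    using w coords[OF w i] by (intro bexI[of _ \<omega>]) auto
next
  fix \<omega> assume w: "\<omega> \<in> S"
  then have "\<omega> = take i \<omega> @ \<omega> ! i # drop (Suc i) \<omega>" using i len(1) by (intro id_take_nth_drop) auto
  then have "P \<omega> = P (take i \<omega>) * P (\<omega> ! i # drop (Suc i) \<omega>)" by (metis P_append)
  moreover have "p (\<omega> ! i) = pxy (xs \<omega> ! i) (ys \<omega> ! i) * pzx (xs \<omega> ! i) (zs \<omega> ! i)"
    unfolding p_factor[symmetric] coords[OF w i] by simp
  ultimately show "P \<omega> = pzx (xs \<omega> ! i) (zs \<omega> ! i) *
     (case (take i \<omega>, drop (Suc i) \<omega>, ys \<omega> ! i) of (b, d, y) \<Rightarrow> \<lambda>x. P b * P d * pxy x y) (xs \<omega> ! i)"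
    by (simp add: P_def[of "_ # _"]) (simp add: P_def)
qed

text \<open>\<open>t1\<close> is a function of \<open>ys\<close>, and the present and future of
  \<open>Z\<close> are functions of \<open>drop i ws\<close>; so all of them can move from the
  second variable of \<open>ci_past\<close> into its condition.\<close>

lemma past_given_present:
  assumes i: "i < n"
  shows "ci S P (\<lambda>ws. take i (zs ws)) (\<lambda>ws. drop i (xs ws)) (\<lambda>ws. (U i ws, zs ws ! i))"
proof (rule ci_sym, rule ci_derive[OF fin_S ci_sym[OF ci_past[of i]]])
  show "i \<le> n" using i by simp
  fix \<omega> \<omega>' assume w: "\<omega> \<in> S" "\<omega>' \<in> S"
  note l = list_split_eq[OF len(4)[OF w(1)] len(4)[OF w(2)] i] drop_eq[OF len(4)[OF w(1)] len(4)[OF w(2)] i]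
  { assume "(ys \<omega>, drop i \<omega>) = (ys \<omega>', drop i \<omega>')" "take i (xs \<omega>) = take i (xs \<omega>')"
    moreover from this have "drop i (zs \<omega>) = drop i (zs \<omega>')" by (simp add: takes)
    ultimately show "(U i \<omega>, zs \<omega> ! i) = (U i \<omega>', zs \<omega>' ! i)" using l by (auto simp: U_def intro: t1_det) }
  { assume "(U i \<omega>, zs \<omega> ! i) = (U i \<omega>', zs \<omega>' ! i)" then show "take i (xs \<omega>) = take i (xs \<omega>')" by (simp add: U_def) }
  { assume "(ys \<omega>, drop i \<omega>) = (ys \<omega>', drop i \<omega>')" then show "drop i (xs \<omega>) = drop i (xs \<omega>')" by (simp add: takes) }
qed

text \<open>Given \<open>U i\<close> and the present letter of \<open>Z\<close>, the message
  \<open>t2\<close> is a function of the past of \<open>Z\<close> and can therefore join the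
  condition.\<close>

lemma past_given_reply:
  assumes i: "i < n"
  shows "ci S P (\<lambda>ws. take i (zs ws)) (\<lambda>ws. drop i (xs ws)) (\<lambda>ws. (U i ws, t2 ws, zs ws ! i))"
  by (rule ci_derive[OF fin_S past_given_present[OF i]]) (auto simp: U_def intro: t2_det[OF i])

text \<open>Here \<open>ci_past\<close> is cut after the present letter, so that past and present of
  \<open>Z\<close> lie on one side; together with \<open>U i\<close> they determine
  \<open>t2\<close>. The result yields both the chain for \<open>W\<close> and the single-letter
  estimator of \<open>Z\<close>.\<close>

lemma future_given_reply:
  assumes i: "i < n"
  shows "ci S P (\<lambda>ws. zs ws ! i) (\<lambda>ws. drop (Suc i) (xs ws)) (\<lambda>ws. (U i ws, t2 ws, xs ws ! i))"
proof -
  have "ci S P (\<lambda>ws. take (Suc i) (zs ws)) (\<lambda>ws. drop (Suc i) (xs ws)) (\<lambda>ws. (U i ws, xs ws ! i))"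
  proof (rule ci_sym, rule ci_derive[OF fin_S ci_sym[OF ci_past[of "Suc i"]]])
    show "Suc i \<le> n" using i by simp
    fix \<omega> \<omega>' assume w: "\<omega> \<in> S" "\<omega>' \<in> S"
    note l = take_Suc_eq[OF len(2)[OF w(1)] len(2)[OF w(2)] i]
    { assume "(ys \<omega>, drop (Suc i) \<omega>) = (ys \<omega>', drop (Suc i) \<omega>')" "take (Suc i) (xs \<omega>) = take (Suc i) (xs \<omega>')"
      moreover from this have "drop (Suc i) (zs \<omega>) = drop (Suc i) (zs \<omega>')" by (simp add: takes)
      ultimately show "(U i \<omega>, xs \<omega> ! i) = (U i \<omega>', xs \<omega>' ! i)" using l by (auto simp: U_def intro: t1_det) }
    { assume "(U i \<omega>, xs \<omega> ! i) = (U i \<omega>', xs \<omega>' ! i)" then show "take (Suc i) (xs \<omega>) = take (Suc i) (xs \<omega>')" using l by (simp add: U_def) }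
    { assume "(ys \<omega>, drop (Suc i) \<omega>) = (ys \<omega>', drop (Suc i) \<omega>')" then show "drop (Suc i) (xs \<omega>) = drop (Suc i) (xs \<omega>')" by (simp add: takes) }
  qed
  then show ?thesis
  proof (rule ci_derive[OF fin_S])
    fix \<omega> \<omega>' assume w: "\<omega> \<in> S" "\<omega>' \<in> S"
    note l = take_Suc_eq[OF len(4)[OF w(1)] len(4)[OF w(2)] i]
    { assume "take (Suc i) (zs \<omega>) = take (Suc i) (zs \<omega>')" "(U i \<omega>, xs \<omega> ! i) = (U i \<omega>', xs \<omega>' ! i)"
      then show "(U i \<omega>, t2 \<omega>, xs \<omega> ! i) = (U i \<omega>', t2 \<omega>', xs \<omega>' ! i)"
        using l by (auto simp: U_def intro: t2_det[OF i w]) }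
    { assume "take (Suc i) (zs \<omega>) = take (Suc i) (zs \<omega>')" then show "zs \<omega> ! i = zs \<omega>' ! i" using l by simp }
  qed auto
qed

text \<open>Given the condition, \<open>t2\<close> depends on the past of \<open>Z\<close> only, and
  the past is independent of the present letter of \<open>X\<close>.\<close>

lemma markov_V:
  assumes i: "i < n"
  shows "ci S P t2 (\<lambda>ws. xs ws ! i) (\<lambda>ws. (U i ws, zs ws ! i))"
  by (rule ci_derive[OF fin_S past_given_present[OF i]])
     (auto simp: U_def drop_eq[OF len(2) len(2) i] intro: t2_det[OF i])

text \<open>Given the condition, \<open>t3\<close> depends on the future of \<open>X\<close> only,
  and this is independent of the present letter of \<open>Z\<close>.\<close>

lemma markov_W:
  assumes i: "i < n"
  shows "ci S P t3 (\<lambda>ws. zs ws ! i) (\<lambda>ws. (U i ws, t2 ws, xs ws ! i))"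
  by (rule ci_derive[OF fin_S ci_sym[OF future_given_reply[OF i]]])
     (auto simp: U_def intro: t3_det[OF i])

lemma present_given_reply:
  assumes i: "i < n"
  shows "ci S P (\<lambda>ws. xs ws ! i) (\<lambda>ws. take i (zs ws)) (\<lambda>ws. (U i ws, t2 ws, zs ws ! i))"
  by (rule ci_derive[OF fin_S ci_sym[OF past_given_reply[OF i]]])
     (auto simp: drop_eq[OF len(2) len(2) i])

text \<open>\<open>t3\<close> is a function of \<open>X\<close> from \<open>i\<close> on and of the
  condition, so it can be absorbed in turn. The decoder that estimates \<open>X\<close> knows all of
  \<open>zs\<close>; the past of \<open>Z\<close> is thereby shown to be of no use to it.\<close>

lemma present_given_messages:
  assumes i: "i < n"
  shows "ci S P (\<lambda>ws. xs ws ! i) (\<lambda>ws. take i (zs ws)) (\<lambda>ws. ((U i ws, t2 ws, zs ws ! i), t3 ws))"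
  by (rule ci_derive[OF fin_S ci_sym[OF past_given_reply[OF i]]])
     (auto simp: U_def drop_eq[OF len(2) len(2) i] intro: t3_det[OF i])

text \<open>\<open>U i\<close> depends on the present symbol only through its \<open>Y\<close>
  letter, which enters \<open>t1\<close>; the rest of \<open>U i\<close> comes from other
  coordinates, and these are independent of the present symbol.\<close>

lemma markov_U:
  assumes i: "i < n"
  shows "ci S P (U i) (\<lambda>ws. (xs ws ! i, zs ws ! i)) (\<lambda>ws. ys ws ! i)"
proof (rule ci_sym, rule ci_derive[OF fin_S])
  show "ci S P (\<lambda>ws. ws ! i) (\<lambda>ws. (take i ws, drop (Suc i) ws)) (\<lambda>_. ())" by (rule ci_coordinate[OF i])
  fix \<omega> \<omega>' assume w: "\<omega> \<in> S" "\<omega>' \<in> S"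
  { assume "(take i \<omega>, drop (Suc i) \<omega>) = (take i \<omega>', drop (Suc i) \<omega>')" "ys \<omega> ! i = ys \<omega>' ! i"
    moreover from this have "ys \<omega> = ys \<omega>'"
      using list_split_eq[OF len(3)[OF w(1)] len(3)[OF w(2)] i] by (simp add: takes)
    ultimately show "U i \<omega> = U i \<omega>'" using t1_det[of \<omega> \<omega>'] by (simp add: U_def takes) }
qed (use coords[OF _ i] in auto)

text \<open>The letter of \<open>Y\<close> is enlarged to the whole symbol, and the past symbols and
  the future of \<open>Z\<close>, which are independent of that symbol, move into the condition. Now
  all of \<open>zs\<close> is known and the known prefix of \<open>ws\<close> grows by one symbol,
  which telescopes.\<close>

lemma rate1_step:
  assumes i: "i < n"
  shows "cond_mutual_info S P (\<lambda>ws. ys ws ! i) (U i) (\<lambda>ws. zs ws ! i) \<le>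
    (ent S P (\<lambda>ws. (t1 ws, (take i ws, zs ws))) - ent S P (\<lambda>ws. (take i ws, zs ws))) -
    (ent S P (\<lambda>ws. (t1 ws, (take (Suc i) ws, zs ws))) - ent S P (\<lambda>ws. (take (Suc i) ws, zs ws)))"
proof -
  have "cond_mutual_info S P (\<lambda>ws. ys ws ! i) (U i) (\<lambda>ws. zs ws ! i)
      \<le> cond_mutual_info S P (\<lambda>ws. ws ! i) (U i) (\<lambda>ws. zs ws ! i)"
    using coords[OF _ i] by (intro cmi_mono_left) auto
  also have "\<dots> \<le> cond_mutual_info S P (\<lambda>ws. ws ! i) t1 (\<lambda>ws. ((take i ws, drop (Suc i) (zs ws)), zs ws ! i))"
  proof (rule cmi_absorb)
    show "ci S P (\<lambda>ws. ws ! i) (\<lambda>ws. (take i ws, drop (Suc i) (zs ws))) (\<lambda>ws. zs ws ! i)"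
      by (rule ci_derive[OF fin_S ci_coordinate[OF i]]) (use coords[OF _ i] in \<open>auto simp: takes\<close>)
  qed (auto simp: U_def takes)
  also have "\<dots> = (ent S P (\<lambda>ws. (t1 ws, (take i ws, zs ws))) - ent S P (\<lambda>ws. (take i ws, zs ws))) -
    (ent S P (\<lambda>ws. (t1 ws, (take (Suc i) ws, zs ws))) - ent S P (\<lambda>ws. (take (Suc i) ws, zs ws)))"
  proof (rule cmi_step)
    fix \<omega> \<omega>' assume w: "\<omega> \<in> S" "\<omega>' \<in> S"
    note l = list_split_eq[OF len(4)[OF w(2)] len(4)[OF w(1)] i] take_Suc_eq[OF len(1)[OF w(2)] len(1)[OF w(1)] i]
    have z: "take i \<omega>' = take i \<omega> \<Longrightarrow> take i (zs \<omega>') = take i (zs \<omega>)" by (simp add: takes)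
    show "(take i \<omega>', zs \<omega>') = (take i \<omega>, zs \<omega>) \<longleftrightarrow>
      ((take i \<omega>', drop (Suc i) (zs \<omega>')), zs \<omega>' ! i) = ((take i \<omega>, drop (Suc i) (zs \<omega>)), zs \<omega> ! i)"
      using l(1) z by auto
    show "(take (Suc i) \<omega>', zs \<omega>') = (take (Suc i) \<omega>, zs \<omega>) \<longleftrightarrow> \<omega>' ! i = \<omega> ! i \<and>
      ((take i \<omega>', drop (Suc i) (zs \<omega>')), zs \<omega>' ! i) = ((take i \<omega>, drop (Suc i) (zs \<omega>)), zs \<omega> ! i)"
      using l z by auto
  qed
  finally show ?thesis .
qed

text \<open>The condition is completed to \<open>t1\<close>, all of \<open>xs\<close> and the future
  of \<open>Z\<close>, which say nothing about the present letter of \<open>Z\<close> beyond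
  \<open>xs ws ! i\<close>. The known future of \<open>Z\<close> grows as \<open>i\<close>
  decreases, so the sum telescopes in the opposite direction.\<close>

lemma rate2_step:
  assumes i: "i < n"
  shows "cond_mutual_info S P (\<lambda>ws. zs ws ! i) t2 (\<lambda>ws. (U i ws, xs ws ! i)) \<le>
    (ent S P (\<lambda>ws. (t2 ws, (t1 ws, xs ws, drop (Suc i) (zs ws)))) - ent S P (\<lambda>ws. (t1 ws, xs ws, drop (Suc i) (zs ws)))) -
    (ent S P (\<lambda>ws. (t2 ws, (t1 ws, xs ws, drop i (zs ws)))) - ent S P (\<lambda>ws. (t1 ws, xs ws, drop i (zs ws))))"
proof -
  have "cond_mutual_info S P (\<lambda>ws. zs ws ! i) t2 (\<lambda>ws. (U i ws, xs ws ! i))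
      \<le> cond_mutual_info S P (\<lambda>ws. zs ws ! i) (\<lambda>ws. (t2 ws, U i ws)) (\<lambda>ws. xs ws ! i)"
    by (rule cmi_split_cond)
  also have "\<dots> \<le> cond_mutual_info S P (\<lambda>ws. zs ws ! i) t2 (\<lambda>ws. ((t1 ws, xs ws, drop (Suc i) (zs ws)), xs ws ! i))"
  proof (rule cmi_absorb)
    show "ci S P (\<lambda>ws. zs ws ! i) (\<lambda>ws. (t1 ws, xs ws, drop (Suc i) (zs ws))) (\<lambda>ws. xs ws ! i)"
    proof (rule ci_derive[OF fin_S ci_coordinate_Z[OF i]])
      fix \<omega> \<omega>' assume w: "\<omega> \<in> S" "\<omega>' \<in> S"
      assume "(take i \<omega>, drop (Suc i) \<omega>, ys \<omega> ! i) = (take i \<omega>', drop (Suc i) \<omega>', ys \<omega>' ! i)" "xs \<omega> ! i = xs \<omega>' ! i"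
      moreover from this have "ys \<omega> = ys \<omega>'" "xs \<omega> = xs \<omega>'"
        using list_split_eq[OF len(3)[OF w(1)] len(3)[OF w(2)] i] list_split_eq[OF len(2)[OF w(1)] len(2)[OF w(2)] i]
        by (simp_all add: takes)
      ultimately show "(t1 \<omega>, xs \<omega>, drop (Suc i) (zs \<omega>)) = (t1 \<omega>', xs \<omega>', drop (Suc i) (zs \<omega>'))"
        using t1_det[of \<omega> \<omega>'] by (simp add: takes)
    qed auto
  qed (auto simp: U_def)
  also have "\<dots> = (ent S P (\<lambda>ws. (t2 ws, (t1 ws, xs ws, drop (Suc i) (zs ws)))) - ent S P (\<lambda>ws. (t1 ws, xs ws, drop (Suc i) (zs ws)))) -
    (ent S P (\<lambda>ws. (t2 ws, (t1 ws, xs ws, drop i (zs ws)))) - ent S P (\<lambda>ws. (t1 ws, xs ws, drop i (zs ws))))"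
    by (rule cmi_step) (auto simp: drop_eq[OF len(4) len(4) i])
  finally show ?thesis .
qed

text \<open>By \<open>present_given_reply\<close> the past of \<open>Z\<close> may be added to the
  condition. Then all of \<open>zs\<close> is known, and \<open>t2\<close>, a function of
  \<open>zs\<close> and \<open>t1\<close>, drops out of the condition.\<close>

lemma rate3_step:
  assumes i: "i < n"
  shows "cond_mutual_info S P (\<lambda>ws. xs ws ! i) t3 (\<lambda>ws. (U i ws, t2 ws, zs ws ! i)) \<le>
    (ent S P (\<lambda>ws. (t3 ws, (take i (xs ws), t1 ws, zs ws))) - ent S P (\<lambda>ws. (take i (xs ws), t1 ws, zs ws))) -
    (ent S P (\<lambda>ws. (t3 ws, (take (Suc i) (xs ws), t1 ws, zs ws))) - ent S P (\<lambda>ws. (take (Suc i) (xs ws), t1 ws, zs ws)))"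
proof -
  have "cond_mutual_info S P (\<lambda>ws. xs ws ! i) t3 (\<lambda>ws. (U i ws, t2 ws, zs ws ! i))
     \<le> cond_mutual_info S P (\<lambda>ws. xs ws ! i) t3 (\<lambda>ws. (take i (zs ws), (U i ws, t2 ws, zs ws ! i)))"
    by (rule cmi_absorb[OF present_given_reply[OF i]]) auto
  also have "\<dots> = (ent S P (\<lambda>ws. (t3 ws, (take i (xs ws), t1 ws, zs ws))) - ent S P (\<lambda>ws. (take i (xs ws), t1 ws, zs ws))) -
    (ent S P (\<lambda>ws. (t3 ws, (take (Suc i) (xs ws), t1 ws, zs ws))) - ent S P (\<lambda>ws. (take (Suc i) (xs ws), t1 ws, zs ws)))"
  proof (rule cmi_step)
    fix \<omega> \<omega>' assume w: "\<omega> \<in> S" "\<omega>' \<in> S"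
    note l = list_split_eq[OF len(4)[OF w(2)] len(4)[OF w(1)] i] take_Suc_eq[OF len(2)[OF w(2)] len(2)[OF w(1)] i]
    have t: "zs \<omega>' = zs \<omega> \<Longrightarrow> t1 \<omega>' = t1 \<omega> \<Longrightarrow> t2 \<omega>' = t2 \<omega>" by (simp add: t2_def)
    show "(take i (xs \<omega>'), t1 \<omega>', zs \<omega>') = (take i (xs \<omega>), t1 \<omega>, zs \<omega>) \<longleftrightarrow>
      (take i (zs \<omega>'), U i \<omega>', t2 \<omega>', zs \<omega>' ! i) = (take i (zs \<omega>), U i \<omega>, t2 \<omega>, zs \<omega> ! i)"
      using l(1) t by (auto simp: U_def)
    show "(take (Suc i) (xs \<omega>'), t1 \<omega>', zs \<omega>') = (take (Suc i) (xs \<omega>), t1 \<omega>, zs \<omega>) \<longleftrightarrow> xs \<omega>' ! i = xs \<omega> ! i \<and>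
      (take i (zs \<omega>'), U i \<omega>', t2 \<omega>', zs \<omega>' ! i) = (take i (zs \<omega>), U i \<omega>, t2 \<omega>, zs \<omega> ! i)"
      using l t by (auto simp: U_def)
  qed
  finally show ?thesis .
qed

lemma rate1_sum: "(\<Sum>i<n. cond_mutual_info S P (\<lambda>ws. ys ws ! i) (U i) (\<lambda>ws. zs ws ! i)) \<le> log 2 M1"
proof -
  define G where "G i = ent S P (\<lambda>ws. (t1 ws, (take i ws, zs ws))) - ent S P (\<lambda>ws. (take i ws, zs ws))" for i
  have "(\<Sum>i<n. cond_mutual_info S P (\<lambda>ws. ys ws ! i) (U i) (\<lambda>ws. zs ws ! i)) \<le> (\<Sum>i<n. G i - G (Suc i))"
    unfolding G_def by (intro sum_mono rate1_step) auto
  also have "\<dots> = G 0 - G n" by (rule sum_lessThan_telescope')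
  also have "\<dots> \<le> log 2 M1" unfolding G_def
    by (rule telescoped_information) (auto simp: t1_def f1 P_sum)
  finally show ?thesis .
qed

lemma rate2_sum: "(\<Sum>i<n. cond_mutual_info S P (\<lambda>ws. zs ws ! i) t2 (\<lambda>ws. (U i ws, xs ws ! i))) \<le> log 2 M2"
proof -
  define G where "G i = ent S P (\<lambda>ws. (t2 ws, (t1 ws, xs ws, drop i (zs ws)))) - ent S P (\<lambda>ws. (t1 ws, xs ws, drop i (zs ws)))" for i
  have "(\<Sum>i<n. cond_mutual_info S P (\<lambda>ws. zs ws ! i) t2 (\<lambda>ws. (U i ws, xs ws ! i))) \<le> (\<Sum>i<n. G (Suc i) - G i)"
    unfolding G_def by (intro sum_mono rate2_step) auto
  also have "\<dots> = G n - G 0" by (rule sum_lessThan_telescope)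
  also have "\<dots> \<le> log 2 M2" unfolding G_def
    by (rule telescoped_information) (auto simp: t2_def f2 P_sum)
  finally show ?thesis .
qed

lemma rate3_sum: "(\<Sum>i<n. cond_mutual_info S P (\<lambda>ws. xs ws ! i) t3 (\<lambda>ws. (U i ws, t2 ws, zs ws ! i))) \<le> log 2 M3"
proof -
  define G where "G i = ent S P (\<lambda>ws. (t3 ws, (take i (xs ws), t1 ws, zs ws))) - ent S P (\<lambda>ws. (take i (xs ws), t1 ws, zs ws))" for i
  have "(\<Sum>i<n. cond_mutual_info S P (\<lambda>ws. xs ws ! i) t3 (\<lambda>ws. (U i ws, t2 ws, zs ws ! i))) \<le> (\<Sum>i<n. G i - G (Suc i))"
    unfolding G_def by (intro sum_mono rate3_step) auto
  also have "\<dots> = G 0 - G n" by (rule sum_lessThan_telescope')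
  also have "\<dots> \<le> log 2 M3" unfolding G_def
    by (rule telescoped_information) (auto simp: t3_def f3 P_sum)
  finally show ?thesis .
qed

end

section \<open>Time sharing over the coordinates\<close>

context source_code
begin

definition T :: "(('x \<times> 'y \<times> 'z) list \<times> nat) set" where "T = S \<times> {..<n}"
definition Q :: "('x \<times> 'y \<times> 'z) list \<times> nat \<Rightarrow> real" where "Q = (\<lambda>(ws, i). P ws / real n)"

lemma fin_T: "finite T" by (simp add: T_def fin_S)

lemma Q_nonneg: "0 \<le> Q \<omega>" by (cases \<omega>) (simp add: Q_def P_nonneg)

lemma sum_T: "(\<Sum>\<omega>\<in>T. Q \<omega> * F \<omega>) = (\<Sum>i<n. \<Sum>ws\<in>S. P ws * F (ws, i)) / real n"
proof -
  have "(\<Sum>\<omega>\<in>T. Q \<omega> * F \<omega>) = (\<Sum>ws\<in>S. \<Sum>i<n. P ws * F (ws, i) / real n)"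
    by (simp add: T_def sum_pair Q_def)
  also have "\<dots> = (\<Sum>i<n. \<Sum>ws\<in>S. P ws * F (ws, i) / real n)" by (rule sum.swap)
  finally show ?thesis by (simp add: sum_divide_distrib)
qed

lemma pr_T_sum: "pr T Q F a = (\<Sum>i<n. pr S P (\<lambda>ws. F (ws, i)) a) / real n"
proof -
  have "pr T Q F a = (\<Sum>\<omega>\<in>T. Q \<omega> * (if F \<omega> = a then 1 else 0))"
    unfolding pr_def by (intro sum.cong) auto
  also have "\<dots> = (\<Sum>i<n. pr S P (\<lambda>ws. F (ws, i)) a) / real n"
    unfolding sum_T pr_def by (intro arg_cong2[where f = "(/)"] sum.cong refl) auto
  finally show ?thesis .
qed

text \<open>A value that reveals the index lives on a single slice, which carries the factor
  \<open>1 / real n\<close>.\<close>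

lemma pr_T_index:
  assumes i: "i < n" and eq: "\<And>ws j. ws \<in> S \<Longrightarrow> j < n \<Longrightarrow> F (ws, j) = a \<longleftrightarrow> j = i \<and> G ws = b"
  shows "pr T Q F a = pr S P G b / real n"
proof -
  have "(\<Sum>j<n. pr S P (\<lambda>ws. F (ws, j)) a) = (\<Sum>j<n. if j = i then pr S P G b else 0)"
  proof (intro sum.cong refl)
    fix j assume "j \<in> {..<n}"
    then show "pr S P (\<lambda>ws. F (ws, j)) a = (if j = i then pr S P G b else 0)"
      using eq by (auto simp: pr_def intro!: sum.cong sum.neutral)
  qed
  also have "\<dots> = pr S P G b" using i by simp
  finally show ?thesis unfolding pr_T_sum by simp
qed

lemma prob_eq_T_index:
  assumes "i < n" and "\<And>ws' j. ws' \<in> S \<Longrightarrow> j < n \<Longrightarrow> F (ws', j) = F (ws, i) \<longleftrightarrow> j = i \<and> G ws' = G ws"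
  shows "prob_eq T Q F (ws, i) = prob_eq S P G ws / real n"
  unfolding prob_eq_pr using assms by (rule pr_T_index)

text \<open>With the index in the condition, the factors of different slices can be chosen
  independently of each other; the weight of the slice goes into the first factor.\<close>

lemma ci_T:
  assumes ci: "\<And>i. i < n \<Longrightarrow> ci S P (A i) (B i) (C i)"
  shows "ci T Q (\<lambda>(ws, i). A i ws) (\<lambda>(ws, i). B i ws) (\<lambda>(ws, i). (i, C i ws))"
proof -
  have "\<forall>i. \<exists>fg. i < n \<longrightarrow> (\<forall>a b c. pr S P (\<lambda>ws. (A i ws, B i ws, C i ws)) (a, b, c) = fst fg a c * snd fg b c)"
  proof
    fix i
    show "\<exists>fg. i < n \<longrightarrow> (\<forall>a b c. pr S P (\<lambda>ws. (A i ws, B i ws, C i ws)) (a, b, c) = fst fg a c * snd fg b c)"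
    proof (cases "i < n")
      case True
      then obtain f g where "\<forall>a b c. pr S P (\<lambda>ws. (A i ws, B i ws, C i ws)) (a, b, c) = f a c * g b c"
        using ci unfolding ci_def by blast
      then show ?thesis by (intro exI[of _ "(f, g)"]) simp
    qed simp
  qed
  from choice[OF this] obtain fg where fg: "\<forall>i. i < n \<longrightarrow>
    (\<forall>a b c. pr S P (\<lambda>ws. (A i ws, B i ws, C i ws)) (a, b, c) = fst (fg i) a c * snd (fg i) b c)" ..
  have "pr T Q (\<lambda>\<omega>. (case \<omega> of (ws, i) \<Rightarrow> A i ws, case \<omega> of (ws, i) \<Rightarrow> B i ws, case \<omega> of (ws, i) \<Rightarrow> (i, C i ws))) (a, b, c)
     = (if fst c < n then fst (fg (fst c)) a (snd c) / real n else 0) * snd (fg (fst c)) b (snd c)" for a b c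
  proof (cases "fst c < n")
    case True
    then show ?thesis
      by (subst pr_T_index[OF True, where G = "\<lambda>ws. (A (fst c) ws, B (fst c) ws, C (fst c) ws)" and b = "(a, b, snd c)"])
         (use fg in \<open>auto simp: prod_eq_iff\<close>)
  next
    case False
    then have "(a, b, c) \<notin> (\<lambda>\<omega>. (case \<omega> of (ws, i) \<Rightarrow> A i ws, case \<omega> of (ws, i) \<Rightarrow> B i ws, case \<omega> of (ws, i) \<Rightarrow> (i, C i ws))) ` T"
      by (auto simp: T_def)
    then show ?thesis using False by (simp add: pr_outside)
  qed
  then show ?thesis unfolding ci_def
    by (intro exI[of _ "\<lambda>a c. if fst c < n then fst (fg (fst c)) a (snd c) / real n else 0"]
        exI[of _ "\<lambda>b c. snd (fg (fst c)) b (snd c)"]) simp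
qed

lemma cmi_T:
  assumes "\<And>ws i. ws \<in> S \<Longrightarrow> i < n \<Longrightarrow> idens T Q A' B' C' (ws, i) = idens S P (A i) (B i) (C i) ws"
  shows "cond_mutual_info T Q A' B' C' = (\<Sum>i<n. cond_mutual_info S P (A i) (B i) (C i)) / real n"
  unfolding cmi_idens sum_T using assms by (intro arg_cong2[where f = "(/)"] sum.cong refl) auto

lemma letter_law:
  assumes "i < n"
  shows "pr S P (\<lambda>ws. (xs ws ! i, ys ws ! i, zs ws ! i)) t = p t"
proof -
  have "pr S P (\<lambda>ws. (xs ws ! i, ys ws ! i, zs ws ! i)) t = pr S P (\<lambda>ws. ws ! i) t"
    unfolding pr_def using coords[OF _ assms] by (intro sum.cong refl) auto
  then show ?thesis using pr_iid_coordinate[OF p_sum assms, of t] by (simp add: S_def P_def[abs_def])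
qed

lemma letter_marginal:
  assumes "i < n"
  shows "pr S P (\<lambda>ws. h (xs ws ! i, ys ws ! i, zs ws ! i)) b = pr UNIV p h b"
  using law_marginal[OF fin_S finite[of UNIV], of P "\<lambda>ws. (xs ws ! i, ys ws ! i, zs ws ! i)" p "\<lambda>t. t" h b]
    letter_law[OF assms] by (simp add: pr_def)

lemma letter_marginal_T:
  "pr T Q (\<lambda>(ws, i). h (xs ws ! i, ys ws ! i, zs ws ! i)) b = pr UNIV p h b"
  using n by (simp add: pr_T_sum letter_marginal)

lemma dist_T:
  fixes d :: "'c \<Rightarrow> 'd \<Rightarrow> real"
  assumes le: "\<And>i. i < n \<Longrightarrow> (\<Sum>ws\<in>S. P ws * d (A (ws, i)) (e (ws, i))) \<le> (\<Sum>ws\<in>S. P ws * d (A (ws, i)) (g ws i))"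
    and D: "(\<Sum>ws\<in>S. P ws * ((1 / real n) * (\<Sum>i<n. d (A (ws, i)) (g ws i)))) \<le> D"
  shows "(\<Sum>\<omega>\<in>T. Q \<omega> * d (A \<omega>) (e \<omega>)) \<le> D"
proof -
  have "(\<Sum>\<omega>\<in>T. Q \<omega> * d (A \<omega>) (e \<omega>)) \<le> (\<Sum>i<n. \<Sum>ws\<in>S. P ws * d (A (ws, i)) (g ws i)) / real n"
    unfolding sum_T by (rule divide_right_mono, rule sum_mono) (use le in auto)
  also have "\<dots> = (\<Sum>ws\<in>S. \<Sum>i<n. P ws * d (A (ws, i)) (g ws i)) / real n" by (subst sum.swap) simp
  also have "\<dots> = (\<Sum>ws\<in>S. P ws * ((1 / real n) * (\<Sum>i<n. d (A (ws, i)) (g ws i))))"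
    by (simp add: sum_divide_distrib sum_distrib_left)
  finally show ?thesis using D by simp
qed

lemma converse:
  fixes dx :: "'x \<Rightarrow> 'xh::finite \<Rightarrow> real" and dz :: "'z \<Rightarrow> 'zh::finite \<Rightarrow> real"
    and g2 :: "'x list \<Rightarrow> nat \<Rightarrow> nat \<Rightarrow> nat \<Rightarrow> 'zh" and g3 :: "'z list \<Rightarrow> nat \<Rightarrow> nat \<Rightarrow> nat \<Rightarrow> 'xh"
  assumes M: "real M1 \<le> 2 powr (real n * R1)" "real M2 \<le> 2 powr (real n * R2)" "real M3 \<le> 2 powr (real n * R3)"
    and Dx: "(\<Sum>ws\<in>S. P ws * ((1 / real n) * (\<Sum>i<n. dx (xs ws ! i) (g3 (zs ws) (t1 ws) (t3 ws) i)))) \<le> Dx"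
    and Dz: "(\<Sum>ws\<in>S. P ws * ((1 / real n) * (\<Sum>i<n. dz (zs ws ! i) (g2 (xs ws) (t1 ws) (t2 ws) i)))) \<le> Dz"
  shows "\<exists>qU qV qW xhat zhat. feasible p dx dz Dx Dz (R1, R2, R3) (alphabet_bound p) qU qV qW xhat zhat"
proof -
  define X where "X = (\<lambda>(ws, i). xs ws ! i)"
  define Y where "Y = (\<lambda>(ws, i). ys ws ! i)"
  define Z where "Z = (\<lambda>(ws, i). zs ws ! i)"
  define U' where "U' = (\<lambda>(ws, i). (i, U i ws))"
  define V where "V = (\<lambda>(ws, i::nat). t2 ws)"
  define W where "W = (\<lambda>(ws, i::nat). t3 ws)"
  note defs = X_def Y_def Z_def U'_def V_def W_def

  \<comment> \<open>The decoder for \<open>Z\<close> knows all of \<open>xs\<close>: the past is in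
    \<open>U i\<close>, the present letter is kept, and the future is independent of the present
    letter of \<open>Z\<close> by \<open>future_given_reply\<close>.\<close>
  have "\<forall>i. \<exists>h. i < n \<longrightarrow> (\<Sum>ws\<in>S. P ws * dz (zs ws ! i) (h (U i ws, t2 ws, xs ws ! i)))
      \<le> (\<Sum>ws\<in>S. P ws * dz (zs ws ! i) (g2 (xs ws) (t1 ws) (t2 ws) i))"
  proof
    fix i
    show "\<exists>h. i < n \<longrightarrow> (\<Sum>ws\<in>S. P ws * dz (zs ws ! i) (h (U i ws, t2 ws, xs ws ! i)))
      \<le> (\<Sum>ws\<in>S. P ws * dz (zs ws ! i) (g2 (xs ws) (t1 ws) (t2 ws) i))"
    proof (cases "i < n")
      case True
      have "\<exists>h. (\<Sum>ws\<in>S. P ws * dz (zs ws ! i) (h (U i ws, t2 ws, xs ws ! i)))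
        \<le> (\<Sum>ws\<in>S. P ws * dz (zs ws ! i) (g2 (xs ws) (t1 ws) (t2 ws) i))"
      proof (rule ci_estimator[OF future_given_reply[OF True]])
        fix \<omega> \<omega>' assume w: "\<omega> \<in> S" "\<omega>' \<in> S" and "drop (Suc i) (xs \<omega>) = drop (Suc i) (xs \<omega>')"
          "(U i \<omega>, t2 \<omega>, xs \<omega> ! i) = (U i \<omega>', t2 \<omega>', xs \<omega>' ! i)"
        then show "g2 (xs \<omega>) (t1 \<omega>) (t2 \<omega>) i = g2 (xs \<omega>') (t1 \<omega>') (t2 \<omega>') i"
          using list_split_eq[OF len(2)[OF w(1)] len(2)[OF w(2)] True] by (simp add: U_def)
      qed
      then show ?thesis by blast
    qed simp
  qed
  from choice[OF this] obtain hz where hz: "\<forall>i. i < n \<longrightarrow> (\<Sum>ws\<in>S. P ws * dz (zs ws ! i) (hz i (U i ws, t2 ws, xs ws ! i)))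
      \<le> (\<Sum>ws\<in>S. P ws * dz (zs ws ! i) (g2 (xs ws) (t1 ws) (t2 ws) i))" ..
  \<comment> \<open>Of the data of the decoder for \<open>X\<close>, only the past of
    \<open>Z\<close> lies outside \<open>U i\<close>, \<open>t3\<close> and the present letter. The
    estimator obtained uses \<open>t2\<close> as well, which \<open>rv_system\<close>
    permits.\<close>
  have "\<forall>i. \<exists>h. i < n \<longrightarrow> (\<Sum>ws\<in>S. P ws * dx (xs ws ! i) (h ((U i ws, t2 ws, zs ws ! i), t3 ws)))
      \<le> (\<Sum>ws\<in>S. P ws * dx (xs ws ! i) (g3 (zs ws) (t1 ws) (t3 ws) i))"
  proof
    fix i
    show "\<exists>h. i < n \<longrightarrow> (\<Sum>ws\<in>S. P ws * dx (xs ws ! i) (h ((U i ws, t2 ws, zs ws ! i), t3 ws)))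
      \<le> (\<Sum>ws\<in>S. P ws * dx (xs ws ! i) (g3 (zs ws) (t1 ws) (t3 ws) i))"
    proof (cases "i < n")
      case True
      have "\<exists>h. (\<Sum>ws\<in>S. P ws * dx (xs ws ! i) (h ((U i ws, t2 ws, zs ws ! i), t3 ws)))
        \<le> (\<Sum>ws\<in>S. P ws * dx (xs ws ! i) (g3 (zs ws) (t1 ws) (t3 ws) i))"
      proof (rule ci_estimator[OF present_given_messages[OF True]])
        fix \<omega> \<omega>' assume w: "\<omega> \<in> S" "\<omega>' \<in> S" and "take i (zs \<omega>) = take i (zs \<omega>')"
          "((U i \<omega>, t2 \<omega>, zs \<omega> ! i), t3 \<omega>) = ((U i \<omega>', t2 \<omega>', zs \<omega>' ! i), t3 \<omega>')"
        then show "g3 (zs \<omega>) (t1 \<omega>) (t3 \<omega>) i = g3 (zs \<omega>') (t1 \<omega>') (t3 \<omega>') i"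
          using list_split_eq[OF len(4)[OF w(1)] len(4)[OF w(2)] True] by (simp add: U_def)
      qed
      then show ?thesis by blast
    qed simp
  qed
  from choice[OF this] obtain hx where hx: "\<forall>i. i < n \<longrightarrow> (\<Sum>ws\<in>S. P ws * dx (xs ws ! i) (hx i ((U i ws, t2 ws, zs ws ! i), t3 ws)))
      \<le> (\<Sum>ws\<in>S. P ws * dx (xs ws ! i) (g3 (zs ws) (t1 ws) (t3 ws) i))" ..
  define xh where "xh = (\<lambda>(ws, i). hx i ((U i ws, t2 ws, zs ws ! i), t3 ws))"
  define zh where "zh = (\<lambda>(ws, i). hz i (U i ws, t2 ws, xs ws ! i))"

  have law: "pr T Q (X \<bowtie> Y \<bowtie> Z) t = p t" for t
    unfolding pr_T_sum defs using letter_law n by simp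
  \<comment> \<open>\<open>ci_T\<close> does not apply, because the index belongs to
    \<open>U'\<close> and not to the condition \<open>Y\<close>. The chain still holds since the law
    of \<open>(X, Z)\<close> given \<open>Y\<close> is the same in every slice.\<close>
  have ciU: "ci T Q U' (X \<bowtie> Z) Y"
  proof -
    let ?py = "\<lambda>y. pr UNIV p (\<lambda>(x, y, z). y) y"
    have py: "pr S P (\<lambda>ws. ys ws ! i) y = ?py y" if "i < n" for i y
      using letter_marginal[OF that, of "\<lambda>(x, y, z). y" y] by simp
    have "pr T Q (U' \<bowtie> (X \<bowtie> Z) \<bowtie> Y) (iu, xz, y) =
      (if fst iu < n then pr S P (\<lambda>ws. (U (fst iu) ws, ys ws ! (fst iu))) (snd iu, y) / real n else 0) *
      (p (fst xz, y, snd xz) / ?py y)" for iu xz y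
    proof (cases "fst iu < n")
      case True
      let ?i = "fst iu"
      have xzy: "pr S P (\<lambda>ws. ((xs ws ! ?i, zs ws ! ?i), ys ws ! ?i)) (xz, y) = p (fst xz, y, snd xz)"
        by (rule trans[OF pr_cong_events letter_law[OF True]]) (auto simp: prod_eq_iff)
      have "pr T Q (U' \<bowtie> (X \<bowtie> Z) \<bowtie> Y) (iu, xz, y) =
        pr S P (\<lambda>ws. (U ?i ws, (xs ws ! ?i, zs ws ! ?i), ys ws ! ?i)) (snd iu, xz, y) / real n"
        by (rule pr_T_index[OF True]) (auto simp: defs prod_eq_iff)
      moreover have "pr S P (\<lambda>ws. (U ?i ws, (xs ws ! ?i, zs ws ! ?i), ys ws ! ?i)) (snd iu, xz, y) =
        pr S P (\<lambda>ws. (U ?i ws, ys ws ! ?i)) (snd iu, y) * (p (fst xz, y, snd xz) / ?py y)"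
      proof (cases "?py y = 0")
        case False
        then show ?thesis using ci_prod[OF fin_S markov_U[OF True], of "snd iu" xz y] py[OF True, of y]
          by (simp add: xzy field_simps)
      next
        case True0: True
        have "pr S P (\<lambda>ws. (U ?i ws, (xs ws ! ?i, zs ws ! ?i), ys ws ! ?i)) (snd iu, xz, y) \<le> pr S P (\<lambda>ws. ys ws ! ?i) y"
          by (rule pr_mono) auto
        then show ?thesis using True0 py[OF True, of y]
            pr_nonneg[of "\<lambda>ws. (U ?i ws, (xs ws ! ?i, zs ws ! ?i), ys ws ! ?i)" "(snd iu, xz, y)"] by simp
      qed
      ultimately show ?thesis using True by simp
    next
      case False
      then have "(iu, xz, y) \<notin> (U' \<bowtie> (X \<bowtie> Z) \<bowtie> Y) ` T" by (auto simp: T_def defs)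
      then show ?thesis using False by (simp add: pr_outside)
    qed
    then show ?thesis unfolding ci_def
      by (intro exI[of _ "\<lambda>iu y. if fst iu < n then pr S P (\<lambda>ws. (U (fst iu) ws, ys ws ! (fst iu))) (snd iu, y) / real n else 0"]
        exI[of _ "\<lambda>xz y. p (fst xz, y, snd xz) / ?py y"]) simp
  qed
  have ciV: "ci T Q V X (U' \<bowtie> Z)"
    by (rule ci_derive[OF fin_T ci_T[OF markov_V]]) (auto simp: defs)
  have ciW: "ci T Q W Z (U' \<bowtie> V \<bowtie> X)"
    by (rule ci_derive[OF fin_T ci_T[OF markov_W]]) (auto simp: defs)

  have n0: "real n \<noteq> 0" using n by simp
  have rates: "log 2 (real M) / real n \<le> R" if "real M \<le> 2 powr (real n * R)" "0 < M" for M R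
  proof -
    have "log 2 (real M) \<le> log 2 (2 powr (real n * R))" using that by (subst log_le_cancel_iff) auto
    then show ?thesis using n by (simp add: field_simps)
  qed
  \<comment> \<open>An encoder has a value, so no message set is empty and the logarithms of the
    sizes can be compared.\<close>
  have M0: "0 < M1" "0 < M2" "0 < M3"
    using f1 f2 f3 by (metis gr_implies_not0 not_gr_zero)+
  have r1: "cond_mutual_info T Q Y U' Z \<le> R1"
  proof -
    have "cond_mutual_info T Q Y U' Z = (\<Sum>i<n. cond_mutual_info S P (\<lambda>ws. ys ws ! i) (U i) (\<lambda>ws. zs ws ! i)) / real n"
    proof (rule cmi_T)
      fix ws i assume w: "ws \<in> S" "i < n"
      have 1: "prob_eq T Q (Y \<bowtie> U' \<bowtie> Z) (ws, i) = prob_eq S P (\<lambda>ws. (ys ws ! i, U i ws, zs ws ! i)) ws / real n"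
        by (rule prob_eq_T_index) (use w in \<open>auto simp: defs\<close>)
      have 2: "prob_eq T Q (U' \<bowtie> Z) (ws, i) = prob_eq S P (\<lambda>ws. (U i ws, zs ws ! i)) ws / real n"
        by (rule prob_eq_T_index) (use w in \<open>auto simp: defs\<close>)
      \<comment> \<open>Events without \<open>U'\<close> do not reveal the index, and letters have
        the same law in all slices, so no factor \<open>1 / real n\<close> appears. The two events
        with \<open>U'\<close> have it, one above and one below in the density.\<close>
      have 3: "prob_eq T Q Z (ws, i) = prob_eq S P (\<lambda>ws. zs ws ! i) ws"
        using letter_marginal_T[of "\<lambda>(x, y, z). z" "zs ws ! i"] letter_marginal[OF w(2), of "\<lambda>(x, y, z). z" "zs ws ! i"]
        by (simp add: prob_eq_pr defs)
      have 4: "prob_eq T Q (Y \<bowtie> Z) (ws, i) = prob_eq S P (\<lambda>ws. (ys ws ! i, zs ws ! i)) ws"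
        using letter_marginal_T[of "\<lambda>(x, y, z). (y, z)" "(ys ws ! i, zs ws ! i)"]
          letter_marginal[OF w(2), of "\<lambda>(x, y, z). (y, z)" "(ys ws ! i, zs ws ! i)"]
        by (simp add: prob_eq_pr defs case_prod_unfold)
      show "idens T Q Y U' Z (ws, i) = idens S P (\<lambda>ws. ys ws ! i) (U i) (\<lambda>ws. zs ws ! i) ws"
        unfolding idens_def 1 2 3 4 using n0 by (simp add: field_simps)
    qed
    also have "\<dots> \<le> log 2 M1 / real n" using rate1_sum by (intro divide_right_mono) auto
    also have "\<dots> \<le> R1" by (rule rates[OF M(1) M0(1)])
    finally show ?thesis .
  qed
  have r2: "cond_mutual_info T Q Z V (U' \<bowtie> X) \<le> R2"
  proof -
    have "cond_mutual_info T Q Z V (U' \<bowtie> X) =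
      (\<Sum>i<n. cond_mutual_info S P (\<lambda>ws. zs ws ! i) t2 (\<lambda>ws. (U i ws, xs ws ! i))) / real n"
    proof (rule cmi_T)
      fix ws i assume w: "ws \<in> S" "i < n"
      have 1: "prob_eq T Q (Z \<bowtie> V \<bowtie> U' \<bowtie> X) (ws, i) = prob_eq S P (\<lambda>ws. (zs ws ! i, t2 ws, U i ws, xs ws ! i)) ws / real n"
       and 2: "prob_eq T Q (U' \<bowtie> X) (ws, i) = prob_eq S P (\<lambda>ws. (U i ws, xs ws ! i)) ws / real n"
       and 3: "prob_eq T Q (Z \<bowtie> U' \<bowtie> X) (ws, i) = prob_eq S P (\<lambda>ws. (zs ws ! i, U i ws, xs ws ! i)) ws / real n"
       and 4: "prob_eq T Q (V \<bowtie> U' \<bowtie> X) (ws, i) = prob_eq S P (\<lambda>ws. (t2 ws, U i ws, xs ws ! i)) ws / real n"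
        by (rule prob_eq_T_index; use w in \<open>auto simp: defs\<close>)+
      show "idens T Q Z V (U' \<bowtie> X) (ws, i) = idens S P (\<lambda>ws. zs ws ! i) t2 (\<lambda>ws. (U i ws, xs ws ! i)) ws"
        unfolding idens_def 1 2 3 4 using n0 by (simp add: field_simps)
    qed
    also have "\<dots> \<le> log 2 M2 / real n" using rate2_sum by (intro divide_right_mono) auto
    also have "\<dots> \<le> R2" by (rule rates[OF M(2) M0(2)])
    finally show ?thesis .
  qed
  have r3: "cond_mutual_info T Q X W (U' \<bowtie> V \<bowtie> Z) \<le> R3"
  proof -
    have "cond_mutual_info T Q X W (U' \<bowtie> V \<bowtie> Z) =
      (\<Sum>i<n. cond_mutual_info S P (\<lambda>ws. xs ws ! i) t3 (\<lambda>ws. (U i ws, t2 ws, zs ws ! i))) / real n"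
    proof (rule cmi_T)
      fix ws i assume w: "ws \<in> S" "i < n"
      have 1: "prob_eq T Q (X \<bowtie> W \<bowtie> U' \<bowtie> V \<bowtie> Z) (ws, i) = prob_eq S P (\<lambda>ws. (xs ws ! i, t3 ws, U i ws, t2 ws, zs ws ! i)) ws / real n"
       and 2: "prob_eq T Q (U' \<bowtie> V \<bowtie> Z) (ws, i) = prob_eq S P (\<lambda>ws. (U i ws, t2 ws, zs ws ! i)) ws / real n"
       and 3: "prob_eq T Q (X \<bowtie> U' \<bowtie> V \<bowtie> Z) (ws, i) = prob_eq S P (\<lambda>ws. (xs ws ! i, U i ws, t2 ws, zs ws ! i)) ws / real n"
       and 4: "prob_eq T Q (W \<bowtie> U' \<bowtie> V \<bowtie> Z) (ws, i) = prob_eq S P (\<lambda>ws. (t3 ws, U i ws, t2 ws, zs ws ! i)) ws / real n"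
        by (rule prob_eq_T_index; use w in \<open>auto simp: defs\<close>)+
      show "idens T Q X W (U' \<bowtie> V \<bowtie> Z) (ws, i) = idens S P (\<lambda>ws. xs ws ! i) t3 (\<lambda>ws. (U i ws, t2 ws, zs ws ! i)) ws"
        unfolding idens_def 1 2 3 4 using n0 by (simp add: field_simps)
    qed
    also have "\<dots> \<le> log 2 M3 / real n" using rate3_sum by (intro divide_right_mono) auto
    also have "\<dots> \<le> R3" by (rule rates[OF M(3) M0(3)])
    finally show ?thesis .
  qed

  have ddx: "(\<Sum>\<omega>\<in>T. Q \<omega> * dx (X \<omega>) (xh \<omega>)) \<le> Dx"
    by (rule dist_T[where g = "\<lambda>ws i. g3 (zs ws) (t1 ws) (t3 ws) i"]) (use hx Dx in \<open>auto simp: xh_def X_def\<close>)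
  have ddz: "(\<Sum>\<omega>\<in>T. Q \<omega> * dz (Z \<omega>) (zh \<omega>)) \<le> Dz"
    by (rule dist_T[where g = "\<lambda>ws i. g2 (xs ws) (t1 ws) (t2 ws) i"]) (use hz Dz in \<open>auto simp: zh_def Z_def\<close>)

  \<comment> \<open>Points of probability zero are dropped, since \<open>rv_system\<close> demands
    positive weights.\<close>
  define T' where "T' = {\<omega>\<in>T. Q \<omega> \<noteq> 0}"
  have finT': "finite T'" using fin_T by (simp add: T'_def)
  note supp = pr_support[OF fin_T, of Q, folded T'_def]
  note ssupp = sum_support[OF fin_T, of Q, folded T'_def]
  have "rv_system p dx dz Dx Dz R1 R2 R3 T' Q X Y Z U' V W xh zh"
  proof
    show "0 < Q \<omega>" if "\<omega> \<in> T'" for \<omega> using that Q_nonneg[of \<omega>] by (auto simp: T'_def)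
    show "ci T' Q U' (X \<bowtie> Z) Y" using ciU ci_law[OF supp] by blast
    show "ci T' Q V X (U' \<bowtie> Z)" using ciV ci_law[OF supp] by blast
    show "ci T' Q W Z (U' \<bowtie> V \<bowtie> X)" using ciW ci_law[OF supp] by blast
    show "cond_mutual_info T' Q Y U' Z \<le> R1" unfolding cmi_law[OF finT' fin_T supp] by (rule r1)
    show "cond_mutual_info T' Q Z V (U' \<bowtie> X) \<le> R2" unfolding cmi_law[OF finT' fin_T supp] by (rule r2)
    show "cond_mutual_info T' Q X W (U' \<bowtie> V \<bowtie> Z) \<le> R3" unfolding cmi_law[OF finT' fin_T supp] by (rule r3)
    show "(\<Sum>\<omega>\<in>T'. Q \<omega> * dx (X \<omega>) (xh \<omega>)) \<le> Dx" unfolding ssupp by (rule ddx)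
    show "(\<Sum>\<omega>\<in>T'. Q \<omega> * dz (Z \<omega>) (zh \<omega>)) \<le> Dz" unfolding ssupp by (rule ddz)
    show "pr T' Q (X \<bowtie> Y \<bowtie> Z) t = p t" for t unfolding supp by (rule law)
  qed (auto simp: finT' defs xh_def zh_def)
  then show ?thesis by (rule rv_system.bounded_alphabet)
qed

end

section \<open>One-shot codes by rejection sampling\<close>

text \<open>The summands are the probabilities that independent trials first succeed at
  \<open>i\<close>; the remaining product is the probability of no success at all.\<close>

lemma first_success_sum:
  fixes x :: "nat \<Rightarrow> real"
  shows "(\<Sum>i<L. x i * (\<Prod>k<i. 1 - x k)) + (\<Prod>k<L. 1 - x k) = 1"
  by (induction L) (auto simp: algebra_simps)

text \<open>Codewords are drawn independently from \<open>Q\<close> and put into uniformly random bins. The encoder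
  runs rejection sampling on the codebook, accepting \<open>u\<close> with probability \<open>q a u / (c * Q u)\<close>; up to the
  event that nothing is accepted, it thereby outputs \<open>u\<close> with law \<open>q a\<close>. The index accepted when
  codeword \<open>j\<close> is ignored is independent of codeword \<open>j\<close>, which bounds the collisions.\<close>
locale random_code =
  fixes B :: "'u set" and Q :: "'u \<Rightarrow> real" and q :: "'a \<Rightarrow> 'u \<Rightarrow> real" and c :: real and L M :: nat
  assumes finB: "finite B" and Q0: "\<And>u. u \<in> B \<Longrightarrow> 0 \<le> Q u" and Q1: "(\<Sum>u\<in>B. Q u) = 1"
    and q0: "\<And>a u. u \<in> B \<Longrightarrow> 0 \<le> q a u" and q1: "\<And>a. (\<Sum>u\<in>B. q a u) = 1"
    and c: "0 < c" and L: "0 < L" and M: "0 < M"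
begin

text \<open>Words whose likelihood ratio exceeds \<open>c\<close> are never accepted, which keeps
  the acceptance probability at most one. Such words will count as bad, so that the truncation is
  paid for by the ideal loss.\<close>

definition r :: "'a \<Rightarrow> 'u \<Rightarrow> real" where
  "r a u = (if q a u \<le> c * Q u \<and> 0 < Q u then q a u / (c * Q u) else 0)"

text \<open>The mass of \<open>q a\<close> that survives the truncation; by \<open>Qr_sum\<close> a
  single trial succeeds with probability \<open>\<alpha> a / c\<close>.\<close>

definition \<alpha> :: "'a \<Rightarrow> real" where
  "\<alpha> a = (\<Sum>u\<in>B. if q a u \<le> c * Q u then q a u else 0)"

definition C :: "('u \<times> nat) set" where "C = B \<times> {..<M}"
definition \<kappa> :: "'u \<times> nat \<Rightarrow> real" where "\<kappa> x = Q (fst x) / real M"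
definition H :: "(nat \<Rightarrow> 'u \<times> nat) set" where "H = ({..<L} \<rightarrow>\<^sub>E C)"
definition w :: "(nat \<Rightarrow> 'u \<times> nat) \<Rightarrow> real" where "w h = (\<Prod>k<L. \<kappa> (h k))"
definition E :: "((nat \<Rightarrow> 'u \<times> nat) \<Rightarrow> real) \<Rightarrow> real" where "E f = (\<Sum>h\<in>H. w h * f h)"

lemma finC: "finite C" by (simp add: C_def finB)
lemma finH: "finite H" unfolding H_def by (intro finite_PiE finC) auto
lemma \<kappa>0: "x \<in> C \<Longrightarrow> 0 \<le> \<kappa> x" using Q0 by (auto simp: C_def \<kappa>_def)
lemma H_C: "h \<in> H \<Longrightarrow> k < L \<Longrightarrow> h k \<in> C" by (auto simp: H_def)
lemma w0: "h \<in> H \<Longrightarrow> 0 \<le> w h" unfolding w_def using H_C \<kappa>0 by (intro prod_nonneg) auto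

lemma sum_\<kappa>: "(\<Sum>x\<in>C. \<kappa> x * f x) = (\<Sum>u\<in>B. \<Sum>m<M. Q u * f (u, m)) / real M"
  by (simp add: C_def sum_pair \<kappa>_def sum_divide_distrib)

lemma sum_\<kappa>_fst: "(\<Sum>x\<in>C. \<kappa> x * f (fst x)) = (\<Sum>u\<in>B. Q u * f u)"
  unfolding sum_\<kappa> using M by (simp add: sum_distrib_left[symmetric])

lemma sum_\<kappa>_bin:
  assumes "m < M"
  shows "(\<Sum>x\<in>C. \<kappa> x * (f (fst x) * (if snd x = m then 1 else 0))) = (\<Sum>u\<in>B. Q u * f u) / real M"
  unfolding sum_\<kappa> using assms by (simp add: sum_distrib_left[symmetric] if_distrib cong: if_cong)

lemma \<kappa>1: "(\<Sum>x\<in>C. \<kappa> x) = 1" using sum_\<kappa>_fst[of "\<lambda>_. 1"] Q1 by simp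

lemma E_prod: "E (\<lambda>h. \<Prod>k<L. g k (h k)) = (\<Prod>k<L. \<Sum>x\<in>C. \<kappa> x * g k x)"
proof -
  have "(\<Prod>k<L. \<Sum>x\<in>C. \<kappa> x * g k x) = (\<Sum>h\<in>{..<L} \<rightarrow>\<^sub>E C. \<Prod>k<L. \<kappa> (h k) * g k (h k))"
    by (rule prod_sum_PiE) (auto simp: finC)
  then show ?thesis by (simp add: E_def H_def w_def prod.distrib)
qed

lemma E_mono: "(\<And>h. h \<in> H \<Longrightarrow> f h \<le> g h) \<Longrightarrow> E f \<le> E g"
  unfolding E_def using w0 by (intro sum_mono mult_left_mono) auto

lemma E_sum: "E (\<lambda>h. \<Sum>i\<in>I. f i h) = (\<Sum>i\<in>I. E (f i))"
  unfolding E_def sum_distrib_left by (rule sum.swap)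

lemma E_add: "E (\<lambda>h. f h + g h) = E f + E g"
  by (simp add: E_def distrib_left sum.distrib)

lemma E_cmult: "E (\<lambda>h. t * f h) = t * E f"
  by (simp add: E_def sum_distrib_left mult.left_commute)

lemma E_one: "E (\<lambda>_. 1) = 1"
  using E_prod[of "\<lambda>_ _. 1"] by (simp add: \<kappa>1)

text \<open>The first moment method, by which a fixed codebook is extracted from the random
  one.\<close>

lemma E_witness: "\<exists>h\<in>H. f h \<le> E f"
proof (rule ccontr)
  assume "\<not> (\<exists>h\<in>H. f h \<le> E f)"
  then have less: "E f < f h" if "h \<in> H" for h using that by force
  have w1: "(\<Sum>h\<in>H. w h) = 1" using E_one by (simp add: E_def)
  then obtain h0 where h0: "h0 \<in> H" "w h0 \<noteq> 0" by (metis sum.neutral zero_neq_one)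
  have "(\<Sum>h\<in>H. w h * E f) < (\<Sum>h\<in>H. w h * f h)"
  proof (rule sum_strict_mono_ex1[OF finH])
    show "\<forall>h\<in>H. w h * E f \<le> w h * f h" using less w0 by (intro ballI mult_left_mono) (auto intro: less_imp_le)
    show "\<exists>h\<in>H. w h * E f < w h * f h" using h0 less w0[OF h0(1)] by (intro bexI[of _ h0]) auto
  qed
  moreover have "(\<Sum>h\<in>H. w h * E f) = E f" by (simp add: sum_distrib_right[symmetric] w1)
  ultimately show False by (simp add: E_def)
qed

lemma r01: "u \<in> B \<Longrightarrow> 0 \<le> r a u" "r a u \<le> 1"
  using c q0[of u a] by (auto simp: r_def)

lemma Qr: "u \<in> B \<Longrightarrow> Q u * r a u = (if q a u \<le> c * Q u then q a u else 0) / c"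
  using c Q0[of u] q0[of u a] by (auto simp: r_def order_less_le)

lemma Qr_sum: "(\<Sum>u\<in>B. Q u * r a u) = \<alpha> a / c"
  unfolding \<alpha>_def sum_divide_distrib using Qr by (intro sum.cong) auto

lemma \<alpha>01: "0 \<le> \<alpha> a" "\<alpha> a \<le> 1"
proof -
  show "0 \<le> \<alpha> a" unfolding \<alpha>_def using q0 by (intro sum_nonneg) auto
  have "\<alpha> a \<le> (\<Sum>u\<in>B. q a u)" unfolding \<alpha>_def using q0 by (intro sum_mono) auto
  then show "\<alpha> a \<le> 1" using q1 by simp
qed

lemma \<rho>01: "0 \<le> \<alpha> a / c" "\<alpha> a / c \<le> 1"
proof -
  show "0 \<le> \<alpha> a / c" using \<alpha>01(1)[of a] c by simp
  have "(\<Sum>u\<in>B. Q u * r a u) \<le> (\<Sum>u\<in>B. Q u * 1)" using Q0 r01(2) by (intro sum_mono mult_left_mono) auto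
  then show "\<alpha> a / c \<le> 1" using Q1 Qr_sum[of a] by simp
qed

text \<open>A probability for a fixed codebook \<open>h\<close>: the randomness is that of the
  acceptance decisions of the encoder. It is removed at the end by choosing the best index.\<close>

definition e :: "nat \<Rightarrow> 'a \<Rightarrow> (nat \<Rightarrow> 'u \<times> nat) \<Rightarrow> real" where
  "e i a h = r a (fst (h i)) * (\<Prod>k<i. 1 - r a (fst (h k)))"

definition fail :: "'a \<Rightarrow> (nat \<Rightarrow> 'u \<times> nat) \<Rightarrow> real" where
  "fail a h = (\<Prod>k<L. 1 - r a (fst (h k)))"

lemma e_fail: "(\<Sum>i<L. e i a h) + fail a h = 1"
  using first_success_sum[of "\<lambda>i. r a (fst (h i))" L] by (simp add: e_def fail_def)

lemma e0: "h \<in> H \<Longrightarrow> i < L \<Longrightarrow> 0 \<le> e i a h"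
proof -
  assume h: "h \<in> H" and i: "i < L"
  have "0 \<le> r a (fst (h i))" using H_C[OF h i] r01 by (auto simp: C_def)
  moreover have "0 \<le> (\<Prod>k<i. 1 - r a (fst (h k)))" using r01(2) by (intro prod_nonneg) auto
  ultimately show ?thesis by (simp add: e_def)
qed

lemma fail0: "0 \<le> fail a h" unfolding fail_def using r01(2) by (intro prod_nonneg) auto

lemma E_fail: "E (fail a) = (1 - \<alpha> a / c) ^ L"
proof -
  have "E (fail a) = (\<Prod>k<L. \<Sum>x\<in>C. \<kappa> x * (1 - r a (fst x)))"
    unfolding fail_def using E_prod[of "\<lambda>_ x. 1 - r a (fst x)"] by simp
  also have "(\<Sum>x\<in>C. \<kappa> x * (1 - r a (fst x))) = 1 - \<alpha> a / c"
    using sum_\<kappa>_fst[of "\<lambda>u. 1 - r a u"] by (simp add: right_diff_distrib sum_subtractf Q1 Qr_sum)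
  finally show ?thesis by simp
qed

lemma prod_restrict:
  assumes "i < L"
  shows "(\<Prod>k<L. if k < i \<and> R k then f k else (1::real)) = (\<Prod>k<i. if R k then f k else 1)"
  using assms by (intro prod.mono_neutral_cong_right) auto

lemma E_accept:
  assumes i: "i < L"
  shows "E (\<lambda>h. e i a h * g (fst (h i))) = (1 - \<alpha> a / c) ^ i * (\<Sum>u\<in>B. Q u * (r a u * g u))"
proof -
  define G where "G k x = (if k = i then r a (fst x) * g (fst x) else 1) * (if k < i \<and> True then 1 - r a (fst x) else 1)" for k and x :: "'u \<times> nat"
  have "e i a h * g (fst (h i)) = (\<Prod>k<L. G k (h k))" for h
    unfolding G_def prod.distrib prod_restrict[OF i] using i by (simp add: e_def)
  then have "E (\<lambda>h. e i a h * g (fst (h i))) = (\<Prod>k<L. \<Sum>x\<in>C. \<kappa> x * G k x)" by (simp add: E_prod)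
  also have "\<dots> = (\<Prod>k<L. (if k = i then (\<Sum>u\<in>B. Q u * (r a u * g u)) else 1) * (if k < i \<and> True then 1 - \<alpha> a / c else 1))"
  proof (intro prod.cong refl)
    fix k
    show "(\<Sum>x\<in>C. \<kappa> x * G k x) = (if k = i then (\<Sum>u\<in>B. Q u * (r a u * g u)) else 1) * (if k < i \<and> True then 1 - \<alpha> a / c else 1)"
      using sum_\<kappa>_fst[of "\<lambda>u. r a u * g u"] sum_\<kappa>_fst[of "\<lambda>u. 1 - r a u"]
      by (auto simp: G_def \<kappa>1 right_diff_distrib sum_subtractf Q1 Qr_sum)
  qed
  also have "\<dots> = (\<Sum>u\<in>B. Q u * (r a u * g u)) * (1 - \<alpha> a / c) ^ i"
    unfolding prod.distrib prod_restrict[OF i] using i by simp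
  finally show ?thesis by simp
qed

text \<open>The factor of codeword \<open>j\<close> in \<open>e i a h\<close> is at most one and is
  dropped; afterwards the choice of \<open>i\<close> no longer depends on codeword \<open>j\<close>.
  The bound keeps the shape of a first success with trial \<open>j\<close> disabled, so that summing
  over \<open>i\<close> costs nothing by \<open>first_success_sum\<close>, and only the sum over
  \<open>j\<close> contributes a factor \<open>L\<close>.\<close>

lemma E_collide:
  fixes a :: 'a
  assumes i: "i < L" and j: "j < L" "j \<noteq> i" and \<tau>: "(\<Sum>u\<in>B. if u \<in> T then Q u else 0) \<le> \<tau>"
  defines "x \<equiv> \<lambda>k. if k = j then 0 else \<alpha> a / c"
  shows "E (\<lambda>h. e i a h * (if snd (h j) = snd (h i) \<and> fst (h j) \<in> T then 1 else 0))
     \<le> \<tau> / real M * (x i * (\<Prod>k<i. 1 - x k))"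
proof -
  define \<tau>0 where "\<tau>0 = (\<Sum>u\<in>B. Q u * (if u \<in> T then 1 else 0))"
  have \<tau>0: "\<tau>0 \<le> \<tau>" using \<tau> by (simp add: \<tau>0_def if_distrib cong: if_cong)
  \<comment> \<open>Splitting by the common bin \<open>m\<close> restores a product over the
    codewords. Each of the two bin constraints contributes a factor \<open>1 / real M\<close>, and
    the sum over \<open>m\<close> takes one of them back.\<close>
  define G where "G m k y = (if k = i then r a (fst y) * (if snd y = m then 1 else 0) else 1) *
     (if k = j then (if fst y \<in> T then 1 else 0) * (if snd y = m then 1 else 0) else 1) *
     (if k < i \<and> k \<noteq> j then 1 - r a (fst y) else 1)" for m :: nat and k and y :: "'u \<times> nat"
  have "e i a h * (if snd (h j) = snd (h i) \<and> fst (h j) \<in> T then 1 else 0) \<le> (\<Sum>m<M. \<Prod>k<L. G m k (h k))" if h: "h \<in> H" for h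
  proof -
    have r0: "0 \<le> r a (fst (h i))" using H_C[OF h i] r01 by (auto simp: C_def)
    have P: "(\<Prod>k<L. G m k (h k)) = (r a (fst (h i)) * (if snd (h i) = m then 1 else 0)) *
       ((if fst (h j) \<in> T then 1 else 0) * (if snd (h j) = m then 1 else 0)) *
       (\<Prod>k<i. if k \<noteq> j then 1 - r a (fst (h k)) else 1)" for m
      unfolding G_def prod.distrib prod_restrict[OF i] using i j by simp
    have P0: "0 \<le> (\<Prod>k<L. G m k (h k))" for m
      unfolding P using r0 r01(2) by (intro mult_nonneg_nonneg prod_nonneg) auto
    show ?thesis
    proof (cases "snd (h j) = snd (h i) \<and> fst (h j) \<in> T")
      case True
      have m: "snd (h i) < M" using H_C[OF h i] by (auto simp: C_def)
      have "e i a h \<le> r a (fst (h i)) * (\<Prod>k<i. if k \<noteq> j then 1 - r a (fst (h k)) else 1)"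
        unfolding e_def
      proof (intro mult_left_mono prod_mono r0)
        fix k assume "k \<in> {..<i}"
        then have "fst (h k) \<in> B" using H_C[OF h, of k] i by (auto simp: C_def)
        then show "0 \<le> 1 - r a (fst (h k)) \<and> 1 - r a (fst (h k)) \<le> (if k \<noteq> j then 1 - r a (fst (h k)) else 1)"
          using r01 by auto
      qed
      also have "\<dots> = (\<Prod>k<L. G (snd (h i)) k (h k))" unfolding P using True by simp
      also have "\<dots> \<le> (\<Sum>m<M. \<Prod>k<L. G m k (h k))"
        using P0 m by (intro member_le_sum) auto
      finally show ?thesis using True by simp
    qed (use P0 in \<open>auto intro: sum_nonneg\<close>)
  qed
  then have "E (\<lambda>h. e i a h * (if snd (h j) = snd (h i) \<and> fst (h j) \<in> T then 1 else 0))
    \<le> E (\<lambda>h. \<Sum>m<M. \<Prod>k<L. G m k (h k))" by (rule E_mono)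
  also have "\<dots> = (\<Sum>m<M. \<Prod>k<L. \<Sum>y\<in>C. \<kappa> y * G m k y)" unfolding E_sum E_prod ..
  also have "\<dots> = (\<Sum>m<M. \<Prod>k<L. (if k = i then \<alpha> a / c / real M else 1) * (if k = j then \<tau>0 / real M else 1) *
     (if k < i \<and> k \<noteq> j then 1 - \<alpha> a / c else 1))"
  proof (intro sum.cong prod.cong refl)
    fix m k assume "m \<in> {..<M}"
    then have m: "m < M" by simp
    show "(\<Sum>y\<in>C. \<kappa> y * G m k y) = (if k = i then \<alpha> a / c / real M else 1) * (if k = j then \<tau>0 / real M else 1) *
     (if k < i \<and> k \<noteq> j then 1 - \<alpha> a / c else 1)"
      using sum_\<kappa>_bin[OF m, of "r a"] sum_\<kappa>_bin[OF m, of "\<lambda>u. if u \<in> T then 1 else 0"] sum_\<kappa>_fst[of "\<lambda>u. 1 - r a u"] j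
      by (auto simp: G_def \<kappa>1 right_diff_distrib sum_subtractf Q1 Qr_sum \<tau>0_def)
  qed
  also have "\<dots> = (\<Sum>m<M. (\<alpha> a / c / real M) * (\<tau>0 / real M) * (\<Prod>k<i. if k \<noteq> j then 1 - \<alpha> a / c else 1))"
    unfolding prod.distrib prod_restrict[OF i] using i j by simp
  also have "(\<Prod>k<i. if k \<noteq> j then 1 - \<alpha> a / c else 1) = (\<Prod>k<i. 1 - x k)"
    by (intro prod.cong) (auto simp: x_def)
  also have "(\<Sum>m<M. (\<alpha> a / c / real M) * (\<tau>0 / real M) * (\<Prod>k<i. 1 - x k)) = \<tau>0 / real M * (x i * (\<Prod>k<i. 1 - x k))"
    using M j by (simp add: x_def mult_ac)
  also have "\<dots> \<le> \<tau> / real M * (x i * (\<Prod>k<i. 1 - x k))"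
    using \<tau>0 \<rho>01[of a] by (intro mult_right_mono divide_right_mono mult_nonneg_nonneg prod_nonneg) (auto simp: x_def)
  finally show ?thesis .
qed

text \<open>\<open>\<beta>\<close> is the loss caused by the selected word and \<open>T\<close> the
  set of words passing the decoder's test. In the constant \<open>4\<close>, one factor
  \<open>2\<close> is the price of conditioning on acceptance, the other comes from adding the
  collision indicator and the loss, which are both at most \<open>val\<close>. The total mass stays
  visible because the lemma is applied to parts of a probability space.\<close>

lemma codebook_exists:
  fixes \<Omega> :: "'w set" and \<mu> :: "'w \<Rightarrow> real" and ao :: "'w \<Rightarrow> 'a" and \<beta> :: "'w \<Rightarrow> 'u \<Rightarrow> real" and T :: "'w \<Rightarrow> 'u set"
  assumes fin\<Omega>: "finite \<Omega>" and \<mu>: "\<And>\<omega>. \<omega> \<in> \<Omega> \<Longrightarrow> 0 \<le> \<mu> \<omega>"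
    and \<beta>: "\<And>\<omega> u. \<omega> \<in> \<Omega> \<Longrightarrow> u \<in> B \<Longrightarrow> 0 \<le> \<beta> \<omega> u \<and> \<beta> \<omega> u \<le> 1"
    and \<beta>1: "\<And>\<omega> u. \<omega> \<in> \<Omega> \<Longrightarrow> u \<in> B \<Longrightarrow> c * Q u < q (ao \<omega>) u \<Longrightarrow> \<beta> \<omega> u = 1"
    and \<tau>: "\<And>\<omega>. \<omega> \<in> \<Omega> \<Longrightarrow> (\<Sum>u\<in>B. if u \<in> T \<omega> then Q u else 0) \<le> \<tau>"
  shows "\<exists>cb m I. (\<forall>j. cb j \<in> B) \<and> (\<forall>j. m j < M) \<and> (\<forall>a. I a < L) \<and>
    (\<Sum>\<omega>\<in>\<Omega>. \<mu> \<omega> * ((if \<exists>j<L. j \<noteq> I (ao \<omega>) \<and> m j = m (I (ao \<omega>)) \<and> cb j \<in> T \<omega> then 1 else 0) + \<beta> \<omega> (cb (I (ao \<omega>)))))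
     \<le> 4 * (\<Sum>\<omega>\<in>\<Omega>. \<mu> \<omega> * (\<Sum>u\<in>B. q (ao \<omega>) u * \<beta> \<omega> u))
       + 2 * (exp (- (real L / (2 * c))) + real L * \<tau> / real M) * (\<Sum>\<omega>\<in>\<Omega>. \<mu> \<omega>)"
proof -
  define coll where "coll \<omega> h i \<longleftrightarrow> (\<exists>j<L. j \<noteq> i \<and> snd (h j) = snd (h i) \<and> fst (h j) \<in> T \<omega>)"
    for \<omega> and h :: "nat \<Rightarrow> 'u \<times> nat" and i
  define val where "val \<omega> h i = (if coll \<omega> h i then 1 else \<beta> \<omega> (fst (h i)))" for \<omega> h i
  \<comment> \<open>If no word is accepted, the maximal loss \<open>1\<close> is charged.\<close>
  define J where "J \<omega> h = (\<Sum>i<L. e i (ao \<omega>) h * val \<omega> h i) + fail (ao \<omega>) h" for \<omega> h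
  define bd where "bd \<omega> = 2 * (\<Sum>u\<in>B. q (ao \<omega>) u * \<beta> \<omega> u) + exp (- (real L / (2 * c))) + real L * \<tau> / real M" for \<omega>
  have inB: "fst (h i) \<in> B" "snd (h i) < M" if "h \<in> H" "i < L" for h i using H_C[OF that] by (auto simp: C_def)
  have val: "0 \<le> val \<omega> h i" "val \<omega> h i \<le> 1" if "\<omega> \<in> \<Omega>" "h \<in> H" "i < L" for \<omega> h i
    using \<beta>[OF that(1) inB(1)[OF that(2,3)]] by (auto simp: val_def)
  have Ecoll: "E (\<lambda>h. \<Sum>i<L. e i (ao \<omega>) h * (if coll \<omega> h i then 1 else 0)) \<le> real L * \<tau> / real M" if w: "\<omega> \<in> \<Omega>" for \<omega>
  proof -
    let ?a = "ao \<omega>"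
    let ?x = "\<lambda>j k. if k = j then 0 else \<alpha> ?a / c"
    have \<tau>0: "0 \<le> \<tau>" using \<tau>[OF w] sum_nonneg[of B "\<lambda>u. if u \<in> T \<omega> then Q u else 0"] Q0 by force
    have "E (\<lambda>h. \<Sum>i<L. e i ?a h * (if coll \<omega> h i then 1 else 0)) \<le>
      E (\<lambda>h. \<Sum>i<L. \<Sum>j\<in>{..<L} - {i}. e i ?a h * (if snd (h j) = snd (h i) \<and> fst (h j) \<in> T \<omega> then 1 else 0))"
    proof (intro E_mono sum_mono)
      fix h i assume h: "h \<in> H" and "i \<in> {..<L}"
      then have i: "i < L" by simp
      have "(if coll \<omega> h i then 1 else 0) \<le> (\<Sum>j\<in>{..<L} - {i}. if snd (h j) = snd (h i) \<and> fst (h j) \<in> T \<omega> then 1 else (0::real))"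
      proof (cases "coll \<omega> h i")
        case True
        then obtain j where j: "j \<in> {..<L} - {i}" "snd (h j) = snd (h i)" "fst (h j) \<in> T \<omega>" by (auto simp: coll_def)
        have "(if snd (h j) = snd (h i) \<and> fst (h j) \<in> T \<omega> then 1 else (0::real)) \<le>
          (\<Sum>j\<in>{..<L} - {i}. if snd (h j) = snd (h i) \<and> fst (h j) \<in> T \<omega> then 1 else 0)"
          using j(1) by (intro member_le_sum) auto
        then show ?thesis using j True by simp
      next
        case False
        then show ?thesis by (simp add: sum_nonneg)
      qed
      then show "e i ?a h * (if coll \<omega> h i then 1 else 0) \<le>
        (\<Sum>j\<in>{..<L} - {i}. e i ?a h * (if snd (h j) = snd (h i) \<and> fst (h j) \<in> T \<omega> then 1 else 0))"
        unfolding sum_distrib_left[symmetric] by (rule mult_left_mono[OF _ e0[OF h i]])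
    qed
    also have "\<dots> = (\<Sum>i<L. \<Sum>j\<in>{..<L} - {i}. E (\<lambda>h. e i ?a h * (if snd (h j) = snd (h i) \<and> fst (h j) \<in> T \<omega> then 1 else 0)))"
      by (simp add: E_sum)
    also have "\<dots> \<le> (\<Sum>i<L. \<Sum>j\<in>{..<L} - {i}. \<tau> / real M * (?x j i * (\<Prod>k<i. 1 - ?x j k)))"
      by (intro sum_mono E_collide \<tau>[OF w]) auto
    also have "\<dots> = (\<Sum>i<L. \<Sum>j<L. \<tau> / real M * (?x j i * (\<Prod>k<i. 1 - ?x j k)))"
      by (intro sum.cong refl sum.mono_neutral_left) auto
    also have "\<dots> = (\<Sum>j<L. \<tau> / real M * (\<Sum>i<L. ?x j i * (\<Prod>k<i. 1 - ?x j k)))"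
      unfolding sum_distrib_left by (rule sum.swap)
    also have "\<dots> \<le> (\<Sum>j<L. \<tau> / real M * 1)"
    proof (intro sum_mono mult_left_mono)
      fix j
      have "0 \<le> (\<Prod>k<L. 1 - ?x j k)" using \<rho>01[of ?a] by (intro prod_nonneg) auto
      then show "(\<Sum>i<L. ?x j i * (\<Prod>k<i. 1 - ?x j k)) \<le> 1" using first_success_sum[of "?x j" L] by linarith
    qed (use \<tau>0 in auto)
    finally show ?thesis by simp
  qed
  have EJ: "E (J \<omega>) \<le> bd \<omega>" if w: "\<omega> \<in> \<Omega>" for \<omega>
  proof -
    let ?a = "ao \<omega>"
    have Jle: "J \<omega> h \<le> (\<Sum>i<L. e i ?a h * \<beta> \<omega> (fst (h i))) + fail ?a h +
       (\<Sum>i<L. e i ?a h * (if coll \<omega> h i then 1 else 0))" if h: "h \<in> H" for h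
    proof -
      have "(\<Sum>i<L. e i ?a h * val \<omega> h i) \<le> (\<Sum>i<L. e i ?a h * (\<beta> \<omega> (fst (h i)) + (if coll \<omega> h i then 1 else 0)))"
        using e0[OF h] \<beta>[OF w inB(1)[OF h]] by (intro sum_mono mult_left_mono) (auto simp: val_def)
      then show ?thesis by (simp add: J_def distrib_left sum.distrib)
    qed
    have q\<beta>0: "0 \<le> (\<Sum>u\<in>B. q ?a u * \<beta> \<omega> u)" using q0 \<beta>[OF w] by (intro sum_nonneg) auto
    \<comment> \<open>If less than half of \<open>q\<close> survives the truncation, the ideal loss
      exceeds one half, since truncated words have loss one; twice the ideal loss then pays for
      everything but collisions. Otherwise the law of the accepted word is at most \<open>q\<close>
      divided by \<open>\<alpha>\<close>, hence at most twice \<open>q\<close>.\<close>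
    show ?thesis
    proof (cases "\<alpha> ?a < 1 / 2")
      case True
      have "E (J \<omega>) \<le> E (\<lambda>h. 1 + (\<Sum>i<L. e i ?a h * (if coll \<omega> h i then 1 else 0)))"
      proof (rule E_mono)
        fix h assume h: "h \<in> H"
        have "(\<Sum>i<L. e i ?a h * \<beta> \<omega> (fst (h i))) \<le> (\<Sum>i<L. e i ?a h * 1)"
          using e0[OF h] \<beta>[OF w inB(1)[OF h]] by (intro sum_mono mult_left_mono) auto
        then show "J \<omega> h \<le> 1 + (\<Sum>i<L. e i ?a h * (if coll \<omega> h i then 1 else 0))"
          using Jle[OF h] e_fail[of ?a h] by simp
      qed
      also have "\<dots> \<le> 1 + real L * \<tau> / real M" using Ecoll[OF w] by (simp add: E_add E_one)
      also have "1 \<le> 2 * (\<Sum>u\<in>B. q ?a u * \<beta> \<omega> u)"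
      proof -
        have "1 - \<alpha> ?a = (\<Sum>u\<in>B. q ?a u - (if q ?a u \<le> c * Q u then q ?a u else 0))"
          by (simp add: \<alpha>_def sum_subtractf q1)
        also have "\<dots> \<le> (\<Sum>u\<in>B. q ?a u * \<beta> \<omega> u)"
          using q0 \<beta>[OF w] \<beta>1[OF w] by (intro sum_mono) (auto simp: not_le)
        finally show ?thesis using True by linarith
      qed
      finally show ?thesis unfolding bd_def using exp_ge_zero[of "- (real L / (2 * c))"] by linarith
    next
      case False
      then have \<alpha>: "1 / 2 \<le> \<alpha> ?a" by simp
      let ?\<rho> = "\<alpha> ?a / c"
      have \<rho>: "0 < ?\<rho>" using \<alpha> c by simp
      have "E (J \<omega>) \<le> E (\<lambda>h. (\<Sum>i<L. e i ?a h * \<beta> \<omega> (fst (h i))) + fail ?a h +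
        (\<Sum>i<L. e i ?a h * (if coll \<omega> h i then 1 else 0)))" by (rule E_mono[OF Jle])
      also have "\<dots> = (\<Sum>i<L. E (\<lambda>h. e i ?a h * \<beta> \<omega> (fst (h i)))) + E (fail ?a) +
        E (\<lambda>h. \<Sum>i<L. e i ?a h * (if coll \<omega> h i then 1 else 0))" by (simp add: E_add E_sum)
      also have "(\<Sum>i<L. E (\<lambda>h. e i ?a h * \<beta> \<omega> (fst (h i)))) =
         (\<Sum>i<L. (1 - ?\<rho>) ^ i * (\<Sum>u\<in>B. Q u * (r ?a u * \<beta> \<omega> u)))"
        by (intro sum.cong refl E_accept) auto
      also have "\<dots> = (\<Sum>i<L. (1 - ?\<rho>) ^ i) * (\<Sum>u\<in>B. Q u * (r ?a u * \<beta> \<omega> u))" by (simp add: sum_distrib_right)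
      also have "\<dots> \<le> (1 / ?\<rho>) * (1 / c * (\<Sum>u\<in>B. q ?a u * \<beta> \<omega> u))"
      proof (rule mult_mono)
        have "?\<rho> * (\<Sum>i<L. (1 - ?\<rho>) ^ i) = 1 - (1 - ?\<rho>) ^ L"
          using one_diff_power_eq[of "1 - ?\<rho>" L] by simp
        also have "\<dots> \<le> 1" using \<rho>01[of ?a] by simp
        finally have "(\<Sum>i<L. (1 - ?\<rho>) ^ i) * ?\<rho> \<le> 1" by (simp only: mult.commute)
        then show "(\<Sum>i<L. (1 - ?\<rho>) ^ i) \<le> 1 / ?\<rho>" by (simp only: pos_le_divide_eq[OF \<rho>])
        have "(\<Sum>u\<in>B. Q u * (r ?a u * \<beta> \<omega> u)) \<le> (\<Sum>u\<in>B. 1 / c * (q ?a u * \<beta> \<omega> u))"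
        proof (rule sum_mono)
          fix u assume u: "u \<in> B"
          have "Q u * r ?a u \<le> q ?a u / c" unfolding Qr[OF u] using q0[OF u, of ?a] c by (auto simp: divide_right_mono)
          then have "(Q u * r ?a u) * \<beta> \<omega> u \<le> q ?a u / c * \<beta> \<omega> u" using \<beta>[OF w u] by (intro mult_right_mono) auto
          then show "Q u * (r ?a u * \<beta> \<omega> u) \<le> 1 / c * (q ?a u * \<beta> \<omega> u)" by (simp add: mult.assoc)
        qed
        then show "(\<Sum>u\<in>B. Q u * (r ?a u * \<beta> \<omega> u)) \<le> 1 / c * (\<Sum>u\<in>B. q ?a u * \<beta> \<omega> u)"
          by (simp add: sum_distrib_left)
        show "0 \<le> 1 / ?\<rho>" using \<rho>01(1)[of ?a] by (rule divide_nonneg_nonneg[OF zero_le_one])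
        show "0 \<le> (\<Sum>u\<in>B. Q u * (r ?a u * \<beta> \<omega> u))" using Q0 r01 \<beta>[OF w] by (intro sum_nonneg mult_nonneg_nonneg) auto
      qed
      also have "\<dots> = (1 / \<alpha> ?a) * (\<Sum>u\<in>B. q ?a u * \<beta> \<omega> u)" using c by simp
      also have "\<dots> \<le> 2 * (\<Sum>u\<in>B. q ?a u * \<beta> \<omega> u)"
        using \<alpha> q\<beta>0 by (intro mult_right_mono) (auto simp: field_simps)
      also have "E (fail ?a) \<le> exp (- (real L / (2 * c)))"
      proof -
        have "E (fail ?a) \<le> exp (- ?\<rho>) ^ L" unfolding E_fail
          using exp_ge_add_one_self[of "- ?\<rho>"] \<rho>01[of ?a] by (intro power_mono) auto
        also have "\<dots> = exp (- (real L * ?\<rho>))" by (simp add: exp_of_nat_mult[symmetric])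
        also have "\<dots> \<le> exp (- (real L / (2 * c)))"
        proof -
          have "1 / 2 / c \<le> ?\<rho>" using \<alpha> c by (intro divide_right_mono) auto
          then have "real L * (1 / 2 / c) \<le> real L * ?\<rho>" by (intro mult_left_mono) auto
          then show ?thesis by simp
        qed
        finally show ?thesis .
      qed
      finally show ?thesis using Ecoll[OF w] by (simp add: bd_def)
    qed
  qed
  have EJ': "E (\<lambda>h. \<Sum>\<omega>\<in>\<Omega>. \<mu> \<omega> * J \<omega> h) \<le> (\<Sum>\<omega>\<in>\<Omega>. \<mu> \<omega> * bd \<omega>)"
    unfolding E_sum E_cmult using EJ \<mu> by (intro sum_mono mult_left_mono) auto
  obtain h where h: "h \<in> H" and "(\<Sum>\<omega>\<in>\<Omega>. \<mu> \<omega> * J \<omega> h) \<le> E (\<lambda>h. \<Sum>\<omega>\<in>\<Omega>. \<mu> \<omega> * J \<omega> h)"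
    using E_witness[of "\<lambda>h. \<Sum>\<omega>\<in>\<Omega>. \<mu> \<omega> * J \<omega> h"] by (elim bexE)
  then have hJ: "(\<Sum>\<omega>\<in>\<Omega>. \<mu> \<omega> * J \<omega> h) \<le> (\<Sum>\<omega>\<in>\<Omega>. \<mu> \<omega> * bd \<omega>)" using EJ' by linarith
  \<comment> \<open>Derandomisation: for each observation \<open>a\<close>, the index of least loss
    is no worse than the mixture with weights \<open>e i a h\<close>, failure being charged the
    whole mass of the observations.\<close>
  define N where "N a i = (\<Sum>\<omega>\<in>{\<omega>\<in>\<Omega>. ao \<omega> = a}. \<mu> \<omega> * val \<omega> h i)" for a i
  have "\<exists>i. i < L \<and> (\<forall>j<L. N a i \<le> N a j)" for a
  proof -
    have f: "finite (N a ` {..<L})" "N a ` {..<L} \<noteq> {}" using L by auto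
    obtain i where i: "Min (N a ` {..<L}) = N a i" "i \<in> {..<L}" using Min_in[OF f] by (rule imageE)
    have "N a i \<le> N a j" if "j < L" for j
      unfolding i(1)[symmetric] by (rule Min_le[OF f(1)]) (use that in blast)
    then show ?thesis using i(2) by blast
  qed
  then have "\<forall>a. \<exists>i. i < L \<and> (\<forall>j<L. N a i \<le> N a j)" by (rule allI)
  from choice[OF this] obtain I where I': "\<forall>a. I a < L \<and> (\<forall>j<L. N a (I a) \<le> N a j)" ..
  then have I: "\<And>a. I a < L" "\<And>a j. j < L \<Longrightarrow> N a (I a) \<le> N a j" by blast+
  have Nle: "N a (I a) \<le> (\<Sum>\<omega>\<in>{\<omega>\<in>\<Omega>. ao \<omega> = a}. \<mu> \<omega> * J \<omega> h)" for a
  proof -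
    have N1: "N a (I a) \<le> (\<Sum>\<omega>\<in>{\<omega>\<in>\<Omega>. ao \<omega> = a}. \<mu> \<omega>)"
    proof -
      have "N a (I a) \<le> (\<Sum>\<omega>\<in>{\<omega>\<in>\<Omega>. ao \<omega> = a}. \<mu> \<omega> * 1)"
        unfolding N_def using val(2)[OF _ h I(1)] \<mu> by (intro sum_mono mult_left_mono) auto
      then show ?thesis by simp
    qed
    have "N a (I a) = (\<Sum>i<L. e i a h * N a (I a)) + fail a h * N a (I a)"
      using e_fail[of a h] by (metis distrib_right mult_1 sum_distrib_right)
    also have "\<dots> \<le> (\<Sum>i<L. e i a h * N a i) + fail a h * (\<Sum>\<omega>\<in>{\<omega>\<in>\<Omega>. ao \<omega> = a}. \<mu> \<omega>)"
      using e0[OF h] fail0 I(2) N1 by (intro add_mono sum_mono mult_left_mono) auto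
    also have "(\<Sum>i<L. e i a h * N a i) = (\<Sum>\<omega>\<in>{\<omega>\<in>\<Omega>. ao \<omega> = a}. \<mu> \<omega> * (\<Sum>i<L. e i a h * val \<omega> h i))"
      unfolding N_def sum_distrib_left by (subst sum.swap) (simp add: mult.left_commute)
    also have "\<dots> + fail a h * (\<Sum>\<omega>\<in>{\<omega>\<in>\<Omega>. ao \<omega> = a}. \<mu> \<omega>) =
      (\<Sum>\<omega>\<in>{\<omega>\<in>\<Omega>. ao \<omega> = a}. \<mu> \<omega> * ((\<Sum>i<L. e i a h * val \<omega> h i) + fail a h))"
      by (simp add: distrib_left sum.distrib sum_distrib_left mult.commute)
    also have "\<dots> = (\<Sum>\<omega>\<in>{\<omega>\<in>\<Omega>. ao \<omega> = a}. \<mu> \<omega> * J \<omega> h)"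
      by (intro sum.cong refl) (auto simp: J_def)
    finally show ?thesis .
  qed
  have "(\<Sum>\<omega>\<in>\<Omega>. \<mu> \<omega> * val \<omega> h (I (ao \<omega>))) = (\<Sum>a\<in>ao ` \<Omega>. N a (I a))"
    unfolding N_def by (subst sum.image_gen[OF fin\<Omega>, of _ ao]) (auto intro!: sum.cong)
  also have "\<dots> \<le> (\<Sum>a\<in>ao ` \<Omega>. \<Sum>\<omega>\<in>{\<omega>\<in>\<Omega>. ao \<omega> = a}. \<mu> \<omega> * J \<omega> h)" by (intro sum_mono Nle)
  also have "\<dots> = (\<Sum>\<omega>\<in>\<Omega>. \<mu> \<omega> * J \<omega> h)" by (rule sum.image_gen[OF fin\<Omega>, symmetric])
  also note hJ
  finally have valle: "(\<Sum>\<omega>\<in>\<Omega>. \<mu> \<omega> * val \<omega> h (I (ao \<omega>))) \<le> (\<Sum>\<omega>\<in>\<Omega>. \<mu> \<omega> * bd \<omega>)" .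
  have "B \<noteq> {}" using Q1 by auto
  then obtain u0 where u0: "u0 \<in> B" by blast
  \<comment> \<open>Indices beyond \<open>L\<close> receive arbitrary legal values, so that the
    claimed ranges hold for every argument.\<close>
  define cb where "cb j = (if j < L then fst (h j) else u0)" for j
  define m where "m j = (if j < L then snd (h j) else 0)" for j
  have "(\<Sum>\<omega>\<in>\<Omega>. \<mu> \<omega> * ((if \<exists>j<L. j \<noteq> I (ao \<omega>) \<and> m j = m (I (ao \<omega>)) \<and> cb j \<in> T \<omega> then 1 else 0) + \<beta> \<omega> (cb (I (ao \<omega>)))))
     \<le> (\<Sum>\<omega>\<in>\<Omega>. \<mu> \<omega> * (2 * val \<omega> h (I (ao \<omega>))))"
  proof (intro sum_mono mult_left_mono \<mu>)
    fix \<omega> assume w: "\<omega> \<in> \<Omega>"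
    have "(\<exists>j<L. j \<noteq> I (ao \<omega>) \<and> m j = m (I (ao \<omega>)) \<and> cb j \<in> T \<omega>) \<longleftrightarrow> coll \<omega> h (I (ao \<omega>))"
      using I(1) by (auto simp: coll_def m_def cb_def)
    moreover have "cb (I (ao \<omega>)) = fst (h (I (ao \<omega>)))" using I(1) by (simp add: cb_def)
    ultimately show "(if \<exists>j<L. j \<noteq> I (ao \<omega>) \<and> m j = m (I (ao \<omega>)) \<and> cb j \<in> T \<omega> then 1 else 0) + \<beta> \<omega> (cb (I (ao \<omega>)))
      \<le> 2 * val \<omega> h (I (ao \<omega>))"
      using \<beta>[OF w inB(1)[OF h I(1)[of "ao \<omega>"]]] by (auto simp: val_def)
  qed auto
  also have "\<dots> = 2 * (\<Sum>\<omega>\<in>\<Omega>. \<mu> \<omega> * val \<omega> h (I (ao \<omega>)))" by (simp add: sum_distrib_left mult.left_commute)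
  also have "\<dots> \<le> 2 * (\<Sum>\<omega>\<in>\<Omega>. \<mu> \<omega> * bd \<omega>)" using valle by simp
  also have "\<dots> = 4 * (\<Sum>\<omega>\<in>\<Omega>. \<mu> \<omega> * (\<Sum>u\<in>B. q (ao \<omega>) u * \<beta> \<omega> u))
       + 2 * (exp (- (real L / (2 * c))) + real L * \<tau> / real M) * (\<Sum>\<omega>\<in>\<Omega>. \<mu> \<omega>)"
  proof -
    let ?K = "exp (- (real L / (2 * c))) + real L * \<tau> / real M"
    have "(\<Sum>\<omega>\<in>\<Omega>. \<mu> \<omega> * bd \<omega>) = (\<Sum>\<omega>\<in>\<Omega>. 2 * (\<mu> \<omega> * (\<Sum>u\<in>B. q (ao \<omega>) u * \<beta> \<omega> u)) + ?K * \<mu> \<omega>)"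
      by (intro sum.cong refl) (simp only: bd_def algebra_simps)
    also have "\<dots> = 2 * (\<Sum>\<omega>\<in>\<Omega>. \<mu> \<omega> * (\<Sum>u\<in>B. q (ao \<omega>) u * \<beta> \<omega> u)) + ?K * (\<Sum>\<omega>\<in>\<Omega>. \<mu> \<omega>)"
      by (simp only: sum.distrib sum_distrib_left)
    finally show ?thesis by linarith
  qed
  finally have fin: "(\<Sum>\<omega>\<in>\<Omega>. \<mu> \<omega> * ((if \<exists>j<L. j \<noteq> I (ao \<omega>) \<and> m j = m (I (ao \<omega>)) \<and> cb j \<in> T \<omega> then 1 else 0) + \<beta> \<omega> (cb (I (ao \<omega>)))))
     \<le> 4 * (\<Sum>\<omega>\<in>\<Omega>. \<mu> \<omega> * (\<Sum>u\<in>B. q (ao \<omega>) u * \<beta> \<omega> u))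
       + 2 * (exp (- (real L / (2 * c))) + real L * \<tau> / real M) * (\<Sum>\<omega>\<in>\<Omega>. \<mu> \<omega>)" .
  show ?thesis
    by (rule exI[of _ cb], rule exI[of _ m], rule exI[of _ I])
       (use fin inB[OF h] u0 M I(1) in \<open>auto simp: cb_def m_def\<close>)
qed

end

section \<open>Composition of three coding steps\<close>

text \<open>There is a separate codebook for each value of \<open>\<sigma>\<close>, the words
  already shared by encoder and decoder. \<open>codebook_exists\<close> is applied to the part of
  the space where \<open>\<sigma>\<close> has a given value, and the bounds add up.\<close>

lemma codebooks_for_contexts:
  fixes \<Omega> :: "'w set" and \<mu> :: "'w \<Rightarrow> real" and ao :: "'w \<Rightarrow> 'a" and \<sigma> :: "'w \<Rightarrow> 's"
    and \<beta> :: "'w \<Rightarrow> 'u \<Rightarrow> real" and T :: "'w \<Rightarrow> 'u set"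
  assumes rc: "\<And>s. random_code B (Q s) (q s) c L M"
    and fin\<Omega>: "finite \<Omega>" and \<mu>: "\<And>\<omega>. \<omega> \<in> \<Omega> \<Longrightarrow> 0 \<le> \<mu> \<omega>" and \<mu>1: "(\<Sum>\<omega>\<in>\<Omega>. \<mu> \<omega>) = 1"
    and \<beta>: "\<And>\<omega> u. \<omega> \<in> \<Omega> \<Longrightarrow> u \<in> B \<Longrightarrow> 0 \<le> \<beta> \<omega> u \<and> \<beta> \<omega> u \<le> 1"
    and \<beta>1: "\<And>\<omega> u. \<omega> \<in> \<Omega> \<Longrightarrow> u \<in> B \<Longrightarrow> c * Q (\<sigma> \<omega>) u < q (\<sigma> \<omega>) (ao \<omega>) u \<Longrightarrow> \<beta> \<omega> u = 1"
    and \<tau>: "\<And>\<omega>. \<omega> \<in> \<Omega> \<Longrightarrow> (\<Sum>u\<in>B. if u \<in> T \<omega> then Q (\<sigma> \<omega>) u else 0) \<le> \<tau>"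
  shows "\<exists>cb m I. (\<forall>s j. cb s j \<in> B) \<and> (\<forall>s j. m s j < M) \<and> (\<forall>s a. I s a < L) \<and>
    (\<Sum>\<omega>\<in>\<Omega>. \<mu> \<omega> * ((if \<exists>j<L. j \<noteq> I (\<sigma> \<omega>) (ao \<omega>) \<and> m (\<sigma> \<omega>) j = m (\<sigma> \<omega>) (I (\<sigma> \<omega>) (ao \<omega>)) \<and> cb (\<sigma> \<omega>) j \<in> T \<omega>
        then 1 else 0) + \<beta> \<omega> (cb (\<sigma> \<omega>) (I (\<sigma> \<omega>) (ao \<omega>)))))
     \<le> 4 * (\<Sum>\<omega>\<in>\<Omega>. \<mu> \<omega> * (\<Sum>u\<in>B. q (\<sigma> \<omega>) (ao \<omega>) u * \<beta> \<omega> u))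
       + 2 * (exp (- (real L / (2 * c))) + real L * \<tau> / real M)"
proof -
  define \<Omega>s where "\<Omega>s s = {\<omega>\<in>\<Omega>. \<sigma> \<omega> = s}" for s
  let ?err = "2 * (exp (- (real L / (2 * c))) + real L * \<tau> / real M)"
  have "\<forall>s. \<exists>z. (\<forall>j. fst z j \<in> B) \<and> (\<forall>j. fst (snd z) j < M) \<and> (\<forall>a. snd (snd z) a < L) \<and>
    (\<Sum>\<omega>\<in>\<Omega>s s. \<mu> \<omega> * ((if \<exists>j<L. j \<noteq> snd (snd z) (ao \<omega>) \<and> fst (snd z) j = fst (snd z) (snd (snd z) (ao \<omega>)) \<and> fst z j \<in> T \<omega>
        then 1 else 0) + \<beta> \<omega> (fst z (snd (snd z) (ao \<omega>)))))
     \<le> 4 * (\<Sum>\<omega>\<in>\<Omega>s s. \<mu> \<omega> * (\<Sum>u\<in>B. q s (ao \<omega>) u * \<beta> \<omega> u)) + ?err * (\<Sum>\<omega>\<in>\<Omega>s s. \<mu> \<omega>)"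
  proof
    fix s
    interpret random_code B "Q s" "q s" c L M by (rule rc)
    have "\<exists>cb m I. (\<forall>j. cb j \<in> B) \<and> (\<forall>j. m j < M) \<and> (\<forall>a. I a < L) \<and>
      (\<Sum>\<omega>\<in>\<Omega>s s. \<mu> \<omega> * ((if \<exists>j<L. j \<noteq> I (ao \<omega>) \<and> m j = m (I (ao \<omega>)) \<and> cb j \<in> T \<omega> then 1 else 0) + \<beta> \<omega> (cb (I (ao \<omega>)))))
       \<le> 4 * (\<Sum>\<omega>\<in>\<Omega>s s. \<mu> \<omega> * (\<Sum>u\<in>B. q s (ao \<omega>) u * \<beta> \<omega> u)) + ?err * (\<Sum>\<omega>\<in>\<Omega>s s. \<mu> \<omega>)"
      by (rule codebook_exists) (use fin\<Omega> \<mu> \<beta> \<beta>1 \<tau> in \<open>auto simp: \<Omega>s_def\<close>)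
    then obtain cb m I where "(\<forall>j. cb j \<in> B) \<and> (\<forall>j. m j < M) \<and> (\<forall>a. I a < L) \<and>
      (\<Sum>\<omega>\<in>\<Omega>s s. \<mu> \<omega> * ((if \<exists>j<L. j \<noteq> I (ao \<omega>) \<and> m j = m (I (ao \<omega>)) \<and> cb j \<in> T \<omega> then 1 else 0) + \<beta> \<omega> (cb (I (ao \<omega>)))))
       \<le> 4 * (\<Sum>\<omega>\<in>\<Omega>s s. \<mu> \<omega> * (\<Sum>u\<in>B. q s (ao \<omega>) u * \<beta> \<omega> u)) + ?err * (\<Sum>\<omega>\<in>\<Omega>s s. \<mu> \<omega>)" by blast
    then show "\<exists>z. (\<forall>j. fst z j \<in> B) \<and> (\<forall>j. fst (snd z) j < M) \<and> (\<forall>a. snd (snd z) a < L) \<and>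
      (\<Sum>\<omega>\<in>\<Omega>s s. \<mu> \<omega> * ((if \<exists>j<L. j \<noteq> snd (snd z) (ao \<omega>) \<and> fst (snd z) j = fst (snd z) (snd (snd z) (ao \<omega>)) \<and> fst z j \<in> T \<omega>
          then 1 else 0) + \<beta> \<omega> (fst z (snd (snd z) (ao \<omega>)))))
       \<le> 4 * (\<Sum>\<omega>\<in>\<Omega>s s. \<mu> \<omega> * (\<Sum>u\<in>B. q s (ao \<omega>) u * \<beta> \<omega> u)) + ?err * (\<Sum>\<omega>\<in>\<Omega>s s. \<mu> \<omega>)"
      by (intro exI[of _ "(cb, m, I)"]) (unfold fst_conv snd_conv)
  qed
  from choice[OF this] obtain z where z: "\<forall>s. (\<forall>j. fst (z s) j \<in> B) \<and> (\<forall>j. fst (snd (z s)) j < M) \<and> (\<forall>a. snd (snd (z s)) a < L) \<and>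
    (\<Sum>\<omega>\<in>\<Omega>s s. \<mu> \<omega> * ((if \<exists>j<L. j \<noteq> snd (snd (z s)) (ao \<omega>) \<and> fst (snd (z s)) j = fst (snd (z s)) (snd (snd (z s)) (ao \<omega>)) \<and> fst (z s) j \<in> T \<omega>
        then 1 else 0) + \<beta> \<omega> (fst (z s) (snd (snd (z s)) (ao \<omega>)))))
     \<le> 4 * (\<Sum>\<omega>\<in>\<Omega>s s. \<mu> \<omega> * (\<Sum>u\<in>B. q s (ao \<omega>) u * \<beta> \<omega> u)) + ?err * (\<Sum>\<omega>\<in>\<Omega>s s. \<mu> \<omega>)" ..
  define cb where "cb s = fst (z s)" for s
  define m where "m s = fst (snd (z s))" for s
  define I where "I s = snd (snd (z s))" for s
  define F where "F s \<omega> = \<mu> \<omega> * ((if \<exists>j<L. j \<noteq> I s (ao \<omega>) \<and> m s j = m s (I s (ao \<omega>)) \<and> cb s j \<in> T \<omega>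
        then 1 else 0) + \<beta> \<omega> (cb s (I s (ao \<omega>))))" for s \<omega>
  have Fs: "(\<Sum>\<omega>\<in>\<Omega>s s. F s \<omega>) \<le> 4 * (\<Sum>\<omega>\<in>\<Omega>s s. \<mu> \<omega> * (\<Sum>u\<in>B. q s (ao \<omega>) u * \<beta> \<omega> u)) + ?err * (\<Sum>\<omega>\<in>\<Omega>s s. \<mu> \<omega>)" for s
    using z unfolding F_def cb_def m_def I_def by blast
  have split: "(\<Sum>\<omega>\<in>\<Omega>. G (\<sigma> \<omega>) \<omega>) = (\<Sum>s\<in>\<sigma> ` \<Omega>. \<Sum>\<omega>\<in>\<Omega>s s. G s \<omega>)" for G :: "'s \<Rightarrow> 'w \<Rightarrow> real"
    unfolding \<Omega>s_def by (subst sum.image_gen[OF fin\<Omega>, of _ \<sigma>]) (auto intro!: sum.cong)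
  have "(\<Sum>\<omega>\<in>\<Omega>. F (\<sigma> \<omega>) \<omega>) \<le> (\<Sum>s\<in>\<sigma> ` \<Omega>. 4 * (\<Sum>\<omega>\<in>\<Omega>s s. \<mu> \<omega> * (\<Sum>u\<in>B. q s (ao \<omega>) u * \<beta> \<omega> u)) + ?err * (\<Sum>\<omega>\<in>\<Omega>s s. \<mu> \<omega>))"
    unfolding split by (intro sum_mono Fs)
  also have "\<dots> = 4 * (\<Sum>s\<in>\<sigma> ` \<Omega>. \<Sum>\<omega>\<in>\<Omega>s s. \<mu> \<omega> * (\<Sum>u\<in>B. q s (ao \<omega>) u * \<beta> \<omega> u)) + ?err * (\<Sum>s\<in>\<sigma> ` \<Omega>. \<Sum>\<omega>\<in>\<Omega>s s. \<mu> \<omega>)"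
    by (simp only: sum.distrib sum_distrib_left)
  also have "\<dots> = 4 * (\<Sum>\<omega>\<in>\<Omega>. \<mu> \<omega> * (\<Sum>u\<in>B. q (\<sigma> \<omega>) (ao \<omega>) u * \<beta> \<omega> u)) + ?err * (\<Sum>\<omega>\<in>\<Omega>. \<mu> \<omega>)"
    using split[of "\<lambda>s \<omega>. \<mu> \<omega> * (\<Sum>u\<in>B. q s (ao \<omega>) u * \<beta> \<omega> u)"] split[of "\<lambda>s \<omega>. \<mu> \<omega>"] by simp
  finally have "(\<Sum>\<omega>\<in>\<Omega>. F (\<sigma> \<omega>) \<omega>) \<le> 4 * (\<Sum>\<omega>\<in>\<Omega>. \<mu> \<omega> * (\<Sum>u\<in>B. q (\<sigma> \<omega>) (ao \<omega>) u * \<beta> \<omega> u)) + ?err" by (simp add: \<mu>1)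
  moreover have "(\<forall>s j. cb s j \<in> B) \<and> (\<forall>s j. m s j < M) \<and> (\<forall>s a. I s a < L)"
    using z unfolding cb_def m_def I_def by blast
  ultimately show ?thesis unfolding F_def by blast
qed

text \<open>The sent index passes the test and no other index of its bin does, so
  \<open>SOME\<close> has a single candidate.\<close>

lemma decode_unique:
  assumes "i < L" "m i = t" "test (cb i)" "\<not> (\<exists>j<L. j \<noteq> i \<and> m j = m i \<and> test (cb j))"
  shows "cb (SOME j. j < (L::nat) \<and> m j = t \<and> test (cb j)) = cb i"
proof -
  have "(SOME j. j < L \<and> m j = t \<and> test (cb j)) = i"
    by (rule some_equality) (use assms in auto)
  then show ?thesis by simp
qed

text \<open>Every later step multiplies the loss handed to it by \<open>4\<close>. Hence the ideal
  loss gets \<open>4 * 4 * 4 = 64\<close>, and the coding errors, each doubled in its own step, get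
  \<open>32\<close>, \<open>8\<close> and \<open>2\<close>. The collision terms \<open>c1\<close>
  and \<open>c2\<close> are absorbed because they also stand on the left of the bounds for
  \<open>b1\<close> and \<open>b2\<close>.\<close>

lemma three_step_bound:
  fixes F c1 c2 t b1 b2 i x1 x2 x3 y1 y2 y3 :: real
  assumes "F \<le> c1 + c2 + t" "c1 + b1 \<le> 4 * i + (2 * x1 + 2 * y1)" "c2 + b2 \<le> 4 * b1 + (2 * x2 + 2 * y2)"
    "t \<le> 4 * b2 + 2 * (x3 + y3)" "0 \<le> c1" "0 \<le> c2"
  shows "F \<le> 64 * i + 32 * (x1 + y1) + 8 * (x2 + y2) + 2 * (x3 + y3)"
  using assms by (simp add: algebra_simps)

text \<open>\<open>good\<close> is any relation that forces the likelihood ratios below the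
  truncation levels and lets all tests succeed. Averaging its failure over \<open>w\<close>, then
  \<open>v\<close>, then \<open>u\<close> gives losses such that the loss realised by one step is
  the ideal loss of the next; nothing has to be re-estimated in between. Both users decode the first
  word, so a single bound covers its two tests.\<close>

lemma one_shot_code:
  fixes \<Omega> :: "'w set" and \<mu> :: "'w \<Rightarrow> real"
    and X :: "'w \<Rightarrow> 'x" and Y :: "'w \<Rightarrow> 'y" and Z :: "'w \<Rightarrow> 'z"
    and BU :: "'u set" and BV :: "'v set" and BW :: "'t set"
    and good :: "'w \<Rightarrow> 'u \<Rightarrow> 'v \<Rightarrow> 't \<Rightarrow> bool"
  assumes fin\<Omega>: "finite \<Omega>" and \<mu>: "\<And>\<omega>. \<omega> \<in> \<Omega> \<Longrightarrow> 0 \<le> \<mu> \<omega>" and \<mu>1: "(\<Sum>\<omega>\<in>\<Omega>. \<mu> \<omega>) = 1"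
    and rcU: "random_code BU QU KU cU LU MU"
    and rcV: "\<And>u. random_code BV (QV u) (KV u) cV LV MV"
    and rcW: "\<And>s. random_code BW (QW s) (KW s) cW LW MW"
    and goodU: "\<And>\<omega> u v w. \<omega> \<in> \<Omega> \<Longrightarrow> good \<omega> u v w \<Longrightarrow> KU (Y \<omega>) u \<le> cU * QU u \<and> tX (X \<omega>) u \<and> tZ (Z \<omega>) u"
    and goodV: "\<And>\<omega> u v w. \<omega> \<in> \<Omega> \<Longrightarrow> good \<omega> u v w \<Longrightarrow> KV u (Z \<omega>) v \<le> cV * QV u v \<and> tV u (X \<omega>) v"
    and goodW: "\<And>\<omega> u v w. \<omega> \<in> \<Omega> \<Longrightarrow> good \<omega> u v w \<Longrightarrow> KW (u, v) (X \<omega>) w \<le> cW * QW (u, v) w \<and> tW (u, v) (Z \<omega>) w"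
    and \<tau>U: "\<And>x z. (\<Sum>u\<in>BU. if tX x u \<or> tZ z u then QU u else 0) \<le> \<tau>U"
    and \<tau>V: "\<And>u x. (\<Sum>v\<in>BV. if tV u x v then QV u v else 0) \<le> \<tau>V"
    and \<tau>W: "\<And>s z. (\<Sum>w\<in>BW. if tW s z w then QW s w else 0) \<le> \<tau>W"
  shows "\<exists>f1 f2 f3 gX gZ. (\<forall>y. f1 y < MU) \<and> (\<forall>z t. f2 z t < MV) \<and> (\<forall>x t t'. f3 x t t' < MW) \<and>
    (\<Sum>\<omega>\<in>\<Omega>. \<mu> \<omega> * (if \<exists>u v w. gX (X \<omega>) (f1 (Y \<omega>)) (f2 (Z \<omega>) (f1 (Y \<omega>))) = (u, v) \<and>
        gZ (Z \<omega>) (f1 (Y \<omega>)) (f3 (X \<omega>) (f1 (Y \<omega>)) (f2 (Z \<omega>) (f1 (Y \<omega>)))) = (u, w) \<and> good \<omega> u v w then 0 else 1))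
    \<le> 64 * (\<Sum>\<omega>\<in>\<Omega>. \<mu> \<omega> * (\<Sum>u\<in>BU. KU (Y \<omega>) u * (\<Sum>v\<in>BV. KV u (Z \<omega>) v * (\<Sum>w\<in>BW. KW (u, v) (X \<omega>) w *
          (if good \<omega> u v w then 0 else 1)))))
      + 32 * (exp (- (real LU / (2 * cU))) + real LU * \<tau>U / real MU)
      + 8 * (exp (- (real LV / (2 * cV))) + real LV * \<tau>V / real MV)
      + 2 * (exp (- (real LW / (2 * cW))) + real LW * \<tau>W / real MW)"
proof -
  interpret U: random_code BU QU KU cU LU MU by (rule rcU)
  interpret V: random_code BV "QV u" "KV u" cV LV MV for u by (rule rcV)
  interpret W: random_code BW "QW s" "KW s" cW LW MW for s by (rule rcW)
  define \<beta>3 where "\<beta>3 \<omega> u v w = (if good \<omega> u v w then 0 else 1::real)" for \<omega> u v w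
  define \<beta>2 where "\<beta>2 \<omega> u v = (\<Sum>w\<in>BW. KW (u, v) (X \<omega>) w * \<beta>3 \<omega> u v w)" for \<omega> u v
  define \<beta>1 where "\<beta>1 \<omega> u = (\<Sum>v\<in>BV. KV u (Z \<omega>) v * \<beta>2 \<omega> u v)" for \<omega> u
  have b3: "0 \<le> \<beta>3 \<omega> u v w \<and> \<beta>3 \<omega> u v w \<le> 1" for \<omega> u v w by (simp add: \<beta>3_def)
  have b2: "0 \<le> \<beta>2 \<omega> u v \<and> \<beta>2 \<omega> u v \<le> 1" for \<omega> u v
    unfolding \<beta>2_def
  proof -
    have "(\<Sum>w\<in>BW. KW (u, v) (X \<omega>) w * \<beta>3 \<omega> u v w) \<le> (\<Sum>w\<in>BW. KW (u, v) (X \<omega>) w * 1)"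
      using b3 W.q0 by (intro sum_mono mult_left_mono) auto
    then show "0 \<le> (\<Sum>w\<in>BW. KW (u, v) (X \<omega>) w * \<beta>3 \<omega> u v w) \<and> (\<Sum>w\<in>BW. KW (u, v) (X \<omega>) w * \<beta>3 \<omega> u v w) \<le> 1"
      using W.q1 W.q0 b3 by (auto intro!: sum_nonneg)
  qed
  have b1: "0 \<le> \<beta>1 \<omega> u \<and> \<beta>1 \<omega> u \<le> 1" for \<omega> u
    unfolding \<beta>1_def
  proof -
    have "(\<Sum>v\<in>BV. KV u (Z \<omega>) v * \<beta>2 \<omega> u v) \<le> (\<Sum>v\<in>BV. KV u (Z \<omega>) v * 1)"
      using b2 V.q0 by (intro sum_mono mult_left_mono) auto
    then show "0 \<le> (\<Sum>v\<in>BV. KV u (Z \<omega>) v * \<beta>2 \<omega> u v) \<and> (\<Sum>v\<in>BV. KV u (Z \<omega>) v * \<beta>2 \<omega> u v) \<le> 1"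
      using V.q1 V.q0 b2 by (auto intro!: sum_nonneg)
  qed
  \<comment> \<open>A truncated word has no good completion, so its loss is one, as
    \<open>codebooks_for_contexts\<close> requires.\<close>
  have b2one: "\<beta>2 \<omega> u v = 1" if "\<And>w. \<not> good \<omega> u v w" for \<omega> u v
    using that W.q1 by (simp add: \<beta>2_def \<beta>3_def)
  have b1one: "\<beta>1 \<omega> u = 1" if "\<And>v w. \<not> good \<omega> u v w" for \<omega> u
    using that V.q1 b2one by (simp add: \<beta>1_def)

  \<comment> \<open>The first word has no context, hence the type \<open>unit\<close>. A competing
    word does harm if it passes the test of either user.\<close>
  have "\<exists>cb m I. (\<forall>s::unit. \<forall>j. cb s j \<in> BU) \<and> (\<forall>s j. m s j < MU) \<and> (\<forall>s a. I s a < LU) \<and>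
    (\<Sum>\<omega>\<in>\<Omega>. \<mu> \<omega> * ((if \<exists>j<LU. j \<noteq> I () (Y \<omega>) \<and> m () j = m () (I () (Y \<omega>)) \<and> cb () j \<in> {u. tX (X \<omega>) u \<or> tZ (Z \<omega>) u}
        then 1 else 0) + \<beta>1 \<omega> (cb () (I () (Y \<omega>)))))
     \<le> 4 * (\<Sum>\<omega>\<in>\<Omega>. \<mu> \<omega> * (\<Sum>u\<in>BU. KU (Y \<omega>) u * \<beta>1 \<omega> u))
       + 2 * (exp (- (real LU / (2 * cU))) + real LU * \<tau>U / real MU)"
  proof (rule codebooks_for_contexts[of BU "\<lambda>_. QU" "\<lambda>_. KU" cU LU MU \<Omega> \<mu> \<beta>1 "\<lambda>_. ()" Y])
    fix \<omega> u assume w: "\<omega> \<in> \<Omega>" and "cU * QU u < KU (Y \<omega>) u"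
    then show "\<beta>1 \<omega> u = 1" using goodU[OF w] by (intro b1one) (auto simp: not_le[symmetric])
  qed (use fin\<Omega> \<mu> \<mu>1 b1 \<tau>U rcU in auto)
  then obtain cb1' m1' I1' where cb1': "(\<forall>s::unit. \<forall>j. cb1' s j \<in> BU) \<and> (\<forall>s j. m1' s j < MU) \<and> (\<forall>s a. I1' s a < LU) \<and>
    (\<Sum>\<omega>\<in>\<Omega>. \<mu> \<omega> * ((if \<exists>j<LU. j \<noteq> I1' () (Y \<omega>) \<and> m1' () j = m1' () (I1' () (Y \<omega>)) \<and> cb1' () j \<in> {u. tX (X \<omega>) u \<or> tZ (Z \<omega>) u}
        then 1 else 0) + \<beta>1 \<omega> (cb1' () (I1' () (Y \<omega>)))))
     \<le> 4 * (\<Sum>\<omega>\<in>\<Omega>. \<mu> \<omega> * (\<Sum>u\<in>BU. KU (Y \<omega>) u * \<beta>1 \<omega> u))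
       + 2 * (exp (- (real LU / (2 * cU))) + real LU * \<tau>U / real MU)" by blast
  define cb1 where "cb1 = cb1' ()"
  define m1 where "m1 = m1' ()"
  define I1 where "I1 = I1' ()"
  define coll1 where "coll1 \<omega> \<longleftrightarrow> (\<exists>j<LU. j \<noteq> I1 (Y \<omega>) \<and> m1 j = m1 (I1 (Y \<omega>)) \<and> (tX (X \<omega>) (cb1 j) \<or> tZ (Z \<omega>) (cb1 j)))" for \<omega>
  define uu where "uu \<omega> = cb1 (I1 (Y \<omega>))" for \<omega>
  have s1: "(\<Sum>\<omega>\<in>\<Omega>. \<mu> \<omega> * ((if coll1 \<omega> then 1 else 0) + \<beta>1 \<omega> (uu \<omega>)))
     \<le> 4 * (\<Sum>\<omega>\<in>\<Omega>. \<mu> \<omega> * (\<Sum>u\<in>BU. KU (Y \<omega>) u * \<beta>1 \<omega> u))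
       + 2 * (exp (- (real LU / (2 * cU))) + real LU * \<tau>U / real MU)"
    and m1: "\<And>j. m1 j < MU" and I1: "\<And>y. I1 y < LU"
    using cb1' unfolding coll1_def uu_def cb1_def m1_def I1_def mem_Collect_eq by blast+

  have "\<exists>cb m I. (\<forall>s j. cb s j \<in> BV) \<and> (\<forall>s j. m s j < MV) \<and> (\<forall>s a. I s a < LV) \<and>
    (\<Sum>\<omega>\<in>\<Omega>. \<mu> \<omega> * ((if \<exists>j<LV. j \<noteq> I (uu \<omega>) (Z \<omega>) \<and> m (uu \<omega>) j = m (uu \<omega>) (I (uu \<omega>) (Z \<omega>)) \<and> cb (uu \<omega>) j \<in> {v. tV (uu \<omega>) (X \<omega>) v}
        then 1 else 0) + \<beta>2 \<omega> (uu \<omega>) (cb (uu \<omega>) (I (uu \<omega>) (Z \<omega>)))))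
     \<le> 4 * (\<Sum>\<omega>\<in>\<Omega>. \<mu> \<omega> * (\<Sum>v\<in>BV. KV (uu \<omega>) (Z \<omega>) v * \<beta>2 \<omega> (uu \<omega>) v))
       + 2 * (exp (- (real LV / (2 * cV))) + real LV * \<tau>V / real MV)"
  proof (rule codebooks_for_contexts[of BV QV KV cV LV MV \<Omega> \<mu> "\<lambda>\<omega>. \<beta>2 \<omega> (uu \<omega>)" uu Z])
    fix \<omega> v assume w: "\<omega> \<in> \<Omega>" and "cV * QV (uu \<omega>) v < KV (uu \<omega>) (Z \<omega>) v"
    then show "\<beta>2 \<omega> (uu \<omega>) v = 1" using goodV[OF w] by (intro b2one) (auto simp: not_le[symmetric])
  qed (use fin\<Omega> \<mu> \<mu>1 b2 \<tau>V rcV in auto)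
  then obtain cb2 m2 I2 where c2: "(\<forall>s j. cb2 s j \<in> BV) \<and> (\<forall>s j. m2 s j < MV) \<and> (\<forall>s a. I2 s a < LV) \<and>
    (\<Sum>\<omega>\<in>\<Omega>. \<mu> \<omega> * ((if \<exists>j<LV. j \<noteq> I2 (uu \<omega>) (Z \<omega>) \<and> m2 (uu \<omega>) j = m2 (uu \<omega>) (I2 (uu \<omega>) (Z \<omega>)) \<and> cb2 (uu \<omega>) j \<in> {v. tV (uu \<omega>) (X \<omega>) v}
        then 1 else 0) + \<beta>2 \<omega> (uu \<omega>) (cb2 (uu \<omega>) (I2 (uu \<omega>) (Z \<omega>)))))
     \<le> 4 * (\<Sum>\<omega>\<in>\<Omega>. \<mu> \<omega> * (\<Sum>v\<in>BV. KV (uu \<omega>) (Z \<omega>) v * \<beta>2 \<omega> (uu \<omega>) v))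
       + 2 * (exp (- (real LV / (2 * cV))) + real LV * \<tau>V / real MV)" by blast
  define vv where "vv \<omega> = cb2 (uu \<omega>) (I2 (uu \<omega>) (Z \<omega>))" for \<omega>
  define coll2 where "coll2 \<omega> \<longleftrightarrow> (\<exists>j<LV. j \<noteq> I2 (uu \<omega>) (Z \<omega>) \<and> m2 (uu \<omega>) j = m2 (uu \<omega>) (I2 (uu \<omega>) (Z \<omega>)) \<and>
      tV (uu \<omega>) (X \<omega>) (cb2 (uu \<omega>) j))" for \<omega>
  have s2: "(\<Sum>\<omega>\<in>\<Omega>. \<mu> \<omega> * ((if coll2 \<omega> then 1 else 0) + \<beta>2 \<omega> (uu \<omega>) (vv \<omega>)))
     \<le> 4 * (\<Sum>\<omega>\<in>\<Omega>. \<mu> \<omega> * \<beta>1 \<omega> (uu \<omega>))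
       + 2 * (exp (- (real LV / (2 * cV))) + real LV * \<tau>V / real MV)"
    and m2: "\<And>s j. m2 s j < MV" and I2: "\<And>s z. I2 s z < LV"
    using c2 unfolding coll2_def vv_def \<beta>1_def mem_Collect_eq by blast+

  let ?s = "uu \<bowtie> vv"
  have "\<exists>cb m I. (\<forall>s j. cb s j \<in> BW) \<and> (\<forall>s j. m s j < MW) \<and> (\<forall>s a. I s a < LW) \<and>
    (\<Sum>\<omega>\<in>\<Omega>. \<mu> \<omega> * ((if \<exists>j<LW. j \<noteq> I (?s \<omega>) (X \<omega>) \<and> m (?s \<omega>) j = m (?s \<omega>) (I (?s \<omega>) (X \<omega>)) \<and> cb (?s \<omega>) j \<in> {w. tW (?s \<omega>) (Z \<omega>) w}
        then 1 else 0) + \<beta>3 \<omega> (uu \<omega>) (vv \<omega>) (cb (?s \<omega>) (I (?s \<omega>) (X \<omega>)))))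
     \<le> 4 * (\<Sum>\<omega>\<in>\<Omega>. \<mu> \<omega> * (\<Sum>w\<in>BW. KW (?s \<omega>) (X \<omega>) w * \<beta>3 \<omega> (uu \<omega>) (vv \<omega>) w))
       + 2 * (exp (- (real LW / (2 * cW))) + real LW * \<tau>W / real MW)"
  proof (rule codebooks_for_contexts[of BW QW KW cW LW MW \<Omega> \<mu> "\<lambda>\<omega>. \<beta>3 \<omega> (uu \<omega>) (vv \<omega>)" ?s X])
    fix \<omega> w assume w: "\<omega> \<in> \<Omega>" and "cW * QW (?s \<omega>) w < KW (?s \<omega>) (X \<omega>) w"
    then show "\<beta>3 \<omega> (uu \<omega>) (vv \<omega>) w = 1" using goodW[OF w] by (auto simp: \<beta>3_def not_le[symmetric])
  qed (use fin\<Omega> \<mu> \<mu>1 b3 \<tau>W rcW in auto)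
  then obtain cb3 m3 I3 where c3: "(\<forall>s j. cb3 s j \<in> BW) \<and> (\<forall>s j. m3 s j < MW) \<and> (\<forall>s a. I3 s a < LW) \<and>
    (\<Sum>\<omega>\<in>\<Omega>. \<mu> \<omega> * ((if \<exists>j<LW. j \<noteq> I3 (?s \<omega>) (X \<omega>) \<and> m3 (?s \<omega>) j = m3 (?s \<omega>) (I3 (?s \<omega>) (X \<omega>)) \<and> cb3 (?s \<omega>) j \<in> {w. tW (?s \<omega>) (Z \<omega>) w}
        then 1 else 0) + \<beta>3 \<omega> (uu \<omega>) (vv \<omega>) (cb3 (?s \<omega>) (I3 (?s \<omega>) (X \<omega>)))))
     \<le> 4 * (\<Sum>\<omega>\<in>\<Omega>. \<mu> \<omega> * (\<Sum>w\<in>BW. KW (?s \<omega>) (X \<omega>) w * \<beta>3 \<omega> (uu \<omega>) (vv \<omega>) w))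
       + 2 * (exp (- (real LW / (2 * cW))) + real LW * \<tau>W / real MW)" by blast
  define ww where "ww \<omega> = cb3 (?s \<omega>) (I3 (?s \<omega>) (X \<omega>))" for \<omega>
  define coll3 where "coll3 \<omega> \<longleftrightarrow> (\<exists>j<LW. j \<noteq> I3 (?s \<omega>) (X \<omega>) \<and> m3 (?s \<omega>) j = m3 (?s \<omega>) (I3 (?s \<omega>) (X \<omega>)) \<and>
      tW (?s \<omega>) (Z \<omega>) (cb3 (?s \<omega>) j))" for \<omega>
  have s3: "(\<Sum>\<omega>\<in>\<Omega>. \<mu> \<omega> * ((if coll3 \<omega> then 1 else 0) + \<beta>3 \<omega> (uu \<omega>) (vv \<omega>) (ww \<omega>)))
     \<le> 4 * (\<Sum>\<omega>\<in>\<Omega>. \<mu> \<omega> * \<beta>2 \<omega> (uu \<omega>) (vv \<omega>))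
       + 2 * (exp (- (real LW / (2 * cW))) + real LW * \<tau>W / real MW)"
    and m3: "\<And>s j. m3 s j < MW" and I3: "\<And>s x. I3 s x < LW"
    using c3 unfolding coll3_def ww_def \<beta>2_def mem_Collect_eq by blast+

  define dZ where "dZ z t = cb1 (SOME j. j < LU \<and> m1 j = t \<and> tZ z (cb1 j))" for z t
  define dX where "dX x t = cb1 (SOME j. j < LU \<and> m1 j = t \<and> tX x (cb1 j))" for x t
  define dV where "dV x t t' = cb2 (dX x t) (SOME j. j < LV \<and> m2 (dX x t) j = t' \<and> tV (dX x t) x (cb2 (dX x t) j))" for x t t'
  \<comment> \<open>User Z is the encoder of the second word: it recomputes that word from its own
    source and the decoded first word.\<close>
  define vZ where "vZ z t = cb2 (dZ z t) (I2 (dZ z t) z)" for z t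
  define dW where "dW z t t' = cb3 (dZ z t, vZ z t) (SOME j. j < LW \<and> m3 (dZ z t, vZ z t) j = t' \<and>
      tW (dZ z t, vZ z t) z (cb3 (dZ z t, vZ z t) j))" for z t t'
  define f1 where "f1 y = m1 (I1 y)" for y
  define f2 where "f2 z t = m2 (dZ z t) (I2 (dZ z t) z)" for z t
  define f3 where "f3 x t t' = m3 (dX x t, dV x t t') (I3 (dX x t, dV x t t') x)" for x t t'
  define gX where "gX x t t' = (dX x t, dV x t t')" for x t t'
  define gZ where "gZ z t t' = (dZ z t, dW z t t')" for z t t'
  have ok: "gX (X \<omega>) (f1 (Y \<omega>)) (f2 (Z \<omega>) (f1 (Y \<omega>))) = (uu \<omega>, vv \<omega>) \<and>
        gZ (Z \<omega>) (f1 (Y \<omega>)) (f3 (X \<omega>) (f1 (Y \<omega>)) (f2 (Z \<omega>) (f1 (Y \<omega>)))) = (uu \<omega>, ww \<omega>)"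
    if w: "\<omega> \<in> \<Omega>" and no: "\<not> coll1 \<omega>" "\<not> coll2 \<omega>" "\<not> coll3 \<omega>" and g: "good \<omega> (uu \<omega>) (vv \<omega>) (ww \<omega>)" for \<omega>
  proof -
    let ?t1 = "f1 (Y \<omega>)"
    have tests: "tX (X \<omega>) (uu \<omega>)" "tZ (Z \<omega>) (uu \<omega>)" "tV (uu \<omega>) (X \<omega>) (vv \<omega>)" "tW (uu \<omega>, vv \<omega>) (Z \<omega>) (ww \<omega>)"
      using goodU[OF w g] goodV[OF w g] goodW[OF w g] by auto
    have Z1: "dZ (Z \<omega>) ?t1 = uu \<omega>" unfolding dZ_def uu_def f1_def
      by (rule decode_unique) (use I1 tests no in \<open>auto simp: uu_def coll1_def\<close>)
    have X1: "dX (X \<omega>) ?t1 = uu \<omega>" unfolding dX_def uu_def f1_def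
      by (rule decode_unique) (use I1 tests no in \<open>auto simp: uu_def coll1_def\<close>)
    let ?t2 = "f2 (Z \<omega>) ?t1"
    have t2: "?t2 = m2 (uu \<omega>) (I2 (uu \<omega>) (Z \<omega>))" by (simp add: f2_def Z1)
    have V1: "dV (X \<omega>) ?t1 ?t2 = vv \<omega>" unfolding dV_def X1 t2 unfolding vv_def
      by (rule decode_unique) (use I2 tests no in \<open>auto simp: vv_def coll2_def\<close>)
    have vZ1: "vZ (Z \<omega>) ?t1 = vv \<omega>" by (simp add: vZ_def Z1 vv_def)
    have t3: "f3 (X \<omega>) ?t1 ?t2 = m3 (?s \<omega>) (I3 (?s \<omega>) (X \<omega>))" by (simp add: f3_def X1 V1)
    have W1: "dW (Z \<omega>) ?t1 (f3 (X \<omega>) ?t1 ?t2) = ww \<omega>" unfolding dW_def Z1 vZ1 t3 unfolding ww_def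
      by (rule decode_unique) (use I3 tests no in \<open>auto simp: ww_def coll3_def\<close>)
    show ?thesis by (simp add: gX_def gZ_def X1 V1 Z1 W1)
  qed
  have "(\<Sum>\<omega>\<in>\<Omega>. \<mu> \<omega> * (if \<exists>u v w. gX (X \<omega>) (f1 (Y \<omega>)) (f2 (Z \<omega>) (f1 (Y \<omega>))) = (u, v) \<and>
        gZ (Z \<omega>) (f1 (Y \<omega>)) (f3 (X \<omega>) (f1 (Y \<omega>)) (f2 (Z \<omega>) (f1 (Y \<omega>)))) = (u, w) \<and> good \<omega> u v w then 0 else 1))
    \<le> (\<Sum>\<omega>\<in>\<Omega>. \<mu> \<omega> * (((if coll1 \<omega> then 1 else 0) + (if coll2 \<omega> then 1 else 0)) + ((if coll3 \<omega> then 1 else 0) + \<beta>3 \<omega> (uu \<omega>) (vv \<omega>) (ww \<omega>))))"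
  proof (intro sum_mono mult_left_mono \<mu>)
    fix \<omega> assume w: "\<omega> \<in> \<Omega>"
    show "(if \<exists>u v w. gX (X \<omega>) (f1 (Y \<omega>)) (f2 (Z \<omega>) (f1 (Y \<omega>))) = (u, v) \<and>
        gZ (Z \<omega>) (f1 (Y \<omega>)) (f3 (X \<omega>) (f1 (Y \<omega>)) (f2 (Z \<omega>) (f1 (Y \<omega>)))) = (u, w) \<and> good \<omega> u v w then 0 else (1::real))
      \<le> ((if coll1 \<omega> then 1 else 0) + (if coll2 \<omega> then 1 else 0)) + ((if coll3 \<omega> then 1 else 0) + \<beta>3 \<omega> (uu \<omega>) (vv \<omega>) (ww \<omega>))"
    proof (cases "\<not> coll1 \<omega> \<and> \<not> coll2 \<omega> \<and> \<not> coll3 \<omega> \<and> good \<omega> (uu \<omega>) (vv \<omega>) (ww \<omega>)")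
      case True
      then have "\<exists>u v w'. gX (X \<omega>) (f1 (Y \<omega>)) (f2 (Z \<omega>) (f1 (Y \<omega>))) = (u, v) \<and>
        gZ (Z \<omega>) (f1 (Y \<omega>)) (f3 (X \<omega>) (f1 (Y \<omega>)) (f2 (Z \<omega>) (f1 (Y \<omega>)))) = (u, w') \<and> good \<omega> u v w'"
        using ok[OF w] by blast
      then show ?thesis by (simp add: \<beta>3_def)
    qed (auto simp: \<beta>3_def)
  qed
  also have "\<dots> = (\<Sum>\<omega>\<in>\<Omega>. \<mu> \<omega> * (if coll1 \<omega> then 1 else 0)) + (\<Sum>\<omega>\<in>\<Omega>. \<mu> \<omega> * (if coll2 \<omega> then 1 else 0)) +
     (\<Sum>\<omega>\<in>\<Omega>. \<mu> \<omega> * ((if coll3 \<omega> then 1 else 0) + \<beta>3 \<omega> (uu \<omega>) (vv \<omega>) (ww \<omega>)))"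
    by (simp only: distrib_left sum.distrib)
  finally have main: "(\<Sum>\<omega>\<in>\<Omega>. \<mu> \<omega> * (if \<exists>u v w. gX (X \<omega>) (f1 (Y \<omega>)) (f2 (Z \<omega>) (f1 (Y \<omega>))) = (u, v) \<and>
        gZ (Z \<omega>) (f1 (Y \<omega>)) (f3 (X \<omega>) (f1 (Y \<omega>)) (f2 (Z \<omega>) (f1 (Y \<omega>)))) = (u, w) \<and> good \<omega> u v w then 0 else 1)) \<le>
     (\<Sum>\<omega>\<in>\<Omega>. \<mu> \<omega> * (if coll1 \<omega> then 1 else 0)) + (\<Sum>\<omega>\<in>\<Omega>. \<mu> \<omega> * (if coll2 \<omega> then 1 else 0)) +
     (\<Sum>\<omega>\<in>\<Omega>. \<mu> \<omega> * ((if coll3 \<omega> then 1 else 0) + \<beta>3 \<omega> (uu \<omega>) (vv \<omega>) (ww \<omega>)))" .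
  have nnc: "0 \<le> (\<Sum>\<omega>\<in>\<Omega>. \<mu> \<omega> * (if R \<omega> then 1 else 0))" for R using \<mu> by (intro sum_nonneg) auto
  note s1' = s1[unfolded distrib_left sum.distrib] and s2' = s2[unfolded distrib_left sum.distrib]
  have "(\<Sum>\<omega>\<in>\<Omega>. \<mu> \<omega> * (if \<exists>u v w. gX (X \<omega>) (f1 (Y \<omega>)) (f2 (Z \<omega>) (f1 (Y \<omega>))) = (u, v) \<and>
        gZ (Z \<omega>) (f1 (Y \<omega>)) (f3 (X \<omega>) (f1 (Y \<omega>)) (f2 (Z \<omega>) (f1 (Y \<omega>)))) = (u, w) \<and> good \<omega> u v w then 0 else 1))
    \<le> 64 * (\<Sum>\<omega>\<in>\<Omega>. \<mu> \<omega> * (\<Sum>u\<in>BU. KU (Y \<omega>) u * \<beta>1 \<omega> u))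
      + 32 * (exp (- (real LU / (2 * cU))) + real LU * \<tau>U / real MU)
      + 8 * (exp (- (real LV / (2 * cV))) + real LV * \<tau>V / real MV)
      + 2 * (exp (- (real LW / (2 * cW))) + real LW * \<tau>W / real MW)"
  proof -
    show ?thesis by (rule three_step_bound[OF main s1' s2' s3 nnc nnc])
  qed
  then show ?thesis
    unfolding \<beta>1_def \<beta>2_def \<beta>3_def
    by (intro exI[of _ f1] exI[of _ f2] exI[of _ f3] exI[of _ gX] exI[of _ gZ])
       (simp add: f1_def f2_def f3_def m1 m2 m3)
qed

section \<open>Achievability\<close>

text \<open>One statement for all three test channels: a variable attached by a kernel that sees
  only \<open>C\<close> is conditionally independent of the rest, and the kernel is its conditional
  law. \<open>F\<close> arranges the triple of coordinates into a sample point.\<close>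

lemma kernel_factor:
  fixes F :: "'a \<times> 'b \<times> 'c \<Rightarrow> 'w"
  assumes fin: "finite SA" "finite SB" "finite SC" and S: "S = F ` (SA \<times> SB \<times> SC)"
    and ABC: "\<And>a b c. a \<in> SA \<Longrightarrow> b \<in> SB \<Longrightarrow> c \<in> SC \<Longrightarrow> A (F (a, b, c)) = a \<and> B (F (a, b, c)) = b \<and> C (F (a, b, c)) = c"
    and P: "\<And>a b c. a \<in> SA \<Longrightarrow> b \<in> SB \<Longrightarrow> c \<in> SC \<Longrightarrow> P (F (a, b, c)) = k a c * g b c"
    and k1: "\<And>c. c \<in> SC \<Longrightarrow> (\<Sum>a\<in>SA. k a c) = 1"
  shows "ci S P A B C" and "a \<in> SA \<Longrightarrow> pr S P (A \<bowtie> C) (a, c) = k a c * pr S P C c"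
proof -
  have inj: "inj_on F (SA \<times> SB \<times> SC)"
  proof (rule inj_onI)
    fix s t assume st: "s \<in> SA \<times> SB \<times> SC" "t \<in> SA \<times> SB \<times> SC" "F s = F t"
    obtain a b c where s: "s = (a, b, c)" by (cases s)
    obtain a' b' c' where t: "t = (a', b', c')" by (cases t)
    have "A (F s) = a" "B (F s) = b" "C (F s) = c" using ABC[of a b c] st(1) unfolding s by blast+
    moreover have "A (F t) = a'" "B (F t) = b'" "C (F t) = c'" using ABC[of a' b' c'] st(2) unfolding t by blast+
    ultimately show "s = t" unfolding st(3) by (simp only: s t)
  qed
  have red: "pr S P G t = (\<Sum>a\<in>SA. \<Sum>b\<in>SB. \<Sum>c\<in>SC. if G (F (a, b, c)) = t then k a c * g b c else 0)" for G :: "'w \<Rightarrow> 'g" and t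
    unfolding pr_def S sum.reindex[OF inj] sum_triple o_def using P by (intro sum.cong refl) auto
  have "pr S P (A \<bowtie> B \<bowtie> C) (a, b, c) =
    (if a \<in> SA \<and> c \<in> SC then k a c else 0) * (if b \<in> SB then g b c else 0)" for a b c
  proof -
    have "pr S P (A \<bowtie> B \<bowtie> C) (a, b, c) =
      (\<Sum>a'\<in>SA. \<Sum>b'\<in>SB. \<Sum>c'\<in>SC. if c' = c then (if b' = b then (if a' = a then k a c * g b c else 0) else 0) else 0)"
      unfolding red using ABC by (intro sum.cong refl) auto
    also have "\<dots> = (\<Sum>a'\<in>SA. if a' = a then (\<Sum>b'\<in>SB. if b' = b then (if c \<in> SC then k a c * g b c else 0) else 0) else 0)"
      using fin by (intro sum.cong refl) (auto simp: sum.delta intro!: sum.cong)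
    also have "\<dots> = (if a \<in> SA \<and> c \<in> SC then k a c else 0) * (if b \<in> SB then g b c else 0)"
      using fin by (simp add: sum.delta)
    finally show ?thesis .
  qed
  then show "ci S P A B C" unfolding ci_def by (intro exI allI)
  assume a: "a \<in> SA"
  have "pr S P (A \<bowtie> C) (a, c) =
      (\<Sum>a'\<in>SA. \<Sum>b'\<in>SB. \<Sum>c'\<in>SC. if c' = c then (if a' = a then k a c * g b' c else 0) else 0)"
    unfolding red using ABC by (intro sum.cong refl) auto
  also have "\<dots> = (\<Sum>a'\<in>SA. if a' = a then (\<Sum>b'\<in>SB. if c \<in> SC then k a c * g b' c else 0) else 0)"
    using fin by (intro sum.cong refl) (auto simp: sum.delta intro!: sum.cong sum.neutral)
  also have "\<dots> = (\<Sum>b'\<in>SB. if c \<in> SC then k a c * g b' c else 0)" using a fin by simp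
  finally have 1: "pr S P (A \<bowtie> C) (a, c) = (\<Sum>b'\<in>SB. if c \<in> SC then k a c * g b' c else 0)" .
  have "pr S P C c = (\<Sum>a'\<in>SA. \<Sum>b'\<in>SB. \<Sum>c'\<in>SC. if c' = c then k a' c * g b' c else 0)"
    unfolding red using ABC by (intro sum.cong refl) auto
  also have "\<dots> = (if c \<in> SC then (\<Sum>a'\<in>SA. k a' c) * (\<Sum>b'\<in>SB. g b' c) else 0)"
    using fin by (simp add: sum.delta sum_product)
  finally have 2: "pr S P C c = (if c \<in> SC then (\<Sum>b'\<in>SB. g b' c) else 0)" using k1 by simp
  show "pr S P (A \<bowtie> C) (a, c) = k a c * pr S P C c"
    unfolding 1 2 by (auto simp: sum_distrib_left)
qed

section \<open>Concentration and likelihood ratios\<close>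

lemma sum_lists_prod:
  fixes f :: "nat \<Rightarrow> 'a \<Rightarrow> real"
  assumes "finite A"
  shows "(\<Sum>us\<in>{us. set us \<subseteq> A \<and> length us = n}. \<Prod>i<n. f i (us ! i)) = (\<Prod>i<n. \<Sum>u\<in>A. f i u)"
proof (induction n arbitrary: f)
  case 0
  have "{us::'a list. set us \<subseteq> A \<and> length us = 0} = {[]}" by auto
  then show ?case by simp
next
  case (Suc n)
  have "(\<Sum>us\<in>{us. set us \<subseteq> A \<and> length us = Suc n}. \<Prod>i<Suc n. f i (us ! i)) =
    (\<Sum>u\<in>A. \<Sum>us\<in>{us. set us \<subseteq> A \<and> length us = n}. f 0 u * (\<Prod>i<n. f (Suc i) (us ! i)))"
    by (simp add: sum_lists_Suc[OF assms] prod.lessThan_Suc_shift del: prod.lessThan_Suc)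
  also have "\<dots> = (\<Sum>u\<in>A. f 0 u) * (\<Prod>i<n. \<Sum>u\<in>A. f (Suc i) u)"
    using Suc[of "\<lambda>i. f (Suc i)"] by (simp add: sum_distrib_left[symmetric] sum_distrib_right)
  finally show ?case by (simp add: prod.lessThan_Suc_shift del: prod.lessThan_Suc)
qed

text \<open>The second moment of the centred sum is computed by induction on the length: cross terms
  vanish by \<open>e1\<close>, so each letter adds one variance.\<close>

lemma chebyshev_lists:
  fixes P l :: "'a \<Rightarrow> real"
  assumes fin: "finite A" and P0: "\<And>a. a \<in> A \<Longrightarrow> 0 \<le> P a" and P1: "(\<Sum>a\<in>A. P a) = 1" and \<gamma>: "0 < \<gamma>" and n: "0 < n"
  defines "m \<equiv> \<Sum>a\<in>A. P a * l a"
  shows "(\<Sum>us\<in>{us. set us \<subseteq> A \<and> length us = n}. (\<Prod>i<n. P (us ! i)) *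
     (if \<bar>(\<Sum>i<n. l (us ! i)) - real n * m\<bar> \<le> real n * \<gamma> then 0 else 1)) \<le> (\<Sum>a\<in>A. P a * (l a - m)\<^sup>2) / (real n * \<gamma>\<^sup>2)"
proof -
  define V where "V = (\<Sum>a\<in>A. P a * (l a - m)\<^sup>2)"
  define g where "g a = l a - m" for a
  define L where "L n = {us. set us \<subseteq> A \<and> length us = n}" for n
  define w where "w n us = (\<Prod>i<n. P (us ! i))" for n us
  have V_g: "(\<Sum>a\<in>A. P a * (g a)\<^sup>2) = V" by (simp add: V_def g_def)
  have g0: "(\<Sum>a\<in>A. P a * g a) = 0"
    by (simp add: g_def right_diff_distrib sum_subtractf m_def sum_distrib_right[symmetric] P1)
  have S: "(\<Sum>us\<in>L (Suc n). F us) = (\<Sum>a\<in>A. \<Sum>us\<in>L n. F (a # us))" for F :: "'a list \<Rightarrow> real" and n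
    unfolding L_def by (rule sum_lists_Suc[OF fin])
  have wS: "w (Suc n) (a # us) = P a * w n us" for n a us
    by (simp add: w_def prod.lessThan_Suc_shift del: prod.lessThan_Suc)
  have gS: "(\<Sum>i<Suc n. g ((a # us) ! i)) = g a + (\<Sum>i<n. g (us ! i))" for n a us
    by (simp add: sum.lessThan_Suc_shift del: sum.lessThan_Suc)
  have e0: "(\<Sum>us\<in>L n. w n us) = 1" for n
    using sum_lists_prod[OF fin, of "\<lambda>_. P" n] P1 by (simp add: L_def w_def)
  have e1: "(\<Sum>us\<in>L n. w n us * (\<Sum>i<n. g (us ! i))) = 0" for n
  proof (induction n)
    case (Suc n)
    have "(\<Sum>us\<in>L (Suc n). w (Suc n) us * (\<Sum>i<Suc n. g (us ! i))) =
      (\<Sum>a\<in>A. \<Sum>us\<in>L n. (P a * g a) * w n us + P a * (w n us * (\<Sum>i<n. g (us ! i))))"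
      unfolding S wS gS by (intro sum.cong refl) (simp add: algebra_simps)
    also have "\<dots> = (\<Sum>a\<in>A. (P a * g a) * (\<Sum>us\<in>L n. w n us) + P a * (\<Sum>us\<in>L n. w n us * (\<Sum>i<n. g (us ! i))))"
      by (simp only: sum.distrib sum_distrib_left)
    also have "\<dots> = 0" by (simp add: e0 Suc g0)
    finally show ?case .
  qed simp
  have e2: "(\<Sum>us\<in>L n. w n us * (\<Sum>i<n. g (us ! i))\<^sup>2) = real n * V" for n
  proof (induction n)
    case (Suc n)
    have "(\<Sum>us\<in>L (Suc n). w (Suc n) us * (\<Sum>i<Suc n. g (us ! i))\<^sup>2) =
      (\<Sum>a\<in>A. \<Sum>us\<in>L n. (P a * (g a)\<^sup>2) * w n us + (2 * P a * g a) * (w n us * (\<Sum>i<n. g (us ! i)))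
         + P a * (w n us * (\<Sum>i<n. g (us ! i))\<^sup>2))"
      unfolding S wS gS by (intro sum.cong refl) (simp add: algebra_simps power2_eq_square)
    also have "\<dots> = (\<Sum>a\<in>A. (P a * (g a)\<^sup>2) * (\<Sum>us\<in>L n. w n us) + (2 * P a * g a) * (\<Sum>us\<in>L n. w n us * (\<Sum>i<n. g (us ! i)))
         + P a * (\<Sum>us\<in>L n. w n us * (\<Sum>i<n. g (us ! i))\<^sup>2))"
      by (simp only: sum.distrib sum_distrib_left)
    also have "\<dots> = V + real n * V"
      by (simp add: e0 e1 Suc sum.distrib V_g sum_distrib_right[symmetric] P1)
    finally show ?case by (simp add: algebra_simps)
  qed simp
  have w0: "0 \<le> w n us" if "us \<in> L n" for us
    unfolding w_def
  proof (rule prod_nonneg)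
    fix i assume "i \<in> {..<n}"
    then have "us ! i \<in> set us" using that by (auto simp: L_def)
    then show "0 \<le> P (us ! i)" using that by (intro P0) (auto simp: L_def)
  qed
  have "(real n * \<gamma>)\<^sup>2 * (\<Sum>us\<in>L n. w n us * (if \<bar>(\<Sum>i<n. l (us ! i)) - real n * m\<bar> \<le> real n * \<gamma> then 0 else 1))
     \<le> (\<Sum>us\<in>L n. w n us * (\<Sum>i<n. g (us ! i))\<^sup>2)"
    unfolding sum_distrib_left
  proof (rule sum_mono)
    fix us assume us: "us \<in> L n"
    have "(\<Sum>i<n. g (us ! i)) = (\<Sum>i<n. l (us ! i)) - real n * m" by (simp add: g_def sum_subtractf)
    moreover have "(real n * \<gamma>)\<^sup>2 * (if \<bar>t\<bar> \<le> real n * \<gamma> then 0 else 1) \<le> t\<^sup>2" for t :: real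
    proof (cases "\<bar>t\<bar> \<le> real n * \<gamma>")
      case False
      then have "(real n * \<gamma>)\<^sup>2 \<le> \<bar>t\<bar>\<^sup>2" using n \<gamma> by (intro power_mono) auto
      then show ?thesis using False by simp
    qed simp
    ultimately have "(real n * \<gamma>)\<^sup>2 * (if \<bar>(\<Sum>i<n. l (us ! i)) - real n * m\<bar> \<le> real n * \<gamma> then 0 else 1) \<le> (\<Sum>i<n. g (us ! i))\<^sup>2"
      by simp
    from mult_left_mono[OF this w0[OF us]]
    show "(real n * \<gamma>)\<^sup>2 * (w n us * (if \<bar>(\<Sum>i<n. l (us ! i)) - real n * m\<bar> \<le> real n * \<gamma> then 0 else 1))
        \<le> w n us * (\<Sum>i<n. g (us ! i))\<^sup>2"
      by (simp only: mult.left_commute)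
  qed
  also have "\<dots> = real n * V" by (rule e2)
  finally have "(\<Sum>us\<in>L n. w n us * (if \<bar>(\<Sum>i<n. l (us ! i)) - real n * m\<bar> \<le> real n * \<gamma> then 0 else 1)) \<le> real n * V / (real n * \<gamma>)\<^sup>2"
    using n \<gamma> by (simp only: pos_le_divide_eq zero_less_power mult_pos_pos of_nat_0_less_iff mult.commute)
  also have "\<dots> = V / (real n * \<gamma>\<^sup>2)" using n by (simp add: power2_eq_square)
  finally show ?thesis unfolding L_def w_def V_def .
qed

text \<open>Both orders of the chain rule for the information between \<open>F\<close> and the pair
  \<open>A\<close>, \<open>D\<close> given \<open>C\<close>, where \<open>D\<close> adds nothing to
  \<open>A\<close>. With \<open>A\<close> the observation of the encoder and \<open>D\<close> that
  of the decoder, the binning rate is the covering rate minus what the decoder's test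
  recovers.\<close>

lemma (in fin_space) cmi_chain_diff:
  assumes "ci S P F D (C \<bowtie> A)"
  shows "cond_mutual_info S P A F C - cond_mutual_info S P D F C = cond_mutual_info S P A F (C \<bowtie> D)"
proof -
  have 0: "cond_mutual_info S P F D (C \<bowtie> A) = 0" by (rule ci_cmi_zero[OF assms])
  have e: "ent S P (F \<bowtie> C \<bowtie> A) = ent S P (A \<bowtie> F \<bowtie> C)"
    "ent S P (D \<bowtie> C \<bowtie> A) = ent S P (A \<bowtie> C \<bowtie> D)"
    "ent S P (F \<bowtie> D \<bowtie> C \<bowtie> A) = ent S P (A \<bowtie> F \<bowtie> C \<bowtie> D)"
    "ent S P (C \<bowtie> A) = ent S P (A \<bowtie> C)"
    "ent S P (F \<bowtie> C \<bowtie> D) = ent S P (D \<bowtie> F \<bowtie> C)"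
    "ent S P (C \<bowtie> D) = ent S P (D \<bowtie> C)"
    by (auto intro!: ent_cong)
  show ?thesis using 0 unfolding cmi_ent e by linarith
qed

text \<open>Bayes' rule: the argument of the logarithm in the information is a likelihood ratio of
  \<open>F\<close> with and without knowledge of \<open>A\<close>. This links the products of
  kernels compared by encoders and decoders to information quantities.\<close>

lemma (in fin_space) kern_ratio:
  assumes w: "\<omega> \<in> S" "0 < P \<omega>"
  shows "kern S P (C \<bowtie> A) F (C \<omega>, A \<omega>) (F \<omega>) / kern S P C F (C \<omega>) (F \<omega>) = idens S P A F C \<omega>"
    and "0 < kern S P (C \<bowtie> A) F (C \<omega>, A \<omega>) (F \<omega>)" and "0 < kern S P C F (C \<omega>) (F \<omega>)"
proof -
  have p1: "0 < pr S P C (C \<omega>)" "0 < pr S P (C \<bowtie> A) (C \<omega>, A \<omega>)"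
    "0 < pr S P (F \<bowtie> C) (F \<omega>, C \<omega>)" "0 < pr S P (F \<bowtie> C \<bowtie> A) (F \<omega>, C \<omega>, A \<omega>)"
    by (rule pr_pos[OF w, of C] pr_pos[OF w, of "C \<bowtie> A"] pr_pos[OF w, of "F \<bowtie> C"]
        pr_pos[OF w, of "F \<bowtie> C \<bowtie> A"])+
  then show "0 < kern S P (C \<bowtie> A) F (C \<omega>, A \<omega>) (F \<omega>)" "0 < kern S P C F (C \<omega>) (F \<omega>)"
    by (simp_all add: kern_def)
  have "pr S P (C \<bowtie> A) (C \<omega>, A \<omega>) = pr S P (A \<bowtie> C) (A \<omega>, C \<omega>)"
    "pr S P (F \<bowtie> C \<bowtie> A) (F \<omega>, C \<omega>, A \<omega>) = pr S P (A \<bowtie> F \<bowtie> C) (A \<omega>, F \<omega>, C \<omega>)"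
    by (rule pr_cong_events; auto)+
  then show "kern S P (C \<bowtie> A) F (C \<omega>, A \<omega>) (F \<omega>) / kern S P C F (C \<omega>) (F \<omega>) = idens S P A F C \<omega>"
    using p1 by (simp add: kern_def idens_def prob_eq_pr)
qed

lemma log_prod_sum:
  assumes "\<And>i. i < n \<Longrightarrow> 0 < f i"
  shows "(\<Sum>i<n. log 2 (f i)) = log 2 (\<Prod>i<(n::nat). f i)"
  using assms
proof (induction n)
  case (Suc n)
  have "0 < (\<Prod>i<n. f i)" using Suc.prems by (intro prod_pos) auto
  then show ?case using Suc.IH Suc.prems log_mult_pos[of "\<Prod>i<n. f i" "f n" 2] by simp
qed simp

lemma prod_le_powr:
  assumes "\<And>i. i < n \<Longrightarrow> 0 < a i" "\<And>i. i < n \<Longrightarrow> 0 < b i" "(\<Sum>i<n. log 2 (a i / b i)) \<le> t"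
  shows "(\<Prod>i<n. a i) \<le> 2 powr t * (\<Prod>i<(n::nat). b i :: real)"
proof -
  have pa: "0 < (\<Prod>i<n. a i)" and pb: "0 < (\<Prod>i<n. b i)" using assms by (auto intro: prod_pos)
  have "(\<Sum>i<n. log 2 (a i / b i)) = log 2 (\<Prod>i<n. a i / b i)"
    using assms by (intro log_prod_sum) auto
  then have "log 2 ((\<Prod>i<n. a i) / (\<Prod>i<n. b i)) \<le> t" using assms(3) by (simp add: prod_dividef)
  then have "(\<Prod>i<n. a i) / (\<Prod>i<n. b i) \<le> 2 powr t" using pa pb by (simp add: log_le_iff)
  then show ?thesis using pb by (simp add: field_simps)
qed

lemma powr_le_prod:
  assumes "\<And>i. i < n \<Longrightarrow> 0 < a i" "\<And>i. i < n \<Longrightarrow> 0 < b i" "t \<le> (\<Sum>i<n. log 2 (a i / b i))"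
  shows "2 powr t * (\<Prod>i<n. b i) \<le> (\<Prod>i<(n::nat). a i :: real)"
proof -
  have pa: "0 < (\<Prod>i<n. a i)" and pb: "0 < (\<Prod>i<n. b i)" using assms by (auto intro: prod_pos)
  have "(\<Sum>i<n. log 2 (a i / b i)) = log 2 (\<Prod>i<n. a i / b i)"
    using assms by (intro log_prod_sum) auto
  then have "t \<le> log 2 ((\<Prod>i<n. a i) / (\<Prod>i<n. b i))" using assms(3) by (simp add: prod_dividef)
  then have "2 powr t \<le> (\<Prod>i<n. a i) / (\<Prod>i<n. b i)" using pa pb by (simp add: le_log_iff)
  then show ?thesis using pb by (simp add: field_simps)
qed

text \<open>Change of measure: where the test passes, the probability under \<open>b\<close> is at
  most that under \<open>a\<close> divided by \<open>\<theta>\<close>, and the latter sums to one.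
  So an independently drawn wrong codeword passes with probability at most
  \<open>1 / \<theta>\<close>.\<close>

lemma likelihood_test_sum:
  fixes a b :: "nat \<Rightarrow> nat \<Rightarrow> real"
  assumes "0 < \<theta>" "\<And>i u. i < n \<Longrightarrow> u < K \<Longrightarrow> 0 \<le> a i u" "\<And>i. i < n \<Longrightarrow> (\<Sum>u<K. a i u) = 1"
  shows "(\<Sum>us\<in>{us. set us \<subseteq> {..<K} \<and> length us = n}.
     if \<theta> * (\<Prod>i<n. b i (us ! i)) \<le> (\<Prod>i<n. a i (us ! i)) then \<Prod>i<n. b i (us ! i) else 0) \<le> 1 / \<theta>"
proof -
  have "(\<Sum>us\<in>{us. set us \<subseteq> {..<K} \<and> length us = n}.
     if \<theta> * (\<Prod>i<n. b i (us ! i)) \<le> (\<Prod>i<n. a i (us ! i)) then \<Prod>i<n. b i (us ! i) else 0)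
    \<le> (\<Sum>us\<in>{us. set us \<subseteq> {..<K} \<and> length us = n}. (\<Prod>i<n. a i (us ! i)) / \<theta>)"
  proof (rule sum_mono)
    fix us assume us: "us \<in> {us. set us \<subseteq> {..<K} \<and> length us = n}"
    have "0 \<le> (\<Prod>i<n. a i (us ! i))"
    proof (intro prod_nonneg ballI)
      fix i assume i: "i \<in> {..<n}"
      then have "us ! i \<in> set us" using us by auto
      then have "us ! i \<in> {..<K}" using us by blast
      then show "0 \<le> a i (us ! i)" using assms(2) i by auto
    qed
    then show "(if \<theta> * (\<Prod>i<n. b i (us ! i)) \<le> (\<Prod>i<n. a i (us ! i)) then \<Prod>i<n. b i (us ! i) else 0) \<le> (\<Prod>i<n. a i (us ! i)) / \<theta>"
      using assms(1) by (auto simp: field_simps)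
  qed
  also have "\<dots> = (\<Prod>i<n. \<Sum>u<K. a i u) / \<theta>"
    by (simp add: sum_divide_distrib[symmetric] sum_lists_prod)
  also have "\<dots> = 1 / \<theta>" using assms(3) by simp
  finally show ?thesis .
qed

section \<open>The joint law of the test channel and its information densities\<close>

locale test_channel =
  fixes p :: "'x::finite \<times> 'y::finite \<times> 'z::finite \<Rightarrow> real" and K :: nat
    and qU :: "'y \<Rightarrow> nat \<Rightarrow> real" and qV :: "nat \<Rightarrow> 'z \<Rightarrow> nat \<Rightarrow> real" and qW :: "nat \<Rightarrow> nat \<Rightarrow> 'x \<Rightarrow> nat \<Rightarrow> real"
  assumes pmf: "is_pmf p" and markov: "markov_YXZ p"
    and kU: "is_kernel K qU" and kV: "is_kernel K (\<lambda>(u, z). qV u z)" and kW: "is_kernel K (\<lambda>(u, v, x). qW u v x)"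
begin

definition S :: "(('x \<times> 'y \<times> 'z) \<times> nat \<times> nat \<times> nat) set" where "S = aux_space K"
definition P :: "('x \<times> 'y \<times> 'z) \<times> nat \<times> nat \<times> nat \<Rightarrow> real" where "P = joint_law p qU qV qW"
definition X :: "('x \<times> 'y \<times> 'z) \<times> nat \<times> nat \<times> nat \<Rightarrow> 'x" where "X \<omega> = fst (fst \<omega>)"
definition Y :: "('x \<times> 'y \<times> 'z) \<times> nat \<times> nat \<times> nat \<Rightarrow> 'y" where "Y \<omega> = fst (snd (fst \<omega>))"
definition Z :: "('x \<times> 'y \<times> 'z) \<times> nat \<times> nat \<times> nat \<Rightarrow> 'z" where "Z \<omega> = snd (snd (fst \<omega>))"
definition U :: "('x \<times> 'y \<times> 'z) \<times> nat \<times> nat \<times> nat \<Rightarrow> nat" where "U \<omega> = fst (snd \<omega>)"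
definition V :: "('x \<times> 'y \<times> 'z) \<times> nat \<times> nat \<times> nat \<Rightarrow> nat" where "V \<omega> = fst (snd (snd \<omega>))"
definition W :: "('x \<times> 'y \<times> 'z) \<times> nat \<times> nat \<times> nat \<Rightarrow> nat" where "W \<omega> = snd (snd (snd \<omega>))"

lemmas rv_defs = X_def Y_def Z_def U_def V_def W_def

lemma p_nonneg: "0 \<le> p t" and p_sum: "(\<Sum>t\<in>UNIV. p t) = 1"
  using pmf unfolding is_pmf_def by blast+

lemma qU0: "u < K \<Longrightarrow> 0 \<le> qU y u" and qU1: "(\<Sum>u<K. qU y u) = 1"
  using kU by (auto simp: is_kernel_def)
lemma qV0: "v < K \<Longrightarrow> 0 \<le> qV u z v" and qV1: "(\<Sum>v<K. qV u z v) = 1"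
  using kV by (auto simp: is_kernel_def)
lemma qW0: "w < K \<Longrightarrow> 0 \<le> qW u v x w" and qW1: "(\<Sum>w<K. qW u v x w) = 1"
  using kW by (auto simp: is_kernel_def)

lemma K0: "0 < K"
  using qU1[of undefined] by (cases K) auto

lemma P_apply: "P (t, u, v, w) = p t * qU (fst (snd t)) u * qV u (snd (snd t)) v * qW u v (fst t) w"
  by (cases t) (simp add: P_def joint_law_def)

lemma finS: "finite S" by (simp add: S_def aux_space_def)

sublocale fin_space S P
  using finS joint_law_nonneg[OF p_nonneg kU kV kW] by unfold_locales (auto simp: S_def P_def)

lemma rv_bounds: "\<omega> \<in> S \<Longrightarrow> U \<omega> < K" "\<omega> \<in> S \<Longrightarrow> V \<omega> < K" "\<omega> \<in> S \<Longrightarrow> W \<omega> < K"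
  by (auto simp: S_def aux_space_def rv_defs)

text \<open>The laws before the last two kernels, or the last one, are attached. There the kernel
  under study is the final one, as \<open>kernel_factor\<close> requires.\<close>

definition S1 :: "(('x \<times> 'y \<times> 'z) \<times> nat) set" where "S1 = UNIV \<times> {..<K}"
definition P1 :: "('x \<times> 'y \<times> 'z) \<times> nat \<Rightarrow> real" where "P1 = (\<lambda>(t, u). p t * qU (fst (snd t)) u)"
definition S2 :: "(('x \<times> 'y \<times> 'z) \<times> nat \<times> nat) set" where "S2 = UNIV \<times> {..<K} \<times> {..<K}"
definition P2 :: "('x \<times> 'y \<times> 'z) \<times> nat \<times> nat \<Rightarrow> real" where
  "P2 = (\<lambda>(t, u, v). p t * qU (fst (snd t)) u * qV u (snd (snd t)) v)"

lemma pr_S_unfold: "pr S P G a = (\<Sum>t\<in>UNIV. \<Sum>u<K. \<Sum>v<K. \<Sum>w<K. if G (t, u, v, w) = a then P (t, u, v, w) else 0)"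
  unfolding pr_def S_def aux_space_def sum_pair ..

lemma marginal2: "pr S P (\<lambda>\<omega>. F (fst \<omega>, U \<omega>, V \<omega>)) a = pr S2 P2 F a"
proof -
  have "(\<Sum>w<K. if F (t, u, v) = a then P (t, u, v, w) else 0) = (if F (t, u, v) = a then P2 (t, u, v) else 0)" for t u v
    by (simp add: P_apply P2_def sum_distrib_left[symmetric] qW1)
  then show ?thesis unfolding pr_S_unfold by (simp add: pr_def S2_def sum_pair U_def V_def)
qed

lemma marginal1: "pr S P (\<lambda>\<omega>. F (fst \<omega>, U \<omega>)) a = pr S1 P1 F a"
proof -
  have "pr S P (\<lambda>\<omega>. F (fst \<omega>, U \<omega>)) a = pr S2 P2 (\<lambda>\<omega>. F (fst \<omega>, fst (snd \<omega>))) a"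
    using marginal2[of "\<lambda>\<omega>. F (fst \<omega>, fst (snd \<omega>))" a] by simp
  also have "\<dots> = pr S1 P1 F a"
  proof -
    have "(\<Sum>v<K. if F (t, u) = a then P2 (t, u, v) else 0) = (if F (t, u) = a then P1 (t, u) else 0)" for t u
      by (simp add: P1_def P2_def sum_distrib_left[symmetric] qV1)
    then show ?thesis by (simp add: pr_def S1_def S2_def sum_pair)
  qed
  finally show ?thesis .
qed

lemma level1: "ci S P U (X \<bowtie> Z) Y" "u < K \<Longrightarrow> pr S P (U \<bowtie> Y) (u, y) = qU y u * pr S P Y y"
proof -
  let ?F = "\<lambda>(u::nat, (x::'x, z::'z), y::'y). ((x, y, z), u)"
  let ?B = "\<lambda>(t::'x \<times> 'y \<times> 'z, u::nat). (fst t, snd (snd t))" and ?C = "\<lambda>(t::'x \<times> 'y \<times> 'z, u::nat). fst (snd t)"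
  have S1: "S1 = ?F ` ({..<K} \<times> UNIV \<times> UNIV)"
    by (auto simp: S1_def image_iff)
  note kf = kernel_factor[of "{..<K}" UNIV UNIV S1 ?F snd ?B ?C P1 "\<lambda>u y. qU y u" "\<lambda>(x, z) y. p (x, y, z)", OF _ _ _ S1]
  have 1: "ci S1 P1 snd ?B ?C" by (rule kf(1)) (auto simp: P1_def qU1)
  have 2: "u < K \<Longrightarrow> pr S1 P1 (\<lambda>\<omega>. (snd \<omega>, ?C \<omega>)) (u, y) = qU y u * pr S1 P1 ?C y" by (rule kf(2)) (auto simp: P1_def qU1)
  have "ci S P U (X \<bowtie> Z) Y \<longleftrightarrow> ci S1 P1 snd ?B ?C"
    by (rule ci_law) (use marginal1[of "\<lambda>\<omega>. (snd \<omega>, ?B \<omega>, ?C \<omega>)"] in \<open>simp add: rv_defs\<close>)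
  then show "ci S P U (X \<bowtie> Z) Y" using 1 by simp
  show "u < K \<Longrightarrow> pr S P (U \<bowtie> Y) (u, y) = qU y u * pr S P Y y"
    using 2 marginal1[of "\<lambda>\<omega>. (snd \<omega>, ?C \<omega>)"] marginal1[of ?C] by (simp add: rv_defs[abs_def])
qed

lemma level2: "ci S P V (X \<bowtie> Y) (U \<bowtie> Z)"
  "v < K \<Longrightarrow> pr S P (V \<bowtie> U \<bowtie> Z) (v, u, z) = qV u z v * pr S P (U \<bowtie> Z) (u, z)"
proof -
  let ?F = "\<lambda>(v::nat, (x::'x, y::'y), (u::nat, z::'z)). ((x, y, z), u, v)"
  let ?A = "\<lambda>(t::'x \<times> 'y \<times> 'z, u::nat, v::nat). v" and ?B = "\<lambda>(t::'x \<times> 'y \<times> 'z, u::nat, v::nat). (fst t, fst (snd t))"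
    and ?C = "\<lambda>(t::'x \<times> 'y \<times> 'z, u::nat, v::nat). (u, snd (snd t))"
  have S2: "S2 = ?F ` ({..<K} \<times> UNIV \<times> ({..<K} \<times> UNIV))"
    by (auto simp: S2_def image_iff)
  note kf = kernel_factor[of "{..<K}" UNIV "{..<K} \<times> UNIV" S2 ?F ?A ?B ?C P2 "\<lambda>v (u, z). qV u z v" "\<lambda>(x, y) (u, z). p (x, y, z) * qU y u", OF _ _ _ S2]
  have 1: "ci S2 P2 ?A ?B ?C" by (rule kf(1)) (auto simp: P2_def qV1)
  have 2: "v < K \<Longrightarrow> pr S2 P2 (\<lambda>\<omega>. (?A \<omega>, ?C \<omega>)) (v, u, z) = (\<lambda>v (u, z). qV u z v) v (u, z) * pr S2 P2 ?C (u, z)"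
    by (rule kf(2)) (auto simp: P2_def qV1)
  have "ci S P V (X \<bowtie> Y) (U \<bowtie> Z) \<longleftrightarrow> ci S2 P2 ?A ?B ?C"
    by (rule ci_law) (use marginal2[of "\<lambda>\<omega>. (?A \<omega>, ?B \<omega>, ?C \<omega>)"] in \<open>simp add: rv_defs\<close>)
  then show "ci S P V (X \<bowtie> Y) (U \<bowtie> Z)" using 1 by simp
  show "v < K \<Longrightarrow> pr S P (V \<bowtie> U \<bowtie> Z) (v, u, z) = qV u z v * pr S P (U \<bowtie> Z) (u, z)"
    using 2 marginal2[of "\<lambda>\<omega>. (?A \<omega>, ?C \<omega>)"] marginal2[of ?C] by (simp add: rv_defs[abs_def])
qed

lemma level3: "ci S P W (Y \<bowtie> Z) ((U \<bowtie> V) \<bowtie> X)"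
  "w < K \<Longrightarrow> pr S P (W \<bowtie> (U \<bowtie> V) \<bowtie> X) (w, (u, v), x) = qW u v x w * pr S P ((U \<bowtie> V) \<bowtie> X) ((u, v), x)"
proof -
  let ?F = "\<lambda>(w::nat, (y::'y, z::'z), ((u::nat, v::nat), x::'x)). ((x, y, z), u, v, w)"
  have SF: "S = ?F ` ({..<K} \<times> UNIV \<times> (({..<K} \<times> {..<K}) \<times> UNIV))"
    by (auto simp: S_def aux_space_def image_iff)
  note kf = kernel_factor[of "{..<K}" UNIV "({..<K} \<times> {..<K}) \<times> UNIV" S ?F W "Y \<bowtie> Z" "(U \<bowtie> V) \<bowtie> X" P
     "\<lambda>w ((u, v), x). qW u v x w" "\<lambda>(y, z) ((u, v), x). p (x, y, z) * qU y u * qV u z v", OF _ _ _ SF]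
  show "ci S P W (Y \<bowtie> Z) ((U \<bowtie> V) \<bowtie> X)" by (rule kf(1)) (auto simp: P_apply rv_defs qW1)
  have "w < K \<Longrightarrow> pr S P (W \<bowtie> (U \<bowtie> V) \<bowtie> X) (w, (u, v), x) =
     (\<lambda>w ((u, v), x). qW u v x w) w ((u, v), x) * pr S P ((U \<bowtie> V) \<bowtie> X) ((u, v), x)"
    by (rule kf(2)) (auto simp: P_apply rv_defs qW1)
  then show "w < K \<Longrightarrow> pr S P (W \<bowtie> (U \<bowtie> V) \<bowtie> X) (w, (u, v), x) = qW u v x w * pr S P ((U \<bowtie> V) \<bowtie> X) ((u, v), x)"
    by simp
qed

text \<open>Here the Markov chain of the source enters achievability: \<open>Z\<close> depends on
  \<open>Y\<close> and \<open>U\<close> only through \<open>X\<close>. The unit component of the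
  condition makes the result match \<open>cmi_chain_diff\<close> with a constant
  \<open>C\<close>.\<close>

lemma ci_UZ_X: "ci S P U Z (\<lambda>\<omega>. ((), X \<omega>))"
proof -
  define pxy where "pxy x y = (\<Sum>z\<in>UNIV. p (x, y, z))" for x y
  define pzx where "pzx x z = (\<Sum>y\<in>UNIV. p (x, y, z)) / (\<Sum>y\<in>UNIV. \<Sum>z'\<in>UNIV. p (x, y, z'))" for x z
  have pf: "p (x, y, z) = pxy x y * pzx x z" for x y z
    using markov unfolding markov_YXZ_def pxy_def pzx_def by blast
  let ?A = "\<lambda>(t::'x \<times> 'y \<times> 'z, u::nat). snd (snd t)" and ?B = "\<lambda>(t::'x \<times> 'y \<times> 'z, u::nat). (fst (snd t), u)"
    and ?C = "\<lambda>(t::'x \<times> 'y \<times> 'z, u::nat). fst t"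
  have "ci S1 P1 ?A ?B ?C"
  proof (rule ci_rectangular[where f = "\<lambda>z x. pzx x z" and g = "\<lambda>(y, u) x. pxy x y * qU y u"])
    show "finite S1" by (simp add: S1_def)
    show "inj_on (\<lambda>\<omega>. (?A \<omega>, ?B \<omega>, ?C \<omega>)) S1" by (auto simp: inj_on_def)
    fix \<omega>1 \<omega>2 assume "\<omega>1 \<in> S1" "\<omega>2 \<in> S1"
    then show "\<exists>\<omega>\<in>S1. ?A \<omega> = ?A \<omega>1 \<and> ?B \<omega> = ?B \<omega>2 \<and> ?C \<omega> = ?C \<omega>1"
      by (intro bexI[of _ "((fst (fst \<omega>1), fst (snd (fst \<omega>2)), snd (snd (fst \<omega>1))), snd \<omega>2)"]) (auto simp: S1_def)
  next
    fix \<omega> :: "('x \<times> 'y \<times> 'z) \<times> nat"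
    obtain x y z u where "\<omega> = ((x, y, z), u)" by (metis surj_pair)
    then show "P1 \<omega> = pzx (?C \<omega>) (?A \<omega>) * (case ?B \<omega> of (y, u) \<Rightarrow> \<lambda>x. pxy x y * qU y u) (?C \<omega>)"
      by (simp add: P1_def pf)
  qed
  moreover have "ci S P Z (Y \<bowtie> U) X \<longleftrightarrow> ci S1 P1 ?A ?B ?C"
    by (rule ci_law) (use marginal1[of "\<lambda>\<omega>. (?A \<omega>, ?B \<omega>, ?C \<omega>)"] in \<open>simp add: rv_defs\<close>)
  ultimately have c: "ci S P Z (Y \<bowtie> U) X" by simp
  show ?thesis by (rule ci_sym, rule ci_derive[OF finS c]) auto
qed

lemma P_sum: "(\<Sum>\<omega>\<in>S. P \<omega>) = 1"
proof -
  have "(\<Sum>\<omega>\<in>S. P \<omega>) = pr S P (\<lambda>\<omega>. ()) ()" by (simp add: pr_def)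
  also have "\<dots> = pr S1 P1 (\<lambda>\<omega>. ()) ()" by (rule marginal1)
  also have "\<dots> = 1" by (simp add: pr_def S1_def P1_def sum_pair sum_distrib_left[symmetric] qU1 p_sum)
  finally show ?thesis .
qed

text \<open>\<open>QU\<close>, \<open>QV\<close> and \<open>QW\<close> are the laws from which
  codewords are drawn, given the earlier words. \<open>TX\<close>, \<open>TZ\<close>,
  \<open>TV\<close> and \<open>TW\<close> also condition on the observation of a decoder and serve
  in its test. Unit conditions make the first step an instance of \<open>kern_ratio\<close>.\<close>

definition QU where "QU = kern S P (\<lambda>_. ()) U ()"
definition TX where "TX x = kern S P (\<lambda>\<omega>. ((), X \<omega>)) U ((), x)" for x
definition TZ where "TZ z = kern S P (\<lambda>\<omega>. ((), Z \<omega>)) U ((), z)" for z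
definition QV where "QV u = kern S P U V u" for u
definition TV where "TV u x = kern S P (U \<bowtie> X) V (u, x)" for u x
definition QW where "QW s = kern S P (U \<bowtie> V) W s" for s
definition TW where "TW s z = kern S P ((U \<bowtie> V) \<bowtie> Z) W (s, z)" for s z

lemma kern_qU:
  assumes "\<omega> \<in> S" "0 < P \<omega>"
  shows "kern S P (\<lambda>\<omega>. ((), Y \<omega>)) U ((), Y \<omega>) (U \<omega>) = qU (Y \<omega>) (U \<omega>)"
proof -
  have "pr S P (\<lambda>\<omega>. (U \<omega>, (), Y \<omega>)) (u, (), y) = pr S P (U \<bowtie> Y) (u, y)"
    "pr S P (\<lambda>\<omega>. ((), Y \<omega>)) ((), y) = pr S P Y y" for u y by (rule pr_cong_events; simp)+
  then show ?thesis using level1(2)[OF rv_bounds(1)[OF assms(1)], of "Y \<omega>"] pr_pos[OF assms, of Y] by (simp add: kern_def)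
qed

lemma kern_qV:
  assumes "\<omega> \<in> S" "0 < P \<omega>"
  shows "kern S P (U \<bowtie> Z) V (U \<omega>, Z \<omega>) (V \<omega>) = qV (U \<omega>) (Z \<omega>) (V \<omega>)"
  using level2(2)[OF rv_bounds(2)[OF assms(1)], of "U \<omega>" "Z \<omega>"] pr_pos[OF assms, of "U \<bowtie> Z"] by (simp add: kern_def)

lemma kern_qW:
  assumes "\<omega> \<in> S" "0 < P \<omega>"
  shows "kern S P ((U \<bowtie> V) \<bowtie> X) W ((U \<omega>, V \<omega>), X \<omega>) (W \<omega>) = qW (U \<omega>) (V \<omega>) (X \<omega>) (W \<omega>)"
  using level3(2)[OF rv_bounds(3)[OF assms(1)], of "U \<omega>" "V \<omega>" "X \<omega>"] pr_pos[OF assms, of "(U \<bowtie> V) \<bowtie> X"]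
  by (simp add: kern_def)

lemma mean_density:
  assumes "\<And>\<omega>. \<omega> \<in> S \<Longrightarrow> 0 < P \<omega> \<Longrightarrow> kern S P (C \<bowtie> A) F (C \<omega>, A \<omega>) (F \<omega>) = k \<omega>"
  shows "(\<Sum>\<omega>\<in>S. P \<omega> * log 2 (k \<omega> / kern S P C F (C \<omega>) (F \<omega>))) = cond_mutual_info S P A F C"
  unfolding cmi_idens
proof (intro sum.cong refl)
  fix \<omega> assume w: "\<omega> \<in> S"
  show "P \<omega> * log 2 (k \<omega> / kern S P C F (C \<omega>) (F \<omega>)) = P \<omega> * log 2 (idens S P A F C \<omega>)"
  proof (cases "P \<omega> = 0")
    case False
    then have "0 < P \<omega>" using nn[OF w] by simp
    then show ?thesis using kern_ratio(1)[OF w, of C A F] assms[OF w] by simp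
  qed simp
qed

lemma kern_pos:
  assumes w: "\<omega> \<in> S" "0 < P \<omega>"
  shows "0 < QU (U \<omega>)" "0 < qU (Y \<omega>) (U \<omega>)" "0 < TX (X \<omega>) (U \<omega>)" "0 < TZ (Z \<omega>) (U \<omega>)"
    "0 < QV (U \<omega>) (V \<omega>)" "0 < qV (U \<omega>) (Z \<omega>) (V \<omega>)" "0 < TV (U \<omega>) (X \<omega>) (V \<omega>)"
    "0 < QW (U \<omega>, V \<omega>) (W \<omega>)" "0 < qW (U \<omega>) (V \<omega>) (X \<omega>) (W \<omega>)" "0 < TW (U \<omega>, V \<omega>) (Z \<omega>) (W \<omega>)"
  using kern_ratio(3)[OF w, of "\<lambda>_. ()" U] kern_ratio(2)[OF w, of "\<lambda>_. ()" Y U] kern_ratio(2)[OF w, of "\<lambda>_. ()" X U]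
    kern_ratio(2)[OF w, of "\<lambda>_. ()" Z U] kern_ratio(3)[OF w, of U V] kern_ratio(2)[OF w, of U Z V] kern_ratio(2)[OF w, of U X V]
    kern_ratio(3)[OF w, of "U \<bowtie> V" W] kern_ratio(2)[OF w, of "U \<bowtie> V" X W]
    kern_ratio(2)[OF w, of "U \<bowtie> V" Z W] kern_qU[OF w] kern_qV[OF w] kern_qW[OF w]
  by (simp_all add: QU_def TX_def TZ_def QV_def TV_def QW_def TW_def)

lemma means:
  "(\<Sum>\<omega>\<in>S. P \<omega> * log 2 (qU (Y \<omega>) (U \<omega>) / QU (U \<omega>))) = cond_mutual_info S P Y U (\<lambda>_. ())"
  "(\<Sum>\<omega>\<in>S. P \<omega> * log 2 (TX (X \<omega>) (U \<omega>) / QU (U \<omega>))) = cond_mutual_info S P X U (\<lambda>_. ())"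
  "(\<Sum>\<omega>\<in>S. P \<omega> * log 2 (TZ (Z \<omega>) (U \<omega>) / QU (U \<omega>))) = cond_mutual_info S P Z U (\<lambda>_. ())"
  "(\<Sum>\<omega>\<in>S. P \<omega> * log 2 (qV (U \<omega>) (Z \<omega>) (V \<omega>) / QV (U \<omega>) (V \<omega>))) = cond_mutual_info S P Z V U"
  "(\<Sum>\<omega>\<in>S. P \<omega> * log 2 (TV (U \<omega>) (X \<omega>) (V \<omega>) / QV (U \<omega>) (V \<omega>))) = cond_mutual_info S P X V U"
  "(\<Sum>\<omega>\<in>S. P \<omega> * log 2 (qW (U \<omega>) (V \<omega>) (X \<omega>) (W \<omega>) / QW (U \<omega>, V \<omega>) (W \<omega>))) = cond_mutual_info S P X W (U \<bowtie> V)"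
  "(\<Sum>\<omega>\<in>S. P \<omega> * log 2 (TW (U \<omega>, V \<omega>) (Z \<omega>) (W \<omega>) / QW (U \<omega>, V \<omega>) (W \<omega>))) = cond_mutual_info S P Z W (U \<bowtie> V)"
  unfolding QU_def TX_def TZ_def QV_def TV_def QW_def TW_def
  by (rule mean_density; simp add: kern_qU kern_qV kern_qW)+

text \<open>The equations turn covering exponents minus test exponents into the rates of the region.
  The inequality is data processing along \<open>U - X - Z\<close>; it allows a single threshold for
  both tests of the first word.\<close>

lemma rate_differences:
  "cond_mutual_info S P Y U (\<lambda>_. ()) - cond_mutual_info S P Z U (\<lambda>_. ()) = cond_mutual_info S P Y U Z"
  "cond_mutual_info S P Z U (\<lambda>_. ()) \<le> cond_mutual_info S P X U (\<lambda>_. ())"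
  "cond_mutual_info S P Z V U - cond_mutual_info S P X V U = cond_mutual_info S P Z V (U \<bowtie> X)"
  "cond_mutual_info S P X W (U \<bowtie> V) - cond_mutual_info S P Z W (U \<bowtie> V) =
     cond_mutual_info S P X W (U \<bowtie> V \<bowtie> Z)"
proof -
  have c1: "ci S P U Z (\<lambda>\<omega>. ((), Y \<omega>))" by (rule ci_derive[OF finS level1(1)]) auto
  have "cond_mutual_info S P Y U (\<lambda>\<omega>. ((), Z \<omega>)) = cond_mutual_info S P Y U Z" by (rule cmi_cong) auto
  then show "cond_mutual_info S P Y U (\<lambda>_. ()) - cond_mutual_info S P Z U (\<lambda>_. ()) = cond_mutual_info S P Y U Z"
    using cmi_chain_diff[OF c1] by simp
  show "cond_mutual_info S P Z U (\<lambda>_. ()) \<le> cond_mutual_info S P X U (\<lambda>_. ())"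
    using cmi_chain_diff[OF ci_UZ_X] cmi_nonneg[of X U "\<lambda>\<omega>. ((), Z \<omega>)"] by simp
  have c2: "ci S P V X (U \<bowtie> Z)" by (rule ci_derive[OF finS level2(1)]) auto
  show "cond_mutual_info S P Z V U - cond_mutual_info S P X V U = cond_mutual_info S P Z V (U \<bowtie> X)"
    using cmi_chain_diff[OF c2] by simp
  have c3: "ci S P W Z ((U \<bowtie> V) \<bowtie> X)" by (rule ci_derive[OF finS level3(1)]) auto
  have "cond_mutual_info S P X W ((U \<bowtie> V) \<bowtie> Z) = cond_mutual_info S P X W (U \<bowtie> V \<bowtie> Z)" by (rule cmi_cong) auto
  then show "cond_mutual_info S P X W (U \<bowtie> V) - cond_mutual_info S P Z W (U \<bowtie> V) =
     cond_mutual_info S P X W (U \<bowtie> V \<bowtie> Z)"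
    using cmi_chain_diff[OF c3] by simp
qed

end

section \<open>Codebook sizes and error exponents\<close>

text \<open>\<open>a\<close> is the covering exponent and \<open>b\<close> the exponent of the test.
  The codebook is larger than the truncation level \<open>c\<close> by the factor
  \<open>2 powr (real n * \<gamma>)\<close>, so the bound on failure of rejection sampling is doubly
  exponentially small. The collision exponent is at most \<open>- (real n * \<gamma>)\<close>, since
  \<open>4 * \<gamma> \<le> \<delta>\<close>. The \<open>8\<close> collects a factor
  \<open>2\<close> from rounding \<open>L\<close>, one from rounding \<open>M\<close> and the one in
  the bound on \<open>\<tau>\<close>.\<close>

lemma rate_error_bound:
  fixes a b R \<delta> \<gamma> :: real
  assumes a: "0 \<le> a" and ab: "a - b \<le> R" and R: "0 \<le> R" and \<gamma>: "0 < \<gamma>" "8 * \<gamma> \<le> \<delta>" and n: "0 < n"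
    and \<tau>: "\<tau> \<le> 2 / 2 powr (real n * (b - \<gamma>))"
  defines "c \<equiv> 2 powr (real n * (a + \<gamma>))" and "L \<equiv> nat \<lceil>2 powr (real n * (a + 2 * \<gamma>))\<rceil>"
    and "M \<equiv> nat \<lfloor>2 powr (real n * (R + \<delta>))\<rfloor>"
  shows "0 < L" "0 < M" "real M \<le> 2 powr (real n * (R + \<delta>))"
    "exp (- (real L / (2 * c))) + real L * \<tau> / real M \<le> exp (- (2 powr (real n * \<gamma>) / 2)) + 8 * 2 powr (- (real n * \<gamma>))"
proof -
  define x where "x = 2 powr (real n * (a + 2 * \<gamma>))"
  define y where "y = 2 powr (real n * (R + \<delta>))"
  have x1: "1 \<le> x" unfolding x_def using a \<gamma> by (intro ge_one_powr_ge_zero) auto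
  have y1: "1 \<le> y" unfolding y_def using R \<gamma> by (intro ge_one_powr_ge_zero) auto
  have L: "x \<le> real L" "real L \<le> 2 * x"
  proof -
    have "x \<le> of_int \<lceil>x\<rceil>" "of_int \<lceil>x\<rceil> < x + 1" by linarith+
    moreover have "real L = of_int \<lceil>x\<rceil>" using x1 by (simp add: L_def x_def)
    ultimately show "x \<le> real L" "real L \<le> 2 * x" using x1 by linarith+
  qed
  have M: "real M \<le> y" "y \<le> 2 * real M" "1 \<le> real M"
  proof -
    have "of_int \<lfloor>y\<rfloor> \<le> y" "y < of_int \<lfloor>y\<rfloor> + 1" by linarith+
    moreover have r: "real M = of_int \<lfloor>y\<rfloor>" using y1 by (simp add: M_def y_def)
    moreover have "(1::int) \<le> \<lfloor>y\<rfloor>" using y1 by simp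
    then have "(1::real) \<le> of_int \<lfloor>y\<rfloor>" by linarith
    ultimately show "real M \<le> y" "y \<le> 2 * real M" "1 \<le> real M" using y1 by linarith+
  qed
  show "0 < L" using L(1) x1 by (cases L) auto
  show "0 < M" using M(3) by (cases M) auto
  show "real M \<le> 2 powr (real n * (R + \<delta>))" using M(1) by (simp add: y_def)
  have c0: "0 < c" by (simp add: c_def)
  have xc: "x = c * 2 powr (real n * \<gamma>)" by (simp add: x_def c_def powr_add[symmetric] algebra_simps)
  have "2 powr (real n * \<gamma>) / 2 = x / (2 * c)" using c0 by (simp add: xc)
  also have "\<dots> \<le> real L / (2 * c)" using L(1) c0 by (intro divide_right_mono) auto
  finally have e1: "exp (- (real L / (2 * c))) \<le> exp (- (2 powr (real n * \<gamma>) / 2))" by simp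
  have "real L * \<tau> / real M \<le> real L * (2 / 2 powr (real n * (b - \<gamma>))) / real M"
    using \<tau> M(3) by (intro divide_right_mono mult_left_mono) auto
  also have "\<dots> \<le> (2 * x) * (2 / 2 powr (real n * (b - \<gamma>))) / real M"
    using L(2) M(3) by (intro divide_right_mono mult_right_mono) auto
  also have "\<dots> \<le> (2 * x) * (2 / 2 powr (real n * (b - \<gamma>))) / (y / 2)"
    using M x1 y1 by (intro divide_left_mono) auto
  also have "\<dots> = 8 * (x / 2 powr (real n * (b - \<gamma>)) / y)" by simp
  also have "x / 2 powr (real n * (b - \<gamma>)) / y = 2 powr (real n * (a + 2 * \<gamma>) - real n * (b - \<gamma>) - real n * (R + \<delta>))"
    by (simp add: x_def y_def powr_diff)
  also have "\<dots> \<le> 2 powr (- (real n * \<gamma>))"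
  proof (rule powr_mono)
    have "real n * ((a - b - R) + (4 * \<gamma> - \<delta>)) \<le> 0" using ab \<gamma> by (intro mult_nonneg_nonpos) auto
    then show "real n * (a + 2 * \<gamma>) - real n * (b - \<gamma>) - real n * (R + \<delta>) \<le> - (real n * \<gamma>)"
      by (simp add: algebra_simps)
  qed simp
  finally have e2: "real L * \<tau> / real M \<le> 8 * 2 powr (- (real n * \<gamma>))" by simp
  show "exp (- (real L / (2 * c))) + real L * \<tau> / real M \<le> exp (- (2 powr (real n * \<gamma>) / 2)) + 8 * 2 powr (- (real n * \<gamma>))"
    by (rule add_mono[OF e1 e2])
qed

lemma rate_error_tendsto:
  fixes \<gamma> :: real
  assumes "0 < \<gamma>"
  shows "(\<lambda>n. exp (- (2 powr (real n * \<gamma>) / 2)) + 8 * 2 powr (- (real n * \<gamma>))) \<longlonglongrightarrow> 0"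
proof -
  have top: "filterlim (\<lambda>n. real n * \<gamma>) at_top sequentially"
    using filterlim_tendsto_pos_mult_at_top[OF tendsto_const assms filterlim_real_sequentially] by (simp add: mult.commute)
  have e: "2 powr t = exp (t * ln 2)" for t :: real by (simp add: powr_def)
  have top2: "filterlim (\<lambda>n. real n * \<gamma> * ln 2) at_top sequentially"
    using filterlim_tendsto_pos_mult_at_top[OF tendsto_const _ top, of "ln 2"] by (simp add: mult.commute)
  have p: "filterlim (\<lambda>n. 2 powr (real n * \<gamma>)) at_top sequentially"
    unfolding e by (rule filterlim_compose[OF exp_at_top top2])
  have p2: "filterlim (\<lambda>n. 2 powr (real n * \<gamma>) / 2) at_top sequentially"
    using filterlim_tendsto_pos_mult_at_top[OF tendsto_const _ p, of "1 / 2"] by simp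
  have 1: "(\<lambda>n. exp (- (2 powr (real n * \<gamma>) / 2))) \<longlonglongrightarrow> 0"
    by (rule filterlim_compose[OF exp_at_bot]) (use p2 in \<open>simp add: filterlim_uminus_at_bot\<close>)
  have 2: "(\<lambda>n. 2 powr (- (real n * \<gamma>))) \<longlonglongrightarrow> 0"
    unfolding e by (rule filterlim_compose[OF exp_at_bot]) (use top2 in \<open>simp add: filterlim_uminus_at_bot\<close>)
  show ?thesis using tendsto_add[OF 1 tendsto_mult_left[OF 2, of 8]] by simp
qed

section \<open>Words of letters and typicality\<close>

definition word_list :: "nat \<Rightarrow> nat \<Rightarrow> nat list set" where
  "word_list K n = {us. set us \<subseteq> {..<K} \<and> length us = n}"

lemma word_list_nth: "us \<in> word_list K n \<Longrightarrow> i < n \<Longrightarrow> us ! i < K"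
  unfolding word_list_def using nth_mem by blast

lemma word_list_prod_nonneg:
  assumes "us \<in> word_list K n" "\<And>i u. u < K \<Longrightarrow> 0 \<le> f i u"
  shows "0 \<le> (\<Prod>i<n. f i (us ! i) :: real)"
  using word_list_nth[OF assms(1)] assms(2) by (intro prod_nonneg) auto

lemma random_code_letters:
  fixes q :: "'a \<Rightarrow> nat \<Rightarrow> nat \<Rightarrow> real"
  assumes "\<And>i u. u < K \<Longrightarrow> 0 \<le> Q i u" "\<And>i. (\<Sum>u<K. Q i u) = 1"
    and "\<And>a i u. u < K \<Longrightarrow> 0 \<le> q a i u" "\<And>a i. (\<Sum>u<K. q a i u) = 1" "0 < c" "0 < L" "0 < M"
  shows "random_code (word_list K n) (\<lambda>us. \<Prod>i<n. Q i (us ! i)) (\<lambda>a us. \<Prod>i<n. q a i (us ! i)) c L M"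
proof
  show "finite (word_list K n)" unfolding word_list_def by (rule finite_lists_length_eq) simp
  show "(\<Sum>us\<in>word_list K n. \<Prod>i<n. Q i (us ! i)) = 1"
    unfolding word_list_def using assms(2) by (simp add: sum_lists_prod)
  show "(\<Sum>us\<in>word_list K n. \<Prod>i<n. q a i (us ! i)) = 1" for a
    unfolding word_list_def using assms(4) by (simp add: sum_lists_prod)
qed (use assms in \<open>auto intro: word_list_prod_nonneg\<close>)

context test_channel
begin

definition letter :: "('x \<times> 'y \<times> 'z) list \<Rightarrow> nat list \<Rightarrow> nat list \<Rightarrow> nat list \<Rightarrow> nat \<Rightarrow> ('x \<times> 'y \<times> 'z) \<times> nat \<times> nat \<times> nat" where
  "letter ws us vs ts i = (ws ! i, us ! i, vs ! i, ts ! i)"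

text \<open>A source word with three code words is regrouped into one word of sample points.
  \<open>h\<close> takes functions on all natural numbers, whose values beyond the block are
  arbitrary, so it is required to look only at the first \<open>n\<close>.\<close>

lemma sum_letters:
  fixes h :: "(nat \<Rightarrow> ('x \<times> 'y \<times> 'z) \<times> nat \<times> nat \<times> nat) \<Rightarrow> real"
  assumes cong: "\<And>f g. (\<And>i. i < n \<Longrightarrow> f i = g i) \<Longrightarrow> h f = h g"
  shows "(\<Sum>ws\<in>{ws. length ws = n}. \<Sum>us\<in>word_list K n. \<Sum>vs\<in>word_list K n. \<Sum>ts\<in>word_list K n. h (letter ws us vs ts))
    = (\<Sum>\<omega>s\<in>{\<omega>s. set \<omega>s \<subseteq> S \<and> length \<omega>s = n}. h (\<lambda>i. \<omega>s ! i))"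
proof -
  let ?A = "{ws :: ('x \<times> 'y \<times> 'z) list. length ws = n} \<times> word_list K n \<times> word_list K n \<times> word_list K n"
  let ?j = "\<lambda>(ws, us, vs, ts). zip ws (zip us (zip vs ts))"
  let ?i = "\<lambda>\<omega>s. (map fst \<omega>s, map U \<omega>s, map V \<omega>s, map W \<omega>s)"
  have "(\<Sum>ws\<in>{ws. length ws = n}. \<Sum>us\<in>word_list K n. \<Sum>vs\<in>word_list K n. \<Sum>ts\<in>word_list K n. h (letter ws us vs ts))
    = (\<Sum>(ws, us, vs, ts)\<in>?A. h (letter ws us vs ts))" by (simp add: sum_pair)
  also have "\<dots> = (\<Sum>\<omega>s\<in>{\<omega>s. set \<omega>s \<subseteq> S \<and> length \<omega>s = n}. h (\<lambda>i. \<omega>s ! i))"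
  proof (rule sum.reindex_bij_witness[of _ ?i ?j])
    fix a assume a: "a \<in> ?A"
    obtain ws us vs ts where e: "a = (ws, us, vs, ts)" by (metis surj_pair)
    have len: "length ws = n" "length us = n" "length vs = n" "length ts = n" using a by (auto simp: e word_list_def)
    have nth: "i < n \<Longrightarrow> ?j a ! i = letter ws us vs ts i" for i using len by (simp add: e letter_def)
    have lj: "length (?j a) = n" using len by (simp add: e)
    show "?i (?j a) = a"
      using len lj nth by (auto simp: e letter_def U_def V_def W_def intro!: nth_equalityI)
    show "?j a \<in> {\<omega>s. set \<omega>s \<subseteq> S \<and> length \<omega>s = n}"
    proof -
      have "?j a ! i \<in> S" if "i < n" for i
        unfolding nth[OF that] using a that word_list_nth[OF _ that, of _ K]
        by (auto simp: e letter_def S_def aux_space_def)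
      moreover have "set l \<subseteq> S" if "length l = n" "\<And>i. i < n \<Longrightarrow> l ! i \<in> S" for l
        using that by (metis in_set_conv_nth subsetI)
      ultimately show ?thesis using lj by blast
    qed
    show "h (\<lambda>i. ?j a ! i) = (case a of (ws, us, vs, ts) \<Rightarrow> h (letter ws us vs ts))"
      using cong[of "\<lambda>i. ?j a ! i" "letter ws us vs ts"] nth by (simp add: e)
  next
    fix \<omega>s assume w: "\<omega>s \<in> {\<omega>s. set \<omega>s \<subseteq> S \<and> length \<omega>s = n}"
    show "?j (?i \<omega>s) = \<omega>s" by (rule nth_equalityI) (auto simp: U_def V_def W_def)
    show "?i \<omega>s \<in> ?A" using w rv_bounds by (auto simp: word_list_def)
  qed
  finally show ?thesis .
qed

definition mean :: "(('x \<times> 'y \<times> 'z) \<times> nat \<times> nat \<times> nat \<Rightarrow> real) \<Rightarrow> real" where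
  "mean l = (\<Sum>\<omega>\<in>S. P \<omega> * l \<omega>)"
definition var :: "(('x \<times> 'y \<times> 'z) \<times> nat \<times> nat \<times> nat \<Rightarrow> real) \<Rightarrow> real" where
  "var l = (\<Sum>\<omega>\<in>S. P \<omega> * (l \<omega> - mean l)\<^sup>2)"

text \<open>Weak typicality with respect to finitely many functions. The positivity clause keeps all
  likelihood ratios positive, so that their logarithms can be added.\<close>

definition typical :: "(('x \<times> 'y \<times> 'z) \<times> nat \<times> nat \<times> nat \<Rightarrow> real) set \<Rightarrow> real \<Rightarrow> nat \<Rightarrow>
    (nat \<Rightarrow> ('x \<times> 'y \<times> 'z) \<times> nat \<times> nat \<times> nat) \<Rightarrow> bool" where
  "typical Fs \<gamma> n f \<longleftrightarrow> (\<forall>i<n. f i \<in> S \<and> 0 < P (f i)) \<and> (\<forall>l\<in>Fs. \<bar>(\<Sum>i<n. l (f i)) - real n * mean l\<bar> \<le> real n * \<gamma>)"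

text \<open>The nested sums have the form of the ideal loss in \<open>one_shot_code\<close>. They
  multiply out to the product law of the test channel, where Chebyshev's inequality and a union
  bound over \<open>Fs\<close> apply.\<close>

lemma atypical_bound:
  assumes Fs: "finite Fs" and \<gamma>: "0 < \<gamma>" and n: "0 < n"
  shows "(\<Sum>ws\<in>{ws. length ws = n}. prod_list (map p ws) * (\<Sum>us\<in>word_list K n. (\<Prod>i<n. qU (map (fst \<circ> snd) ws ! i) (us ! i)) *
     (\<Sum>vs\<in>word_list K n. (\<Prod>i<n. qV (us ! i) (map (snd \<circ> snd) ws ! i) (vs ! i)) *
     (\<Sum>ts\<in>word_list K n. (\<Prod>i<n. qW (us ! i) (vs ! i) (map fst ws ! i) (ts ! i)) *
       (if typical Fs \<gamma> n (letter ws us vs ts) then 0 else 1)))))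
    \<le> (\<Sum>l\<in>Fs. var l) / (real n * \<gamma>\<^sup>2)"
proof -
  define h where "h f = (\<Prod>i<n. P (f i)) * (if typical Fs \<gamma> n f then 0 else 1)" for f
  have hc: "h f = h g" if "\<And>i. i < n \<Longrightarrow> f i = g i" for f g
  proof -
    have "(\<Prod>i<n. P (f i)) = (\<Prod>i<n. P (g i))" using that by (intro prod.cong) auto
    moreover have "typical Fs \<gamma> n f = typical Fs \<gamma> n g" using that by (auto simp: typical_def)
    ultimately show ?thesis by (simp add: h_def)
  qed
  have "(\<Sum>ws\<in>{ws. length ws = n}. prod_list (map p ws) * (\<Sum>us\<in>word_list K n. (\<Prod>i<n. qU (map (fst \<circ> snd) ws ! i) (us ! i)) *
     (\<Sum>vs\<in>word_list K n. (\<Prod>i<n. qV (us ! i) (map (snd \<circ> snd) ws ! i) (vs ! i)) *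
     (\<Sum>ts\<in>word_list K n. (\<Prod>i<n. qW (us ! i) (vs ! i) (map fst ws ! i) (ts ! i)) *
       (if typical Fs \<gamma> n (letter ws us vs ts) then 0 else 1)))))
     = (\<Sum>ws\<in>{ws. length ws = n}. \<Sum>us\<in>word_list K n. \<Sum>vs\<in>word_list K n. \<Sum>ts\<in>word_list K n. h (letter ws us vs ts))"
  proof (rule sum.cong[OF refl])
    fix ws :: "('x \<times> 'y \<times> 'z) list" assume "ws \<in> {ws. length ws = n}"
    then have len: "length ws = n" by simp
    have pl: "prod_list (map p ws) = (\<Prod>i<n. p (ws ! i))"
      using len by (simp add: prod.list_conv_set_nth atLeast0LessThan)
    have PP: "(\<Prod>i<n. P (letter ws us vs ts i)) = (\<Prod>i<n. p (ws ! i)) * ((\<Prod>i<n. qU (map (fst \<circ> snd) ws ! i) (us ! i)) *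
      ((\<Prod>i<n. qV (us ! i) (map (snd \<circ> snd) ws ! i) (vs ! i)) * (\<Prod>i<n. qW (us ! i) (vs ! i) (map fst ws ! i) (ts ! i))))" for us vs ts
      unfolding prod.distrib[symmetric] using len by (intro prod.cong) (auto simp: letter_def P_apply)
    show "prod_list (map p ws) * (\<Sum>us\<in>word_list K n. (\<Prod>i<n. qU (map (fst \<circ> snd) ws ! i) (us ! i)) *
     (\<Sum>vs\<in>word_list K n. (\<Prod>i<n. qV (us ! i) (map (snd \<circ> snd) ws ! i) (vs ! i)) *
     (\<Sum>ts\<in>word_list K n. (\<Prod>i<n. qW (us ! i) (vs ! i) (map fst ws ! i) (ts ! i)) *
       (if typical Fs \<gamma> n (letter ws us vs ts) then 0 else 1)))) =
      (\<Sum>us\<in>word_list K n. \<Sum>vs\<in>word_list K n. \<Sum>ts\<in>word_list K n. h (letter ws us vs ts))"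
      unfolding h_def PP pl by (simp only: sum_distrib_left mult.assoc)
  qed
  also have "\<dots> = (\<Sum>\<omega>s\<in>{\<omega>s. set \<omega>s \<subseteq> S \<and> length \<omega>s = n}. h (\<lambda>i. \<omega>s ! i))" by (rule sum_letters[OF hc])
  also have "\<dots> \<le> (\<Sum>\<omega>s\<in>{\<omega>s. set \<omega>s \<subseteq> S \<and> length \<omega>s = n}. \<Sum>l\<in>Fs. (\<Prod>i<n. P (\<omega>s ! i)) *
      (if \<bar>(\<Sum>i<n. l (\<omega>s ! i)) - real n * mean l\<bar> \<le> real n * \<gamma> then 0 else 1))"
  proof (rule sum_mono)
    fix \<omega>s assume w: "\<omega>s \<in> {\<omega>s. set \<omega>s \<subseteq> S \<and> length \<omega>s = n}"
    have inS: "\<omega>s ! i \<in> S" if "i < n" for i using w that nth_mem by blast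
    have w0: "0 \<le> (\<Prod>i<n. P (\<omega>s ! i))" using nn inS by (intro prod_nonneg) auto
    show "h (\<lambda>i. \<omega>s ! i) \<le> (\<Sum>l\<in>Fs. (\<Prod>i<n. P (\<omega>s ! i)) *
      (if \<bar>(\<Sum>i<n. l (\<omega>s ! i)) - real n * mean l\<bar> \<le> real n * \<gamma> then 0 else 1))"
    proof (cases "typical Fs \<gamma> n (\<lambda>i. \<omega>s ! i) \<or> (\<Prod>i<n. P (\<omega>s ! i)) = 0")
      case True
      then have "h (\<lambda>i. \<omega>s ! i) = 0" by (auto simp: h_def)
      then show ?thesis using w0 by (auto intro!: sum_nonneg)
    next
      case False
      then have "\<forall>i<n. P (\<omega>s ! i) \<noteq> 0" by (auto simp: prod_zero_iff)
      then have "\<forall>i<n. 0 < P (\<omega>s ! i)" using nn inS by (auto simp: order_less_le)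
      then obtain l where l: "l \<in> Fs" "\<not> \<bar>(\<Sum>i<n. l (\<omega>s ! i)) - real n * mean l\<bar> \<le> real n * \<gamma>"
        using False inS by (auto simp: typical_def)
      have "h (\<lambda>i. \<omega>s ! i) = (\<Prod>i<n. P (\<omega>s ! i)) *
        (if \<bar>(\<Sum>i<n. l (\<omega>s ! i)) - real n * mean l\<bar> \<le> real n * \<gamma> then 0 else 1)" using l(2) False by (simp add: h_def)
      also have "\<dots> \<le> (\<Sum>l\<in>Fs. (\<Prod>i<n. P (\<omega>s ! i)) *
        (if \<bar>(\<Sum>i<n. l (\<omega>s ! i)) - real n * mean l\<bar> \<le> real n * \<gamma> then 0 else 1))"
        using l(1) w0 Fs by (intro member_le_sum) auto
      finally show ?thesis .
    qed
  qed
  also have "\<dots> = (\<Sum>l\<in>Fs. \<Sum>\<omega>s\<in>{\<omega>s. set \<omega>s \<subseteq> S \<and> length \<omega>s = n}. (\<Prod>i<n. P (\<omega>s ! i)) *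
      (if \<bar>(\<Sum>i<n. l (\<omega>s ! i)) - real n * mean l\<bar> \<le> real n * \<gamma> then 0 else 1))" by (rule sum.swap)
  also have "\<dots> \<le> (\<Sum>l\<in>Fs. var l / (real n * \<gamma>\<^sup>2))"
    unfolding var_def mean_def by (intro sum_mono chebyshev_lists finS nn P_sum \<gamma> n)
  finally show ?thesis by (simp add: sum_divide_distrib)
qed

end

context test_channel
begin

lemma QU0: "0 \<le> QU u" and QU1: "(\<Sum>u<K. QU u) = 1"
  and TX0: "0 \<le> TX x u" and TX1: "(\<Sum>u<K. TX x u) = 1"
  and TZ0: "0 \<le> TZ z u" and TZ1: "(\<Sum>u<K. TZ z u) = 1"
  unfolding QU_def TX_def TZ_def by (auto intro!: kern_nonneg kern_sum rv_bounds K0)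

lemma QV0: "0 \<le> QV u v" and QV1: "(\<Sum>v<K. QV u v) = 1"
  and TV0: "0 \<le> TV u x v" and TV1: "(\<Sum>v<K. TV u x v) = 1"
  unfolding QV_def TV_def by (auto intro!: kern_nonneg kern_sum rv_bounds K0)

lemma QW0: "0 \<le> QW s w" and QW1: "(\<Sum>w<K. QW s w) = 1"
  and TW0: "0 \<le> TW s z w" and TW1: "(\<Sum>w<K. TW s z w) = 1"
  unfolding QW_def TW_def by (auto intro!: kern_nonneg kern_sum rv_bounds K0)

text \<open>\<open>l1\<close>, \<open>l4\<close> and \<open>l6\<close> compare the encoders' kernels
  with the codebook laws and control the truncation; \<open>l2\<close>, \<open>l3\<close>,
  \<open>l5\<close> and \<open>l7\<close> do the same for the decoders and control the
  tests.\<close>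

definition l1 where "l1 \<omega> = log 2 (qU (Y \<omega>) (U \<omega>) / QU (U \<omega>))" for \<omega>
definition l2 where "l2 \<omega> = log 2 (TX (X \<omega>) (U \<omega>) / QU (U \<omega>))" for \<omega>
definition l3 where "l3 \<omega> = log 2 (TZ (Z \<omega>) (U \<omega>) / QU (U \<omega>))" for \<omega>
definition l4 where "l4 \<omega> = log 2 (qV (U \<omega>) (Z \<omega>) (V \<omega>) / QV (U \<omega>) (V \<omega>))" for \<omega>
definition l5 where "l5 \<omega> = log 2 (TV (U \<omega>) (X \<omega>) (V \<omega>) / QV (U \<omega>) (V \<omega>))" for \<omega>
definition l6 where "l6 \<omega> = log 2 (qW (U \<omega>) (V \<omega>) (X \<omega>) (W \<omega>) / QW (U \<omega>, V \<omega>) (W \<omega>))" for \<omega>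
definition l7 where "l7 \<omega> = log 2 (TW (U \<omega>, V \<omega>) (Z \<omega>) (W \<omega>) / QW (U \<omega>, V \<omega>) (W \<omega>))" for \<omega>

definition densities where "densities = {l1, l2, l3, l4, l5, l6, l7}"

lemma density_means:
  "mean l1 = cond_mutual_info S P Y U (\<lambda>_. ())" "mean l2 = cond_mutual_info S P X U (\<lambda>_. ())"
  "mean l3 = cond_mutual_info S P Z U (\<lambda>_. ())" "mean l4 = cond_mutual_info S P Z V U"
  "mean l5 = cond_mutual_info S P X V U" "mean l6 = cond_mutual_info S P X W (U \<bowtie> V)"
  "mean l7 = cond_mutual_info S P Z W (U \<bowtie> V)"
  unfolding mean_def l1_def l2_def l3_def l4_def l5_def l6_def l7_def by (rule means)+

lemma typical_densities:
  assumes t: "typical Fs \<gamma> n (letter ws us vs ts)" and Fs: "densities \<subseteq> Fs" and len: "length ws = n"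
  shows "(\<Prod>i<n. qU (map (fst \<circ> snd) ws ! i) (us ! i)) \<le> 2 powr (real n * (mean l1 + \<gamma>)) * (\<Prod>i<n. QU (us ! i))"
    and "2 powr (real n * (mean l3 - \<gamma>)) * (\<Prod>i<n. QU (us ! i)) \<le> (\<Prod>i<n. TX (map fst ws ! i) (us ! i))"
    and "2 powr (real n * (mean l3 - \<gamma>)) * (\<Prod>i<n. QU (us ! i)) \<le> (\<Prod>i<n. TZ (map (snd \<circ> snd) ws ! i) (us ! i))"
    and "(\<Prod>i<n. qV (us ! i) (map (snd \<circ> snd) ws ! i) (vs ! i)) \<le> 2 powr (real n * (mean l4 + \<gamma>)) * (\<Prod>i<n. QV (us ! i) (vs ! i))"
    and "2 powr (real n * (mean l5 - \<gamma>)) * (\<Prod>i<n. QV (us ! i) (vs ! i)) \<le> (\<Prod>i<n. TV (us ! i) (map fst ws ! i) (vs ! i))"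
    and "(\<Prod>i<n. qW (us ! i) (vs ! i) (map fst ws ! i) (ts ! i)) \<le> 2 powr (real n * (mean l6 + \<gamma>)) * (\<Prod>i<n. QW (us ! i, vs ! i) (ts ! i))"
    and "2 powr (real n * (mean l7 - \<gamma>)) * (\<Prod>i<n. QW (us ! i, vs ! i) (ts ! i)) \<le> (\<Prod>i<n. TW (us ! i, vs ! i) (map (snd \<circ> snd) ws ! i) (ts ! i))"
proof -
  let ?l = "letter ws us vs ts"
  have pos: "?l i \<in> S" "0 < P (?l i)" if "i < n" for i using t that by (auto simp: typical_def)
  note kp = kern_pos[OF pos]
  have c: "map fst ws ! i = X (?l i)" "map (fst \<circ> snd) ws ! i = Y (?l i)" "map (snd \<circ> snd) ws ! i = Z (?l i)" if "i < n" for i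
    using that len by (auto simp: letter_def rv_defs)
  have d: "us ! i = U (?l i)" "vs ! i = V (?l i)" "ts ! i = W (?l i)" for i by (auto simp: letter_def rv_defs)
  have dev: "\<bar>(\<Sum>i<n. l (?l i)) - real n * mean l\<bar> \<le> real n * \<gamma>" if "l \<in> densities" for l
    using t Fs that by (auto simp: typical_def)
  have up: "(\<Sum>i<n. l (?l i)) \<le> real n * (mean l + \<gamma>)" if "l \<in> densities" for l
    using dev[OF that] by (simp add: algebra_simps abs_le_iff)
  have lo: "real n * (mean l - \<gamma>) \<le> (\<Sum>i<n. l (?l i))" if "l \<in> densities" for l
    using dev[OF that] by (simp add: algebra_simps abs_le_iff)
  have mem: "l1 \<in> densities" "l2 \<in> densities" "l3 \<in> densities" "l4 \<in> densities" "l5 \<in> densities" "l6 \<in> densities" "l7 \<in> densities"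
    by (auto simp: densities_def)
  show "(\<Prod>i<n. qU (map (fst \<circ> snd) ws ! i) (us ! i)) \<le> 2 powr (real n * (mean l1 + \<gamma>)) * (\<Prod>i<n. QU (us ! i))"
    by (rule prod_le_powr) (use kp c d up[OF mem(1)] in \<open>simp_all add: l1_def\<close>)
  \<comment> \<open>Both users test the first word against the threshold of User Z; the mean density
    of User X is at least as large.\<close>
  have "real n * (mean l3 - \<gamma>) \<le> real n * (mean l2 - \<gamma>)"
    unfolding density_means using rate_differences(2) by (intro mult_left_mono) auto
  also note lo[OF mem(2)]
  finally show "2 powr (real n * (mean l3 - \<gamma>)) * (\<Prod>i<n. QU (us ! i)) \<le> (\<Prod>i<n. TX (map fst ws ! i) (us ! i))"
    by (intro powr_le_prod) (use kp c d in \<open>simp_all add: l2_def\<close>)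
  show "2 powr (real n * (mean l3 - \<gamma>)) * (\<Prod>i<n. QU (us ! i)) \<le> (\<Prod>i<n. TZ (map (snd \<circ> snd) ws ! i) (us ! i))"
    by (rule powr_le_prod) (use kp c d lo[OF mem(3)] in \<open>simp_all add: l3_def\<close>)
  show "(\<Prod>i<n. qV (us ! i) (map (snd \<circ> snd) ws ! i) (vs ! i)) \<le> 2 powr (real n * (mean l4 + \<gamma>)) * (\<Prod>i<n. QV (us ! i) (vs ! i))"
    by (rule prod_le_powr) (use kp c d up[OF mem(4)] in \<open>simp_all add: l4_def\<close>)
  show "2 powr (real n * (mean l5 - \<gamma>)) * (\<Prod>i<n. QV (us ! i) (vs ! i)) \<le> (\<Prod>i<n. TV (us ! i) (map fst ws ! i) (vs ! i))"
    by (rule powr_le_prod) (use kp c d lo[OF mem(5)] in \<open>simp_all add: l5_def\<close>)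
  show "(\<Prod>i<n. qW (us ! i) (vs ! i) (map fst ws ! i) (ts ! i)) \<le> 2 powr (real n * (mean l6 + \<gamma>)) * (\<Prod>i<n. QW (us ! i, vs ! i) (ts ! i))"
    by (rule prod_le_powr) (use kp c d up[OF mem(6)] in \<open>simp_all add: l6_def\<close>)
  show "2 powr (real n * (mean l7 - \<gamma>)) * (\<Prod>i<n. QW (us ! i, vs ! i) (ts ! i)) \<le> (\<Prod>i<n. TW (us ! i, vs ! i) (map (snd \<circ> snd) ws ! i) (ts ! i))"
    by (rule powr_le_prod) (use kp c d lo[OF mem(7)] in \<open>simp_all add: l7_def\<close>)
qed

lemma code_with_small_error:
  assumes Fs: "finite Fs" "densities \<subseteq> Fs" and \<gamma>: "0 < \<gamma>" "8 * \<gamma> \<le> \<delta>" and n: "0 < n"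
    and R1: "cond_mutual_info S P Y U Z \<le> R1"
    and R2: "cond_mutual_info S P Z V (U \<bowtie> X) \<le> R2"
    and R3: "cond_mutual_info S P X W (U \<bowtie> V \<bowtie> Z) \<le> R3"
  defines "M1 \<equiv> nat \<lfloor>2 powr (real n * (R1 + \<delta>))\<rfloor>" and "M2 \<equiv> nat \<lfloor>2 powr (real n * (R2 + \<delta>))\<rfloor>"
    and "M3 \<equiv> nat \<lfloor>2 powr (real n * (R3 + \<delta>))\<rfloor>"
  shows "real M1 \<le> 2 powr (real n * (R1 + \<delta>))" "real M2 \<le> 2 powr (real n * (R2 + \<delta>))" "real M3 \<le> 2 powr (real n * (R3 + \<delta>))"
    and "\<exists>f1 f2 f3 gX gZ. (\<forall>y. f1 y < M1) \<and> (\<forall>z t. f2 z t < M2) \<and> (\<forall>x t t'. f3 x t t' < M3) \<and>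
    (\<Sum>ws\<in>{ws. length ws = n}. prod_list (map p ws) *
      (if \<exists>us vs ts. gX (map fst ws) (f1 (map (fst \<circ> snd) ws)) (f2 (map (snd \<circ> snd) ws) (f1 (map (fst \<circ> snd) ws))) = (us, vs) \<and>
        gZ (map (snd \<circ> snd) ws) (f1 (map (fst \<circ> snd) ws)) (f3 (map fst ws) (f1 (map (fst \<circ> snd) ws))
           (f2 (map (snd \<circ> snd) ws) (f1 (map (fst \<circ> snd) ws)))) = (us, ts) \<and>
        typical Fs \<gamma> n (letter ws us vs ts) then 0 else 1))
    \<le> 64 * ((\<Sum>l\<in>Fs. var l) / (real n * \<gamma>\<^sup>2))
      + 42 * (exp (- (2 powr (real n * \<gamma>) / 2)) + 8 * 2 powr (- (real n * \<gamma>)))"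
proof -
  have a: "0 \<le> mean l1" "0 \<le> mean l4" "0 \<le> mean l6" unfolding density_means by (rule cmi_nonneg)+
  have ab: "mean l1 - mean l3 \<le> R1" "mean l4 - mean l5 \<le> R2" "mean l6 - mean l7 \<le> R3"
    unfolding density_means rate_differences using R1 R2 R3 by auto
  have R0: "0 \<le> R1" "0 \<le> R2" "0 \<le> R3"
    using R1 R2 R3 cmi_nonneg[of Y U Z] cmi_nonneg[of Z V "U \<bowtie> X"] cmi_nonneg[of X W "U \<bowtie> V \<bowtie> Z"] by linarith+
  define \<theta>1 where "\<theta>1 = 2 powr (real n * (mean l3 - \<gamma>))"
  define \<theta>2 where "\<theta>2 = 2 powr (real n * (mean l5 - \<gamma>))"
  define \<theta>3 where "\<theta>3 = 2 powr (real n * (mean l7 - \<gamma>))"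
  have \<theta>: "0 < \<theta>1" "0 < \<theta>2" "0 < \<theta>3" by (auto simp: \<theta>1_def \<theta>2_def \<theta>3_def)
  define L1 where "L1 = nat \<lceil>2 powr (real n * (mean l1 + 2 * \<gamma>))\<rceil>"
  define L2 where "L2 = nat \<lceil>2 powr (real n * (mean l4 + 2 * \<gamma>))\<rceil>"
  define L3 where "L3 = nat \<lceil>2 powr (real n * (mean l6 + 2 * \<gamma>))\<rceil>"
  let ?c1 = "2 powr (real n * (mean l1 + \<gamma>))" and ?c2 = "2 powr (real n * (mean l4 + \<gamma>))" and ?c3 = "2 powr (real n * (mean l6 + \<gamma>))"
  \<comment> \<open>The first word has two tests, and a wrong word passes each with probability at
    most \<open>1 / \<theta>1\<close>; hence \<open>2 / \<theta>1\<close>.\<close>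
  note e1 = rate_error_bound[OF a(1) ab(1) R0(1) \<gamma> n, of "2 / \<theta>1", folded M1_def L1_def \<theta>1_def, OF order_refl]
  have "1 / \<theta>2 \<le> 2 / \<theta>2" "1 / \<theta>3 \<le> 2 / \<theta>3" using \<theta> by (auto intro: divide_right_mono)
  note e2 = rate_error_bound[OF a(2) ab(2) R0(2) \<gamma> n, of "1 / \<theta>2", folded M2_def L2_def \<theta>2_def, OF this(1)]
    and e3 = rate_error_bound[OF a(3) ab(3) R0(3) \<gamma> n, of "1 / \<theta>3", folded M3_def L3_def \<theta>3_def, OF this(2)]
  show "real M1 \<le> 2 powr (real n * (R1 + \<delta>))" "real M2 \<le> 2 powr (real n * (R2 + \<delta>))" "real M3 \<le> 2 powr (real n * (R3 + \<delta>))"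
    by (rule e1(3) e2(3) e3(3))+
  define good where "good ws us vs ts \<longleftrightarrow> typical Fs \<gamma> n (letter ws us vs ts)" for ws us vs ts
  define tX where "tX xs us \<longleftrightarrow> \<theta>1 * (\<Prod>i<n. QU (us ! i)) \<le> (\<Prod>i<n. TX (xs ! i) (us ! i))" for xs us
  define tZ where "tZ zs us \<longleftrightarrow> \<theta>1 * (\<Prod>i<n. QU (us ! i)) \<le> (\<Prod>i<n. TZ (zs ! i) (us ! i))" for zs us
  define tV where "tV us xs vs \<longleftrightarrow> \<theta>2 * (\<Prod>i<n. QV (us ! i) (vs ! i)) \<le> (\<Prod>i<n. TV (us ! i) (xs ! i) (vs ! i))" for us xs vs
  define tW where "tW s zs ts \<longleftrightarrow> \<theta>3 * (\<Prod>i<n. QW (fst s ! i, snd s ! i) (ts ! i)) \<le> (\<Prod>i<n. TW (fst s ! i, snd s ! i) (zs ! i) (ts ! i))" for s zs ts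
  let ?\<Omega> = "{ws :: ('x \<times> 'y \<times> 'z) list. length ws = n}"
  let ?KU = "\<lambda>ys us. \<Prod>i<n. qU (ys ! i) (us ! i)"
  let ?KV = "\<lambda>us zs vs. \<Prod>i<n. qV (us ! i) (zs ! i) (vs ! i)"
  let ?KW = "\<lambda>s xs ts. \<Prod>i<n. qW (fst s ! i) (snd s ! i) (xs ! i) (ts ! i)"
  let ?X = "\<lambda>ws :: ('x \<times> 'y \<times> 'z) list. map fst ws" and ?Y = "\<lambda>ws :: ('x \<times> 'y \<times> 'z) list. map (fst \<circ> snd) ws"
    and ?Z = "\<lambda>ws :: ('x \<times> 'y \<times> 'z) list. map (snd \<circ> snd) ws"
  have "\<exists>f1 f2 f3 gX gZ. (\<forall>y. f1 y < M1) \<and> (\<forall>z t. f2 z t < M2) \<and> (\<forall>x t t'. f3 x t t' < M3) \<and>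
    (\<Sum>\<omega>\<in>?\<Omega>. prod_list (map p \<omega>) * (if \<exists>u v w. gX (?X \<omega>) (f1 (?Y \<omega>)) (f2 (?Z \<omega>) (f1 (?Y \<omega>))) = (u, v) \<and>
        gZ (?Z \<omega>) (f1 (?Y \<omega>)) (f3 (?X \<omega>) (f1 (?Y \<omega>)) (f2 (?Z \<omega>) (f1 (?Y \<omega>)))) = (u, w) \<and> good \<omega> u v w then 0 else 1))
    \<le> 64 * (\<Sum>\<omega>\<in>?\<Omega>. prod_list (map p \<omega>) * (\<Sum>u\<in>word_list K n. ?KU (?Y \<omega>) u * (\<Sum>v\<in>word_list K n. ?KV u (?Z \<omega>) v *
          (\<Sum>w\<in>word_list K n. ?KW (u, v) (?X \<omega>) w * (if good \<omega> u v w then 0 else 1)))))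
      + 32 * (exp (- (real L1 / (2 * ?c1))) + real L1 * (2 / \<theta>1) / real M1)
      + 8 * (exp (- (real L2 / (2 * ?c2))) + real L2 * (1 / \<theta>2) / real M2)
      + 2 * (exp (- (real L3 / (2 * ?c3))) + real L3 * (1 / \<theta>3) / real M3)"
  proof (rule one_shot_code[where tX = tX and tZ = tZ and tV = tV and tW = tW])
    show "finite ?\<Omega>" by (rule finite_lists_length)
    show "0 \<le> prod_list (map p ws)" for ws using p_nonneg by (induction ws) auto
    show "(\<Sum>ws\<in>?\<Omega>. prod_list (map p ws)) = 1" by (rule sum_prod_list[OF p_sum])
    show "random_code (word_list K n) (\<lambda>us. \<Prod>i<n. QU (us ! i)) ?KU ?c1 L1 M1"
      by (rule random_code_letters) (use QU0 QU1 qU0 qU1 e1(1,2) in auto)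
    show "random_code (word_list K n) (\<lambda>vs. \<Prod>i<n. QV (us ! i) (vs ! i)) (?KV us) ?c2 L2 M2" for us
      by (rule random_code_letters) (use QV0 QV1 qV0 qV1 e2(1,2) in auto)
    show "random_code (word_list K n) (\<lambda>ts. \<Prod>i<n. QW (fst s ! i, snd s ! i) (ts ! i)) (?KW s) ?c3 L3 M3" for s
      by (rule random_code_letters) (use QW0 QW1 qW0 qW1 e3(1,2) in auto)
    fix ws us vs ts assume "ws \<in> ?\<Omega>" and g: "good ws us vs ts"
    then have "length ws = n" by simp
    note td = typical_densities[OF g[unfolded good_def] Fs(2) this]
    show "?KU (?Y ws) us \<le> ?c1 * (\<Prod>i<n. QU (us ! i)) \<and> tX (?X ws) us \<and> tZ (?Z ws) us"
      using td unfolding tX_def tZ_def \<theta>1_def by blast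
    show "?KV us (?Z ws) vs \<le> ?c2 * (\<Prod>i<n. QV (us ! i) (vs ! i)) \<and> tV us (?X ws) vs"
      using td unfolding tV_def \<theta>2_def by blast
    show "?KW (us, vs) (?X ws) ts \<le> ?c3 * (\<Prod>i<n. QW (fst (us, vs) ! i, snd (us, vs) ! i) (ts ! i)) \<and> tW (us, vs) (?Z ws) ts"
      using td unfolding tW_def \<theta>3_def fst_conv snd_conv by blast
  next
    fix xs zs
    have "(\<Sum>us\<in>word_list K n. if tX xs us \<or> tZ zs us then \<Prod>i<n. QU (us ! i) else 0) \<le>
      (\<Sum>us\<in>word_list K n. (if tX xs us then \<Prod>i<n. QU (us ! i) else 0) + (if tZ zs us then \<Prod>i<n. QU (us ! i) else 0))"
      using QU0 by (intro sum_mono) (auto intro: prod_nonneg)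
    also have "\<dots> \<le> 1 / \<theta>1 + 1 / \<theta>1"
      unfolding sum.distrib tX_def tZ_def word_list_def
      by (intro add_mono likelihood_test_sum \<theta> TX0 TX1 TZ0 TZ1)
    finally show "(\<Sum>us\<in>word_list K n. if tX xs us \<or> tZ zs us then \<Prod>i<n. QU (us ! i) else 0) \<le> 2 / \<theta>1" by simp
  next
    fix us xs
    show "(\<Sum>vs\<in>word_list K n. if tV us xs vs then \<Prod>i<n. QV (us ! i) (vs ! i) else 0) \<le> 1 / \<theta>2"
      unfolding tV_def word_list_def by (intro likelihood_test_sum \<theta> TV0 TV1)
  next
    fix s zs
    show "(\<Sum>ts\<in>word_list K n. if tW s zs ts then \<Prod>i<n. QW (fst s ! i, snd s ! i) (ts ! i) else 0) \<le> 1 / \<theta>3"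
      unfolding tW_def word_list_def by (intro likelihood_test_sum \<theta> TW0 TW1)
  qed
  then obtain f1 f2 f3 gX gZ where code: "(\<forall>y. f1 y < M1) \<and> (\<forall>z t. f2 z t < M2) \<and> (\<forall>x t t'. f3 x t t' < M3)"
    and bound: "(\<Sum>\<omega>\<in>?\<Omega>. prod_list (map p \<omega>) * (if \<exists>u v w. gX (?X \<omega>) (f1 (?Y \<omega>)) (f2 (?Z \<omega>) (f1 (?Y \<omega>))) = (u, v) \<and>
        gZ (?Z \<omega>) (f1 (?Y \<omega>)) (f3 (?X \<omega>) (f1 (?Y \<omega>)) (f2 (?Z \<omega>) (f1 (?Y \<omega>)))) = (u, w) \<and> good \<omega> u v w then 0 else 1))
    \<le> 64 * (\<Sum>\<omega>\<in>?\<Omega>. prod_list (map p \<omega>) * (\<Sum>u\<in>word_list K n. ?KU (?Y \<omega>) u * (\<Sum>v\<in>word_list K n. ?KV u (?Z \<omega>) v *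
          (\<Sum>w\<in>word_list K n. ?KW (u, v) (?X \<omega>) w * (if good \<omega> u v w then 0 else 1)))))
      + 32 * (exp (- (real L1 / (2 * ?c1))) + real L1 * (2 / \<theta>1) / real M1)
      + 8 * (exp (- (real L2 / (2 * ?c2))) + real L2 * (1 / \<theta>2) / real M2)
      + 2 * (exp (- (real L3 / (2 * ?c3))) + real L3 * (1 / \<theta>3) / real M3)" by blast
  \<comment> \<open>The three coding errors have a common bound, and
    \<open>32 + 8 + 2 = 42\<close>.\<close>
  have combine: "F \<le> 64 * v + 42 * e" if "F \<le> 64 * i + 32 * r1 + 8 * r2 + 2 * r3" "i \<le> v" "r1 \<le> e" "r2 \<le> e" "r3 \<le> e" for F i v e r1 r2 r3 :: real
    using that by linarith
  have "(\<Sum>\<omega>\<in>?\<Omega>. prod_list (map p \<omega>) * (if \<exists>u v w. gX (?X \<omega>) (f1 (?Y \<omega>)) (f2 (?Z \<omega>) (f1 (?Y \<omega>))) = (u, v) \<and>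
        gZ (?Z \<omega>) (f1 (?Y \<omega>)) (f3 (?X \<omega>) (f1 (?Y \<omega>)) (f2 (?Z \<omega>) (f1 (?Y \<omega>)))) = (u, w) \<and> good \<omega> u v w then 0 else 1))
      \<le> 64 * ((\<Sum>l\<in>Fs. var l) / (real n * \<gamma>\<^sup>2)) + 42 * (exp (- (2 powr (real n * \<gamma>) / 2)) + 8 * 2 powr (- (real n * \<gamma>)))"
    by (rule combine[OF bound _ e1(4) e2(4) e3(4)])
       (use atypical_bound[OF Fs(1) \<gamma>(1) n] in \<open>simp only: good_def fst_conv snd_conv\<close>)
  with code show "\<exists>f1 f2 f3 gX gZ. (\<forall>y. f1 y < M1) \<and> (\<forall>z t. f2 z t < M2) \<and> (\<forall>x t t'. f3 x t t' < M3) \<and>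
    (\<Sum>ws\<in>{ws. length ws = n}. prod_list (map p ws) *
      (if \<exists>us vs ts. gX (map fst ws) (f1 (map (fst \<circ> snd) ws)) (f2 (map (snd \<circ> snd) ws) (f1 (map (fst \<circ> snd) ws))) = (us, vs) \<and>
        gZ (map (snd \<circ> snd) ws) (f1 (map (fst \<circ> snd) ws)) (f3 (map fst ws) (f1 (map (fst \<circ> snd) ws))
           (f2 (map (snd \<circ> snd) ws) (f1 (map (fst \<circ> snd) ws)))) = (us, ts) \<and>
        typical Fs \<gamma> n (letter ws us vs ts) then 0 else 1))
    \<le> 64 * ((\<Sum>l\<in>Fs. var l) / (real n * \<gamma>\<^sup>2))
      + 42 * (exp (- (2 powr (real n * \<gamma>) / 2)) + 8 * 2 powr (- (real n * \<gamma>)))"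
    unfolding good_def by blast
qed

end

section \<open>Distortion, and the two inclusions\<close>

text \<open>On a bad block each letter is charged the sum of all values of \<open>d\<close>, a crude
  substitute for the maximal distortion.\<close>

lemma (in test_channel) average_distortion_bound:
  fixes d :: "'c::finite \<Rightarrow> 'd::finite \<Rightarrow> real"
  assumes d0: "\<And>a b. 0 \<le> d a b" and n: "0 < n" and D: "0 \<le> D"
    and bad: "(\<Sum>ws\<in>{ws. length ws = n}. prod_list (map p ws) * (if G ws then 0 else 1)) \<le> e"
    and good: "\<And>ws. length ws = n \<Longrightarrow> G ws \<Longrightarrow> (\<Sum>i<n. d (A ws i) (h ws i)) \<le> real n * D"
  shows "iid_expect p n (\<lambda>ws. (1 / real n) * (\<Sum>i<n. d (A ws i) (h ws i))) \<le> D + (\<Sum>a\<in>UNIV. \<Sum>b\<in>UNIV. d a b) * e"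
proof -
  define B where "B = (\<Sum>a\<in>UNIV. \<Sum>b\<in>UNIV. d a b)"
  have B0: "0 \<le> B" unfolding B_def using d0 by (intro sum_nonneg)
  have dB: "d a b \<le> B" for a b
  proof -
    have "d a b \<le> (\<Sum>b\<in>UNIV. d a b)" using d0 by (intro member_le_sum) auto
    also have "\<dots> \<le> B" unfolding B_def using d0 by (intro member_le_sum[of a UNIV "\<lambda>a. \<Sum>b\<in>UNIV. d a b"]) (auto intro: sum_nonneg)
    finally show ?thesis .
  qed
  have \<mu>: "0 \<le> prod_list (map p ws)" for ws using p_nonneg by (induction ws) auto
  have "iid_expect p n (\<lambda>ws. (1 / real n) * (\<Sum>i<n. d (A ws i) (h ws i))) \<le>
    (\<Sum>ws\<in>{ws. length ws = n}. prod_list (map p ws) * (D + B * (if G ws then 0 else 1)))"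
    unfolding iid_expect_def
  proof (intro sum_mono mult_left_mono \<mu>)
    fix ws :: "('x \<times> 'y \<times> 'z) list" assume "ws \<in> {ws. length ws = n}"
    then have len: "length ws = n" by simp
    show "(1 / real n) * (\<Sum>i<n. d (A ws i) (h ws i)) \<le> D + B * (if G ws then 0 else 1)"
    proof (cases "G ws")
      case True
      then show ?thesis using good[OF len True] n by (simp add: field_simps)
    next
      case False
      have "(\<Sum>i<n. d (A ws i) (h ws i)) \<le> (\<Sum>i<n. B)" by (intro sum_mono dB)
      then have "(1 / real n) * (\<Sum>i<n. d (A ws i) (h ws i)) \<le> B" using n by (simp add: field_simps)
      then show ?thesis using D False by simp
    qed
  qed
  also have "\<dots> = D * (\<Sum>ws\<in>{ws. length ws = n}. prod_list (map p ws)) +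
      B * (\<Sum>ws\<in>{ws. length ws = n}. prod_list (map p ws) * (if G ws then 0 else 1))"
    by (simp only: distrib_left sum.distrib sum_distrib_left mult.commute mult.left_commute)
  also have "\<dots> \<le> D + B * e" using bad B0 by (simp only: sum_prod_list[OF p_sum] mult_1_right add_left_mono mult_left_mono)
  finally show ?thesis unfolding B_def .
qed

text \<open>The two distortions are added to the functions tested by \<open>typical\<close>. On a
  good block the empirical distortions are then within \<open>\<gamma>\<close> of their means, at no
  further cost in probability.\<close>

lemma (in test_channel) achieves:
  fixes dx :: "'x \<Rightarrow> 'xh::finite \<Rightarrow> real" and dz :: "'z \<Rightarrow> 'zh::finite \<Rightarrow> real"
    and xhat :: "nat \<Rightarrow> nat \<Rightarrow> 'z \<Rightarrow> 'xh" and zhat :: "nat \<Rightarrow> nat \<Rightarrow> 'x \<Rightarrow> 'zh"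
  assumes dx0: "\<And>x h. 0 \<le> dx x h" and dz0: "\<And>z h. 0 \<le> dz z h"
    and R1: "cond_mutual_info S P Y U Z \<le> R1"
    and R2: "cond_mutual_info S P Z V (U \<bowtie> X) \<le> R2"
    and R3: "cond_mutual_info S P X W (U \<bowtie> V \<bowtie> Z) \<le> R3"
    and Dx: "mean (\<lambda>\<omega>. dx (X \<omega>) (xhat (U \<omega>) (W \<omega>) (Z \<omega>))) \<le> Dx"
    and Dz: "mean (\<lambda>\<omega>. dz (Z \<omega>) (zhat (U \<omega>) (V \<omega>) (X \<omega>))) \<le> Dz"
    and \<delta>: "0 < \<delta>"
  shows "achievable p dx dz Dx Dz (R1 + \<delta>, R2 + \<delta>, R3 + \<delta>)"
  unfolding achievable_def
proof (intro allI impI)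
  fix \<epsilon> :: real assume \<epsilon>: "0 < \<epsilon>"
  \<comment> \<open>\<open>\<delta> / 8\<close> is what the rates allow;
    \<open>\<epsilon> / 2\<close> leaves the other half of the excess distortion for the bad
    blocks.\<close>
  define \<gamma> where "\<gamma> = min (\<delta> / 8) (\<epsilon> / 2)"
  have \<gamma>: "0 < \<gamma>" "8 * \<gamma> \<le> \<delta>" "\<gamma> \<le> \<epsilon> / 2" using \<delta> \<epsilon> by (auto simp: \<gamma>_def)
  define lx where "lx \<omega> = dx (X \<omega>) (xhat (U \<omega>) (W \<omega>) (Z \<omega>))" for \<omega>
  define lz where "lz \<omega> = dz (Z \<omega>) (zhat (U \<omega>) (V \<omega>) (X \<omega>))" for \<omega>
  define Fs where "Fs = densities \<union> {lx, lz}"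
  have Fs: "finite Fs" "densities \<subseteq> Fs" "lx \<in> Fs" "lz \<in> Fs" by (auto simp: Fs_def densities_def)
  have mx: "0 \<le> mean lx" "mean lx \<le> Dx" using Dx nn dx0 by (auto simp: mean_def lx_def intro!: sum_nonneg)
  have mz: "0 \<le> mean lz" "mean lz \<le> Dz" using Dz nn dz0 by (auto simp: mean_def lz_def intro!: sum_nonneg)
  define Bx where "Bx = (\<Sum>a\<in>UNIV. \<Sum>b\<in>UNIV. dx a b)"
  define Bz where "Bz = (\<Sum>a\<in>UNIV. \<Sum>b\<in>UNIV. dz a b)"
  have B0: "0 \<le> Bx" "0 \<le> Bz" unfolding Bx_def Bz_def using dx0 dz0 by (auto intro!: sum_nonneg)
  define err where "err n = 64 * ((\<Sum>l\<in>Fs. var l) / (real n * \<gamma>\<^sup>2)) +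
      42 * (exp (- (2 powr (real n * \<gamma>) / 2)) + 8 * 2 powr (- (real n * \<gamma>)))" for n
  have "(\<lambda>n. (\<Sum>l\<in>Fs. var l) / \<gamma>\<^sup>2 * (1 / real n)) \<longlonglongrightarrow> (\<Sum>l\<in>Fs. var l) / \<gamma>\<^sup>2 * 0"
    by (intro tendsto_mult_left lim_1_over_n)
  then have "(\<lambda>n. (\<Sum>l\<in>Fs. var l) / (real n * \<gamma>\<^sup>2)) \<longlonglongrightarrow> 0" by (simp add: mult.commute)
  from tendsto_add[OF tendsto_mult_left[OF this, of 64] tendsto_mult_left[OF rate_error_tendsto[OF \<gamma>(1)], of 42]]
  have "err \<longlonglongrightarrow> 0" by (simp add: err_def[abs_def])
  \<comment> \<open>One denominator serves both distortions; the summand \<open>1\<close> keeps it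
    positive.\<close>
  moreover have "0 < \<epsilon> / 2 / (Bx + Bz + 1)" using \<epsilon> B0 by simp
  ultimately have "eventually (\<lambda>n. err n < \<epsilon> / 2 / (Bx + Bz + 1)) sequentially" by (rule order_tendstoD(2))
  then obtain N where N: "\<And>n. n \<ge> N \<Longrightarrow> err n < \<epsilon> / 2 / (Bx + Bz + 1)" unfolding eventually_sequentially by blast
  show "\<exists>N. \<forall>n\<ge>N. \<exists>M1 M2 M3. real M1 \<le> 2 powr (real n * fst (R1 + \<delta>, R2 + \<delta>, R3 + \<delta>)) \<and>
       real M2 \<le> 2 powr (real n * fst (snd (R1 + \<delta>, R2 + \<delta>, R3 + \<delta>))) \<and>
       real M3 \<le> 2 powr (real n * snd (snd (R1 + \<delta>, R2 + \<delta>, R3 + \<delta>))) \<and>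
       code_exists p dx dz n M1 M2 M3 (Dx + \<epsilon>) (Dz + \<epsilon>)"
  proof (rule exI[of _ "max N 1"], intro allI impI)
    \<comment> \<open>The empty block is excluded because distortions are divided by
      \<open>n\<close>.\<close>
    fix n assume "max N 1 \<le> n"
    then have nN: "N \<le> n" and n: "0 < n" by auto
    define M1 where "M1 = nat \<lfloor>2 powr (real n * (R1 + \<delta>))\<rfloor>"
    define M2 where "M2 = nat \<lfloor>2 powr (real n * (R2 + \<delta>))\<rfloor>"
    define M3 where "M3 = nat \<lfloor>2 powr (real n * (R3 + \<delta>))\<rfloor>"
    note code = code_with_small_error[OF Fs(1,2) \<gamma>(1,2) n R1 R2 R3, folded M1_def M2_def M3_def err_def]
    from code(4) obtain f1 f2 f3 gX gZ where f: "\<forall>y. f1 y < M1" "\<forall>z t. f2 z t < M2" "\<forall>x t t'. f3 x t t' < M3"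
      and bad: "(\<Sum>ws\<in>{ws. length ws = n}. prod_list (map p ws) *
      (if \<exists>us vs ts. gX (map fst ws) (f1 (map (fst \<circ> snd) ws)) (f2 (map (snd \<circ> snd) ws) (f1 (map (fst \<circ> snd) ws))) = (us, vs) \<and>
        gZ (map (snd \<circ> snd) ws) (f1 (map (fst \<circ> snd) ws)) (f3 (map fst ws) (f1 (map (fst \<circ> snd) ws))
           (f2 (map (snd \<circ> snd) ws) (f1 (map (fst \<circ> snd) ws)))) = (us, ts) \<and>
        typical Fs \<gamma> n (letter ws us vs ts) then 0 else 1)) \<le> err n" by blast
    define t1 where "t1 ws = f1 (map (fst \<circ> snd) ws)" for ws :: "('x \<times> 'y \<times> 'z) list"
    define t2 where "t2 ws = f2 (map (snd \<circ> snd) ws) (t1 ws)" for ws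
    define t3 where "t3 ws = f3 (map fst ws) (t1 ws) (t2 ws)" for ws
    define G where "G ws \<longleftrightarrow> (\<exists>us vs ts. gX (map fst ws) (t1 ws) (t2 ws) = (us, vs) \<and>
        gZ (map (snd \<circ> snd) ws) (t1 ws) (t3 ws) = (us, ts) \<and> typical Fs \<gamma> n (letter ws us vs ts))" for ws
    have bad': "(\<Sum>ws\<in>{ws. length ws = n}. prod_list (map p ws) * (if G ws then 0 else 1)) \<le> err n"
      using bad unfolding G_def t3_def t2_def t1_def .
    define g2 where "g2 xs t t' i = zhat (fst (gX xs t t') ! i) (snd (gX xs t t') ! i) (xs ! i)" for xs t t' i
    define g3 where "g3 zs t t' i = xhat (fst (gZ zs t t') ! i) (snd (gZ zs t t') ! i) (zs ! i)" for zs t t' i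
    have dev: "(\<Sum>i<n. l (letter ws us vs ts i)) \<le> real n * (mean l + \<gamma>)"
      if "typical Fs \<gamma> n (letter ws us vs ts)" "l \<in> Fs" for l ws us vs ts
      using that by (auto simp: typical_def algebra_simps abs_le_iff)
    have gx: "(\<Sum>i<n. dx (map fst ws ! i) (g3 (map (snd \<circ> snd) ws) (t1 ws) (t3 ws) i)) \<le> real n * (Dx + \<gamma>)"
      if len: "length ws = n" and g: "G ws" for ws
    proof -
      from g obtain us vs ts where e: "gX (map fst ws) (t1 ws) (t2 ws) = (us, vs)"
        "gZ (map (snd \<circ> snd) ws) (t1 ws) (t3 ws) = (us, ts)" and t: "typical Fs \<gamma> n (letter ws us vs ts)" unfolding G_def by blast
      have "(\<Sum>i<n. dx (map fst ws ! i) (g3 (map (snd \<circ> snd) ws) (t1 ws) (t3 ws) i)) = (\<Sum>i<n. lx (letter ws us vs ts i))"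
        using len by (intro sum.cong refl) (simp add: g3_def e lx_def letter_def rv_defs)
      also have "\<dots> \<le> real n * (mean lx + \<gamma>)" by (rule dev[OF t Fs(3)])
      also have "\<dots> \<le> real n * (Dx + \<gamma>)" using mx by (intro mult_left_mono) auto
      finally show ?thesis .
    qed
    have gz: "(\<Sum>i<n. dz (map (snd \<circ> snd) ws ! i) (g2 (map fst ws) (t1 ws) (t2 ws) i)) \<le> real n * (Dz + \<gamma>)"
      if len: "length ws = n" and g: "G ws" for ws
    proof -
      from g obtain us vs ts where e: "gX (map fst ws) (t1 ws) (t2 ws) = (us, vs)"
        "gZ (map (snd \<circ> snd) ws) (t1 ws) (t3 ws) = (us, ts)" and t: "typical Fs \<gamma> n (letter ws us vs ts)" unfolding G_def by blast
      have "(\<Sum>i<n. dz (map (snd \<circ> snd) ws ! i) (g2 (map fst ws) (t1 ws) (t2 ws) i)) = (\<Sum>i<n. lz (letter ws us vs ts i))"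
        using len by (intro sum.cong refl) (simp add: g2_def e lz_def letter_def rv_defs)
      also have "\<dots> \<le> real n * (mean lz + \<gamma>)" by (rule dev[OF t Fs(4)])
      also have "\<dots> \<le> real n * (Dz + \<gamma>)" using mz by (intro mult_left_mono) auto
      finally show ?thesis .
    qed
    have err: "b * err n \<le> \<epsilon> / 2" if "0 \<le> b" "b \<le> Bx + Bz + 1" for b
    proof -
      have "b * err n \<le> b * (\<epsilon> / 2 / (Bx + Bz + 1))" using N[OF nN] that by (intro mult_left_mono) auto
      also have "\<dots> \<le> (Bx + Bz + 1) * (\<epsilon> / 2 / (Bx + Bz + 1))" using that \<epsilon> B0 by (intro mult_right_mono) auto
      also have "\<dots> = \<epsilon> / 2"
      proof -
        have "c * (\<epsilon> / 2 / c) = \<epsilon> / 2" if "0 < c" for c :: real using that by simp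
        from this[of "Bx + Bz + 1"] show ?thesis using B0 by linarith
      qed
      finally show ?thesis .
    qed
    have "iid_expect p n (\<lambda>ws. (1 / real n) * (\<Sum>i<n. dx (map fst ws ! i) (g3 (map (snd \<circ> snd) ws) (t1 ws) (t3 ws) i)))
        \<le> (Dx + \<gamma>) + Bx * err n"
      unfolding Bx_def by (rule average_distortion_bound[where d = dx and G = G]) (use dx0 n bad' gx mx \<gamma> in auto)
    also have "\<dots> \<le> Dx + \<epsilon>" using err[of Bx] B0 \<gamma>(3) by simp
    finally have ex: "iid_expect p n (\<lambda>ws. (1 / real n) * (\<Sum>i<n. dx (map fst ws ! i) (g3 (map (snd \<circ> snd) ws) (t1 ws) (t3 ws) i))) \<le> Dx + \<epsilon>" .
    have "iid_expect p n (\<lambda>ws. (1 / real n) * (\<Sum>i<n. dz (map (snd \<circ> snd) ws ! i) (g2 (map fst ws) (t1 ws) (t2 ws) i)))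
        \<le> (Dz + \<gamma>) + Bz * err n"
      unfolding Bz_def by (rule average_distortion_bound[where d = dz and G = G]) (use dz0 n bad' gz mz \<gamma> in auto)
    also have "\<dots> \<le> Dz + \<epsilon>" using err[of Bz] B0 \<gamma>(3) by simp
    finally have ez: "iid_expect p n (\<lambda>ws. (1 / real n) * (\<Sum>i<n. dz (map (snd \<circ> snd) ws ! i) (g2 (map fst ws) (t1 ws) (t2 ws) i))) \<le> Dz + \<epsilon>" .
    have "code_exists p dx dz n M1 M2 M3 (Dx + \<epsilon>) (Dz + \<epsilon>)"
      unfolding code_exists_def Let_def
      by (rule exI[of _ f1], rule exI[of _ f2], rule exI[of _ f3], rule exI[of _ g2], rule exI[of _ g3])
         (use f ex ez in \<open>simp add: t1_def t2_def t3_def\<close>)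
    then show "\<exists>M1 M2 M3. real M1 \<le> 2 powr (real n * fst (R1 + \<delta>, R2 + \<delta>, R3 + \<delta>)) \<and>
       real M2 \<le> 2 powr (real n * fst (snd (R1 + \<delta>, R2 + \<delta>, R3 + \<delta>))) \<and>
       real M3 \<le> 2 powr (real n * snd (snd (R1 + \<delta>, R2 + \<delta>, R3 + \<delta>))) \<and>
       code_exists p dx dz n M1 M2 M3 (Dx + \<epsilon>) (Dz + \<epsilon>)"
      using code(1-3) by auto
  qed
qed

lemma feasible_achievable:
  fixes dx :: "'x::finite \<Rightarrow> 'xh::finite \<Rightarrow> real" and dz :: "'z::finite \<Rightarrow> 'zh::finite \<Rightarrow> real"
    and p :: "'x \<times> 'y::finite \<times> 'z \<Rightarrow> real"
  assumes pmf: "is_pmf p" and markov: "markov_YXZ p" and dx0: "\<And>x h. 0 \<le> dx x h" and dz0: "\<And>z h. 0 \<le> dz z h"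
    and f: "feasible p dx dz Dx Dz (R1, R2, R3) K qU qV qW xhat zhat" and \<delta>: "0 < \<delta>"
  shows "achievable p dx dz Dx Dz (R1 + \<delta>, R2 + \<delta>, R3 + \<delta>)"
proof -
  interpret test_channel p K qU qV qW
    using pmf markov f by unfold_locales (auto simp: feasible_def)
  have rv: "(\<lambda>((x, y, z), u, v, w). x) = X" "(\<lambda>((x, y, z), u, v, w). y) = Y" "(\<lambda>((x, y, z), u, v, w). z) = Z"
    "(\<lambda>((x, y, z), u, v, w). u) = U" "(\<lambda>((x, y, z), u, v, w). v) = V" "(\<lambda>((x, y, z), u, v, w). w) = W"
    "(\<lambda>((x, y, z), u, v, w). (u, x)) = (U \<bowtie> X)" "(\<lambda>((x, y, z), u, v, w). (u, v, z)) = (U \<bowtie> V \<bowtie> Z)"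
    by (auto simp: rv_defs fun_eq_iff)
  note F = f[unfolded feasible_def, folded S_def P_def, unfolded rv fst_conv snd_conv]
  show ?thesis
  proof (rule achieves[OF dx0 dz0 _ _ _ _ _ \<delta>])
    show "mean (\<lambda>\<omega>. dx (X \<omega>) (xhat (U \<omega>) (W \<omega>) (Z \<omega>))) \<le> Dx"
      using F by (simp add: mean_def rv_defs case_prod_unfold)
    show "mean (\<lambda>\<omega>. dz (Z \<omega>) (zhat (U \<omega>) (V \<omega>) (X \<omega>))) \<le> Dz"
      using F by (simp add: mean_def rv_defs case_prod_unfold)
  qed (use F in blast)+
qed

text \<open>The converse applies to each code separately, so one block length suffices for a given
  excess distortion.\<close>

lemma achievable_feasible:
  fixes p :: "'x::finite \<times> 'y::finite \<times> 'z::finite \<Rightarrow> real"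
    and dx :: "'x \<Rightarrow> 'xh::finite \<Rightarrow> real" and dz :: "'z \<Rightarrow> 'zh::finite \<Rightarrow> real"
  assumes pmf: "is_pmf p" and markov: "markov_YXZ p" and R: "achievable p dx dz Dx Dz R" and \<epsilon>: "0 < \<epsilon>"
  shows "\<exists>qU qV qW xhat zhat. feasible p dx dz (Dx + \<epsilon>) (Dz + \<epsilon>) R (alphabet_bound p) qU qV qW xhat zhat"
proof -
  from R \<epsilon> obtain N where N: "\<forall>n\<ge>N. \<exists>M1 M2 M3. real M1 \<le> 2 powr (real n * fst R) \<and> real M2 \<le> 2 powr (real n * fst (snd R)) \<and>
       real M3 \<le> 2 powr (real n * snd (snd R)) \<and> code_exists p dx dz n M1 M2 M3 (Dx + \<epsilon>) (Dz + \<epsilon>)"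
    unfolding achievable_def by blast
  define n where "n = max N 1"
  have n: "0 < n" "N \<le> n" by (auto simp: n_def)
  obtain M1 M2 M3 where M: "real M1 \<le> 2 powr (real n * fst R)" "real M2 \<le> 2 powr (real n * fst (snd R))"
    "real M3 \<le> 2 powr (real n * snd (snd R))" and code: "code_exists p dx dz n M1 M2 M3 (Dx + \<epsilon>) (Dz + \<epsilon>)"
    using N n(2) by blast
  from code obtain f1 f2 f3 g2 g3 where f: "\<forall>ys. f1 ys < M1" "\<forall>zs t1. f2 zs t1 < M2" "\<forall>xs t1 t2. f3 xs t1 t2 < M3"
    and Dx: "iid_expect p n (\<lambda>ws. let xs = map fst ws; ys = map (fst \<circ> snd) ws; zs = map (snd \<circ> snd) ws;
              t1 = f1 ys; t2 = f2 zs t1; t3 = f3 xs t1 t2; xh = g3 zs t1 t3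
          in (1 / real n) * (\<Sum>i<n. dx (xs ! i) (xh i))) \<le> Dx + \<epsilon>"
    and Dz: "iid_expect p n (\<lambda>ws. let xs = map fst ws; ys = map (fst \<circ> snd) ws; zs = map (snd \<circ> snd) ws;
              t1 = f1 ys; t2 = f2 zs t1; zh = g2 xs t1 t2
          in (1 / real n) * (\<Sum>i<n. dz (zs ! i) (zh i))) \<le> Dz + \<epsilon>"
    unfolding code_exists_def by blast
  interpret source_code p n f1 f2 f3 M1 M2 M3
    using pmf markov n(1) f by unfold_locales auto
  show ?thesis
    using converse[OF M, of dx g3 "Dx + \<epsilon>" dz g2 "Dz + \<epsilon>"] Dx Dz
    by (simp add: iid_expect_def Let_def S_def P_def xs_def ys_def zs_def t1_def t2_def t3_def)
qed

theorem theorem1: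
  fixes p :: "'x::finite \<times> 'y::finite \<times> 'z::finite \<Rightarrow> real"
    and dx :: "'x \<Rightarrow> 'xh::finite \<Rightarrow> real"
    and dz :: "'z \<Rightarrow> 'zh::finite \<Rightarrow> real"
    and Dx Dz :: real
  assumes "is_pmf p"
    and "markov_YXZ p"
    and "\<forall>x xh. 0 \<le> dx x xh"
    and "\<forall>z zh. 0 \<le> dz z zh"
  shows "operational_region p dx dz Dx Dz = single_letter_region p dx dz Dx Dz"
proof (intro equalityI subsetI)
  fix R assume "R \<in> operational_region p dx dz Dx Dz"
  then obtain Rs where Rs: "\<And>k. achievable p dx dz Dx Dz (Rs k)" "Rs \<longlonglongrightarrow> R"
    unfolding operational_region_def closure_sequential by blast
  \<comment> \<open>The excess distortion and the approximating rates pass to the limit together;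
    this is possible because the alphabet size is the same for all \<open>k\<close>.\<close>
  have "\<exists>qU qV qW xhat zhat. feasible p dx dz Dx Dz R (alphabet_bound p) qU qV qW xhat zhat"
  proof (rule feasible_limit[OF _ Rs(2) LIMSEQ_inverse_real_of_nat])
    show "0 \<le> p t" for t using assms(1) unfolding is_pmf_def by blast
    show "\<exists>qU qV qW xhat zhat. feasible p dx dz (Dx + inverse (real (Suc k))) (Dz + inverse (real (Suc k))) (Rs k)
        (alphabet_bound p) qU qV qW xhat zhat" for k
      by (rule achievable_feasible[OF assms(1,2) Rs(1)]) simp
  qed
  then show "R \<in> single_letter_region p dx dz Dx Dz" unfolding single_letter_region_feasible by blast
next
  fix R assume "R \<in> single_letter_region p dx dz Dx Dz"
  then obtain K qU qV qW xhat zhat where f: "feasible p dx dz Dx Dz R K qU qV qW xhat zhat"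
    unfolding single_letter_region_feasible by blast
  obtain R1 R2 R3 where R: "R = (R1, R2, R3)" by (cases R)
  \<comment> \<open>A point of the region is only approached: codes are built at slightly larger
    rates, and the closure in the operational region absorbs the excess.\<close>
  define \<delta> where "\<delta> k = inverse (real (Suc k))" for k
  have \<delta>: "\<delta> \<longlonglongrightarrow> 0" unfolding \<delta>_def by (rule LIMSEQ_inverse_real_of_nat)
  have "achievable p dx dz Dx Dz (R1 + \<delta> k, R2 + \<delta> k, R3 + \<delta> k)" for k
    using assms f by (intro feasible_achievable) (auto simp: R \<delta>_def)
  moreover have "(\<lambda>k. (R1 + \<delta> k, R2 + \<delta> k, R3 + \<delta> k)) \<longlonglongrightarrow> (R1 + 0, R2 + 0, R3 + 0)"
    by (intro tendsto_Pair tendsto_add tendsto_const \<delta>)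
  ultimately show "R \<in> operational_region p dx dz Dx Dz"
    unfolding operational_region_def closure_sequential R
    by (intro exI[of _ "\<lambda>k. (R1 + \<delta> k, R2 + \<delta> k, R3 + \<delta> k)"]) simp
qed

end
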